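(* Consider the mixed integer trust region problem (MITR) $$\min\ f(x) := x^{\mathsf T} H x + h^{\mathsf T} x \quad \text{s.t.}\quad x^{\mathsf T} x \le 1,\quad x \in \Pi_p(b^1,\dots,b^n) + \{c\},$$ where $H \in \mathbb{Q}^{n\times n}$ is symmetric, $h, c \in \mathbb{Q}^n$, $b^1,\dots,b^n \in \mathbb{Q}^n$ are linearly independent, and $p \in \{0,1,\dots,n\}$. There is an algorithm which, for any $\epsilon \in (0,1/3]$, either finds two feasible solutions $x^1, x^2$ to (MITR) such that $$f(x^1) - f(x^2) \ge (1 - 7\epsilon) \max\{\|H\|_2, \|h\|_2\},$$ or finds a nonzero vector $d \in \mathbb{Q}^n$ with $d^{\mathsf T} b^1,\dots,d^{\mathsf T} b^p$ integer and $d^{\mathsf T} b^{p+1} = \cdots = d^{\mathsf T} b^n = 0$ such that $\mathrm{width}_d(\mathcal{B}(0,1)) \le p\,2^{p(p-1)/4}/\epsilon$. The running time of the algorithm is polynomial in the size of (MITR) and in $\log(1/\epsilon)$.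
   Context: For linearly independent $b^1,\dots,b^n$ and $p \in \{0,\dots,n\}$, the mixed integer lattice is $$\Pi_p(b^1,\dots,b^n) := \Big\{\sum_{i=1}^n \mu_i b^i : \mu_i \in \mathbb{Z}\ \forall i=1,\dots,p,\ \mu_i \in \mathbb{R}\ \forall i=p+1,\dots,n\Big\}.$$ $\|h\|_2$ is the Euclidean norm and $\|H\|_2 := \sup_{x\neq 0}\|Hx\|_2/\|x\|_2$ is the spectral norm. $\mathcal{B}(c,r) := \{x \in \mathbb{R}^n : \|x-c\|_2 \le r\}$. For a nonempty bounded closed set $\mathcal{S} \subseteq \mathbb{R}^n$ and $d \in \mathbb{R}^n$, $\mathrm{width}_d(\mathcal{S}) := \max\{d^{\mathsf T}x : x \in \mathcal{S}\} - \min\{d^{\mathsf T}x : x \in \mathcal{S}\}$. $\log$ is the base-2 logarithm. The size of rational numbers, vectors, matrices, and optimization problems is the standard bit size: essentially the number of bits required to encode the object in binary. *)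

theory Defs
  imports
    "HOL-Library.Log_Nat"
    "HOL-Computational_Algebra.Polynomial"
    "Jordan_Normal_Form.VS_Connect"
begin

section \<open>Mixed integer trust region problems\<close>

abbreviation real_vec :: "rat vec \<Rightarrow> real vec" where
  "real_vec \<equiv> map_vec of_rat"

abbreviation real_mat :: "rat mat \<Rightarrow> real mat" where
  "real_mat \<equiv> map_mat of_rat"

definition l2_norm :: "real vec \<Rightarrow> real" where
  "l2_norm x = sqrt (x \<bullet> x)"

definition spectral_norm :: "real mat \<Rightarrow> real" where
  "spectral_norm A =
     (SUP x \<in> {x \<in> carrier_vec (dim_col A). x \<noteq> 0\<^sub>v (dim_col A)}. l2_norm (A *\<^sub>v x) / l2_norm x)"

definition l2_ball :: "real vec \<Rightarrow> real \<Rightarrow> real vec set" where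
  "l2_ball c r = {x \<in> carrier_vec (dim_vec c). l2_norm (x - c) \<le> r}"

text \<open>Used for nonempty compact \<open>S\<close> only, where the supremum and the infimum are attained.\<close>

definition width :: "real vec \<Rightarrow> real vec set \<Rightarrow> real" where
  "width d S = Sup ((\<lambda>x. d \<bullet> x) ` S) - Inf ((\<lambda>x. d \<bullet> x) ` S)"

definition lin_indep_vecs :: "nat \<Rightarrow> real vec list \<Rightarrow> bool" where
  "lin_indep_vecs n bs \<longleftrightarrow>
     distinct bs \<and> module.lin_indpt class_ring (module_vec TYPE(real) n) (set bs)"

text \<open>Vectors are indexed from \<open>0\<close>: the integer multipliers are those of
  \<open>bs ! 0, \<dots>, bs ! (p - 1)\<close>.\<close>

definition mixed_lattice :: "nat \<Rightarrow> nat \<Rightarrow> real vec list \<Rightarrow> real vec set" where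
  "mixed_lattice n p bs =
     {finsum_vec TYPE(real) n (\<lambda>i. \<mu> i \<cdot>\<^sub>v (bs ! i)) {..<n} | \<mu>. \<forall>i<p. \<mu> i \<in> \<int>}"

definition mitr_objective :: "rat mat \<Rightarrow> rat vec \<Rightarrow> real vec \<Rightarrow> real" where
  "mitr_objective H h x = x \<bullet> (real_mat H *\<^sub>v x) + real_vec h \<bullet> x"

definition mitr_feasible ::
  "nat \<Rightarrow> nat \<Rightarrow> rat vec \<Rightarrow> rat vec list \<Rightarrow> real vec \<Rightarrow> bool" where
  "mitr_feasible n p c bs x \<longleftrightarrow>
     x \<bullet> x \<le> 1 \<and> x \<in> (\<lambda>y. y + real_vec c) ` mixed_lattice n p (map real_vec bs)"

definition mitr_instance ::
  "nat \<Rightarrow> nat \<Rightarrow> rat mat \<Rightarrow> rat vec \<Rightarrow> rat vec \<Rightarrow> rat vec list \<Rightarrow> bool" where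
  "mitr_instance n p H h c bs \<longleftrightarrow>
     1 \<le> n \<and> p \<le> n \<and>
     H \<in> carrier_mat n n \<and> transpose_mat H = H \<and>
     h \<in> carrier_vec n \<and> c \<in> carrier_vec n \<and>
     length bs = n \<and> set bs \<subseteq> carrier_vec n \<and> lin_indep_vecs n (map real_vec bs)"

section \<open>Bit sizes\<close>

text \<open>The size of \<open>a / b\<close> in lowest terms is
  \<open>1 + \<lceil>log 2 (\<bar>a\<bar> + 1)\<rceil> + \<lceil>log 2 (b + 1)\<rceil>\<close>; note that
  \<open>floorlog 2 m = \<lceil>log 2 (m + 1)\<rceil>\<close> is the number of binary digits of \<open>m\<close>.\<close>

definition int_size :: "int \<Rightarrow> nat" where
  "int_size z = 1 + floorlog 2 (nat \<bar>z\<bar>)"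

definition rat_size :: "rat \<Rightarrow> nat" where
  "rat_size r = int_size (fst (quotient_of r)) + floorlog 2 (nat (snd (quotient_of r)))"

definition vec_size :: "rat vec \<Rightarrow> nat" where
  "vec_size v = dim_vec v + (\<Sum>i<dim_vec v. rat_size (v $ i))"

definition mat_size :: "rat mat \<Rightarrow> nat" where
  "mat_size A =
     dim_row A * dim_col A + (\<Sum>i<dim_row A. \<Sum>j<dim_col A. rat_size (A $$ (i, j)))"

definition mitr_size ::
  "nat \<Rightarrow> nat \<Rightarrow> rat mat \<Rightarrow> rat vec \<Rightarrow> rat vec \<Rightarrow> rat vec list \<Rightarrow> nat" where
  "mitr_size n p H h c bs =
     int_size (int n) + int_size (int p) + mat_size H + vec_size h + vec_size c
       + (\<Sum>b\<leftarrow>bs. vec_size b)"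

section \<open>Algorithms and their running time\<close>

text \<open>
  Algorithms are programs of a small imperative language in the bit model of computation. The
  memory consists of arrays of integers; a program mentions finitely many arrays by name, and
  array indices are computed. Integers are unbounded, so running time is not the number of steps:
  every operation is charged for the binary lengths of the integers involved. A binary operation on
  integers of lengths \<open>k\<close> and \<open>l\<close> costs \<open>1 + k * l\<close>, as in schoolbook multiplication and division.
  With these charges a program and a Turing machine simulate one another with polynomial overhead.

  The parameter \<open>\<epsilon>\<close> is an arbitrary real number with \<open>0 < \<epsilon> < 1\<close>. A program accesses it through
  its binary expansion: \<open>Eps e\<close> returns \<open>\<lfloor>2 ^ k * \<epsilon>\<rfloor>\<close>, the number formed by the first \<open>k\<close> binary
  digits of \<open>\<epsilon>\<close>, where \<open>k\<close> is the value of \<open>e\<close>, and is charged for reading these \<open>k\<close> digits.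
  For rational \<open>\<epsilon>\<close> they are obtained from numerator and denominator by one integer division.
\<close>

type_synonym mem = "nat \<Rightarrow> int \<Rightarrow> int"

datatype aexp =
    Const int
  | Get nat aexp
  | Eps aexp
  | Add aexp aexp
  | Sub aexp aexp
  | Mul aexp aexp
  | Div aexp aexp

datatype bexp =
    Less aexp aexp
  | BNot bexp
  | BAnd bexp bexp

datatype com =
    Skip
  | Store nat aexp aexp
  | Seq com com
  | Cond bexp com com
  | While bexp com

text \<open>\<open>Get x i\<close> reads and \<open>Store x i e\<close> overwrites the cell with index \<open>i\<close> of array \<open>x\<close>.\<close>

fun aval :: "real \<Rightarrow> aexp \<Rightarrow> mem \<Rightarrow> int" where
  "aval \<epsilon> (Const z) s = z"
| "aval \<epsilon> (Get x i) s = s x (aval \<epsilon> i s)"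
| "aval \<epsilon> (Eps e) s = \<lfloor>2 ^ nat (aval \<epsilon> e s) * \<epsilon>\<rfloor>"
| "aval \<epsilon> (Add a b) s = aval \<epsilon> a s + aval \<epsilon> b s"
| "aval \<epsilon> (Sub a b) s = aval \<epsilon> a s - aval \<epsilon> b s"
| "aval \<epsilon> (Mul a b) s = aval \<epsilon> a s * aval \<epsilon> b s"
| "aval \<epsilon> (Div a b) s = aval \<epsilon> a s div aval \<epsilon> b s"

fun bval :: "real \<Rightarrow> bexp \<Rightarrow> mem \<Rightarrow> bool" where
  "bval \<epsilon> (Less a b) s \<longleftrightarrow> aval \<epsilon> a s < aval \<epsilon> b s"
| "bval \<epsilon> (BNot b) s \<longleftrightarrow> \<not> bval \<epsilon> b s"
| "bval \<epsilon> (BAnd a b) s \<longleftrightarrow> bval \<epsilon> a s \<and> bval \<epsilon> b s"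

definition binop_cost :: "real \<Rightarrow> aexp \<Rightarrow> aexp \<Rightarrow> mem \<Rightarrow> nat" where
  "binop_cost \<epsilon> a b s = 1 + int_size (aval \<epsilon> a s) * int_size (aval \<epsilon> b s)"

fun acost :: "real \<Rightarrow> aexp \<Rightarrow> mem \<Rightarrow> nat" where
  "acost \<epsilon> (Const z) s = int_size z"
| "acost \<epsilon> (Get x i) s =
     acost \<epsilon> i s + 1 + int_size (aval \<epsilon> i s) + int_size (s x (aval \<epsilon> i s))"
| "acost \<epsilon> (Eps e) s = acost \<epsilon> e s + 1 + int_size (aval \<epsilon> e s) + nat (aval \<epsilon> e s)"
| "acost \<epsilon> (Add a b) s = acost \<epsilon> a s + acost \<epsilon> b s + binop_cost \<epsilon> a b s"
| "acost \<epsilon> (Sub a b) s = acost \<epsilon> a s + acost \<epsilon> b s + binop_cost \<epsilon> a b s"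
| "acost \<epsilon> (Mul a b) s = acost \<epsilon> a s + acost \<epsilon> b s + binop_cost \<epsilon> a b s"
| "acost \<epsilon> (Div a b) s = acost \<epsilon> a s + acost \<epsilon> b s + binop_cost \<epsilon> a b s"

fun bcost :: "real \<Rightarrow> bexp \<Rightarrow> mem \<Rightarrow> nat" where
  "bcost \<epsilon> (Less a b) s = acost \<epsilon> a s + acost \<epsilon> b s + binop_cost \<epsilon> a b s"
| "bcost \<epsilon> (BNot b) s = 1 + bcost \<epsilon> b s"
| "bcost \<epsilon> (BAnd a b) s = 1 + bcost \<epsilon> a s + bcost \<epsilon> b s"

text \<open>\<open>exec \<epsilon> prog s t s'\<close>: started in memory \<open>s\<close>, \<open>prog\<close> halts after time \<open>t\<close> with memory \<open>s'\<close>.\<close>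

inductive exec :: "real \<Rightarrow> com \<Rightarrow> mem \<Rightarrow> nat \<Rightarrow> mem \<Rightarrow> bool" for \<epsilon> :: real where
  Skip: "exec \<epsilon> Skip s 1 s"
| Store: "exec \<epsilon> (Store x i e) s
     (acost \<epsilon> i s + acost \<epsilon> e s + 1 + int_size (aval \<epsilon> i s) + int_size (aval \<epsilon> e s))
     (s(x := (s x)(aval \<epsilon> i s := aval \<epsilon> e s)))"
| Seq: "exec \<epsilon> c s t s' \<Longrightarrow> exec \<epsilon> d s' u s'' \<Longrightarrow> exec \<epsilon> (Seq c d) s (t + u) s''"
| CondT: "bval \<epsilon> b s \<Longrightarrow> exec \<epsilon> c s t s' \<Longrightarrow> exec \<epsilon> (Cond b c d) s (bcost \<epsilon> b s + 1 + t) s'"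
| CondF: "\<not> bval \<epsilon> b s \<Longrightarrow> exec \<epsilon> d s t s' \<Longrightarrow> exec \<epsilon> (Cond b c d) s (bcost \<epsilon> b s + 1 + t) s'"
| WhileF: "\<not> bval \<epsilon> b s \<Longrightarrow> exec \<epsilon> (While b c) s (bcost \<epsilon> b s + 1) s"
| WhileT: "bval \<epsilon> b s \<Longrightarrow> exec \<epsilon> c s t s' \<Longrightarrow> exec \<epsilon> (While b c) s' u s'' \<Longrightarrow>
     exec \<epsilon> (While b c) s (bcost \<epsilon> b s + 1 + t + u) s''"

inductive_cases exec_SkipE: "exec \<epsilon> Skip s t s'"
inductive_cases exec_StoreE: "exec \<epsilon> (Store x i e) s t s'"
inductive_cases exec_SeqE: "exec \<epsilon> (Seq c d) s t s'"
inductive_cases exec_CondE: "exec \<epsilon> (Cond b c d) s t s'"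
inductive_cases exec_WhileE: "exec \<epsilon> (While b c) s t s'"

lemma exec_deterministic:
  "exec \<epsilon> prog s t s' \<Longrightarrow> exec \<epsilon> prog s u s'' \<Longrightarrow> u = t \<and> s'' = s'"
proof (induction arbitrary: u s'' rule: exec.induct)
  case (Seq c s t s' d v r)
  from Seq.prems show ?case by (rule exec_SeqE) (metis Seq.IH)
next
  case (WhileT b s c t s' v r)
  from WhileT.prems show ?case
  proof (rule exec_WhileE)
    fix t' s1 u'
    assume "exec \<epsilon> c s t' s1" "exec \<epsilon> (While b c) s1 u' s''" "u = Suc (bcost \<epsilon> b s + t' + u')"
    moreover from this(1) have "t' = t \<and> s1 = s'" by (rule WhileT.IH(1))
    ultimately show ?thesis using WhileT.IH(2)[of u' s''] by simp
  qed (use WhileT.hyps in simp)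
next
  case (WhileF b s c)
  from WhileF.prems show ?case by (rule exec_WhileE) (use WhileF.hyps in simp_all)
next
  case (CondT b s c t s' d)
  from CondT.prems show ?case by (rule exec_CondE) (use CondT.hyps in \<open>auto dest: CondT.IH\<close>)
next
  case (CondF b s d t s' c)
  from CondF.prems show ?case by (rule exec_CondE) (use CondF.hyps in \<open>auto dest: CondF.IH\<close>)
next
  case (Skip s)
  then show ?case by (rule exec_SkipE) simp
next
  case (Store x i e s)
  then show ?case by (rule exec_StoreE) simp
qed

section \<open>Input and output\<close>

definition rat_code :: "rat \<Rightarrow> int list" where
  "rat_code r = [fst (quotient_of r), snd (quotient_of r)]"

definition vec_code :: "rat vec \<Rightarrow> int list" where
  "vec_code v = concat (map rat_code (list_of_vec v))"

definition mitr_code ::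
  "nat \<Rightarrow> nat \<Rightarrow> rat mat \<Rightarrow> rat vec \<Rightarrow> rat vec \<Rightarrow> rat vec list \<Rightarrow> int list" where
  "mitr_code n p H h c bs =
     [int n, int p] @ concat (map vec_code (rows H)) @ vec_code h @ vec_code c
       @ concat (map vec_code bs)"

text \<open>The input is stored in array \<open>0\<close>; all other cells are initially \<open>0\<close>.\<close>

definition initial_mem :: "int list \<Rightarrow> mem" where
  "initial_mem zs = (\<lambda>x i. if x = 0 \<and> 0 \<le> i \<and> i < int (length zs) then zs ! nat i else 0)"

text \<open>The output is read off array \<open>1\<close>. Its cell \<open>0\<close> tells which kind of answer follows.
  The entries of a vector are stored consecutively as pairs of numerator and positive denominator,
  not necessarily in lowest terms.\<close>

definition holds_vec :: "mem \<Rightarrow> int \<Rightarrow> rat vec \<Rightarrow> bool" where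
  "holds_vec s a v \<longleftrightarrow> (\<forall>j<dim_vec v.
     s 1 (a + 2 * int j + 1) > 0 \<and>
     v $ j = Rat.Fract (s 1 (a + 2 * int j)) (s 1 (a + 2 * int j + 1)))"

definition outputs_solutions :: "mem \<Rightarrow> rat vec \<Rightarrow> rat vec \<Rightarrow> bool" where
  "outputs_solutions s x y \<longleftrightarrow>
     s 1 0 = 1 \<and> holds_vec s 1 x \<and> holds_vec s (1 + 2 * int (dim_vec x)) y"

definition outputs_direction :: "mem \<Rightarrow> rat vec \<Rightarrow> bool" where
  "outputs_direction s d \<longleftrightarrow> s 1 0 = 2 \<and> holds_vec s 1 d"

end

theory Submission
  imports Defs "HOL-Analysis.L2_Norm"
begin

text \<open>
  Bisection on \<open>\<lambda>\<close>, with exact integer orthogonalization for the forms \<open>\<lambda> I \<plusminus> H\<close> as a test of positivity,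
  yields an integer vector \<open>v\<close> with \<open>\<bar>v\<^sup>T H v\<bar> / \<bar>v\<bar>\<^sup>2\<close> close to the spectral norm of \<open>H\<close>.
  Shrink the six points \<open>0, \<plusminus>v / \<bar>v\<bar>\<close> and \<open>0, \<plusminus>h / \<bar>h\<bar>\<close> by a factor slightly below \<open>1 - \<epsilon>\<close> and round each
  of them to the mixed lattice. If all rounding errors are at most about \<open>\<epsilon>\<close>, the rounded points lie in the unit ball.
  When the spectral norm dominates, \<open>f\<close> differs enough between \<open>0\<close> and one of \<open>\<plusminus>v\<close>, namely the one at which the linear
  term has the sign of the quadratic term; otherwise it differs enough between \<open>h\<close> and \<open>- h\<close>. The best and the worst of
  the six points are therefore good enough.

  Rounding is done by Babai's nearest plane procedure, in a basis that starts with the continuous directions and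
  whose integral part is reduced. Its error is bounded by half the lengths of the last \<open>p\<close> orthogonalized basis
  vectors, each of which is at most twice as long as its successor. Hence, if some error is too large, the last
  orthogonalized vector \<open>b\<^sup>*\<close> is long, and \<open>d = b\<^sup>* / \<bar>b\<^sup>*\<bar>\<^sup>2\<close>, which has integral products with the integral basis vectors
  and is orthogonal to the continuous ones, is short.

  Reduction swaps two neighbours only if this at least halves a Gram determinant; since the
  determinants are positive integers, there are polynomially many swaps, and orthogonalization and rounding keep all
  vectors integral by carrying Gram determinants as denominators.
\<close>

section \<open>Executions with bounded integers\<close>

text \<open>Bit lengths and running time cannot be separated for unbounded integers, so one number
  \<open>B\<close> bounds every stored integer and every loop. This forces integral arithmetic and
  forbids growth that compounds over the swaps: size reduction brings the entries back under a bound
  that depends only on the Gram determinants, and these never increase. The spectral norm is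
  irrational in general, and bisection gives an absolute error. It becomes relative because a
  nonzero symmetric integer matrix has spectral norm at least 1. The orthogonalization pairs two
  families \<open>U\<close> and \<open>Y\<close>. With \<open>U = Y\<close> it is Gram-Schmidt for a
  basis; with \<open>U\<close> the unit vectors it diagonalizes the form with matrix
  \<open>Y\<close>, and the vector at which positivity fails serves as \<open>v\<close>. Squared
  lengths of successive orthogonalized vectors may shrink by a factor 4, since a swap is to halve a
  determinant; the geometric sum of p of them is at most p^2 2^(p(p-1)/2) times the last. The square
  root of this factor is the constant in the width bound: the half in the rounding error cancels
  against the diameter 2 of the ball.\<close>

lemma int_size_le: "\<bar>z\<bar> < 2 ^ k \<Longrightarrow> int_size z \<le> k + 1"
proof -
  assume "\<bar>z\<bar> < 2 ^ k"
  then have "nat \<bar>z\<bar> < 2 ^ k" by (simp add: nat_less_iff)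
  then have "floorlog 2 (nat \<bar>z\<bar>) \<le> k" by (intro floorlog_leI) auto
  then show ?thesis by (simp add: int_size_def)
qed

lemma abs_less_int_size: "\<bar>z\<bar> < 2 ^ (int_size z - 1)"
proof (cases "z = 0")
  case False
  then have "nat \<bar>z\<bar> < 2 ^ floorlog 2 (nat \<bar>z\<bar>)"
    using floorlog_bounds[of "nat \<bar>z\<bar>" 2] by simp
  then show ?thesis by (simp add: int_size_def nat_less_iff)
qed (simp add: int_size_def)

lemma int_size_pos: "0 < int_size z"
  by (simp add: int_size_def)

lemma int_size_add: "int_size (x + y) \<le> int_size x + int_size y"
proof -
  let ?a = "int_size x - 1" and ?b = "int_size y - 1"
  have "\<bar>x\<bar> < 2 ^ ?a" "\<bar>y\<bar> < 2 ^ ?b" by (rule abs_less_int_size)+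
  moreover have "(2::int) ^ ?a \<le> 2 ^ (?a + ?b)" "(2::int) ^ ?b \<le> 2 ^ (?a + ?b)" by simp_all
  ultimately have "\<bar>x + y\<bar> < 2 ^ Suc (?a + ?b)" unfolding power_Suc by linarith
  from int_size_le[OF this] show ?thesis using int_size_pos[of x] int_size_pos[of y] by simp
qed

lemma int_size_minus: "int_size (- x) = int_size x"
  by (simp add: int_size_def)

lemma int_size_diff: "int_size (x - y) \<le> int_size x + int_size y"
  using int_size_add[of x "- y"] by (simp add: int_size_minus)

lemma int_size_mult: "int_size (x * y) \<le> int_size x + int_size y"
proof -
  let ?a = "int_size x - 1" and ?b = "int_size y - 1"
  have "\<bar>x\<bar> < 2 ^ ?a" "\<bar>y\<bar> < 2 ^ ?b" by (rule abs_less_int_size)+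
  then have "\<bar>x * y\<bar> < 2 ^ (?a + ?b)"
    unfolding abs_mult power_add by (intro mult_strict_mono') auto
  from int_size_le[OF this] show ?thesis using int_size_pos[of x] int_size_pos[of y] by simp
qed

lemma int_size_mono: "\<bar>x\<bar> \<le> \<bar>y\<bar> \<Longrightarrow> int_size x \<le> int_size y"
  by (simp add: int_size_def floorlog_mono nat_mono)

text \<open>Rounding towards minus infinity could enlarge a negative quotient; for integers
  \<open>x * y \<le> x\<close> keeps it at least \<open>x\<close>. Thus \<open>Div\<close> never
  produces more bits than its dividend has.\<close>

lemma abs_div_le: "\<bar>x div y\<bar> \<le> \<bar>x :: int\<bar>"
proof (cases "y = 0")
  case False
  have *: "\<bar>x div y\<bar> \<le> \<bar>x\<bar>" if "y > 0" for x y :: int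
  proof (cases "x \<ge> 0")
    case True
    have "0 \<le> x div y" "x div y \<le> x"
      using True that zdiv_mono2[of x 1 y] by (simp_all add: pos_imp_zdiv_nonneg_iff)
    then show ?thesis using True by simp
  next
    case False
    then have "x div y < 0" using that by (simp add: pos_imp_zdiv_neg_iff)
    moreover have "x \<le> x div y"
    proof -
      have "x * y \<le> x" using False that mult_left_mono_neg[of 1 y x] by simp
      then have "x * y div y \<le> x div y" using that zdiv_mono1 by blast
      then show ?thesis using that by simp
    qed
    ultimately show ?thesis using False by simp
  qed
  show ?thesis
  proof (cases "y > 0")
    case True then show ?thesis by (rule *)
  next
    case F: False
    have "x div y = (- x) div (- y)" by simp
    then show ?thesis using *[of "- y" "- x"] F False by simp
  qed
qed simp

text \<open>\<open>aok\<close> bounds the number of digits of \<open>\<epsilon>\<close> that are read, which is the only charge that is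
  not controlled by the lengths of the stored integers.\<close>

primrec aok :: "real \<Rightarrow> nat \<Rightarrow> aexp \<Rightarrow> mem \<Rightarrow> bool" where
  "aok \<epsilon> B (Const z) s = True"
| "aok \<epsilon> B (Get x i) s = aok \<epsilon> B i s"
| "aok \<epsilon> B (Eps e) s = (aok \<epsilon> B e s \<and> aval \<epsilon> e s \<le> int B)"
| "aok \<epsilon> B (Add a b) s = (aok \<epsilon> B a s \<and> aok \<epsilon> B b s)"
| "aok \<epsilon> B (Sub a b) s = (aok \<epsilon> B a s \<and> aok \<epsilon> B b s)"
| "aok \<epsilon> B (Mul a b) s = (aok \<epsilon> B a s \<and> aok \<epsilon> B b s)"
| "aok \<epsilon> B (Div a b) s = (aok \<epsilon> B a s \<and> aok \<epsilon> B b s)"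

primrec bok :: "real \<Rightarrow> nat \<Rightarrow> bexp \<Rightarrow> mem \<Rightarrow> bool" where
  "bok \<epsilon> B (Less a b) s = (aok \<epsilon> B a s \<and> aok \<epsilon> B b s)"
| "bok \<epsilon> B (BNot b) s = bok \<epsilon> B b s"
| "bok \<epsilon> B (BAnd a b) s = (bok \<epsilon> B a s \<and> bok \<epsilon> B b s)"

text \<open>Weakest preconditions of runs in which every stored integer has absolute value at most
  \<open>2 ^ B\<close> and every loop makes at most \<open>B\<close> iterations each time it is entered.\<close>

primrec wp :: "real \<Rightarrow> nat \<Rightarrow> com \<Rightarrow> (mem \<Rightarrow> bool) \<Rightarrow> mem \<Rightarrow> bool" where
  "wp \<epsilon> B Skip Q s = Q s"
| "wp \<epsilon> B (Store x i e) Q s = (aok \<epsilon> B i s \<and> aok \<epsilon> B e s \<and> \<bar>aval \<epsilon> e s\<bar> \<le> 2 ^ B \<and>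
     Q (s(x := (s x)(aval \<epsilon> i s := aval \<epsilon> e s))))"
| "wp \<epsilon> B (Seq c d) Q s = wp \<epsilon> B c (wp \<epsilon> B d Q) s"
| "wp \<epsilon> B (Cond b c d) Q s = (bok \<epsilon> B b s \<and> (if bval \<epsilon> b s then wp \<epsilon> B c Q s else wp \<epsilon> B d Q s))"
| "wp \<epsilon> B (While b c) Q s =
     ((\<lambda>W s. bok \<epsilon> B b s \<and> (if bval \<epsilon> b s then wp \<epsilon> B c W s else Q s)) ^^ Suc B) (\<lambda>_. False) s"

primrec mods :: "com \<Rightarrow> nat set" where
  "mods Skip = {}"
| "mods (Store x i e) = {x}"
| "mods (Seq c d) = mods c \<union> mods d"
| "mods (Cond b c d) = mods c \<union> mods d"
| "mods (While b c) = mods c"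

text \<open>Rule of consequence and frame rule in one. All arrays are global, so the knowledge that
  a subprogram leaves an array alone has to be carried through every composition;
  \<open>mods\<close> supplies it syntactically.\<close>

lemma wp_frame:
  assumes "wp \<epsilon> B c Q s" "\<And>s'. Q s' \<Longrightarrow> (\<And>x. x \<notin> mods c \<Longrightarrow> s' x = s x) \<Longrightarrow> R s'"
  shows "wp \<epsilon> B c R s"
  using assms
proof (induction c arbitrary: Q R s)
  case (Seq c d)
  have "wp \<epsilon> B c (wp \<epsilon> B d Q) s" using Seq.prems(1) by simp
  then have "wp \<epsilon> B c (wp \<epsilon> B d R) s"
  proof (rule Seq.IH(1))
    fix s' assume *: "wp \<epsilon> B d Q s'" "\<And>x. x \<notin> mods c \<Longrightarrow> s' x = s x"
    show "wp \<epsilon> B d R s'"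
      by (rule Seq.IH(2)[OF *(1)]) (use *(2) Seq.prems(2) in auto)
  qed
  then show ?case by simp
next
  case (Cond b c d)
  show ?case
  proof (cases "bval \<epsilon> b s")
    case True
    have "wp \<epsilon> B c R s" by (rule Cond.IH(1)[of Q]) (use Cond.prems True in auto)
    then show ?thesis using Cond.prems(1) True by simp
  next
    case False
    have "wp \<epsilon> B d R s" by (rule Cond.IH(2)[of Q]) (use Cond.prems False in auto)
    then show ?thesis using Cond.prems(1) False by simp
  qed
next
  case (While b c)
  let ?F = "\<lambda>Q W s. bok \<epsilon> B b s \<and> (if bval \<epsilon> b s then wp \<epsilon> B c W s else Q s)"
  have "(?F Q ^^ k) (\<lambda>_. False) s' \<Longrightarrow> (\<And>x. x \<notin> mods c \<Longrightarrow> s' x = s x) \<Longrightarrow>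
    (?F R ^^ k) (\<lambda>_. False) s'" for k s'
  proof (induction k arbitrary: s')
    case (Suc k)
    show ?case
    proof (cases "bval \<epsilon> b s'")
      case True
      have "wp \<epsilon> B c ((?F R ^^ k) (\<lambda>_. False)) s'"
      proof (rule While.IH)
        show "wp \<epsilon> B c ((?F Q ^^ k) (\<lambda>_. False)) s'" using Suc.prems(1) True by simp
        show "(?F R ^^ k) (\<lambda>_. False) s''" if "(?F Q ^^ k) (\<lambda>_. False) s''"
          "\<And>x. x \<notin> mods c \<Longrightarrow> s'' x = s' x" for s''
          by (rule Suc.IH[OF that(1)]) (use that(2) Suc.prems(2) in auto)
      qed
      then show ?thesis using Suc.prems(1) True by simp
    next
      case False
      then show ?thesis using Suc.prems While.prems(2)[of s'] by simp
    qed
  qed simp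
  from this[of "Suc B" s] While.prems(1) show ?case by simp
qed auto

declare wp.simps(5) [simp del]

lemma wp_mono: "wp \<epsilon> B c Q s \<Longrightarrow> (\<And>s'. Q s' \<Longrightarrow> R s') \<Longrightarrow> wp \<epsilon> B c R s"
  by (erule wp_frame)

text \<open>\<open>j\<close> bounds the iterations still to come. The frame condition is built into
  each premise, relative to the state in which the loop was entered. The unrolling has depth
  \<open>Suc B\<close> because the final, failing test uses up one level.\<close>

lemma wp_While:
  assumes "I j s" "j \<le> B"
    and "\<And>j s'. I j s' \<Longrightarrow> (\<And>x. x \<notin> mods c \<Longrightarrow> s' x = s x) \<Longrightarrow> bok \<epsilon> B b s'"
    and "\<And>j s'. I j s' \<Longrightarrow> (\<And>x. x \<notin> mods c \<Longrightarrow> s' x = s x) \<Longrightarrow> bval \<epsilon> b s' \<Longrightarrow>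
      j > 0 \<and> wp \<epsilon> B c (I (j - 1)) s'"
    and "\<And>j s'. I j s' \<Longrightarrow> (\<And>x. x \<notin> mods c \<Longrightarrow> s' x = s x) \<Longrightarrow> \<not> bval \<epsilon> b s' \<Longrightarrow> Q s'"
  shows "wp \<epsilon> B (While b c) Q s"
proof -
  let ?F = "\<lambda>W s. bok \<epsilon> B b s \<and> (if bval \<epsilon> b s then wp \<epsilon> B c W s else Q s)"
  have "j \<le> k \<Longrightarrow> I j s' \<Longrightarrow> (\<And>x. x \<notin> mods c \<Longrightarrow> s' x = s x) \<Longrightarrow>
    (?F ^^ Suc k) (\<lambda>_. False) s'" for j k s'
  proof (induction k arbitrary: j s')
    case 0
    then show ?case using assms(3-5)[of j s'] by auto
  next
    case (Suc k)
    show ?case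
    proof (cases "bval \<epsilon> b s'")
      case True
      have j: "j > 0" "wp \<epsilon> B c (I (j - 1)) s'" using assms(4)[OF Suc.prems(2,3) True] by auto
      have "wp \<epsilon> B c ((?F ^^ Suc k) (\<lambda>_. False)) s'"
        by (rule wp_frame[OF j(2)], rule Suc.IH[of "j - 1"]) (use Suc.prems j(1) in auto)
      then show ?thesis using True assms(3)[OF Suc.prems(2,3)] by simp
    next
      case False
      then show ?thesis using assms(3,5)[OF Suc.prems(2,3)] by simp
    qed
  qed
  from this[of j B s] assms(1,2) show ?thesis by (simp add: wp.simps(5))
qed

section \<open>Execution time in terms of a common bit bound\<close>

definition mem_le :: "nat \<Rightarrow> mem \<Rightarrow> bool" where
  "mem_le B s \<longleftrightarrow> (\<forall>x i. \<bar>s x i\<bar> \<le> 2 ^ B)"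

text \<open>Lengths in units of \<open>B + 2\<close>: a stored integer is one unit, sums and
  products add the units of their operands, and a quotient counts like its dividend.\<close>

primrec asize :: "aexp \<Rightarrow> nat" where
  "asize (Const z) = int_size z"
| "asize (Get x i) = 1"
| "asize (Eps e) = 1"
| "asize (Add a b) = asize a + asize b"
| "asize (Sub a b) = asize a + asize b"
| "asize (Mul a b) = asize a + asize b"
| "asize (Div a b) = asize a"

primrec atime :: "aexp \<Rightarrow> nat" where
  "atime (Const z) = int_size z"
| "atime (Get x i) = atime i + asize i + 2"
| "atime (Eps e) = atime e + asize e + 2"
| "atime (Add a b) = atime a + atime b + 1 + asize a * asize b"
| "atime (Sub a b) = atime a + atime b + 1 + asize a * asize b"
| "atime (Mul a b) = atime a + atime b + 1 + asize a * asize b"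
| "atime (Div a b) = atime a + atime b + 1 + asize a * asize b"

primrec btime :: "bexp \<Rightarrow> nat" where
  "btime (Less a b) = atime a + atime b + 1 + asize a * asize b"
| "btime (BNot b) = 1 + btime b"
| "btime (BAnd a b) = 1 + btime a + btime b"

text \<open>Both branches of a conditional are added and every loop is charged with its full budget,
  so that the bound depends on \<open>B\<close> alone.\<close>

primrec ctime :: "com \<Rightarrow> nat \<Rightarrow> nat" where
  "ctime Skip B = 1"
| "ctime (Store x i e) B = (atime i + atime e + 1 + asize i + asize e) * (B + 2) ^ 2"
| "ctime (Seq c d) B = ctime c B + ctime d B"
| "ctime (Cond b c d) B = btime b * (B + 2) ^ 2 + 1 + ctime c B + ctime d B"
| "ctime (While b c) B = Suc B * (btime b * (B + 2) ^ 2 + 1 + ctime c B)"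

lemma int_size_pow: "\<bar>z\<bar> \<le> 2 ^ B \<Longrightarrow> int_size z \<le> B + 2"
  using int_size_le[of z "Suc B"] by (simp add: le_less_trans[of _ "2 ^ B"])

lemma mult_pow2_ge: "a * (B + 2) \<le> a * (B + 2) ^ 2" for a B :: nat
  unfolding power2_eq_square by (intro mult_left_mono) auto

lemma pow2_ge: "B + 3 \<le> 2 * (B + 2) ^ 2" "1 \<le> (B + 2) ^ 2" for B :: nat
  by (auto simp: power2_eq_square)

context
  fixes \<epsilon> :: real
  assumes eps: "0 < \<epsilon>" "\<epsilon> < 1"
begin

lemma int_size_aval:
  "mem_le B s \<Longrightarrow> aok \<epsilon> B e s \<Longrightarrow> int_size (aval \<epsilon> e s) \<le> asize e * (B + 2)"
proof (induction e)
  case (Get x i)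
  then show ?case using int_size_pow[of "s x (aval \<epsilon> i s)" B] by (simp add: mem_le_def)
next
  case (Eps e)
  \<comment> \<open>Since \<epsilon> < 1, the first k digits form a number below 2^k, and k is at
    most \<open>B\<close>; so the value fits into one unit like a stored integer.\<close>
  let ?k = "nat (aval \<epsilon> e s)"
  have "0 \<le> 2 ^ ?k * \<epsilon>" "2 ^ ?k * \<epsilon> < 2 ^ ?k" using eps by simp_all
  then have "0 \<le> \<lfloor>2 ^ ?k * \<epsilon>\<rfloor>" "\<lfloor>2 ^ ?k * \<epsilon>\<rfloor> < 2 ^ ?k"
    by (simp, simp add: floor_less_iff)
  moreover have "?k \<le> B" using Eps.prems(2) by auto
  ultimately have "\<bar>\<lfloor>2 ^ ?k * \<epsilon>\<rfloor>\<bar> \<le> 2 ^ B"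
    by (smt (verit) power_increasing)
  then show ?case using int_size_pow by simp
next
  case (Const z)
  then show ?case by (simp add: add_mult_distrib2)
next
  case (Add a b)
  then show ?case using int_size_add[of "aval \<epsilon> a s" "aval \<epsilon> b s"] by (simp add: add_mult_distrib)
next
  case (Sub a b)
  then show ?case using int_size_diff[of "aval \<epsilon> a s" "aval \<epsilon> b s"] by (simp add: add_mult_distrib)
next
  case (Mul a b)
  then show ?case using int_size_mult[of "aval \<epsilon> a s" "aval \<epsilon> b s"] by (simp add: add_mult_distrib)
next
  case (Div a b)
  then show ?case using int_size_mono[OF abs_div_le, of "aval \<epsilon> a s" "aval \<epsilon> b s"] by simp
qed

lemma binop_cost_le:
  assumes "mem_le B s" "aok \<epsilon> B a s" "aok \<epsilon> B b s"
  shows "binop_cost \<epsilon> a b s \<le> (1 + asize a * asize b) * (B + 2) ^ 2"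
proof -
  have "int_size (aval \<epsilon> a s) * int_size (aval \<epsilon> b s) \<le> (asize a * (B + 2)) * (asize b * (B + 2))"
    by (intro mult_mono int_size_aval assms) auto
  also have "\<dots> = asize a * asize b * (B + 2) ^ 2" by (simp add: power2_eq_square algebra_simps)
  finally show ?thesis unfolding binop_cost_def by (simp add: add_mult_distrib power2_eq_square)
qed

lemma acost_le: "mem_le B s \<Longrightarrow> aok \<epsilon> B e s \<Longrightarrow> acost \<epsilon> e s \<le> atime e * (B + 2) ^ 2"
proof (induction e)
  case (Get x i)
  have "int_size (s x (aval \<epsilon> i s)) \<le> B + 2"
    using Get.prems int_size_pow[of "s x (aval \<epsilon> i s)" B] by (simp add: mem_le_def)
  moreover have "int_size (aval \<epsilon> i s) \<le> asize i * (B + 2)" using int_size_aval Get.prems by simp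
  moreover have "acost \<epsilon> i s \<le> atime i * (B + 2) ^ 2" using Get by simp
  ultimately show ?case using mult_pow2_ge[of "asize i" B] pow2_ge(1)[of B]
    unfolding acost.simps atime.simps add_mult_distrib by linarith
next
  case (Eps e)
  have "int_size (aval \<epsilon> e s) \<le> asize e * (B + 2)" using int_size_aval Eps.prems by simp
  moreover have "nat (aval \<epsilon> e s) \<le> B" "acost \<epsilon> e s \<le> atime e * (B + 2) ^ 2" using Eps by auto
  ultimately show ?case using mult_pow2_ge[of "asize e" B] pow2_ge(1)[of B]
    unfolding acost.simps atime.simps add_mult_distrib by linarith
next
  case (Add a b)
  then show ?case using binop_cost_le[of B s a b] by (simp add: add_mult_distrib)
next
  case (Sub a b)
  then show ?case using binop_cost_le[of B s a b] by (simp add: add_mult_distrib)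
next
  case (Mul a b)
  then show ?case using binop_cost_le[of B s a b] by (simp add: add_mult_distrib)
next
  case (Div a b)
  then show ?case using binop_cost_le[of B s a b] by (simp add: add_mult_distrib)
qed simp

lemma bcost_le: "mem_le B s \<Longrightarrow> bok \<epsilon> B b s \<Longrightarrow> bcost \<epsilon> b s \<le> btime b * (B + 2) ^ 2"
proof (induction b)
  case (Less a b)
  then show ?case using binop_cost_le[of B s a b] acost_le[of B s a] acost_le[of B s b]
    by (simp add: add_mult_distrib)
next
  case (BNot b)
  then have "bcost \<epsilon> b s \<le> btime b * (B + 2) ^ 2" by simp
  then show ?case using pow2_ge(2)[of B] unfolding bcost.simps btime.simps add_mult_distrib by linarith
next
  case (BAnd a b)
  then have "bcost \<epsilon> a s \<le> btime a * (B + 2) ^ 2" "bcost \<epsilon> b s \<le> btime b * (B + 2) ^ 2" by simp_all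
  then show ?case using pow2_ge(2)[of B] unfolding bcost.simps btime.simps add_mult_distrib by linarith
qed

text \<open>Termination comes with the precondition: the unrolling in \<open>wp\<close> is a budget
  of iterations, and the same budget gives the factor \<open>Suc B\<close> in
  \<open>ctime\<close>.\<close>

lemma wp_sound:
  "wp \<epsilon> B c Q s \<Longrightarrow> mem_le B s \<Longrightarrow>
    \<exists>t s'. exec \<epsilon> c s t s' \<and> t \<le> ctime c B \<and> mem_le B s' \<and> Q s'"
proof (induction c arbitrary: Q s)
  case Skip
  then show ?case using exec.Skip[of \<epsilon> s] by fastforce
next
  case (Store x i e)
  have "acost \<epsilon> i s + acost \<epsilon> e s + 1 + int_size (aval \<epsilon> i s) + int_size (aval \<epsilon> e s)
    \<le> ctime (Store x i e) B"
  proof -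
    have "acost \<epsilon> i s \<le> atime i * (B + 2) ^ 2" "acost \<epsilon> e s \<le> atime e * (B + 2) ^ 2"
      "int_size (aval \<epsilon> i s) \<le> asize i * (B + 2)" "int_size (aval \<epsilon> e s) \<le> asize e * (B + 2)"
      using Store.prems acost_le int_size_aval by auto
    then show ?thesis using mult_pow2_ge[of "asize i" B] mult_pow2_ge[of "asize e" B] pow2_ge(2)[of B]
      unfolding ctime.simps add_mult_distrib by linarith
  qed
  moreover have "mem_le B (s(x := (s x)(aval \<epsilon> i s := aval \<epsilon> e s)))"
    using Store.prems by (simp add: mem_le_def)
  ultimately show ?case using exec.Store[of \<epsilon> x i e s] Store.prems(1) by fastforce
next
  case (Seq c d)
  then obtain t s' where 1: "exec \<epsilon> c s t s'" "t \<le> ctime c B" "mem_le B s'" "wp \<epsilon> B d Q s'"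
    by fastforce
  then obtain u s'' where "exec \<epsilon> d s' u s''" "u \<le> ctime d B" "mem_le B s''" "Q s''"
    using Seq.IH(2) by blast
  then show ?case using 1 exec.Seq[of \<epsilon> c s t s' d u s''] by (auto intro!: exI[of _ "t + u"])
next
  case (Cond b c d)
  have b: "bcost \<epsilon> b s \<le> btime b * (B + 2) ^ 2" using bcost_le Cond.prems by simp
  show ?case
  proof (cases "bval \<epsilon> b s")
    case True
    then obtain t s' where 1: "exec \<epsilon> c s t s'" "t \<le> ctime c B" "mem_le B s'" "Q s'"
      using Cond.IH(1)[of Q s] Cond.prems by auto
    have "bcost \<epsilon> b s + 1 + t \<le> ctime (Cond b c d) B" using b 1(2) by simp
    then show ?thesis using exec.CondT[OF True 1(1)] 1(3,4) by blast
  next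
    case False
    then obtain t s' where 1: "exec \<epsilon> d s t s'" "t \<le> ctime d B" "mem_le B s'" "Q s'"
      using Cond.IH(2)[of Q s] Cond.prems by auto
    have "bcost \<epsilon> b s + 1 + t \<le> ctime (Cond b c d) B" using b 1(2) by simp
    then show ?thesis using exec.CondF[OF False 1(1)] 1(3,4) by blast
  qed
next
  case (While b c)
  let ?F = "\<lambda>W s. bok \<epsilon> B b s \<and> (if bval \<epsilon> b s then wp \<epsilon> B c W s else Q s)"
  let ?T = "btime b * (B + 2) ^ 2 + 1 + ctime c B"
  have "(?F ^^ k) (\<lambda>_. False) s \<Longrightarrow> mem_le B s \<Longrightarrow>
    \<exists>t s'. exec \<epsilon> (While b c) s t s' \<and> t \<le> k * ?T \<and> mem_le B s' \<and> Q s'" for k s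
  proof (induction k arbitrary: s)
    case (Suc k)
    have b: "bcost \<epsilon> b s \<le> btime b * (B + 2) ^ 2" using bcost_le Suc.prems by simp
    show ?case
    proof (cases "bval \<epsilon> b s")
      case True
      have "wp \<epsilon> B c ((?F ^^ k) (\<lambda>_. False)) s" using Suc.prems True by simp
      then obtain t s' where 1: "exec \<epsilon> c s t s'" "t \<le> ctime c B" "mem_le B s'"
        "(?F ^^ k) (\<lambda>_. False) s'" using While.IH Suc.prems by blast
      then obtain u s'' where 2: "exec \<epsilon> (While b c) s' u s''" "u \<le> k * ?T" "mem_le B s''" "Q s''"
        using Suc.IH by blast
      have "bcost \<epsilon> b s + 1 + t + u \<le> Suc k * ?T" using b 1(2) 2(2) by simp
      then show ?thesis using exec.WhileT[OF True 1(1) 2(1)] 2(3,4) by blast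
    next
      case False
      have "bcost \<epsilon> b s + 1 \<le> Suc k * ?T" using b by simp
      then show ?thesis using exec.WhileF[OF False] Suc.prems False by fastforce
    qed
  qed simp
  from this[of "Suc B" s] While.prems show ?case by (simp add: wp.simps(5))
qed

end

text \<open>The program is fixed, so its length and its loop nesting are constants and may enter
  both the coefficient and the exponent.\<close>

lemma ctime_poly: "\<exists>C k. \<forall>B. ctime c B \<le> C * (B + 2) ^ k"
proof (induction c)
  case Skip
  show ?case by (intro exI[of _ 1] exI[of _ 0]) simp
next
  case (Store x i e)
  show ?case by (intro exI[of _ "atime i + atime e + 1 + asize i + asize e"] exI[of _ 2]) simp
next
  case (Seq c d)
  then obtain C k D l where 1: "\<And>B. ctime c B \<le> C * (B + 2) ^ k" "\<And>B. ctime d B \<le> D * (B + 2) ^ l"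
    by blast
  have "ctime (Seq c d) B \<le> (C + D) * (B + 2) ^ (k + l)" for B
  proof -
    have "C * (B + 2) ^ k \<le> C * (B + 2) ^ (k + l)" "D * (B + 2) ^ l \<le> D * (B + 2) ^ (k + l)"
      by (intro mult_left_mono power_increasing; simp)+
    then show ?thesis using 1[of B] unfolding ctime.simps add_mult_distrib by linarith
  qed
  then show ?case by blast
next
  case (Cond b c d)
  then obtain C k D l where 1: "\<And>B. ctime c B \<le> C * (B + 2) ^ k" "\<And>B. ctime d B \<le> D * (B + 2) ^ l"
    by blast
  have "ctime (Cond b c d) B \<le> (btime b + 1 + C + D) * (B + 2) ^ (2 + k + l)" for B
  proof -
    have "C * (B + 2) ^ k \<le> C * (B + 2) ^ (2 + k + l)" "D * (B + 2) ^ l \<le> D * (B + 2) ^ (2 + k + l)"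
      "btime b * (B + 2) ^ 2 \<le> btime b * (B + 2) ^ (2 + k + l)"
      by (intro mult_left_mono power_increasing; simp)+
    moreover have "1 \<le> (B + 2) ^ (2 + k + l)" by (rule one_le_power) simp
    ultimately show ?thesis using 1[of B] unfolding ctime.simps add_mult_distrib by linarith
  qed
  then show ?case by blast
next
  case (While b c)
  then obtain C k where 1: "\<And>B. ctime c B \<le> C * (B + 2) ^ k" by blast
  have "ctime (While b c) B \<le> (btime b + 1 + C) * (B + 2) ^ (Suc (2 + k))" for B
  proof -
    have "C * (B + 2) ^ k \<le> C * (B + 2) ^ (2 + k)" "btime b * (B + 2) ^ 2 \<le> btime b * (B + 2) ^ (2 + k)"
      by (intro mult_left_mono power_increasing; simp)+
    moreover have "1 \<le> (B + 2) ^ (2 + k)" by (rule one_le_power) simp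
    ultimately have "btime b * (B + 2) ^ 2 + 1 + ctime c B \<le> (btime b + 1 + C) * (B + 2) ^ (2 + k)"
      using 1[of B] unfolding add_mult_distrib by linarith
    then have "Suc B * (btime b * (B + 2) ^ 2 + 1 + ctime c B) \<le> (B + 2) * ((btime b + 1 + C) * (B + 2) ^ (2 + k))"
      by (intro mult_mono) auto
    also have "\<dots> = (btime b + 1 + C) * (B + 2) ^ Suc (2 + k)" by (simp only: power_Suc mult_ac)
    finally show ?thesis by simp
  qed
  then show ?case by blast
qed

section \<open>Loops and matrices\<close>

abbreviation V :: "nat \<Rightarrow> aexp" where
  "V x \<equiv> Get x (Const 0)"

abbreviation Set :: "nat \<Rightarrow> aexp \<Rightarrow> com" where
  "Set x e \<equiv> Store x (Const 0) e"

lemmas wp_simps = wp.simps(1-4)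

definition For :: "nat \<Rightarrow> aexp \<Rightarrow> com \<Rightarrow> com" where
  "For T e c = Seq (Set T (Const 0)) (While (Less (V T) e) (Seq c (Set T (Add (V T) (Const 1)))))"

definition Sum :: "nat \<Rightarrow> nat \<Rightarrow> aexp \<Rightarrow> aexp \<Rightarrow> com" where
  "Sum x T e f = Seq (Set x (Const 0)) (For T e (Set x (Add (V x) f)))"

definition Vec :: "nat \<Rightarrow> nat \<Rightarrow> aexp \<Rightarrow> aexp \<Rightarrow> aexp \<Rightarrow> com" where
  "Vec X T e i f = For T e (Store X i f)"

lemma mods_For [simp]: "mods (For T e c) = insert T (mods c)"
  by (auto simp: For_def)

lemma mods_Sum [simp]: "mods (Sum x T e f) = {x, T}"
  by (auto simp: Sum_def)

lemma mods_Vec [simp]: "mods (Vec X T e i f) = {X, T}"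
  by (auto simp: Vec_def)

text \<open>The condition \<open>len \<le> B\<close> pays for the iterations as well as for the
  counter, because \<open>t < 2 ^ t\<close>. The upper limit is evaluated anew at each test, hence
  the premise that its value survives the body.\<close>

lemma wp_For:
  assumes T: "T \<notin> mods c" and len: "len \<le> B"
    and e: "\<And>s'. (\<And>x. x \<notin> insert T (mods c) \<Longrightarrow> s' x = s x) \<Longrightarrow>
      aok \<epsilon> B e s' \<and> aval \<epsilon> e s' = int len"
    and init: "I 0 (s(T := (s T)(0 := 0)))"
    and step: "\<And>t s'. t < len \<Longrightarrow> I t s' \<Longrightarrow> s' T 0 = int t \<Longrightarrow>
      (\<And>x. x \<notin> insert T (mods c) \<Longrightarrow> s' x = s x) \<Longrightarrow>
      wp \<epsilon> B c (\<lambda>s''. I (Suc t) (s''(T := (s'' T)(0 := int t + 1)))) s'"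
    and fin: "\<And>s'. I len s' \<Longrightarrow> s' T 0 = int len \<Longrightarrow>
      (\<And>x. x \<notin> insert T (mods c) \<Longrightarrow> s' x = s x) \<Longrightarrow> Q s'"
  shows "wp \<epsilon> B (For T e c) Q s"
proof -
  let ?s = "s(T := (s T)(0 := 0))" and ?c = "Seq c (Set T (Add (V T) (Const 1)))"
  have small: "int t \<le> 2 ^ B" if "t \<le> B" for t
  proof -
    have "int t < 2 ^ t" using of_nat_less_two_power by blast
    also have "\<dots> \<le> 2 ^ B" using that by simp
    finally show ?thesis by simp
  qed
  have frame: "s' x = s x" if "\<And>x. x \<notin> mods ?c \<Longrightarrow> s' x = ?s x" "x \<notin> insert T (mods c)" for s' x
    using that(1)[of x] that(2) by simp
  let ?I = "\<lambda>j s'. \<exists>t\<le>len. j = len - t \<and> s' T 0 = int t \<and> I t s'"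
  have "wp \<epsilon> B (While (Less (V T) e) ?c) Q ?s"
  proof (rule wp_While[where I = ?I and j = len])
    show "?I len ?s" using init by (intro exI[of _ 0]) simp
    fix j s' assume I: "?I j s'" and fr: "\<And>x. x \<notin> mods ?c \<Longrightarrow> s' x = ?s x"
    then obtain t where t: "t \<le> len" "j = len - t" "s' T 0 = int t" "I t s'" by auto
    have ev: "aok \<epsilon> B e s'" "aval \<epsilon> e s' = int len" using e[OF frame[OF fr]] by simp_all
    show "bok \<epsilon> B (Less (V T) e) s'" using ev by simp
    show "Q s'" if "\<not> bval \<epsilon> (Less (V T) e) s'"
      using that t ev by (intro fin[OF _ _ frame[OF fr]]) auto
    assume "bval \<epsilon> (Less (V T) e) s'"
    then have lt: "t < len" using t ev by simp
    have "wp \<epsilon> B c (wp \<epsilon> B (Set T (Add (V T) (Const 1))) (?I (j - 1))) s'"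
    proof (rule wp_frame[OF step[OF lt t(4,3) frame[OF fr]]])
      fix s'' assume *: "I (Suc t) (s''(T := (s'' T)(0 := int t + 1)))" "\<And>x. x \<notin> mods c \<Longrightarrow> s'' x = s' x"
      have "s'' T 0 = int t" using *(2)[OF T] t(3) by simp
      moreover have "int (Suc t) \<le> 2 ^ B" using lt len by (intro small) simp
      ultimately show "wp \<epsilon> B (Set T (Add (V T) (Const 1))) (?I (j - 1)) s''"
        using *(1) lt t(2) by (auto intro!: exI[of _ "Suc t"] simp: add.commute)
    qed
    then show "0 < j \<and> wp \<epsilon> B ?c (?I (j - 1)) s'" using lt t(2) by simp
  qed (use len in auto)
  then show ?thesis by (simp add: For_def)
qed

text \<open>Bounding the sum of absolute values covers every intermediate value of the accumulator
  together with the final one.\<close>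

lemma wp_Sum:
  assumes x: "x \<noteq> T" and len: "len \<le> B"
    and e: "\<And>s'. (\<And>y. y \<notin> {x, T} \<Longrightarrow> s' y = s y) \<Longrightarrow> aok \<epsilon> B e s' \<and> aval \<epsilon> e s' = int len"
    and f: "\<And>t s'. t < len \<Longrightarrow> s' T 0 = int t \<Longrightarrow> (\<And>y. y \<notin> {x, T} \<Longrightarrow> s' y = s y) \<Longrightarrow>
      aok \<epsilon> B f s' \<and> aval \<epsilon> f s' = g t"
    and bound: "(\<Sum>t<len. \<bar>g t\<bar>) \<le> 2 ^ B"
    and fin: "\<And>s'. s' x 0 = (\<Sum>t<len. g t) \<Longrightarrow> (\<And>y. y \<notin> {x, T} \<Longrightarrow> s' y = s y) \<Longrightarrow> Q s'"
  shows "wp \<epsilon> B (Sum x T e f) Q s"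
proof -
  let ?s = "s(x := (s x)(0 := 0))"
  let ?I = "\<lambda>t s'. s' x 0 = (\<Sum>t<t. g t)"
  have frame: "s' y = s y" if "\<And>y. y \<notin> insert T (mods (Set x (Add (V x) f))) \<Longrightarrow> s' y = ?s y"
    "y \<notin> {x, T}" for s' y
    using that(1)[of y] that(2) by simp
  have "wp \<epsilon> B (For T e (Set x (Add (V x) f))) Q ?s"
  proof (rule wp_For[where I = ?I and len = len])
    fix t s' assume t: "t < len" and I: "?I t s'" and T: "s' T 0 = int t"
      and fr: "\<And>y. y \<notin> insert T (mods (Set x (Add (V x) f))) \<Longrightarrow> s' y = ?s y"
    have fv: "aok \<epsilon> B f s'" "aval \<epsilon> f s' = g t" using f[OF t T frame[OF fr]] by simp_all
    have "\<bar>\<Sum>t<Suc t. g t\<bar> \<le> (\<Sum>t<Suc t. \<bar>g t\<bar>)" by (rule sum_abs)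
    also have "\<dots> \<le> (\<Sum>t<len. \<bar>g t\<bar>)" using t by (intro sum_mono2) auto
    finally have "\<bar>\<Sum>t<Suc t. g t\<bar> \<le> 2 ^ B" using bound by simp
    then show "wp \<epsilon> B (Set x (Add (V x) f)) (\<lambda>s''. ?I (Suc t) (s''(T := (s'' T)(0 := int t + 1)))) s'"
      using fv I x by (simp add: add.commute)
  next
    fix s' assume "\<And>y. y \<notin> insert T (mods (Set x (Add (V x) f))) \<Longrightarrow> s' y = ?s y"
    from e[OF frame[OF this]] show "aok \<epsilon> B e s' \<and> aval \<epsilon> e s' = int len" by simp
  next
    fix s' assume 1: "?I len s'" and 2: "\<And>y. y \<notin> insert T (mods (Set x (Add (V x) f))) \<Longrightarrow> s' y = ?s y"
    show "Q s'" by (rule fin[OF 1 frame[OF 2]]) simp_all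
  qed (use x len in auto)
  then show ?thesis by (simp add: Sum_def)
qed

text \<open>\<open>g\<close> gives the address written in round \<open>t\<close>. Injectivity means
  that no cell is written twice, so earlier results survive.\<close>

lemma wp_Vec:
  assumes X: "X \<noteq> T" and len: "len \<le> B" and inj: "inj_on g {..<len}"
    and e: "\<And>s'. (\<And>y. y \<notin> {X, T} \<Longrightarrow> s' y = s y) \<Longrightarrow> aok \<epsilon> B e s' \<and> aval \<epsilon> e s' = int len"
    and f: "\<And>t s'. t < len \<Longrightarrow> s' T 0 = int t \<Longrightarrow> (\<And>y. y \<notin> {X, T} \<Longrightarrow> s' y = s y) \<Longrightarrow>
      (\<And>i. i \<notin> g ` {..<t} \<Longrightarrow> s' X i = s X i) \<Longrightarrow>
      aok \<epsilon> B i s' \<and> aok \<epsilon> B f s' \<and> aval \<epsilon> i s' = g t \<and> aval \<epsilon> f s' = h t"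
    and bound: "\<And>t. t < len \<Longrightarrow> \<bar>h t\<bar> \<le> 2 ^ B"
    and fin: "\<And>s'. (\<And>t. t < len \<Longrightarrow> s' X (g t) = h t) \<Longrightarrow>
      (\<And>i. i \<notin> g ` {..<len} \<Longrightarrow> s' X i = s X i) \<Longrightarrow> (\<And>y. y \<notin> {X, T} \<Longrightarrow> s' y = s y) \<Longrightarrow> Q s'"
  shows "wp \<epsilon> B (Vec X T e i f) Q s"
  unfolding Vec_def
proof (rule wp_For[where len = len and
      I = "\<lambda>t s'. (\<forall>u<t. s' X (g u) = h u) \<and> (\<forall>i. i \<notin> g ` {..<t} \<longrightarrow> s' X i = s X i)"])
  fix t s'
  assume t: "t < len" and T: "s' T 0 = int t"
    and I: "(\<forall>u<t. s' X (g u) = h u) \<and> (\<forall>i. i \<notin> g ` {..<t} \<longrightarrow> s' X i = s X i)"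
    and fr: "\<And>y. y \<notin> insert T (mods (Store X i f)) \<Longrightarrow> s' y = s y"
  have fv: "aok \<epsilon> B i s'" "aok \<epsilon> B f s'" "aval \<epsilon> i s' = g t" "aval \<epsilon> f s' = h t"
    using f[of t s'] t T fr I by auto
  have "g u \<noteq> g t" if "u < t" for u using inj that t by (auto simp: inj_on_def)
  then show "wp \<epsilon> B (Store X i f) (\<lambda>s''. (\<forall>u<Suc t. (s''(T := (s'' T)(0 := int t + 1))) X (g u) = h u) \<and>
      (\<forall>i. i \<notin> g ` {..<Suc t} \<longrightarrow> (s''(T := (s'' T)(0 := int t + 1))) X i = s X i)) s'"
    using fv bound[OF t] I X by (auto simp: less_Suc_eq lessThan_Suc)
next
  fix s' assume fr: "\<And>y. y \<notin> insert T (mods (Store X i f)) \<Longrightarrow> s' y = s y"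
    and I: "(\<forall>u<len. s' X (g u) = h u) \<and> (\<forall>i. i \<notin> g ` {..<len} \<longrightarrow> s' X i = s X i)"
  show "Q s'" by (rule fin) (use fr I in auto)
qed (use X len e in auto)

text \<open>Matrices with rows of length \<open>n\<close> are stored row by row; entries outside the row are read as
  \<open>0\<close>, so that equations between matrices are equations between functions. Array \<open>2\<close> holds \<open>n\<close>.\<close>

definition mt :: "nat \<Rightarrow> (int \<Rightarrow> int) \<Rightarrow> nat \<Rightarrow> nat \<Rightarrow> int" where
  "mt n a i t = (if t < n then a (int i * int n + int t) else 0)"

lemma mtD: "mt n a i = w \<Longrightarrow> t < n \<Longrightarrow> a (int i * int n + int t) = w t"
  by (auto simp: mt_def)

lemma mt_eq: "t < n \<Longrightarrow> a (int i * int n + int t) = mt n a i t"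
  by (simp add: mt_def)

lemma row_index_inject:
  assumes "t < n" "u < n" "int i * int n + int t = int j * int n + int u"
  shows "i = j \<and> t = u"
proof -
  have "int (i * n + t) = int (j * n + u)" using assms(3) by simp
  then have *: "i * n + t = j * n + u" by linarith
  have "(i * n + t) div n = i" "(j * n + u) div n = j" using assms(1,2) by simp_all
  then show ?thesis using * by simp
qed

definition Ix :: "nat \<Rightarrow> aexp \<Rightarrow> nat \<Rightarrow> aexp" where
  "Ix X r T = Get X (Add (Mul r (V 2)) (V T))"

definition Row :: "nat \<Rightarrow> aexp \<Rightarrow> nat \<Rightarrow> aexp \<Rightarrow> com" where
  "Row X r T f = Vec X T (V 2) (Add (Mul r (V 2)) (V T)) f"

lemma mods_Row [simp]: "mods (Row X r T f) = {X, T}"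
  by (simp add: Row_def)

lemma Ix_simps [simp]:
  "aok \<epsilon> B (Ix X r T) s = aok \<epsilon> B r s"
  "aval \<epsilon> (Ix X r T) s = s X (aval \<epsilon> r s * s 2 0 + s T 0)"
  by (simp_all add: Ix_def)

text \<open>The premise for \<open>f\<close> also offers those entries of row \<open>k\<close> that
  are not yet overwritten, because rows are often updated in place from their own old
  entries.\<close>

lemma wp_Row:
  assumes X: "X \<noteq> T" "X \<noteq> 2" "T \<noteq> 2" and n: "s 2 0 = int n" "n \<le> B"
    and r: "\<And>s'. (\<And>y. y \<notin> {X, T} \<Longrightarrow> s' y = s y) \<Longrightarrow> aok \<epsilon> B r s' \<and> aval \<epsilon> r s' = int k"
    and f: "\<And>t s'. t < n \<Longrightarrow> s' T 0 = int t \<Longrightarrow> (\<And>y. y \<notin> {X, T} \<Longrightarrow> s' y = s y) \<Longrightarrow>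
      (\<And>i u. u < n \<Longrightarrow> i \<noteq> k \<or> t \<le> u \<Longrightarrow> s' X (int i * int n + int u) = mt n (s X) i u) \<Longrightarrow>
      aok \<epsilon> B f s' \<and> aval \<epsilon> f s' = h t"
    and bound: "\<And>t. t < n \<Longrightarrow> \<bar>h t\<bar> \<le> 2 ^ B"
    and fin: "\<And>s'. mt n (s' X) = (mt n (s X))(k := (\<lambda>t. if t < n then h t else 0)) \<Longrightarrow>
      (\<And>y. y \<notin> {X, T} \<Longrightarrow> s' y = s y) \<Longrightarrow> Q s'"
  shows "wp \<epsilon> B (Row X r T f) Q s"
  unfolding Row_def
proof (rule wp_Vec[where len = n and g = "\<lambda>t. int k * int n + int t" and h = h])
  let ?g = "\<lambda>t. int k * int n + int t"
  show "inj_on ?g {..<n}" by (simp add: inj_on_def)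
  fix t s'
  assume t: "t < n" and T: "s' T 0 = int t" and fr: "\<And>y. y \<notin> {X, T} \<Longrightarrow> s' y = s y"
    and old: "\<And>i. i \<notin> ?g ` {..<t} \<Longrightarrow> s' X i = s X i"
  have "s' X (int i * int n + int u) = mt n (s X) i u" if "u < n" "i \<noteq> k \<or> t \<le> u" for i u
  proof -
    have "int i * int n + int u \<notin> ?g ` {..<t}"
    proof
      assume "int i * int n + int u \<in> ?g ` {..<t}"
      then obtain v where v: "v < t" "int i * int n + int u = int k * int n + int v" by auto
      from row_index_inject[OF that(1) _ v(2)] v(1) t that(2) show False by auto
    qed
    then show ?thesis using old that(1) by (simp add: mt_def)
  qed
  from f[OF t T fr this] r[OF fr]
  show "aok \<epsilon> B (Add (Mul r (V 2)) (V T)) s' \<and> aok \<epsilon> B f s' \<and>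
      aval \<epsilon> (Add (Mul r (V 2)) (V T)) s' = ?g t \<and> aval \<epsilon> f s' = h t"
    using fr[of 2] X n T by simp
next
  let ?g = "\<lambda>t. int k * int n + int t"
  fix s' assume fr: "\<And>y. y \<notin> {X, T} \<Longrightarrow> s' y = s y"
    and new: "\<And>t. t < n \<Longrightarrow> s' X (?g t) = h t"
    and old: "\<And>i. i \<notin> ?g ` {..<n} \<Longrightarrow> s' X i = s X i"
  have "mt n (s' X) i u = ((mt n (s X))(k := (\<lambda>t. if t < n then h t else 0))) i u" for i u
  proof (cases "u < n \<and> i \<noteq> k")
    case True
    have "int i * int n + int u \<notin> ?g ` {..<n}"
    proof
      assume "int i * int n + int u \<in> ?g ` {..<n}"
      then obtain v where v: "v < n" "int i * int n + int u = int k * int n + int v" by auto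
      from row_index_inject[OF _ v(1) v(2)] True show False by auto
    qed
    then show ?thesis using old True by (simp add: mt_def)
  next
    case False
    then show ?thesis using new by (auto simp: mt_def)
  qed
  then show "Q s'" by (intro fin ext fr)
qed (use X n bound in auto)

section \<open>Gram determinants and integral orthogonalization\<close>

definition sqm :: "nat \<Rightarrow> (nat \<Rightarrow> nat \<Rightarrow> int) \<Rightarrow> int mat" where
  "sqm j A = mat j j (\<lambda>(a, b). A a b)"

definition minor :: "(nat \<Rightarrow> nat \<Rightarrow> int) \<Rightarrow> nat \<Rightarrow> int" where
  "minor A j = det (sqm j A)"

definition adj :: "(nat \<Rightarrow> nat \<Rightarrow> int) \<Rightarrow> nat \<Rightarrow> nat \<Rightarrow> nat \<Rightarrow> int" where
  "adj A j a b = adj_mat (sqm j A) $$ (a, b)"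

lemma sqm_carrier [simp]: "sqm j A \<in> carrier_mat j j" "dim_row (sqm j A) = j" "dim_col (sqm j A) = j"
  by (simp_all add: sqm_def)

lemma adj_left:
  assumes "a < j" "b < j"
  shows "(\<Sum>c<j. adj A j a c * A c b) = (if a = b then minor A j else 0)"
proof -
  have "(adj_mat (sqm j A) * sqm j A) $$ (a, b) = (det (sqm j A) \<cdot>\<^sub>m 1\<^sub>m j) $$ (a, b)"
    using adj_mat(3)[of "sqm j A" j] by simp
  then show ?thesis using assms adj_mat(1)[of "sqm j A" j]
    by (auto simp: scalar_prod_def adj_def minor_def sqm_def lessThan_atLeast0)
qed

lemma adj_right:
  assumes "a < j" "b < j"
  shows "(\<Sum>c<j. A a c * adj A j c b) = (if a = b then minor A j else 0)"
proof -
  have "(sqm j A * adj_mat (sqm j A)) $$ (a, b) = (det (sqm j A) \<cdot>\<^sub>m 1\<^sub>m j) $$ (a, b)"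
    using adj_mat(2)[of "sqm j A" j] by simp
  then show ?thesis using assms adj_mat(1)[of "sqm j A" j]
    by (auto simp: scalar_prod_def adj_def minor_def sqm_def lessThan_atLeast0)
qed

lemma minor_0 [simp]: "minor A 0 = 1"
  by (simp add: minor_def sqm_def)

lemma sqm_cong: "(\<And>a b. a < j \<Longrightarrow> b < j \<Longrightarrow> A a b = A' a b) \<Longrightarrow> sqm j A = sqm j A'"
  by (auto simp: sqm_def)

lemma minor_cong: "(\<And>a b. a < j \<Longrightarrow> b < j \<Longrightarrow> A a b = A' a b) \<Longrightarrow> minor A j = minor A' j"
  unfolding minor_def using sqm_cong[of j A A'] by simp

text \<open>Multiplying the vanishing combination of rows by the adjugate isolates
  \<open>c m * minor A j\<close>.\<close>

lemma minor_kernel: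
  fixes c :: "nat \<Rightarrow> real"
  assumes "minor A j \<noteq> 0" "\<And>b. b < j \<Longrightarrow> (\<Sum>i<j. c i * of_int (A i b)) = 0" "m < j"
  shows "c m = 0"
proof -
  have "0 = (\<Sum>b<j. (\<Sum>i<j. c i * of_int (A i b)) * of_int (adj A j b m))"
    using assms(2) by simp
  also have "\<dots> = (\<Sum>i<j. c i * of_int (\<Sum>b<j. A i b * adj A j b m))"
    by (simp add: sum_distrib_left sum_distrib_right, subst sum.swap) (simp add: mult.assoc)
  also have "\<dots> = (\<Sum>i<j. if i = m then c i * of_int (minor A j) else 0)"
    using assms(3) by (intro sum.cong refl) (simp add: adj_right del: of_int_sum)
  also have "\<dots> = c m * of_int (minor A j)" using assms(3) by (simp add: sum.delta)
  finally show ?thesis using assms(1) by simp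
qed

lemma minor_kernel_int:
  fixes c :: "nat \<Rightarrow> int"
  assumes "minor A j \<noteq> 0" "\<And>b. b < j \<Longrightarrow> (\<Sum>i<j. c i * A i b) = 0" "m < j"
  shows "c m = 0"
proof -
  have "(\<Sum>i<j. of_int (c i) * of_int (A i b)) = (0::real)" if "b < j" for b
    using assms(2)[OF that] by (metis (no_types, lifting) of_int_0 of_int_mult of_int_sum sum.cong)
  from minor_kernel[OF assms(1) this assms(3)] show ?thesis by simp
qed

text \<open>Coefficients of \<open>minor A j\<close> times the projection of the \<open>k\<close>-th generator onto the span of the
  first \<open>j\<close> generators, for the bilinear form with Gram matrix \<open>A\<close>; by Cramer's rule they are
  integers. \<open>om A j k b\<close> is the pairing of the corresponding orthogonal component with the \<open>b\<close>-th
  generator.\<close>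

definition zc :: "(nat \<Rightarrow> nat \<Rightarrow> int) \<Rightarrow> nat \<Rightarrow> nat \<Rightarrow> nat \<Rightarrow> int" where
  "zc A j k i = (\<Sum>a<j. A k a * adj A j a i)"

definition om :: "(nat \<Rightarrow> nat \<Rightarrow> int) \<Rightarrow> nat \<Rightarrow> nat \<Rightarrow> nat \<Rightarrow> int" where
  "om A j k b = minor A j * A k b - (\<Sum>i<j. zc A j k i * A i b)"

lemma zc_solve: "b < j \<Longrightarrow> (\<Sum>i<j. zc A j k i * A i b) = minor A j * A k b"
proof -
  assume b: "b < j"
  have "(\<Sum>i<j. zc A j k i * A i b) = (\<Sum>a<j. A k a * (\<Sum>i<j. adj A j a i * A i b))"
    unfolding zc_def sum_distrib_right sum_distrib_left by (subst sum.swap) (simp add: mult.assoc)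
  also have "\<dots> = (\<Sum>a<j. if a = b then A k a * minor A j else 0)"
    using b by (intro sum.cong refl) (simp add: adj_left)
  also have "\<dots> = minor A j * A k b" using b by (simp add: sum.delta)
  finally show ?thesis .
qed

lemma om_eq_0: "b < j \<Longrightarrow> om A j k b = 0"
  by (simp add: om_def zc_solve)

text \<open>After multiplication by \<open>minor A j\<close> the correction term becomes a quadratic
  expression in the projections belonging to \<open>k\<close> and \<open>l\<close>, in which the two
  can be exchanged.\<close>

lemma om_sym:
  assumes "minor A j \<noteq> 0" and sym: "\<And>a b. a < N \<Longrightarrow> b < N \<Longrightarrow> A a b = A b a"
    and "k < N" "l < N" "j \<le> N"
  shows "om A j k l = om A j l k"
proof -
  have *: "minor A j * (\<Sum>i<j. zc A j k i * A i l) = (\<Sum>i<j. \<Sum>b<j. zc A j k i * zc A j l b * A b i)"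
    if "k < N" "l < N" for k l
  proof -
    have "minor A j * (\<Sum>i<j. zc A j k i * A i l) = (\<Sum>i<j. zc A j k i * (minor A j * A l i))"
      using sym[of _ l] that assms(5) by (simp add: sum_distrib_left mult_ac)
    also have "\<dots> = (\<Sum>i<j. zc A j k i * (\<Sum>b<j. zc A j l b * A b i))"
      by (intro sum.cong refl) (simp add: zc_solve)
    finally show ?thesis by (simp add: sum_distrib_left mult_ac)
  qed
  have "(\<Sum>i<j. \<Sum>b<j. zc A j k i * zc A j l b * A b i) = (\<Sum>i<j. \<Sum>b<j. zc A j l i * zc A j k b * A b i)"
    by (subst sum.swap, intro sum.cong refl) (use sym assms(5) in \<open>simp add: mult_ac\<close>)
  then have "minor A j * (\<Sum>i<j. zc A j k i * A i l) = minor A j * (\<Sum>i<j. zc A j l i * A i k)"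
    using *[of k l] *[of l k] assms(3,4) by simp
  then show ?thesis using assms(1) sym[OF assms(3,4)] by (simp add: om_def)
qed

text \<open>Schur complement. A lower triangular matrix with determinant \<open>minor A j\<close>
  replaces the last row of the block of size \<open>Suc j\<close> by the pairings of the orthogonal
  component, all of which vanish except the last. Expanding along that row and the product formula
  give two expressions that share the factor \<open>minor A j\<close>.\<close>

lemma om_diag:
  assumes D: "minor A j \<noteq> 0"
  shows "om A j j j = minor A (Suc j)"
proof -
  let ?D = "minor A j"
  let ?l = "\<lambda>a b. if a < j then of_bool (a = b) else if b < j then - zc A j j b else ?D"
  let ?L = "sqm (Suc j) ?l" and ?M = "sqm (Suc j) A"
  let ?P = "?L * ?M"
  have ent: "?P $$ (a, b) = (if a < j then A a b else om A j j b)" if "a < Suc j" "b < Suc j" for a b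
  proof -
    have "?P $$ (a, b) = (\<Sum>c<Suc j. ?l a c * A c b)"
      using that by (simp add: scalar_prod_def sqm_def lessThan_atLeast0)
    also have "\<dots> = (if a < j then A a b else om A j j b)"
    proof (cases "a < j")
      case True
      then have "(\<Sum>c<Suc j. ?l a c * A c b) = (\<Sum>c<Suc j. if c = a then A c b else 0)"
        by (intro sum.cong) auto
      then show ?thesis using True that(1) by (simp add: sum.delta del: sum.lessThan_Suc)
    next
      case False
      then have "a = j" using that by simp
      then have "(\<Sum>c<Suc j. ?l a c * A c b) = (\<Sum>c<j. - (zc A j j c * A c b)) + ?D * A j b"
        by simp
      then show ?thesis using False by (simp add: om_def sum_negf)
    qed
    finally show ?thesis .
  qed
  have "det ?L = prod_list (diag_mat ?L)"
    by (rule det_lower_triangular[of "Suc j"]) (auto simp: sqm_def)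
  also have "\<dots> = (\<Prod>i<Suc j. ?L $$ (i, i))" by (simp add: prod_list_diag_prod lessThan_atLeast0)
  also have "\<dots> = ?D" by (simp add: sqm_def)
  finally have detL: "det ?L = ?D" .
  have "det ?P = (\<Sum>b<Suc j. ?P $$ (j, b) * cofactor ?P j b)"
    by (rule laplace_expansion_row[of _ "Suc j"]) auto
  also have "\<dots> = ?P $$ (j, j) * cofactor ?P j j" using ent by (simp add: om_eq_0)
  also have "cofactor ?P j j = ?D"
  proof -
    have "mat_delete ?P j j = sqm j A"
      by (rule eq_matI) (use ent in \<open>auto simp: mat_delete_def sqm_def[of j A] simp del: index_mult_mat(1)\<close>)
    then show ?thesis by (simp add: cofactor_def minor_def)
  qed
  finally have "det ?P = om A j j j * ?D" using ent by simp
  moreover have "det ?P = ?D * minor A (Suc j)"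
    by (subst det_mult[of _ "Suc j"]) (simp_all add: detL minor_def)
  ultimately show ?thesis using D by simp
qed

text \<open>Both sides solve the same linear system with the nonsingular block of size
  \<open>Suc j\<close>, so they agree. In column \<open>j\<close> this uses the Schur complement
  formula and the symmetry of the pairings.\<close>

lemma zc_rec:
  assumes D: "minor A j \<noteq> 0" "minor A (Suc j) \<noteq> 0"
    and sym: "\<And>a b. a < N \<Longrightarrow> b < N \<Longrightarrow> A a b = A b a" and k: "j < k" "k < N"
  shows "i \<le> j \<Longrightarrow> minor A j * zc A (Suc j) k i =
    (if i < j then minor A (Suc j) * zc A j k i - om A j j k * zc A j j i else om A j j k * minor A j)"
proof -
  let ?e = "\<lambda>i. if i < j then minor A (Suc j) * zc A j k i - om A j j k * zc A j j i
    else om A j j k * minor A j"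
  let ?c = "\<lambda>i. minor A j * zc A (Suc j) k i - ?e i"
  assume i: "i \<le> j"
  have "(\<Sum>i<Suc j. ?c i * A i b) = 0" if b: "b < Suc j" for b
  proof -
    have "(\<Sum>i<Suc j. ?e i * A i b) = minor A (Suc j) * (\<Sum>i<j. zc A j k i * A i b) +
        om A j j k * (minor A j * A j b - (\<Sum>i<j. zc A j j i * A i b))"
      by (simp add: sum_subtractf sum_distrib_left algebra_simps)
    also have "\<dots> = minor A (Suc j) * (minor A j * A k b - om A j k b) + om A j j k * om A j j b"
      by (simp add: om_def)
    also have "\<dots> = minor A (Suc j) * minor A j * A k b"
    proof (cases "b = j")
      case True
      then show ?thesis using om_diag[OF D(1)] om_sym[OF D(1) sym, of N k j] k
        by (simp add: algebra_simps)
    next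
      case False
      then show ?thesis using b by (simp add: om_eq_0)
    qed
    finally have "(\<Sum>i<Suc j. ?e i * A i b) = minor A (Suc j) * minor A j * A k b" .
    moreover have "(\<Sum>i<Suc j. minor A j * zc A (Suc j) k i * A i b) = minor A j * (minor A (Suc j) * A k b)"
      unfolding zc_solve[OF b, symmetric] sum_distrib_left by (simp add: mult.assoc)
    ultimately show ?thesis by (simp only: left_diff_distrib sum_subtractf) simp
  qed
  from minor_kernel_int[OF D(2) this, of i] i show ?thesis by simp
qed

section \<open>Orthogonal components of integer vectors\<close>

definition dot :: "nat \<Rightarrow> (nat \<Rightarrow> 'a :: comm_ring_1) \<Rightarrow> (nat \<Rightarrow> 'a) \<Rightarrow> 'a" where
  "dot n x y = (\<Sum>t<n. x t * y t)"

lemma dot_sub_sum: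
  "dot n (\<lambda>t. c * x t - (\<Sum>i\<in>I. z i * f i t)) y = c * dot n x y - (\<Sum>i\<in>I. z i * dot n (f i) y)"
proof -
  have "(\<Sum>t<n. \<Sum>i\<in>I. z i * f i t * y t) = (\<Sum>i\<in>I. z i * (\<Sum>t<n. f i t * y t))"
    by (subst sum.swap) (simp add: sum_distrib_left mult.assoc)
  then show ?thesis
    by (simp add: dot_def left_diff_distrib sum_subtractf sum_distrib_left sum_distrib_right mult.assoc)
qed

lemma dot_commute: "dot n x y = dot n y x"
  by (simp add: dot_def mult.commute)

definition gram :: "nat \<Rightarrow> (nat \<Rightarrow> nat \<Rightarrow> int) \<Rightarrow> (nat \<Rightarrow> nat \<Rightarrow> int) \<Rightarrow> nat \<Rightarrow> nat \<Rightarrow> int" where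
  "gram n U Y i j = dot n (U i) (Y j)"

text \<open>For the Gram matrix \<open>A\<close> of a basis \<open>U\<close>, the vector \<open>pu U A j k\<close> is \<open>minor A j\<close> times the
  component of \<open>U k\<close> orthogonal to \<open>U 0, \<dots>, U (j - 1)\<close>.\<close>

definition pu :: "(nat \<Rightarrow> nat \<Rightarrow> int) \<Rightarrow> (nat \<Rightarrow> nat \<Rightarrow> int) \<Rightarrow> nat \<Rightarrow> nat \<Rightarrow> nat \<Rightarrow> int" where
  "pu U A j k t = minor A j * U k t - (\<Sum>i<j. zc A j k i * U i t)"

lemma pu_0 [simp]: "pu U A 0 k = U k"
  by (simp add: pu_def fun_eq_iff)

lemma dot_pu: "dot n (pu U (gram n U Y) j k) (Y b) = om (gram n U Y) j k b"
  using dot_sub_sum[of n "minor (gram n U Y) j" "U k" "zc (gram n U Y) j k" U "{..<j}" "Y b"]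
  by (simp add: pu_def[abs_def] om_def gram_def)

text \<open>One step of fraction-free Gram-Schmidt: the component orthogonal to one more generator
  arises from two vectors that are already known.\<close>

lemma pu_rec:
  assumes D: "minor A j \<noteq> 0" "minor A (Suc j) \<noteq> 0"
    and sym: "\<And>a b. a < N \<Longrightarrow> b < N \<Longrightarrow> A a b = A b a" and k: "j < k" "k < N"
  shows "minor A j * pu U A (Suc j) k t =
    minor A (Suc j) * pu U A j k t - om A j j k * pu U A j j t"
proof -
  have "minor A j * (\<Sum>i<Suc j. zc A (Suc j) k i * U i t) =
      (\<Sum>i<j. (minor A (Suc j) * zc A j k i - om A j j k * zc A j j i) * U i t) + om A j j k * minor A j * U j t"
  proof -
    have "minor A j * (\<Sum>i<Suc j. zc A (Suc j) k i * U i t) =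
        (\<Sum>i<Suc j. (minor A j * zc A (Suc j) k i) * U i t)"
      unfolding sum_distrib_left by (simp add: mult.assoc)
    also have "\<dots> = (\<Sum>i<Suc j. (if i < j then minor A (Suc j) * zc A j k i - om A j j k * zc A j j i
        else om A j j k * minor A j) * U i t)"
      by (intro sum.cong refl) (use zc_rec[OF D sym k] in simp)
    finally show ?thesis by simp
  qed
  then show ?thesis
    by (simp add: pu_def right_diff_distrib left_diff_distrib sum_subtractf sum_distrib_left mult_ac)
qed

text \<open>The quotient is known to be an integer vector beforehand, so the integer division of the
  program is exact.\<close>

lemma pu_rec_div:
  assumes "minor A j \<noteq> 0" "minor A (Suc j) \<noteq> 0"
    "\<And>a b. a < N \<Longrightarrow> b < N \<Longrightarrow> A a b = A b a" "j < k" "k < N"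
  shows "(minor A (Suc j) * pu U A j k t - om A j j k * pu U A j j t) div minor A j = pu U A (Suc j) k t"
  using pu_rec[OF assms, of U t] assms(1) by (metis nonzero_mult_div_cancel_left)

text \<open>Row \<open>i\<close> of the lower triangular change of basis from the generators to
  their scaled orthogonal components.\<close>

definition wc :: "(nat \<Rightarrow> nat \<Rightarrow> int) \<Rightarrow> nat \<Rightarrow> nat \<Rightarrow> int" where
  "wc A i a = (if a = i then minor A i else if a < i then - zc A i i a else 0)"

lemma sum_wc:
  assumes "i < N"
  shows "(\<Sum>a<N. of_int (wc A i a) * f a) = (of_int (minor A i) * f i - (\<Sum>a<i. of_int (zc A i i a) * f a) :: 'a :: comm_ring_1)"
proof -
  have "(\<Sum>a<N. of_int (wc A i a) * f a) = (\<Sum>a<Suc i. of_int (wc A i a) * f a)"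
    using assms by (intro sum.mono_neutral_right) (auto simp: wc_def)
  then show ?thesis by (simp add: wc_def sum_negf)
qed

lemma pu_eq_wc:
  assumes "j < N"
  shows "pu U A j j t = (\<Sum>a<N. wc A j a * U a t)"
  using sum_wc[OF assms, of A "\<lambda>a. U a t"] by (simp add: pu_def)

lemma sum_wc_om: "i < N \<Longrightarrow> (\<Sum>a<N. wc A i a * A a b) = om A i i b"
  using sum_wc[of i N A "\<lambda>a. A a b"] by (simp add: om_def)

section \<open>Diagonalizing a symmetric form\<close>

definition bform :: "nat \<Rightarrow> (nat \<Rightarrow> nat \<Rightarrow> int) \<Rightarrow> (nat \<Rightarrow> real) \<Rightarrow> (nat \<Rightarrow> real) \<Rightarrow> real" where
  "bform N A x y = (\<Sum>a<N. \<Sum>b<N. x a * of_int (A a b) * y b)"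

lemma bform_wc:
  assumes "i < N"
  shows "bform N A (\<lambda>a. of_int (wc A i a)) y = (\<Sum>b<N. of_int (om A i i b) * y b)"
proof -
  have "bform N A (\<lambda>a. of_int (wc A i a)) y = (\<Sum>b<N. of_int (\<Sum>a<N. wc A i a * A a b) * y b)"
    unfolding bform_def by (subst sum.swap) (simp add: sum_distrib_right)
  then show ?thesis using sum_wc_om[OF assms, of A] by simp
qed

lemma bform_sym:
  assumes "\<And>a b. a < N \<Longrightarrow> b < N \<Longrightarrow> A a b = A b a"
  shows "bform N A x y = bform N A y x"
  unfolding bform_def by (subst sum.swap) (intro sum.cong refl, use assms in \<open>simp add: mult_ac\<close>)

lemma bform_add: "bform N A (\<lambda>a. x a + c * w a) y = bform N A x y + c * bform N A w y"
  "bform N A y (\<lambda>a. x a + c * w a) = bform N A y x + c * bform N A y w"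
  by (simp_all add: bform_def algebra_simps sum.distrib sum_distrib_left)

text \<open>Jacobi's diagonalization, by completing squares. The vectors \<open>wc A i\<close> are
  orthogonal for the form with values \<open>minor A i * minor A (Suc i)\<close>. Subtracting a
  multiple of \<open>wc A m\<close> clears the highest coordinate that may be nonzero, and the
  remainder is covered by induction.\<close>

lemma parseval_form:
  assumes sym: "\<And>a b. a < N \<Longrightarrow> b < N \<Longrightarrow> A a b = A b a"
    and "m \<le> N" "\<And>i. i \<le> m \<Longrightarrow> minor A i \<noteq> 0" "\<And>a. m \<le> a \<Longrightarrow> a < N \<Longrightarrow> x a = 0"
  shows "bform N A x x =
    (\<Sum>i<m. (\<Sum>b<N. of_int (om A i i b) * x b)\<^sup>2 / (of_int (minor A i) * of_int (minor A (Suc i))))"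
  using assms(2-)
proof (induction m arbitrary: x)
  case 0
  then show ?case by (simp add: bform_def)
next
  case (Suc m)
  let ?D = "\<lambda>i. real_of_int (minor A i)"
  let ?w = "\<lambda>i a. real_of_int (wc A i a)"
  let ?O = "\<lambda>i x. (\<Sum>b<N. of_int (om A i i b) * x b) :: real"
  \<comment> \<open>\<open>wc A m\<close> has the entry \<open>minor A m\<close> at position
    \<open>m\<close>, so this multiple of it cancels \<open>x m\<close>.\<close>
  define c where "c = x m / ?D m"
  define y where "y = (\<lambda>a. x a + (- c) * ?w m a)"
  have m: "m < N" using Suc.prems by simp
  have D: "?D m \<noteq> 0" "?D (Suc m) \<noteq> 0" "minor A m \<noteq> 0" using Suc.prems(2) by simp_all
  have y0: "y a = 0" if "m \<le> a" "a < N" for a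
    using that Suc.prems(3)[of a] D by (cases "a = m") (auto simp: y_def c_def wc_def)
  have Ow: "?O i (?w m) = (if i = m then ?D (Suc m) * ?D m else 0)" if "i \<le> m" for i
  proof -
    have i: "i < N" using that m by simp
    have "?O i (?w m) = bform N A (?w m) (?w i)"
      using bform_wc[OF i, of A "?w m"] bform_sym[of N A "?w i" "?w m", OF sym] by simp
    also have "\<dots> = ?O m (?w i)" by (rule bform_wc[OF m])
    also have "\<dots> = (\<Sum>b<N. if b = m then of_int (om A m m m) * ?w i m else 0)"
      using that by (intro sum.cong refl) (auto simp: om_eq_0 wc_def linorder_neq_iff)
    also have "\<dots> = of_int (om A m m m) * ?w i m" using m by simp
    also have "\<dots> = (if i = m then ?D (Suc m) * ?D m else 0)"
      using that om_diag[OF D(3)] by (auto simp: wc_def)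
    finally show ?thesis .
  qed
  have Oadd: "?O i (\<lambda>a. u a + r * v a) = ?O i u + r * ?O i v" for i u v r
    by (simp add: algebra_simps sum.distrib sum_distrib_left)
  have x: "x = (\<lambda>a. y a + c * ?w m a)" by (simp add: y_def)
  have Omy: "?O m y = 0"
    by (rule sum.neutral) (metis y0 om_eq_0 not_less lessThan_iff mult_zero_left mult_zero_right of_int_0)
  have Ox: "?O i x = ?O i y" if "i < m" for i
    unfolding x Oadd using Ow[of i] that by simp
  have Omx: "?O m x = c * (?D (Suc m) * ?D m)"
    unfolding x Oadd using Ow[of m] Omy by simp
  have "bform N A x x = bform N A y y + c * bform N A (?w m) y + c * (bform N A (?w m) y + c * bform N A (?w m) (?w m))"
    by (subst (1 2) x) (simp add: bform_add bform_sym[of N A y "?w m", OF sym] algebra_simps)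
  also have "\<dots> = bform N A y y + c\<^sup>2 * (?D (Suc m) * ?D m)"
    using bform_wc[OF m, of A] Omy Ow[of m] by (simp add: power2_eq_square)
  also have "c\<^sup>2 * (?D (Suc m) * ?D m) = (?O m x)\<^sup>2 / (?D m * ?D (Suc m))"
    unfolding Omx using D by (simp add: power2_eq_square field_simps)
  also have "bform N A y y = (\<Sum>i<m. (?O i y)\<^sup>2 / (?D i * ?D (Suc i)))"
    by (rule Suc.IH) (use Suc.prems y0 in auto)
  also have "\<dots> = (\<Sum>i<m. (?O i x)\<^sup>2 / (?D i * ?D (Suc i)))" by (intro sum.cong refl) (simp add: Ox)
  finally show ?case by simp
qed

section \<open>Gram-Schmidt data of a lattice basis\<close>

abbreviation gr :: "nat \<Rightarrow> (nat \<Rightarrow> nat \<Rightarrow> int) \<Rightarrow> nat \<Rightarrow> nat \<Rightarrow> int" where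
  "gr n B \<equiv> gram n B B"

text \<open>This is \<open>gd n B j\<close> times the usual Gram-Schmidt vector, whose squared
  length is \<open>gd n B (Suc j) / gd n B j\<close>.\<close>

definition gs :: "nat \<Rightarrow> (nat \<Rightarrow> nat \<Rightarrow> int) \<Rightarrow> nat \<Rightarrow> nat \<Rightarrow> int" where
  "gs n B j = pu B (gr n B) j j"

definition gd :: "nat \<Rightarrow> (nat \<Rightarrow> nat \<Rightarrow> int) \<Rightarrow> nat \<Rightarrow> int" where
  "gd n B j = minor (gr n B) j"

lemma gr_sym: "gr n B a b = gr n B b a"
  by (simp add: gram_def dot_commute)

lemma dot_gs: "dot n (gs n B j) (B b) = om (gr n B) j j b"
  by (simp add: gs_def dot_pu)

lemma dot_gs_eq_0: "b < j \<Longrightarrow> dot n (gs n B j) (B b) = 0"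
  by (simp add: dot_gs om_eq_0)

lemma dot_gs_diag: "gd n B j \<noteq> 0 \<Longrightarrow> dot n (gs n B j) (B j) = gd n B (Suc j)"
  by (simp add: dot_gs gd_def om_diag)

lemma dot_gs_gs:
  assumes "gd n B j \<noteq> 0"
  shows "dot n (gs n B j) (gs n B j) = gd n B j * gd n B (Suc j)"
proof -
  have "dot n (gs n B j) (gs n B j) =
      gd n B j * dot n (B j) (gs n B j) - (\<Sum>i<j. zc (gr n B) j j i * dot n (B i) (gs n B j))"
    using dot_sub_sum[of n "gd n B j" "B j" "zc (gr n B) j j" B "{..<j}" "gs n B j"]
    by (simp add: gs_def pu_def[abs_def] gd_def)
  also have "\<dots> = gd n B j * gd n B (Suc j)"
    using dot_gs_diag[OF assms] dot_gs_eq_0[of _ j n B] by (simp add: dot_commute[of n _ "gs n B j"])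
  finally show ?thesis .
qed

lemma gd_0 [simp]: "gd n B 0 = 1"
  by (simp add: gd_def)

lemma gd_square: "gd n B n = (minor B n)\<^sup>2"
proof -
  have "sqm n (gr n B) = sqm n B * transpose_mat (sqm n B)"
    by (rule eq_matI) (auto simp: sqm_def gram_def dot_def scalar_prod_def lessThan_atLeast0)
  then have "gd n B n = det (sqm n B) * det (transpose_mat (sqm n B))"
    unfolding gd_def minor_def by (simp add: det_mult[of _ n])
  then show ?thesis by (simp add: minor_def det_transpose[of _ n] power2_eq_square)
qed

text \<open>The coefficient at \<open>B j\<close> is \<open>gd n B j\<close>, so a vanishing vector
  would be a linear dependence of the rows.\<close>

lemma gs_nonzero:
  assumes "minor B n \<noteq> 0" "j < n" "gd n B j \<noteq> 0"
  shows "\<exists>t<n. gs n B j t \<noteq> 0"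
proof (rule ccontr)
  assume "\<not> ?thesis"
  then have "(\<Sum>a<n. wc (gr n B) j a * B a t) = 0" if "t < n" for t
    using that pu_eq_wc[OF assms(2), of B "gr n B" t] by (simp add: gs_def)
  from minor_kernel_int[OF assms(1) this assms(2)] assms(3) show False by (simp add: wc_def gd_def)
qed

lemma dot_self_pos: "\<exists>t<n. x t \<noteq> 0 \<Longrightarrow> 0 < dot n x (x :: nat \<Rightarrow> 'a :: linordered_idom)"
  unfolding dot_def by (auto intro!: sum_pos2 simp: zero_less_mult_iff linorder_neq_iff)

text \<open>The product of two consecutive determinants is a squared length and hence positive,
  which passes positivity from one to the next.\<close>

lemma gd_pos: "minor B n \<noteq> 0 \<Longrightarrow> j \<le> n \<Longrightarrow> 0 < gd n B j"
proof (induction j)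
  case (Suc j)
  then have D: "gd n B j > 0" by simp
  have "0 < dot n (gs n B j) (gs n B j)" using gs_nonzero[of B n j] Suc.prems D by (intro dot_self_pos) auto
  then show ?case using dot_gs_gs[of n B j] D by (simp add: zero_less_mult_iff)
qed simp

lemma basis_span:
  fixes r :: "nat \<Rightarrow> real"
  assumes "minor B n \<noteq> 0"
  obtains y where "\<And>t. t < n \<Longrightarrow> r t = (\<Sum>a<n. y a * of_int (B a t))"
proof
  fix t assume t: "t < n"
  have "(\<Sum>a<n. (\<Sum>b<n. r b * of_int (adj B n b a)) * of_int (B a t)) =
      (\<Sum>b<n. r b * of_int (\<Sum>a<n. adj B n b a * B a t))"
    by (simp add: sum_distrib_left sum_distrib_right mult.assoc, subst sum.swap) simp
  also have "\<dots> = (\<Sum>b<n. if b = t then r b * of_int (minor B n) else 0)"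
    using t by (intro sum.cong refl) (simp add: adj_left del: of_int_sum)
  also have "\<dots> = r t * of_int (minor B n)" using t by (simp add: sum.delta)
  finally show "r t = (\<Sum>a<n. (\<Sum>b<n. r b * of_int (adj B n b a)) / of_int (minor B n) * of_int (B a t))"
    using assms by (simp add: sum_divide_distrib[symmetric] field_simps flip: sum_divide_distrib)
qed

abbreviation (input) rv :: "(nat \<Rightarrow> int) \<Rightarrow> nat \<Rightarrow> real" where
  "rv x \<equiv> (\<lambda>t. of_int (x t))"

lemma dot_of_int: "dot n (\<lambda>t. of_int (x t)) (\<lambda>t. of_int (y t)) = of_int (dot n x y)"
  by (simp add: dot_def)

lemma dot_sum_left: "dot n (\<lambda>t. \<Sum>a\<in>I. y a * f a t) z = (\<Sum>a\<in>I. y a * dot n (f a) z)"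
  unfolding dot_def sum_distrib_right sum_distrib_left by (subst sum.swap) (simp add: mult.assoc)

lemma dot_cong: "(\<And>t. t < n \<Longrightarrow> x t = x' t) \<Longrightarrow> (\<And>t. t < n \<Longrightarrow> y t = y' t) \<Longrightarrow> dot n x y = dot n x' y'"
  by (simp add: dot_def)

text \<open>The diagonalization of the Gram form, applied to the coordinates of \<open>r\<close> in
  the basis \<open>B\<close>.\<close>

lemma parseval:
  fixes r :: "nat \<Rightarrow> real"
  assumes "minor B n \<noteq> 0"
  shows "dot n r r = (\<Sum>i<n. (dot n r (rv (gs n B i)))\<^sup>2 / (of_int (gd n B i) * of_int (gd n B (Suc i))))"
proof -
  obtain y where y: "\<And>t. t < n \<Longrightarrow> r t = (\<Sum>a<n. y a * of_int (B a t))"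
    using basis_span[OF assms, of r] by blast
  have d: "dot n r z = (\<Sum>a<n. y a * dot n (rv (B a)) z)" for z
    unfolding dot_sum_left[symmetric] by (rule dot_cong) (simp_all add: y)
  have "dot n r r = bform n (gr n B) y y"
  proof -
    have "dot n (rv (B a)) r = (\<Sum>b<n. y b * of_int (gr n B a b))" for a
      using d[of "rv (B a)"] by (simp add: dot_commute[of n _ r] dot_of_int gram_def dot_commute[of n "B a"])
    then show ?thesis unfolding d[of r] bform_def
      by (simp add: sum_distrib_left mult_ac)
  qed
  also have "\<dots> = (\<Sum>i<n. (\<Sum>b<n. of_int (om (gr n B) i i b) * y b)\<^sup>2 / (of_int (minor (gr n B) i) * of_int (minor (gr n B) (Suc i))))"
    by (rule parseval_form) (use gr_sym gd_pos[OF assms] in \<open>auto simp: gd_def less_le\<close>)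
  also have "\<dots> = (\<Sum>i<n. (dot n r (rv (gs n B i)))\<^sup>2 / (of_int (gd n B i) * of_int (gd n B (Suc i))))"
  proof (intro sum.cong refl)
    fix i
    have "(\<Sum>b<n. of_int (om (gr n B) i i b) * y b) = dot n r (rv (gs n B i))"
      unfolding d dot_of_int dot_commute[of n "B _"] dot_gs by (simp add: mult.commute)
    then show "(\<Sum>b<n. of_int (om (gr n B) i i b) * y b)\<^sup>2 / (of_int (minor (gr n B) i) * of_int (minor (gr n B) (Suc i))) =
        (dot n r (rv (gs n B i)))\<^sup>2 / (of_int (gd n B i) * of_int (gd n B (Suc i)))"
      by (simp add: gd_def)
  qed
  finally show ?thesis .
qed

text \<open>Along each orthogonalized vector of index at least \<open>q\<close> the residual extends
  over at most half of the length of that vector, and the squared lengths are the quotients of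
  consecutive Gram determinants.\<close>

lemma babai_bound:
  fixes r :: "nat \<Rightarrow> real"
  assumes B: "minor B n \<noteq> 0"
    and "\<And>i. i < q \<Longrightarrow> i < n \<Longrightarrow> dot n r (rv (gs n B i)) = 0"
    and "\<And>i. q \<le> i \<Longrightarrow> i < n \<Longrightarrow> \<bar>dot n r (rv (gs n B i))\<bar> \<le> of_int (gd n B (Suc i)) / 2"
  shows "dot n r r \<le> (\<Sum>i=q..<n. of_int (gd n B (Suc i)) / of_int (gd n B i)) / 4"
proof -
  have "dot n r r = (\<Sum>i<n. (dot n r (rv (gs n B i)))\<^sup>2 / (of_int (gd n B i) * of_int (gd n B (Suc i))))"
    by (rule parseval[OF B])
  also have "\<dots> = (\<Sum>i=q..<n. (dot n r (rv (gs n B i)))\<^sup>2 / (of_int (gd n B i) * of_int (gd n B (Suc i))))"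
    using assms(2) by (intro sum.mono_neutral_right) auto
  also have "\<dots> \<le> (\<Sum>i=q..<n. of_int (gd n B (Suc i)) / of_int (gd n B i) / 4)"
  proof (rule sum_mono)
    fix i assume i: "i \<in> {q..<n}"
    then have D: "0 < gd n B i" "0 < gd n B (Suc i)" using gd_pos[OF B] by auto
    have "(dot n r (rv (gs n B i)))\<^sup>2 \<le> (of_int (gd n B (Suc i)) / 2)\<^sup>2"
      using assms(3)[of i] i by (intro abs_le_square_iff[THEN iffD1]) auto
    then have "(dot n r (rv (gs n B i)))\<^sup>2 / (of_int (gd n B i) * of_int (gd n B (Suc i))) \<le>
        (of_int (gd n B (Suc i)) / 2)\<^sup>2 / (of_int (gd n B i) * of_int (gd n B (Suc i)))"
      using D by (intro divide_right_mono) auto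
    also have "\<dots> = of_int (gd n B (Suc i)) / of_int (gd n B i) / 4"
      using D by (simp add: power2_eq_square field_simps)
    finally show "(dot n r (rv (gs n B i)))\<^sup>2 / (of_int (gd n B i) * of_int (gd n B (Suc i))) \<le>
        of_int (gd n B (Suc i)) / of_int (gd n B i) / 4" .
  qed
  finally show ?thesis by (simp add: sum_divide_distrib)
qed

text \<open>Orthogonality to the first \<open>j\<close> rows determines the coefficients because the
  Gram matrix is nonsingular. This recognizes a vector computed from a modified basis as the old
  one.\<close>

lemma gs_unique:
  assumes D: "gd n B j \<noteq> 0"
    and x: "\<And>t. x t = gd n B j * B j t - (\<Sum>i<j. f i * B i t)"
    and orth: "\<And>b. b < j \<Longrightarrow> dot n x (B b) = 0"
  shows "x = gs n B j"
proof -
  have "f i = zc (gr n B) j j i" if i: "i < j" for i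
  proof -
    have "(\<Sum>i<j. (f i - zc (gr n B) j j i) * gr n B i b) = 0" if b: "b < j" for b
    proof -
      have "x = (\<lambda>t. gd n B j * B j t - (\<Sum>i<j. f i * B i t))" using x by blast
      then have "gd n B j * gr n B j b - (\<Sum>i<j. f i * gr n B i b) = 0"
        using orth[OF b] dot_sub_sum[of n "gd n B j" "B j" f B "{..<j}" "B b"]
        by (simp add: gram_def)
      then show ?thesis using om_eq_0[OF b, of "gr n B" j]
        by (simp add: om_def gd_def left_diff_distrib sum_subtractf)
    qed
    from minor_kernel_int[OF _ this i] D show ?thesis by (simp add: gd_def)
  qed
  then show ?thesis by (auto simp: fun_eq_iff x gs_def pu_def gd_def)
qed

section \<open>Row operations, their effect on Gram determinants and on the mixed lattice\<close>

definition rowop :: "nat \<Rightarrow> (nat \<Rightarrow> int) \<Rightarrow> (nat \<Rightarrow> nat \<Rightarrow> int) \<Rightarrow> nat \<Rightarrow> nat \<Rightarrow> int" where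
  "rowop k c B = B(k := (\<lambda>t. B k t - (\<Sum>i<k. c i * B i t)))"

lemma rowop_inverse: "rowop k (\<lambda>i. - c i) (rowop k c B) = B"
  by (auto simp: rowop_def fun_eq_iff sum_negf)

text \<open>Subtracting earlier rows changes no span of an initial segment. The vector at
  \<open>j\<close> requires the determinant at \<open>j\<close>, and the determinant at
  \<open>Suc j\<close> requires this vector; hence the joint induction.\<close>

lemma gs_rowop:
  assumes B: "minor B n \<noteq> 0"
  shows "j \<le> n \<Longrightarrow> gd n (rowop k c B) j = gd n B j \<and> (j < n \<longrightarrow> gs n (rowop k c B) j = gs n B j)"
proof -
  let ?B = "rowop k c B"
  have step: "gs n ?B j = gs n B j" if j: "j < n" and D: "gd n ?B j = gd n B j" for j
  proof -
    let ?z = "zc (gr n ?B) j j"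
    \<comment> \<open>The multiple of \<open>\<Sum>a<k. c a * B a\<close> that the change of row
      \<open>k\<close> subtracts in total: row \<open>k\<close> may be the leading row itself or one
      of the earlier rows.\<close>
    let ?e = "(if j = k then gd n B j else 0) - (if k < j then ?z k else 0)"
    let ?f = "\<lambda>i. ?z i + ?e * (if i < k then c i else 0)"
    have D0: "gd n B j \<noteq> 0" using gd_pos[OF B, of j] j by simp
    show ?thesis
    proof (rule gs_unique[OF D0])
      fix t
      have rest: "?B i t = B i t - (if i = k then \<Sum>a<k. c a * B a t else 0)" for i
        by (simp add: rowop_def)
      have "gs n ?B j t = gd n B j * ?B j t - (\<Sum>i<j. ?z i * ?B i t)"
        using D by (simp add: gs_def pu_def gd_def)
      also have "(\<Sum>i<j. ?z i * ?B i t) = (\<Sum>i<j. ?z i * B i t) - (\<Sum>i<j. if i = k then ?z k * (\<Sum>a<k. c a * B a t) else 0)"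
        unfolding sum_subtractf[symmetric] by (intro sum.cong refl) (simp add: rest right_diff_distrib)
      also have "(\<Sum>i<j. if i = k then ?z k * (\<Sum>a<k. c a * B a t) else 0) = (if k < j then ?z k * (\<Sum>a<k. c a * B a t) else 0)"
        by (simp add: sum.delta)
      finally have "gs n ?B j t = gd n B j * B j t - (\<Sum>i<j. ?z i * B i t) - ?e * (\<Sum>a<k. c a * B a t)"
        by (cases "j = k"; cases "k < j") (simp_all add: rest algebra_simps)
      moreover have "?e * (\<Sum>a<k. c a * B a t) = (\<Sum>i<j. ?e * (if i < k then c i else 0) * B i t)"
      proof (cases "k \<le> j")
        case True
        have "(\<Sum>i<j. (if i < k then c i else 0) * B i t) = (\<Sum>a<k. c a * B a t)"
          using True by (intro sum.mono_neutral_cong_right) auto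
        then show ?thesis by (simp only: mult.assoc sum_distrib_left[symmetric])
      qed simp
      ultimately show "gs n ?B j t = gd n B j * B j t - (\<Sum>i<j. ?f i * B i t)"
        by (simp add: distrib_right sum.distrib)
    next
      fix b assume b: "b < j"
      have *: "dot n (gs n ?B j) (?B b) = 0" if "b < j" for b using dot_gs_eq_0[OF that] .
      show "dot n (gs n ?B j) (B b) = 0"
      proof (cases "b = k")
        case True
        have "B b = (\<lambda>t. 1 * ?B b t - (\<Sum>i<k. (- c i) * ?B i t))"
          using True by (auto simp: fun_eq_iff rowop_def sum_negf)
        then have "dot n (B b) (gs n ?B j) =
            1 * dot n (?B b) (gs n ?B j) - (\<Sum>i<k. (- c i) * dot n (?B i) (gs n ?B j))"
          using dot_sub_sum[of n 1 "?B b" "\<lambda>i. - c i" ?B "{..<k}" "gs n ?B j"] by simp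
        then show ?thesis using * b True by (simp add: dot_commute[of n _ "gs n ?B j"])
      next
        case False
        then have "B b = ?B b" by (simp add: rowop_def)
        then show ?thesis using *[OF b] by simp
      qed
    qed
  qed
  show "j \<le> n \<Longrightarrow> gd n ?B j = gd n B j \<and> (j < n \<longrightarrow> gs n ?B j = gs n B j)"
  proof (induction j)
  case 0
  then show ?case using step[of 0] by simp
  next
  case (Suc j)
  then have IH: "gd n ?B j = gd n B j" "gs n ?B j = gs n B j" by simp_all
  have D0: "gd n B j \<noteq> 0" using gd_pos[OF B, of j] Suc.prems by simp
  have "gd n ?B (Suc j) = dot n (gs n B j) (?B j)" using dot_gs_diag[of n ?B j] IH D0 by simp
  also have "\<dots> = dot n (gs n B j) (B j)"
  proof (cases "j = k")
    case True
    have "?B j = (\<lambda>t. 1 * B j t - (\<Sum>i<k. c i * B i t))" using True by (simp add: rowop_def)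
    then have "dot n (?B j) (gs n B j) = 1 * dot n (B j) (gs n B j) - (\<Sum>i<k. c i * dot n (B i) (gs n B j))"
      by (simp only: dot_sub_sum)
    moreover have "(\<Sum>i<k. c i * dot n (B i) (gs n B j)) = 0"
      using True dot_gs_eq_0[of _ j n B] by (intro sum.neutral) (simp add: dot_commute[of n "B _"])
    ultimately show ?thesis unfolding dot_commute[of n "gs n B j"] by simp
  qed (simp add: rowop_def)
  finally have "gd n ?B (Suc j) = gd n B (Suc j)" using dot_gs_diag[OF D0] by simp
  then show ?case using step[of "Suc j"] by simp
qed
qed

lemma minor_rowop: "minor B n \<noteq> 0 \<Longrightarrow> minor (rowop k c B) n \<noteq> 0"
  using gs_rowop[of B n n k c] gd_square[of n B] gd_square[of n "rowop k c B"] by auto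

definition rowswap :: "nat \<Rightarrow> (nat \<Rightarrow> nat \<Rightarrow> int) \<Rightarrow> nat \<Rightarrow> nat \<Rightarrow> int" where
  "rowswap k B = B(Suc k := B k, k := B (Suc k))"

lemma rowswap_inverse: "rowswap k (rowswap k B) = B"
  by (auto simp: rowswap_def fun_eq_iff)

lemma om_rec:
  assumes "gd n B j \<noteq> 0" "gd n B (Suc j) \<noteq> 0" "j < k"
  shows "gd n B j * om (gr n B) (Suc j) k b =
    gd n B (Suc j) * om (gr n B) j k b - om (gr n B) j j k * om (gr n B) j j b"
proof -
  let ?p = "\<lambda>i k. pu B (gr n B) i k"
  have *: "gd n B j * ?p (Suc j) k t = gd n B (Suc j) * ?p j k t - om (gr n B) j j k * ?p j j t" for t
    using pu_rec[of "gr n B" j "Suc k" k B t] assms gr_sym by (simp add: gd_def)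
  have "dot n (\<lambda>t. gd n B j * ?p (Suc j) k t) (B b) =
      dot n (\<lambda>t. gd n B (Suc j) * ?p j k t - (\<Sum>i\<in>{j}. om (gr n B) j j k * ?p j i t)) (B b)"
    by (simp add: *)
  then show ?thesis unfolding dot_sub_sum dot_pu by (simp add: dot_def mult.assoc flip: dot_pu sum_distrib_left)
qed

text \<open>Smaller determinants do not see the two rows, and larger ones undergo a row and a column
  transposition whose signs cancel. The determinant in between becomes the Schur complement entry of
  the old row \<open>Suc k\<close> over the first \<open>k\<close> rows, which \<open>om_rec\<close>
  expresses by old data.\<close>

lemma gd_rowswap:
  assumes B: "minor B n \<noteq> 0" and k: "Suc k < n"
  shows "j \<noteq> Suc k \<Longrightarrow> gd n (rowswap k B) j = gd n B j"
    and "gd n B (Suc k) * gd n (rowswap k B) (Suc k) =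
      gd n B (Suc (Suc k)) * gd n B k + (dot n (gs n B k) (B (Suc k)))\<^sup>2"
proof -
  let ?B = "rowswap k B" and ?G = "gr n B"
  have low: "gr n ?B a b = ?G a b" if "a < k" "b < k" for a b
    using that by (simp add: gram_def rowswap_def)
  show "gd n ?B j = gd n B j" if "j \<noteq> Suc k" for j
  proof (cases "j \<le> k")
    case True
    then show ?thesis unfolding gd_def using low by (intro minor_cong) auto
  next
    case False
    then have j: "Suc k < j" using that by simp
    have "sqm j (gr n ?B) = swapcols k (Suc k) (swaprows k (Suc k) (sqm j ?G))"
      by (rule eq_matI) (use j in \<open>auto simp: sqm_def mat_swaprows_def mat_swapcols_def gram_def rowswap_def\<close>)
    also have "det \<dots> = det (sqm j ?G)"
      using j by (subst det_swapcols[of _ j], simp, simp, simp, simp add: mat_swaprows_def)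
        (subst det_swaprows[of _ j], auto)
    finally show ?thesis by (simp add: gd_def minor_def)
  qed
  have D: "gd n B k \<noteq> 0" "gd n B (Suc k) \<noteq> 0" using gd_pos[OF B, of k] gd_pos[OF B, of "Suc k"] k by auto
  have Dk: "gd n ?B k = gd n B k" unfolding gd_def using low by (intro minor_cong) auto
  have adj: "adj (gr n ?B) k a i = adj ?G k a i" for a i
    unfolding adj_def using sqm_cong[of k "gr n ?B" ?G] low by simp
  have "gd n ?B (Suc k) = om (gr n ?B) k k k" using om_diag[of "gr n ?B" k] Dk D by (simp add: gd_def)
  also have "\<dots> = om ?G k (Suc k) (Suc k)"
  proof -
    have "zc (gr n ?B) k k i = zc ?G k (Suc k) i" if "i < k" for i
    proof -
      have "gr n ?B k a = ?G (Suc k) a" if "a < k" for a using that by (simp add: gram_def rowswap_def)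
      then show ?thesis unfolding zc_def by (intro sum.cong refl) (simp add: adj)
    qed
    then show ?thesis using Dk by (simp add: om_def gd_def gram_def rowswap_def)
  qed
  finally have "gd n ?B (Suc k) = om ?G k (Suc k) (Suc k)" .
  moreover have "om ?G (Suc k) (Suc k) (Suc k) = gd n B (Suc (Suc k))"
    using om_diag[of ?G "Suc k"] D by (simp add: gd_def)
  ultimately show "gd n B (Suc k) * gd n ?B (Suc k) = gd n B (Suc (Suc k)) * gd n B k + (dot n (gs n B k) (B (Suc k)))\<^sup>2"
    using om_rec[OF D, of "Suc k" "Suc k"] by (simp add: dot_gs power2_eq_square algebra_simps)
qed

lemma minor_rowswap:
  assumes "minor B n \<noteq> 0" "Suc k < n"
  shows "minor (rowswap k B) n \<noteq> 0"
  using gd_rowswap(1)[OF assms, of n] gd_square[of n B] gd_square[of n "rowswap k B"] assms by auto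

text \<open>Unlike in \<open>mixed_lattice\<close>, the real multipliers come first: an
  orthogonalized vector is orthogonal to all earlier rows, so those of index at least
  \<open>q\<close> are orthogonal to every continuous direction.\<close>

definition mixed :: "nat \<Rightarrow> nat \<Rightarrow> (nat \<Rightarrow> nat \<Rightarrow> int) \<Rightarrow> (nat \<Rightarrow> real) set" where
  "mixed n q B = {(\<lambda>t. \<Sum>i<n. \<mu> i * of_int (B i t)) | \<mu>. \<forall>i. q \<le> i \<and> i < n \<longrightarrow> \<mu> i \<in> \<int>}"

text \<open>For \<open>q \<le> i < k\<close> the multiplier of row \<open>k\<close> is integral, so
  adding an integral multiple of it to the multiplier of row \<open>i\<close> does no harm.\<close>

lemma mixed_rowop_subset:
  assumes k: "k < n"
  shows "mixed n q (rowop k c B) \<subseteq> mixed n q B"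
proof
  fix x assume "x \<in> mixed n q (rowop k c B)"
  then obtain \<mu> where \<mu>: "\<And>i. q \<le> i \<Longrightarrow> i < n \<Longrightarrow> \<mu> i \<in> \<int>" "x = (\<lambda>t. \<Sum>i<n. \<mu> i * of_int (rowop k c B i t))"
    by (auto simp: mixed_def)
  let ?\<nu> = "\<lambda>i. \<mu> i - (if i < k then \<mu> k * of_int (c i) else 0)"
  have "(\<Sum>i<n. \<mu> i * of_int (rowop k c B i t)) = (\<Sum>i<n. ?\<nu> i * of_int (B i t))" for t
  proof -
    have "(\<Sum>i<n. \<mu> i * of_int (rowop k c B i t)) =
        (\<Sum>i<n. \<mu> i * of_int (B i t)) - (\<Sum>i<n. if i = k then \<mu> k * of_int (\<Sum>i<k. c i * B i t) else 0)"
      unfolding sum_subtractf[symmetric] by (intro sum.cong refl) (auto simp: rowop_def algebra_simps)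
    also have "(\<Sum>i<n. if i = k then \<mu> k * of_int (\<Sum>i<k. c i * B i t) else 0) = \<mu> k * of_int (\<Sum>i<k. c i * B i t)"
      using k by (simp add: sum.delta)
    also have "\<dots> = (\<Sum>i<n. (if i < k then \<mu> k * of_int (c i) else 0) * of_int (B i t))"
      using k by (simp add: sum_distrib_left mult.assoc if_distrib if_distribR cong: if_cong)
        (intro sum.mono_neutral_cong_left, auto)
    finally show ?thesis by (simp add: left_diff_distrib sum_subtractf)
  qed
  moreover have "?\<nu> i \<in> \<int>" if "q \<le> i" "i < n" for i using \<mu>(1) that k by auto
  ultimately show "x \<in> mixed n q B" unfolding mixed_def \<mu>(2) by (intro CollectI exI[of _ ?\<nu>]) auto
qed

lemma mixed_rowop: "k < n \<Longrightarrow> mixed n q (rowop k c B) = mixed n q B"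
  using mixed_rowop_subset[of k n q c B] mixed_rowop_subset[of k n q "\<lambda>i. - c i" "rowop k c B"]
  by (auto simp: rowop_inverse)

lemma mixed_rowswap_subset:
  assumes k: "Suc k < n" "q \<le> k"
  shows "mixed n q (rowswap k B) \<subseteq> mixed n q B"
proof
  fix x assume "x \<in> mixed n q (rowswap k B)"
  then obtain \<mu> where \<mu>: "\<And>i. q \<le> i \<Longrightarrow> i < n \<Longrightarrow> \<mu> i \<in> \<int>" "x = (\<lambda>t. \<Sum>i<n. \<mu> i * of_int (rowswap k B i t))"
    by (auto simp: mixed_def)
  let ?\<tau> = "transpose k (Suc k)"
  have "bij_betw ?\<tau> {..<n} {..<n}" using k by (intro bij_betw_byWitness[where f' = ?\<tau>]) (auto simp: transpose_def)
  then have "(\<Sum>i<n. \<mu> (?\<tau> i) * of_int (rowswap k B (?\<tau> i) t)) = (\<Sum>i<n. \<mu> i * of_int (rowswap k B i t))" for t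
    by (rule sum.reindex_bij_betw[of ?\<tau> "{..<n}" "{..<n}" "\<lambda>i. \<mu> i * of_int (rowswap k B i t)"])
  moreover have "rowswap k B (?\<tau> i) = B i" for i by (auto simp: rowswap_def transpose_def)
  moreover have "\<mu> (?\<tau> i) \<in> \<int>" if "q \<le> i" "i < n" for i
    using \<mu>(1) that k by (auto simp: transpose_def)
  ultimately show "x \<in> mixed n q B"
    unfolding mixed_def \<mu>(2) by (auto intro!: exI[of _ "\<lambda>i. \<mu> (?\<tau> i)"])
qed

lemma mixed_rowswap: "Suc k < n \<Longrightarrow> q \<le> k \<Longrightarrow> mixed n q (rowswap k B) = mixed n q B"
  using mixed_rowswap_subset[of k n q B] mixed_rowswap_subset[of k n q "rowswap k B"]
  by (auto simp: rowswap_inverse)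

section \<open>Bit lengths\<close>

lemma abs_det_le:
  assumes "\<And>a b. a < j \<Longrightarrow> b < j \<Longrightarrow> \<bar>A a b\<bar> \<le> M"
  shows "\<bar>det (sqm j A)\<bar> \<le> fact j * M ^ j"
proof -
  have "\<bar>det (sqm j A)\<bar> \<le> (\<Sum>\<pi> | \<pi> permutes {0..<j}. \<bar>signof \<pi> * (\<Prod>i = 0..<j. sqm j A $$ (i, \<pi> i))\<bar>)"
    unfolding det_def'[OF sqm_carrier(1)] by (rule sum_abs)
  also have "\<dots> \<le> (\<Sum>\<pi> | \<pi> permutes {0..<j}. M ^ j)"
  proof (rule sum_mono)
    fix \<pi> assume "\<pi> \<in> {\<pi>. \<pi> permutes {0..<j}}"
    then have \<pi>: "\<pi> i < j" if "i < j" for i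
      using that permutes_in_image[of \<pi> "{0..<j}" i] by simp
    have "\<bar>\<Prod>i = 0..<j. sqm j A $$ (i, \<pi> i)\<bar> \<le> (\<Prod>i = 0..<j. M)"
      unfolding abs_prod by (rule prod_mono) (use \<pi> assms in \<open>auto simp: sqm_def\<close>)
    then show "\<bar>signof \<pi> * (\<Prod>i = 0..<j. sqm j A $$ (i, \<pi> i))\<bar> \<le> M ^ j"
      by (simp add: abs_mult sign_def)
  qed
  also have "\<dots> = fact j * M ^ j" by (simp add: card_permutations)
  finally show ?thesis .
qed

lemma fact_le_pow2: "fact j \<le> (2 :: int) ^ (j * j)"
proof -
  have "(fact j :: nat) \<le> j ^ j" using fact_le_power[of j, where 'a = nat] by simp
  also have "\<dots> \<le> (2 ^ j) ^ j" by (intro power_mono less_imp_le[OF less_exp]) auto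
  finally have "(fact j :: nat) \<le> 2 ^ (j * j)" by (simp add: power_mult)
  then have "int (fact j) \<le> int (2 ^ (j * j))" by linarith
  then show ?thesis by simp
qed

lemma abs_det_le_pow2:
  assumes "\<And>a b. a < j \<Longrightarrow> b < j \<Longrightarrow> \<bar>A a b\<bar> \<le> 2 ^ e" "j \<le> n"
  shows "\<bar>det (sqm j A)\<bar> \<le> 2 ^ (n * n + e * n)"
proof -
  have "\<bar>det (sqm j A)\<bar> \<le> fact j * (2 ^ e) ^ j" using assms(1) by (rule abs_det_le)
  also have "\<dots> \<le> 2 ^ (j * j) * (2 ^ e) ^ j" by (intro mult_right_mono fact_le_pow2) simp
  also have "\<dots> = 2 ^ (j * j + e * j)" by (simp add: power_mult power_add)
  also have "\<dots> \<le> 2 ^ (n * n + e * n)"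
    using assms(2) by (intro power_increasing add_mono mult_mono) auto
  finally show ?thesis .
qed

lemma abs_minor_le:
  assumes "\<And>a b. a < n \<Longrightarrow> b < n \<Longrightarrow> \<bar>A a b\<bar> \<le> 2 ^ e" "j \<le> n"
  shows "\<bar>minor A j\<bar> \<le> 2 ^ (n * n + e * n)"
  unfolding minor_def using assms by (intro abs_det_le_pow2) auto

lemma abs_adj_le:
  assumes A: "\<And>a b. a < n \<Longrightarrow> b < n \<Longrightarrow> \<bar>A a b\<bar> \<le> 2 ^ e" and "j \<le> n" "a < j" "b < j"
  shows "\<bar>adj A j a b\<bar> \<le> 2 ^ (n * n + e * n)"
proof -
  let ?A = "\<lambda>r s. A (if r < b then r else Suc r) (if s < a then s else Suc s)"
  have "mat_delete (sqm j A) b a = sqm (j - 1) ?A"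
    by (rule eq_matI) (use assms(3,4) in \<open>auto simp: mat_delete_def sqm_def\<close>)
  moreover have "\<bar>det (sqm (j - 1) ?A)\<bar> \<le> 2 ^ (n * n + e * n)"
    using assms(2) by (intro abs_det_le_pow2 A) auto
  moreover have "adj A j a b = cofactor (sqm j A) b a"
    using assms(3,4) by (simp add: adj_def adj_mat_def)
  ultimately show ?thesis by (simp add: cofactor_def abs_mult power_abs)
qed

lemma abs_sum_le_pow2:
  assumes "\<And>i. i < m \<Longrightarrow> \<bar>f i\<bar> \<le> (2 :: int) ^ e" "m \<le> n"
  shows "(\<Sum>i<m. \<bar>f i\<bar>) \<le> 2 ^ (n + e)"
proof -
  have "(\<Sum>i<m. \<bar>f i\<bar>) \<le> (\<Sum>i<m. 2 ^ e)" using assms(1) by (intro sum_mono) auto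
  also have "\<dots> = int m * 2 ^ e" by simp
  also have "\<dots> \<le> 2 ^ n * 2 ^ e"
  proof (rule mult_right_mono)
    have "int m \<le> int n" using assms(2) by simp
    also have "\<dots> \<le> 2 ^ n" using of_nat_less_two_power[of n] less_imp_le by blast
    finally show "int m \<le> 2 ^ n" .
  qed simp
  finally show ?thesis by (simp add: power_add)
qed

lemma abs_mult_le_pow2: "\<bar>x\<bar> \<le> 2 ^ a \<Longrightarrow> \<bar>y\<bar> \<le> 2 ^ b \<Longrightarrow> \<bar>x * y\<bar> \<le> (2 :: int) ^ (a + b)"
  unfolding abs_mult power_add by (intro mult_mono) auto

lemma abs_add_le_pow2: "\<bar>x\<bar> \<le> 2 ^ a \<Longrightarrow> \<bar>y\<bar> \<le> 2 ^ a \<Longrightarrow> \<bar>x + y\<bar> \<le> (2 :: int) ^ Suc a"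
  by (simp add: abs_le_iff)

lemma abs_le_pow2_mono: "\<bar>x\<bar> \<le> 2 ^ a \<Longrightarrow> a \<le> b \<Longrightarrow> \<bar>x\<bar> \<le> (2 :: int) ^ b"
  by (meson order_trans one_le_numeral power_increasing)

lemma le_pow2_mono: "x \<le> 2 ^ a \<Longrightarrow> a \<le> b \<Longrightarrow> x \<le> (2 :: int) ^ b"
  by (meson order_trans one_le_numeral power_increasing)

lemma abs_pu_le:
  assumes A: "\<And>a b. a < n \<Longrightarrow> b < n \<Longrightarrow> \<bar>A a b\<bar> \<le> 2 ^ e"
    and U: "\<And>i. i < n \<Longrightarrow> \<bar>U i t\<bar> \<le> 2 ^ u" and jk: "j \<le> k" "k < n"
  shows "\<bar>pu U A j k t\<bar> \<le> 2 ^ (n * n + e * n + e + 2 * n + u + 1)"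
proof -
  let ?m = "n * n + e * n" and ?z = "n + (e + (n * n + e * n))"
  have z: "\<bar>zc A j k i\<bar> \<le> 2 ^ ?z" if "i < j" for i
  proof -
    have "\<bar>zc A j k i\<bar> \<le> (\<Sum>a<j. \<bar>A k a * adj A j a i\<bar>)" unfolding zc_def by (rule sum_abs)
    also have "\<dots> \<le> 2 ^ ?z"
      by (intro abs_sum_le_pow2 abs_mult_le_pow2 A abs_adj_le) (use jk that in auto)
    finally show ?thesis .
  qed
  have "\<bar>\<Sum>i<j. zc A j k i * U i t\<bar> \<le> (\<Sum>i<j. \<bar>zc A j k i * U i t\<bar>)" by (rule sum_abs)
  also have "\<dots> \<le> 2 ^ (n + (?z + u))"
    by (intro abs_sum_le_pow2 abs_mult_le_pow2 z U) (use jk in auto)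
  finally have 1: "\<bar>- (\<Sum>i<j. zc A j k i * U i t)\<bar> \<le> 2 ^ (n + (?z + u))" by simp
  have 2: "\<bar>minor A j * U k t\<bar> \<le> 2 ^ (n + (?z + u))"
    by (rule abs_le_pow2_mono[OF abs_mult_le_pow2[OF abs_minor_le[of n A e j, OF A] U]]) (use jk in auto)
  have "Suc (n + (?z + u)) = n * n + e * n + e + 2 * n + u + 1" by simp
  then show ?thesis using abs_add_le_pow2[OF 2 1] unfolding pu_def by (simp only: diff_conv_add_uminus)
qed

lemma abs_gram_le:
  assumes "\<And>i t. i < n \<Longrightarrow> t < n \<Longrightarrow> \<bar>U i t\<bar> \<le> 2 ^ a" "\<And>i t. i < n \<Longrightarrow> t < n \<Longrightarrow> \<bar>Y i t\<bar> \<le> 2 ^ a"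
    "i < n" "j < n"
  shows "\<bar>gram n U Y i j\<bar> \<le> 2 ^ (n + (a + a))"
proof -
  have "\<bar>gram n U Y i j\<bar> \<le> (\<Sum>t<n. \<bar>U i t * Y j t\<bar>)" unfolding gram_def dot_def by (rule sum_abs)
  also have "\<dots> \<le> 2 ^ (n + (a + a))"
    by (intro abs_sum_le_pow2 abs_mult_le_pow2 assms) (use assms(3,4) in auto)
  finally show ?thesis .
qed

text \<open>Common bit bound for the minors and orthogonal components that arise from vectors with
  entries of \<open>a\<close> bits.\<close>

definition gbits :: "nat \<Rightarrow> nat \<Rightarrow> nat" where
  "gbits n a = n * n + (n + (a + a)) * n + (n + (a + a)) + 2 * n + a + 1"

lemma gbits_bounds:
  assumes U: "\<And>i t. i < n \<Longrightarrow> t < n \<Longrightarrow> \<bar>U i t\<bar> \<le> 2 ^ a" and Y: "\<And>i t. i < n \<Longrightarrow> t < n \<Longrightarrow> \<bar>Y i t\<bar> \<le> 2 ^ a"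
  shows "j \<le> n \<Longrightarrow> \<bar>minor (gram n U Y) j\<bar> \<le> 2 ^ gbits n a"
    and "j \<le> k \<Longrightarrow> k < n \<Longrightarrow> t < n \<Longrightarrow> \<bar>pu U (gram n U Y) j k t\<bar> \<le> 2 ^ gbits n a"
proof -
  show "\<bar>minor (gram n U Y) j\<bar> \<le> 2 ^ gbits n a" if "j \<le> n"
    by (rule abs_le_pow2_mono[OF abs_minor_le[OF abs_gram_le[OF U Y] that]]) (auto simp: gbits_def)
  show "\<bar>pu U (gram n U Y) j k t\<bar> \<le> 2 ^ gbits n a" if "j \<le> k" "k < n" "t < n"
    unfolding gbits_def by (rule abs_pu_le[OF abs_gram_le[OF U Y] U]) (use that in auto)
qed

text \<open>In the orthogonalized frame each coordinate of a size-reduced row contributes at most a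
  quotient of Gram determinants to the squared length. The determinants stay bounded throughout the
  reduction, so entry lengths cannot accumulate over the swaps.\<close>

lemma reduced_entry_le:
  assumes B: "minor B n \<noteq> 0" and k: "k < n" and t: "t < n"
    and red: "\<And>j. j < k \<Longrightarrow> 2 * \<bar>dot n (B k) (gs n B j)\<bar> \<le> gd n B (Suc j)"
    and X: "\<And>j. j \<le> n \<Longrightarrow> gd n B j \<le> 2 ^ x"
  shows "\<bar>B k t\<bar> \<le> 2 ^ (n + x)"
proof -
  have D: "gd n B j > 0" if "j \<le> n" for j using gd_pos[OF B that] .
  let ?D = "\<lambda>j. real_of_int (gd n B j)"
  have term_le: "(dot n (rv (B k)) (rv (gs n B j)))\<^sup>2 / (?D j * ?D (Suc j)) \<le> 2 ^ x" if j: "j < n" for j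
  proof -
    have "\<bar>dot n (B k) (gs n B j)\<bar> \<le> gd n B (Suc j)"
    proof -
      consider "j < k" | "j = k" | "k < j" by linarith
      then show ?thesis
      proof cases
        case 1 then show ?thesis using red[OF 1] by simp
      next
        case 2
        then show ?thesis using dot_gs_diag[of n B k] D[of k] D[of "Suc k"] k
          by (simp add: dot_commute[of n "B k"])
      next
        case 3
        then show ?thesis using dot_gs_eq_0[OF 3, of n B] D[of "Suc j"] j by (simp add: dot_commute[of n "B k"])
      qed
    qed
    then have "\<bar>real_of_int (dot n (B k) (gs n B j))\<bar> \<le> ?D (Suc j)" by linarith
    then have "(real_of_int (dot n (B k) (gs n B j)))\<^sup>2 \<le> (?D (Suc j))\<^sup>2"
      using D[of "Suc j"] j by (intro abs_le_square_iff[THEN iffD1]) simp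
    then have "(dot n (rv (B k)) (rv (gs n B j)))\<^sup>2 / (?D j * ?D (Suc j)) \<le> (?D (Suc j))\<^sup>2 / (?D j * ?D (Suc j))"
      unfolding dot_of_int using D[of j] D[of "Suc j"] j by (intro divide_right_mono) auto
    also have "\<dots> = ?D (Suc j) / ?D j" using D[of "Suc j"] j by (simp add: power2_eq_square)
    also have "\<dots> \<le> ?D (Suc j) / 1"
      using D[of j] D[of "Suc j"] j by (intro divide_left_mono) auto
    also have "\<dots> \<le> of_int (2 ^ x)" unfolding div_by_1 of_int_le_iff using X j by simp
    finally show ?thesis by simp
  qed
  have "real_of_int (dot n (B k) (B k)) = dot n (rv (B k)) (rv (B k))" by (simp add: dot_of_int)
  also have "\<dots> = (\<Sum>j<n. (dot n (rv (B k)) (rv (gs n B j)))\<^sup>2 / (?D j * ?D (Suc j)))" by (rule parseval[OF B])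
  also have "\<dots> \<le> (\<Sum>j<n. 2 ^ x)" by (rule sum_mono) (use term_le in auto)
  also have "\<dots> = real n * 2 ^ x" by simp
  also have "\<dots> \<le> 2 ^ n * 2 ^ x"
    using of_nat_less_two_power[of n, where 'a = real] by (intro mult_right_mono) auto
  finally have "real_of_int (dot n (B k) (B k)) \<le> real_of_int (2 ^ (n + x))" by (simp add: power_add)
  then have "dot n (B k) (B k) \<le> 2 ^ (n + x)" by linarith
  moreover have "B k t * B k t \<le> dot n (B k) (B k)"
    unfolding dot_def using t by (intro member_le_sum[of t "{..<n}" "\<lambda>t. B k t * B k t"]) auto
  \<comment> \<open>Integrality: a nonzero integer is at most its square in absolute value, which
    avoids taking a root.\<close>
  moreover have "\<bar>B k t\<bar> \<le> B k t * B k t"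
  proof -
    have "\<bar>B k t\<bar> * 1 \<le> \<bar>B k t\<bar> * \<bar>B k t\<bar>"
    proof (cases "B k t = 0")
      case False
      then show ?thesis by (intro mult_left_mono) auto
    qed simp
    then show ?thesis by (simp only: abs_mult_self_eq mult_1_right)
  qed
  ultimately show ?thesis by simp
qed

text \<open>The geometric sum (4^p - 1) / 3 without subtraction or division. From p = 2 on the
  right-hand side gains a factor 2^p, which is at least 4; the step from 1 to 2 is done by
  computation.\<close>

lemma four_pow_le: "p \<ge> 1 \<Longrightarrow> (4::nat) ^ p \<le> 3 * p ^ 2 * 2 ^ (\<Sum>i<p. i) + 1"
proof (induction p rule: nat_induct_at_least)
  case (Suc p)
  show ?case
  proof (cases "p = 1")
    case False
    let ?X = "2 ^ (\<Sum>i<p. i) :: nat"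
    have "(2::nat) ^ 2 \<le> 2 ^ p" using Suc.hyps False by (intro power_increasing) auto
    then have p: "4 \<le> (2::nat) ^ p" by simp
    have "4 ^ Suc p \<le> 4 * (3 * p ^ 2 * ?X + 1)" using Suc.IH by simp
    also have "\<dots> \<le> 3 * (Suc p) ^ 2 * ?X * 4 + 1"
    proof -
      define X where "X = ?X"
      have "1 \<le> X" by (simp add: X_def)
      then show ?thesis unfolding X_def[symmetric] by (simp add: power2_eq_square algebra_simps)
    qed
    also have "\<dots> \<le> 3 * (Suc p) ^ 2 * ?X * 2 ^ p + 1" using p by (intro add_mono mult_left_mono) auto
    also have "\<dots> = 3 * (Suc p) ^ 2 * 2 ^ (\<Sum>i<Suc p. i) + 1" by (simp add: power_add mult_ac)
    finally show ?thesis .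
  qed (simp add: power2_eq_square)
qed simp

text \<open>Counted backwards from the last index, the terms are dominated by a geometric series
  with ratio 4.\<close>

lemma sum_quotients_le:
  fixes \<beta> :: "nat \<Rightarrow> real"
  assumes "q < n" "\<And>i. q \<le> i \<Longrightarrow> Suc i < n \<Longrightarrow> \<beta> i \<le> 4 * \<beta> (Suc i)" "0 \<le> \<beta> (n - 1)"
  shows "(\<Sum>i=q..<n. \<beta> i) \<le> \<beta> (n - 1) * (real ((n - q)\<^sup>2) * 2 ^ (\<Sum>i<n - q. i))"
proof -
  have le: "\<beta> (n - 1 - m) \<le> 4 ^ m * \<beta> (n - 1)" if "m < n - q" for m
    using that
  proof (induction m)
    case (Suc m)
    have "\<beta> (n - 1 - Suc m) \<le> 4 * \<beta> (Suc (n - 1 - Suc m))" using Suc.prems by (intro assms(2)) auto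
    also have "Suc (n - 1 - Suc m) = n - 1 - m" using Suc.prems by simp
    also have "4 * \<beta> (n - 1 - m) \<le> 4 * (4 ^ m * \<beta> (n - 1))" using Suc by simp
    finally show ?case by simp
  qed simp
  have "(\<Sum>i=q..<n. \<beta> i) = (\<Sum>m<n - q. \<beta> (n - 1 - m))"
    by (rule sum.reindex_bij_witness[of _ "\<lambda>m. n - 1 - m" "\<lambda>i. n - 1 - i"]) (use assms(1) in auto)
  also have "\<dots> \<le> (\<Sum>m<n - q. 4 ^ m * \<beta> (n - 1))" by (intro sum_mono le) simp
  also have "\<dots> = \<beta> (n - 1) * (\<Sum>m<n - q. 4 ^ m)" by (simp add: sum_distrib_left mult.commute)
  also have "(\<Sum>m<n - q. (4::real) ^ m) \<le> real ((n - q)\<^sup>2) * 2 ^ (\<Sum>i<n - q. i)"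
  proof -
    have "real (4 ^ (n - q)) \<le> real (3 * (n - q) ^ 2 * 2 ^ (\<Sum>i<n - q. i) + 1)"
      using four_pow_le[of "n - q"] assms(1) by (intro of_nat_mono) auto
    then show ?thesis by (simp add: geometric_sum)
  qed
  finally show ?thesis using assms(3) by (simp add: mult_left_mono)
qed

section \<open>The sign of a form from its leading minors\<close>

lemma form_nonneg:
  assumes "\<And>a b. a < n \<Longrightarrow> b < n \<Longrightarrow> A a b = A b a" "\<And>i. i \<le> n \<Longrightarrow> 0 < minor A i"
  shows "0 \<le> bform n A x x"
proof -
  have pos: "0 < minor A i \<and> 0 < minor A (Suc i)" if "i < n" for i using assms(2)[of i] assms(2)[of "Suc i"] that by simp
  have "minor A i \<noteq> 0" if "i \<le> n" for i using assms(2)[OF that] by simp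
  from parseval_form[of n A n, OF assms(1) order_refl this, of x] show ?thesis
    using pos by (auto intro!: sum_nonneg divide_nonneg_nonneg simp: less_imp_le)
qed

text \<open>A certificate of failure: if \<open>minor A (Suc k)\<close> is the first minor that is
  not positive, the form is not positive at this nonzero vector.\<close>

lemma form_gs:
  assumes "k < n" "0 < minor A k"
  shows "bform n A (rv (wc A k)) (rv (wc A k)) = of_int (minor A k * minor A (Suc k))"
proof -
  have "bform n A (rv (wc A k)) (rv (wc A k)) = (\<Sum>b<n. of_int (om A k k b) * of_int (wc A k b))"
    by (rule bform_wc[OF assms(1)])
  also have "\<dots> = (\<Sum>b<n. if b = k then of_int (minor A k * minor A (Suc k)) else 0)"
    using om_diag[of A k] assms(2)
    by (intro sum.cong refl) (auto simp: wc_def om_eq_0 linorder_neq_iff)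
  finally show ?thesis using assms(1) by (simp add: sum.delta)
qed

section \<open>Computing the orthogonalization\<close>

text \<open>
  Array \<open>0\<close> is the input, \<open>1\<close> the output, \<open>2\<close> holds \<open>n\<close> and \<open>3\<close> the number \<open>n - p\<close> of continuous directions.
  Array \<open>4\<close> holds a common denominator \<open>D\<close> of the input, and \<open>6\<close> the vectors \<open>H\<^sub>1, \<dots>, H\<^sub>n, h, c, b\<^sub>1, \<dots>, b\<^sub>n\<close>
  multiplied by \<open>D\<close>. Arrays \<open>10\<close> and \<open>11\<close> hold \<open>N\<close> and \<open>E\<close>, where \<open>E / N\<close> is a dyadic upper bound of \<open>\<epsilon>\<close>;
  \<open>14\<close> and \<open>15\<close> the orthogonalized vectors and the Gram determinants of the basis in \<open>25\<close>, whose continuous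
  directions come first; and \<open>24\<close> the directions \<open>v\<close> and \<open>D h\<close> of the centers.
\<close>

abbreviation Seq' (infixr ";;" 60) where "c ;; d \<equiv> Seq c d"

text \<open>Array 16 holds the row \<open>k\<close> under treatment, 17 the earlier row
  \<open>j\<close> whose direction is split off, and 18 the pairing that occurs in the fraction-free
  recurrence.\<close>

definition gs_step :: "nat \<Rightarrow> com" where
  "gs_step Y =
     Sum 18 7 (V 2) (Mul (Ix Y (V 16) 7) (Ix 14 (V 17) 7)) ;;
     Row 14 (V 16) 7 (Div (Sub (Mul (Get 15 (Add (V 17) (Const 1))) (Ix 14 (V 16) 7))
                               (Mul (V 18) (Ix 14 (V 17) 7)))
                          (Get 15 (V 17)))"

definition gs_body :: "nat \<Rightarrow> nat \<Rightarrow> com" where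
  "gs_body U Y =
     Row 14 (V 16) 7 (Ix U (V 16) 7) ;;
     For 17 (V 16) (gs_step Y) ;;
     Sum 18 7 (V 2) (Mul (Ix Y (V 16) 7) (Ix 14 (V 16) 7)) ;;
     Store 15 (Add (V 16) (Const 1)) (V 18) ;;
     Set 16 (Add (V 16) (Const 1))"

text \<open>Stopping at the first determinant that is not positive keeps all divisors positive, and
  leaves the vector responsible for the failure in the row of array 14 just before the index in
  array 16.\<close>

definition gs_prog :: "nat \<Rightarrow> nat \<Rightarrow> com" where
  "gs_prog U Y =
     Store 15 (Const 0) (Const 1) ;;
     Set 16 (Const 0) ;;
     While (BAnd (Less (V 16) (V 2)) (Less (Const 0) (Get 15 (V 16)))) (gs_body U Y)"

lemma mods_gs_step [simp]: "mods (gs_step Y) = {7, 14, 18}"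
  by (auto simp: gs_step_def)

lemma mods_gs_body [simp]: "mods (gs_body U Y) = {7, 14, 15, 16, 17, 18}"
  by (auto simp: gs_body_def)

lemma mods_gs_prog [simp]: "mods (gs_prog U Y) = {7, 14, 15, 16, 17, 18}"
  by (auto simp: gs_prog_def)

lemma wp_gs_step:
  assumes Y: "Y \<notin> {2, 7, 14, 15, 16, 17, 18}" and n: "s 2 0 = int n" "n \<le> B"
    and jk: "s 16 0 = int k" "s 17 0 = int j" "j < k" "k < n"
    and A: "A = gram n U (mt n (s Y))" and sym: "\<And>a b. a < n \<Longrightarrow> b < n \<Longrightarrow> A a b = A b a"
    and D: "\<And>i. i \<le> k \<Longrightarrow> s 15 (int i) = minor A i" "\<And>i. i \<le> k \<Longrightarrow> minor A i > 0"
    and W: "mt n (s 14) j = pu U A j j" "mt n (s 14) k = pu U A j k"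
    and bds: "\<And>i t. i < n \<Longrightarrow> t < n \<Longrightarrow> \<bar>mt n (s Y) i t\<bar> \<le> 2 ^ a"
      "\<And>i j t. i \<le> j \<Longrightarrow> j < n \<Longrightarrow> t < n \<Longrightarrow> \<bar>pu U A i j t\<bar> \<le> 2 ^ w" "n + (a + w) \<le> B"
    and U0: "\<And>i t. n \<le> t \<Longrightarrow> U i t = 0"
  shows "wp \<epsilon> B (gs_step Y) (\<lambda>s'. mt n (s' 14) = (mt n (s 14))(k := pu U A (Suc j) k)) s"
  unfolding gs_step_def wp_simps
proof (rule wp_Sum[where len = n and g = "\<lambda>t. mt n (s Y) k t * pu U A j j t"])
  fix s1 assume lam: "s1 18 0 = (\<Sum>t<n. mt n (s Y) k t * pu U A j j t)"
    and fr1: "\<And>y. y \<notin> {18, 7} \<Longrightarrow> s1 y = s y"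
  have lam': "s1 18 0 = om A j j k"
    using dot_pu[of n U "mt n (s Y)" j j k] by (simp add: lam A dot_def mult.commute)
  have ne: "minor A j \<noteq> 0" "minor A (Suc j) \<noteq> 0" using D(2)[of j] D(2)[of "Suc j"] jk by auto
  show "wp \<epsilon> B (Row 14 (V 16) 7 (Div (Sub (Mul (Get 15 (Add (V 17) (Const 1))) (Ix 14 (V 16) 7))
      (Mul (V 18) (Ix 14 (V 17) 7))) (Get 15 (V 17))))
      (\<lambda>s'. mt n (s' 14) = (mt n (s 14))(k := pu U A (Suc j) k)) s1"
  proof (rule wp_Row[where n = n and k = k and h = "pu U A (Suc j) k"])
    fix t s2
    assume t: "t < n" "s2 7 0 = int t" and fr: "\<And>y. y \<notin> {14, 7} \<Longrightarrow> s2 y = s1 y"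
      and old: "\<And>i u. u < n \<Longrightarrow> i \<noteq> k \<or> t \<le> u \<Longrightarrow> s2 14 (int i * int n + int u) = mt n (s1 14) i u"
    have s2: "s2 x = s x" if "x \<notin> {7, 14, 18}" for x using fr[of x] fr1[of x] that by simp
    have "s2 14 (int k * int n + int t) = pu U A j k t" "s2 14 (int j * int n + int t) = pu U A j j t"
      using old[OF t(1), of k] old[OF t(1), of j] fr1[of 14] W jk by simp_all
    moreover have "s 15 (int j + 1) = minor A (Suc j)" using D(1)[of "Suc j"] jk by (simp add: add.commute)
    ultimately show "aok \<epsilon> B (Div (Sub (Mul (Get 15 (Add (V 17) (Const 1))) (Ix 14 (V 16) 7))
      (Mul (V 18) (Ix 14 (V 17) 7))) (Get 15 (V 17))) s2 \<and>
      aval \<epsilon> (Div (Sub (Mul (Get 15 (Add (V 17) (Const 1))) (Ix 14 (V 16) 7))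
      (Mul (V 18) (Ix 14 (V 17) 7))) (Get 15 (V 17))) s2 = pu U A (Suc j) k t"
      using pu_rec_div[OF ne sym jk(3,4), of U t] fr[of 18] s2 n jk t D(1)[of j] lam' by simp
  next
    fix s2 assume *: "mt n (s2 14) = (mt n (s1 14))(k := (\<lambda>t. if t < n then pu U A (Suc j) k t else 0))"
    have "(\<lambda>t. if t < n then pu U A (Suc j) k t else 0) = pu U A (Suc j) k"
      using U0 by (auto simp: fun_eq_iff pu_def)
    then show "mt n (s2 14) = (mt n (s 14))(k := pu U A (Suc j) k)" using * fr1[of 14] by simp
  next
    fix t assume "t < n"
    then show "\<bar>pu U A (Suc j) k t\<bar> \<le> 2 ^ B"
      using jk bds(3) by (intro abs_le_pow2_mono[OF bds(2)]) auto
  qed (use fr1 n jk in auto)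
next
  fix t s' assume t: "t < n" "s' 7 0 = int t" and fr: "\<And>y. y \<notin> {18, 7} \<Longrightarrow> s' y = s y"
  then show "aok \<epsilon> B (Mul (Ix Y (V 16) 7) (Ix 14 (V 17) 7)) s' \<and>
    aval \<epsilon> (Mul (Ix Y (V 16) 7) (Ix 14 (V 17) 7)) s' = mt n (s Y) k t * pu U A j j t"
    using Y n jk W(1) mtD[OF W(1) t(1)] by (simp add: mt_eq)
next
  have "(\<Sum>t<n. \<bar>mt n (s Y) k t * pu U A j j t\<bar>) \<le> 2 ^ (n + (a + w))"
    by (intro abs_sum_le_pow2 abs_mult_le_pow2 bds) (use jk in auto)
  then show "(\<Sum>t<n. \<bar>mt n (s Y) k t * pu U A j j t\<bar>) \<le> 2 ^ B"
    using bds(3) by (rule le_pow2_mono)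
qed (use n in auto)

lemma wp_gs_body:
  assumes UY: "U \<notin> {2, 7, 14, 15, 16, 17, 18}" "Y \<notin> {2, 7, 14, 15, 16, 17, 18}"
    and n: "s 2 0 = int n" and U: "U0 = mt n (s U)"
    and A: "A = gram n U0 (mt n (s Y))"
    and sym: "\<And>a b. a < n \<Longrightarrow> b < n \<Longrightarrow> A a b = A b a"
    and bds: "\<And>i t. i < n \<Longrightarrow> t < n \<Longrightarrow> \<bar>U0 i t\<bar> \<le> 2 ^ a"
      "\<And>i t. i < n \<Longrightarrow> t < n \<Longrightarrow> \<bar>mt n (s Y) i t\<bar> \<le> 2 ^ a" "n + (a + gbits n a) \<le> B"
    and k: "s 16 0 = int k" "k < n" "\<And>i. i \<le> k \<Longrightarrow> s 15 (int i) = minor A i"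
      "\<And>i. i < k \<Longrightarrow> mt n (s 14) i = pu U0 A i i" "\<And>i. i \<le> k \<Longrightarrow> minor A i > 0"
  shows "wp \<epsilon> B (gs_body U Y) (\<lambda>s'. s' 16 0 = int (Suc k) \<and> (\<forall>i\<le>Suc k. s' 15 (int i) = minor A i) \<and>
    (\<forall>i<Suc k. mt n (s' 14) i = pu U0 A i i)) s"
proof -
  have U0: "U0 i t = 0" if "n \<le> t" for i t using that U by (simp add: mt_def)
  have nB: "n \<le> B" using bds(3) by simp
  have pb: "\<bar>pu U0 A i j t\<bar> \<le> 2 ^ gbits n a" if "i \<le> j" "j < n" "t < n" for i j t
    unfolding A using bds that by (intro gbits_bounds(2)) auto
  have "int (Suc k) \<le> int n" using k by simp
  also have "\<dots> < 2 ^ n" using of_nat_less_two_power by blast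
  finally have le1: "int (Suc k) \<le> 2 ^ B" using le_pow2_mono[OF less_imp_le nB] by blast
  show ?thesis unfolding gs_body_def
  proof (subst wp.simps, rule wp_Row[where n = n and k = k and h = "U0 k"])
    fix t s'
    assume "t < n" "s' 7 0 = int t" "\<And>y. y \<notin> {14, 7} \<Longrightarrow> s' y = s y"
    then show "aok \<epsilon> B (Ix U (V 16) 7) s' \<and> aval \<epsilon> (Ix U (V 16) 7) s' = U0 k t"
      using k(1) UY n U by (simp add: mt_eq)
  next
    fix t assume "t < n"
    then show "\<bar>U0 k t\<bar> \<le> 2 ^ B" using bds k by (intro abs_le_pow2_mono[OF bds(1)]) auto
  next
    fix s2
    assume "mt n (s2 14) = (mt n (s 14))(k := (\<lambda>t. if t < n then U0 k t else 0))"
      and fr2: "\<And>y. y \<notin> {14, 7} \<Longrightarrow> s2 y = s y"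
    then have W2: "mt n (s2 14) = (mt n (s 14))(k := pu U0 A 0 k)"
      using U by (auto simp: fun_eq_iff mt_def)
    show "wp \<epsilon> B (For 17 (V 16) (gs_step Y) ;; Sum 18 7 (V 2) (Mul (Ix Y (V 16) 7) (Ix 14 (V 16) 7)) ;;
       Store 15 (Add (V 16) (Const 1)) (V 18) ;; Set 16 (Add (V 16) (Const 1)))
       (\<lambda>s'. s' 16 0 = int (Suc k) \<and> (\<forall>i\<le>Suc k. s' 15 (int i) = minor A i) \<and>
         (\<forall>i<Suc k. mt n (s' 14) i = pu U0 A i i)) s2"
    proof (subst wp.simps, rule wp_For[where len = k and I = "\<lambda>j s'. mt n (s' 14) = (mt n (s 14))(k := pu U0 A j k)"])
      fix j s3
      assume j: "j < k" "s3 17 0 = int j" and W3: "mt n (s3 14) = (mt n (s 14))(k := pu U0 A j k)"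
        and fr3: "\<And>x. x \<notin> insert 17 (mods (gs_step Y)) \<Longrightarrow> s3 x = s2 x"
      have s3: "s3 x = s x" if "x \<notin> {7, 14, 17, 18}" for x using fr3[of x] fr2[of x] that by simp
      show "wp \<epsilon> B (gs_step Y) (\<lambda>s''. mt n ((s''(17 := (s'' 17)(0 := int j + 1))) 14) =
          (mt n (s 14))(k := pu U0 A (Suc j) k)) s3"
      proof (rule wp_mono[OF wp_gs_step[where U = U0 and A = A and j = j and k = k and n = n and a = a and w = "gbits n a"]])
        show "A = gram n U0 (mt n (s3 Y))" using A s3[of Y] UY by simp
        show "\<And>i t. i < n \<Longrightarrow> t < n \<Longrightarrow> \<bar>mt n (s3 Y) i t\<bar> \<le> 2 ^ a" using s3[of Y] UY bds by simp
      qed (use UY s3 n k j W3 U0 sym bds pb nB in auto)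
    next
      fix s3
      assume W3: "mt n (s3 14) = (mt n (s 14))(k := pu U0 A k k)"
        and fr3: "\<And>x. x \<notin> insert 17 (mods (gs_step Y)) \<Longrightarrow> s3 x = s2 x"
      have s3: "s3 x = s x" if "x \<notin> {7, 14, 17, 18}" for x using fr3[of x] fr2[of x] that by simp
      show "wp \<epsilon> B (Sum 18 7 (V 2) (Mul (Ix Y (V 16) 7) (Ix 14 (V 16) 7)) ;;
        Store 15 (Add (V 16) (Const 1)) (V 18) ;; Set 16 (Add (V 16) (Const 1)))
        (\<lambda>s'. s' 16 0 = int (Suc k) \<and> (\<forall>i\<le>Suc k. s' 15 (int i) = minor A i) \<and>
         (\<forall>i<Suc k. mt n (s' 14) i = pu U0 A i i)) s3"
      proof (subst wp.simps, rule wp_Sum[where len = n and g = "\<lambda>t. mt n (s Y) k t * pu U0 A k k t"])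
        fix t s' assume t: "t < n" "s' 7 0 = int t" and "\<And>y. y \<notin> {18, 7} \<Longrightarrow> s' y = s3 y"
        moreover have "s3 14 (int k * int n + int t) = pu U0 A k k t"
          using W3 t(1) by (intro mtD) auto
        ultimately show "aok \<epsilon> B (Mul (Ix Y (V 16) 7) (Ix 14 (V 16) 7)) s' \<and>
          aval \<epsilon> (Mul (Ix Y (V 16) 7) (Ix 14 (V 16) 7)) s' = mt n (s Y) k t * pu U0 A k k t"
          using s3[of Y] s3[of 2] s3[of 16] UY n k by (simp add: mt_eq)
      next
        have "(\<Sum>t<n. \<bar>mt n (s Y) k t * pu U0 A k k t\<bar>) \<le> 2 ^ (n + (a + gbits n a))"
          by (intro abs_sum_le_pow2 abs_mult_le_pow2 bds pb) (use k in auto)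
        then show "(\<Sum>t<n. \<bar>mt n (s Y) k t * pu U0 A k k t\<bar>) \<le> 2 ^ B"
          using bds(3) by (rule le_pow2_mono)
      next
        fix s4 assume lam: "s4 18 0 = (\<Sum>t<n. mt n (s Y) k t * pu U0 A k k t)"
          and fr4: "\<And>y. y \<notin> {18, 7} \<Longrightarrow> s4 y = s3 y"
        have lam': "s4 18 0 = minor A (Suc k)"
          using dot_pu[of n U0 "mt n (s Y)" k k k] om_diag[of A k] k(5)[of k] by (simp add: lam A dot_def mult.commute)
        have "\<bar>minor A (Suc k)\<bar> \<le> 2 ^ gbits n a"
          unfolding A using bds k by (intro gbits_bounds(1)) auto
        then have "\<bar>minor A (Suc k)\<bar> \<le> 2 ^ B" by (rule abs_le_pow2_mono) (use bds(3) in simp)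
        moreover have "s4 16 0 = int k" using fr4[of 16] s3[of 16] k(1) by simp
        moreover have "s4 15 (int i) = minor A i" if "i \<le> k" for i using fr4[of 15] s3[of 15] k(3) that by simp
        moreover have "mt n (s4 14) i = pu U0 A i i" if "i \<le> k" for i
          using fr4[of 14] W3 k(4) that by simp
        ultimately show "wp \<epsilon> B (Store 15 (Add (V 16) (Const 1)) (V 18) ;; Set 16 (Add (V 16) (Const 1)))
          (\<lambda>s'. s' 16 0 = int (Suc k) \<and> (\<forall>i\<le>Suc k. s' 15 (int i) = minor A i) \<and>
            (\<forall>i<Suc k. mt n (s' 14) i = pu U0 A i i)) s4"
          using lam' le1 by (auto simp: less_Suc_eq_le le_Suc_eq add.commute)
      qed (use s3[of 2] n nB in auto)
    qed (use W2 k nB fr2 in auto)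
  qed (use n nB k in auto)
qed

lemma wp_gs_prog:
  assumes UY: "U \<notin> {2, 7, 14, 15, 16, 17, 18}" "Y \<notin> {2, 7, 14, 15, 16, 17, 18}"
    and n: "s 2 0 = int n" and U: "U0 = mt n (s U)"
    and A: "A = gram n U0 (mt n (s Y))"
    and sym: "\<And>a b. a < n \<Longrightarrow> b < n \<Longrightarrow> A a b = A b a"
    and bds: "\<And>i t. i < n \<Longrightarrow> t < n \<Longrightarrow> \<bar>U0 i t\<bar> \<le> 2 ^ a"
      "\<And>i t. i < n \<Longrightarrow> t < n \<Longrightarrow> \<bar>mt n (s Y) i t\<bar> \<le> 2 ^ a" "n + (a + gbits n a) \<le> B"
  shows "wp \<epsilon> B (gs_prog U Y) (\<lambda>s'. \<exists>k\<le>n. s' 16 0 = int k \<and> (\<forall>i\<le>k. s' 15 (int i) = minor A i) \<and>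
    (\<forall>i<k. mt n (s' 14) i = pu U0 A i i) \<and> (\<forall>i<k. minor A i > 0) \<and>
    (k = n \<or> minor A k \<le> 0)) s" (is "wp _ _ _ ?Q s")
proof -
  let ?I = "\<lambda>m s'. \<exists>k\<le>n. m = n - k \<and> s' 16 0 = int k \<and> (\<forall>i\<le>k. s' 15 (int i) = minor A i) \<and>
    (\<forall>i<k. mt n (s' 14) i = pu U0 A i i) \<and> (\<forall>i<k. minor A i > 0)"
  let ?s = "s(15 := (s 15)(0 := 1), 16 := (s 16)(0 := 0))"
  let ?b = "BAnd (Less (V 16) (V 2)) (Less (Const 0) (Get 15 (V 16)))"
  have "wp \<epsilon> B (While ?b (gs_body U Y)) ?Q ?s"
  proof (rule wp_While[where I = ?I and j = n])
    show "?I n ?s" by (intro exI[of _ 0]) simp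
    show "n \<le> B" using bds(3) by simp
    fix m s1
    assume I: "?I m s1" and fr0: "\<And>x. x \<notin> mods (gs_body U Y) \<Longrightarrow> s1 x = ?s x"
    then obtain k where k: "k \<le> n" "m = n - k" "s1 16 0 = int k" "\<And>i. i \<le> k \<Longrightarrow> s1 15 (int i) = minor A i"
      "\<And>i. i < k \<Longrightarrow> mt n (s1 14) i = pu U0 A i i" "\<And>i. i < k \<Longrightarrow> minor A i > 0" by blast
    have fr1: "s1 x = s x" if "x \<notin> {7, 14, 15, 16, 17, 18}" for x using fr0[of x] that by simp
    show "bok \<epsilon> B ?b s1" by simp
    show "?Q s1" if "\<not> bval \<epsilon> ?b s1"
      using that k fr1[of 2] n by (intro exI[of _ k]) auto
    assume b: "bval \<epsilon> ?b s1"
    then have kn: "k < n" and Dk: "minor A k > 0" using k fr1[of 2] n by auto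
    then have D: "minor A i > 0" if "i \<le> k" for i using k(6)[of i] that by (cases "i = k") auto
    have "wp \<epsilon> B (gs_body U Y) (?I (m - 1)) s1"
    proof (rule wp_mono[OF wp_gs_body[where n = n and k = k and A = A and a = a and ?U0.0 = U0]])
      show "?I (m - 1) s'" if "s' 16 0 = int (Suc k) \<and> (\<forall>i\<le>Suc k. s' 15 (int i) = minor A i) \<and>
        (\<forall>i<Suc k. mt n (s' 14) i = pu U0 A i i)" for s'
        using that kn k(2) D by (intro exI[of _ "Suc k"]) (simp add: less_Suc_eq_le)
    qed (use UY fr1[of 2] fr1[of U] fr1[of Y] n U A sym bds kn k D in auto)
    then show "0 < m \<and> wp \<epsilon> B (gs_body U Y) (?I (m - 1)) s1" using kn k(2) by simp
  qed
  then show ?thesis by (simp add: gs_prog_def)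
qed

section \<open>Babai's nearest plane procedure\<close>

text \<open>State of the nearest plane procedure after the indices \<open>j, \<dots>, m - 1\<close> have been processed:
  \<open>R / T\<close> is the residual of the target \<open>R0 / T0\<close>; the coefficients of indices \<open>\<ge> q\<close> are rounded.\<close>

definition reduced :: "nat \<Rightarrow> nat \<Rightarrow> (nat \<Rightarrow> nat \<Rightarrow> int) \<Rightarrow> nat \<Rightarrow> (nat \<Rightarrow> int) \<Rightarrow> int \<Rightarrow> nat \<Rightarrow>
    (nat \<Rightarrow> int) \<Rightarrow> int \<Rightarrow> bool" where
  "reduced n q B m R0 T0 j R T \<longleftrightarrow> T > 0 \<and> (q = 0 \<longrightarrow> T = T0) \<and>
     (\<exists>\<mu>. (\<forall>i. q \<le> i \<longrightarrow> \<mu> i \<in> \<int>) \<and>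
       (\<forall>t. of_int (R t) / of_int T = of_int (R0 t) / of_int T0 - (\<Sum>i<m. \<mu> i * real_of_int (B i t)))) \<and>
     (\<forall>i. j \<le> i \<and> i < m \<longrightarrow> (if q \<le> i then 2 * \<bar>dot n R (gs n B i)\<bar> \<le> T * gd n B (Suc i)
        else dot n R (gs n B i) = 0))"

lemma abs_diff_le_half: "2 * a + b = 2 * e + r \<Longrightarrow> 0 \<le> r \<Longrightarrow> r < 2 * b \<Longrightarrow> 2 * \<bar>a - e\<bar> \<le> b" for a b e r :: int
  by (auto simp: abs_if)

lemma abs_le_add_half:
  fixes a y z :: int
  assumes "2 * \<bar>a - y\<bar> \<le> z"
  shows "\<bar>y\<bar> \<le> \<bar>a\<bar> + z"
proof -
  have "\<bar>y\<bar> \<le> \<bar>a\<bar> + \<bar>a - y\<bar>" using abs_triangle_ineq4[of a "a - y"] by simp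
  also have "\<bar>a - y\<bar> \<le> z" by (rule order_trans[OF _ assms]) simp
  finally show ?thesis by simp
qed

text \<open>\<open>(2 * a + b) div (2 * b)\<close> is a / b rounded to a nearest integer.\<close>

lemma round_div:
  fixes a b :: int
  assumes "b > 0"
  shows "2 * \<bar>a - b * ((2 * a + b) div (2 * b))\<bar> \<le> b"
proof -
  let ?c = "(2 * a + b) div (2 * b)"
  have "2 * a + b = 2 * b * ?c + (2 * a + b) mod (2 * b)" by simp
  then have "2 * a + b = 2 * (b * ?c) + (2 * a + b) mod (2 * b)" by (simp only: mult.assoc)
  then show ?thesis by (rule abs_diff_le_half) (use assms in simp_all)
qed

text \<open>The factor for the residual and the multiple of row \<open>j\<close> to be subtracted.
  In a continuous direction the projection is removed exactly, which puts \<open>g\<close> into the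
  denominator. In an integral one the rounded coefficient is multiplied by the denominator
  \<open>T\<close> accumulated so far.\<close>

definition red_coeffs :: "nat \<Rightarrow> nat \<Rightarrow> int \<Rightarrow> int \<Rightarrow> int \<Rightarrow> int \<times> int" where
  "red_coeffs q j g a T = (if j < q then (g, a) else (1, T * ((2 * a + g * T) div (2 * (g * T)))))"

text \<open>Indices are treated downwards because row \<open>j\<close> is orthogonal to all later
  orthogonalized vectors: what was achieved there is merely rescaled.\<close>

lemma reduced_step:
  assumes B: "minor B n \<noteq> 0" and jm: "j < m" "m \<le> n"
    and red: "reduced n q B m R0 T0 (Suc j) R T"
    and gc: "(g, c) = red_coeffs q j (gd n B (Suc j)) (dot n R (gs n B j)) T"
  shows "reduced n q B m R0 T0 j (\<lambda>t. g * R t - c * B j t) (g * T)"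
proof -
  let ?D = "gd n B (Suc j)" and ?R = "\<lambda>t. g * R t - c * B j t"
  have D: "?D > 0" "gd n B j \<noteq> 0" using gd_pos[OF B, of "Suc j"] gd_pos[OF B, of j] jm by auto
  have T: "T > 0" using red by (simp add: reduced_def)
  have g: "g > 0" using gc D by (auto simp: red_coeffs_def split: if_splits)
  obtain \<mu> where \<mu>: "\<And>i. q \<le> i \<Longrightarrow> \<mu> i \<in> \<int>"
    "\<And>t. of_int (R t) / of_int T = of_int (R0 t) / of_int T0 - (\<Sum>i<m. \<mu> i * real_of_int (B i t))"
    using red unfolding reduced_def by blast
  let ?x = "of_int c / (of_int g * of_int T) :: real"
  let ?\<nu> = "\<lambda>i. \<mu> i + (if i = j then ?x else 0)"
  have "?\<nu> i \<in> \<int>" if "q \<le> i" for i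
    using \<mu>(1)[OF that] gc that T by (auto simp: red_coeffs_def)
  moreover have "of_int (?R t) / of_int (g * T) = of_int (R0 t) / of_int T0 - (\<Sum>i<m. ?\<nu> i * real_of_int (B i t))" for t
  proof -
    have "of_int (?R t) / of_int (g * T) = of_int (R t) / of_int T - ?x * of_int (B j t)"
      using g T by (simp add: field_simps)
    moreover have "(\<Sum>i<m. (if i = j then ?x else 0) * of_int (B i t)) = ?x * of_int (B j t)"
      using jm by (simp add: if_distrib if_distribR sum.delta cong: if_cong)
    ultimately show ?thesis using \<mu>(2)[of t] by (simp add: distrib_right sum.distrib)
  qed
  moreover have "if q \<le> i then 2 * \<bar>dot n ?R (gs n B i)\<bar> \<le> g * T * gd n B (Suc i) else dot n ?R (gs n B i) = 0"
    if i: "j \<le> i" "i < m" for i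
  proof -
    have dR: "dot n ?R (gs n B i) = g * dot n R (gs n B i) - c * dot n (gs n B i) (B j)"
      using dot_sub_sum[of n g R "\<lambda>_. c" B "{j}" "gs n B i"] by (simp add: dot_commute[of n "B j"])
    show ?thesis
    proof (cases "i = j")
      case True
      then have dR: "dot n ?R (gs n B i) = g * dot n R (gs n B j) - c * ?D"
        using dR dot_gs_diag[OF D(2)] by simp
      show ?thesis
      proof (cases "j < q")
        case True
        then show ?thesis using dR gc \<open>i = j\<close> by (simp add: red_coeffs_def)
      next
        case False
        then show ?thesis using dR gc \<open>i = j\<close> round_div[of "?D * T" "dot n R (gs n B j)"] D T
          by (simp add: red_coeffs_def mult_ac)
      qed
    next
      case False
      then have "dot n ?R (gs n B i) = g * dot n R (gs n B i)" using dR dot_gs_eq_0[of j i n B] i by simp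
      moreover have "if q \<le> i then 2 * \<bar>dot n R (gs n B i)\<bar> \<le> T * gd n B (Suc i) else dot n R (gs n B i) = 0"
        using red False i by (simp add: reduced_def)
      ultimately show ?thesis using g by (simp add: abs_mult mult.left_commute mult.assoc)
    qed
  qed
  moreover have "q = 0 \<longrightarrow> g * T = T0" using red gc by (cases "q = 0") (simp_all add: reduced_def red_coeffs_def)
  ultimately show ?thesis unfolding reduced_def using g T
    by (intro conjI exI[of _ ?\<nu>] allI impI) auto
qed

lemma red_coeffs_bound:
  assumes g: "0 < g" "g \<le> 2 ^ w" and T: "0 < T" "T \<le> 2 ^ r" and a: "\<bar>a\<bar> \<le> 2 ^ (n + (r + w))"
  shows "0 < fst (red_coeffs q j g a T)" "fst (red_coeffs q j g a T) \<le> 2 ^ w"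
    "\<bar>snd (red_coeffs q j g a T)\<bar> \<le> 2 ^ Suc (n + (r + w))"
proof -
  show "0 < fst (red_coeffs q j g a T)" "fst (red_coeffs q j g a T) \<le> 2 ^ w"
    using g by (auto simp: red_coeffs_def)
  have "\<bar>T * ((2 * a + g * T) div (2 * (g * T)))\<bar> \<le> 2 ^ Suc (n + (r + w))"
  proof -
    let ?c = "(2 * a + g * T) div (2 * (g * T))"
    have "2 * \<bar>a - g * T * ?c\<bar> \<le> g * T" using g T by (intro round_div) simp
    then have "g * T * \<bar>?c\<bar> \<le> \<bar>a\<bar> + g * T"
    proof -
      have "g * T * \<bar>?c\<bar> = \<bar>g * T * ?c\<bar>" using g T by (simp add: abs_mult)
      then show ?thesis using abs_le_add_half[OF \<open>2 * \<bar>a - g * T * ?c\<bar> \<le> g * T\<close>] by simp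
    qed
    moreover have "\<bar>a\<bar> \<le> g * \<bar>a\<bar>" using g mult_right_mono[of 1 g "\<bar>a\<bar>"] by simp
    ultimately have "g * (T * \<bar>?c\<bar>) \<le> g * (\<bar>a\<bar> + T)" by (simp add: algebra_simps)
    then have "T * \<bar>?c\<bar> \<le> \<bar>a\<bar> + T" using g by (simp only: mult_le_cancel_left_pos)
    moreover have "T \<le> 2 ^ (n + (r + w))" using T(2) by (rule le_pow2_mono) simp
    ultimately show ?thesis using a T by (simp add: abs_mult)
  qed
  moreover have "\<bar>a\<bar> \<le> 2 ^ Suc (n + (r + w))" using a by simp
  ultimately show "\<bar>snd (red_coeffs q j g a T)\<bar> \<le> 2 ^ Suc (n + (r + w))" by (simp add: red_coeffs_def)
qed

text \<open>Arrays 26 and 27 hold the residual and its denominator, 28 the number of continuous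
  directions and 30 the index; 32 and 33 receive the two components of
  \<open>red_coeffs\<close>.\<close>

definition red_body :: com where
  "red_body =
     Set 30 (Sub (V 30) (Const 1)) ;;
     Sum 31 7 (V 2) (Mul (Ix 26 (Const 0) 7) (Ix 14 (V 30) 7)) ;;
     Cond (Less (V 30) (V 28))
       (Set 33 (V 31) ;; Set 32 (Get 15 (Add (V 30) (Const 1))))
       (Set 33 (Mul (V 27) (Div (Add (Mul (Const 2) (V 31)) (Mul (Get 15 (Add (V 30) (Const 1))) (V 27)))
                                (Mul (Const 2) (Mul (Get 15 (Add (V 30) (Const 1))) (V 27))))) ;;
        Set 32 (Const 1)) ;;
     Row 26 (Const 0) 7 (Sub (Mul (V 32) (Ix 26 (Const 0) 7)) (Mul (V 33) (Ix 25 (V 30) 7))) ;;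
     Set 27 (Mul (V 32) (V 27))"

definition red_prog :: com where
  "red_prog = Set 30 (V 29) ;; While (Less (Const 0) (V 30)) red_body"

lemma mods_red_body [simp]: "mods red_body = {7, 26, 27, 30, 31, 32, 33}"
  by (auto simp: red_body_def)

lemma mods_red_prog [simp]: "mods red_prog = {7, 26, 27, 30, 31, 32, 33}"
  by (auto simp: red_prog_def)

text \<open>Each step adds the same number \<open>n + w + a + 2\<close> of bits to the residual and
  its denominator, so the growth over at most \<open>n\<close> steps is additive and stays
  polynomial.\<close>

lemma wp_red_body:
  assumes n: "s 2 0 = int n" and B: "B = mt n (s 25)" "minor B n \<noteq> 0"
    and W: "\<And>i. i < n \<Longrightarrow> mt n (s 14) i = gs n B i" "\<And>i. i \<le> n \<Longrightarrow> s 15 (int i) = gd n B i"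
    and q: "s 28 0 = int q" and j: "s 30 0 = int (Suc j)" "j < m" "m \<le> n"
    and bds: "\<And>i t. i < n \<Longrightarrow> t < n \<Longrightarrow> \<bar>B i t\<bar> \<le> 2 ^ a" "\<And>i. i \<le> n \<Longrightarrow> gd n B i \<le> 2 ^ w"
      "\<And>i t. i < n \<Longrightarrow> t < n \<Longrightarrow> \<bar>gs n B i t\<bar> \<le> 2 ^ w"
      "\<And>t. t < n \<Longrightarrow> \<bar>mt n (s 26) 0 t\<bar> \<le> 2 ^ r" "s 27 0 \<le> 2 ^ r" "r + (n + w + a + 2) \<le> Bd"
    and red: "reduced n q B m R0 T0 (Suc j) (mt n (s 26) 0) (s 27 0)"
  shows "wp \<epsilon> Bd red_body (\<lambda>s'. s' 30 0 = int j \<and> reduced n q B m R0 T0 j (mt n (s' 26) 0) (s' 27 0) \<and>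
    (\<forall>t<n. \<bar>mt n (s' 26) 0 t\<bar> \<le> 2 ^ (r + (n + w + a + 2))) \<and> s' 27 0 \<le> 2 ^ (r + (n + w + a + 2))) s"
    (is "wp _ _ _ ?Q s")
proof -
  let ?R = "mt n (s 26) 0" and ?T = "s 27 0"
  let ?a = "dot n ?R (gs n B j)"
  obtain g c where gc: "(g, c) = red_coeffs q j (gd n B (Suc j)) ?a ?T" by (metis surj_pair)
  have T: "?T > 0" using red by (simp add: reduced_def)
  have D: "gd n B (Suc j) > 0" using gd_pos[OF B(2)] j by simp
  have jn: "j < n" using j by simp
  have "(\<Sum>t<n. \<bar>?R t * gs n B j t\<bar>) \<le> 2 ^ (n + (r + w))"
    by (intro abs_sum_le_pow2 abs_mult_le_pow2 bds) (use jn in auto)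
  then have ab: "(\<Sum>t<n. \<bar>?R t * gs n B j t\<bar>) \<le> 2 ^ (n + (r + w))" "\<bar>?a\<bar> \<le> 2 ^ (n + (r + w))"
    unfolding dot_def by (blast, blast intro: order_trans[OF sum_abs])
  have gcb: "0 < g" "g \<le> 2 ^ w" "\<bar>c\<bar> \<le> 2 ^ Suc (n + (r + w))"
    using red_coeffs_bound[OF D bds(2) T bds(5) ab(2), of q j] j
    by (simp_all flip: gc)
  have Rb: "\<bar>g * ?R t - c * B j t\<bar> \<le> 2 ^ (r + (n + w + a + 2))" if t: "t < n" for t
  proof -
    have 1: "\<bar>g * ?R t\<bar> \<le> 2 ^ (Suc (n + (r + w)) + a)"
      using gcb by (intro abs_le_pow2_mono[OF abs_mult_le_pow2[OF _ bds(4)[OF t]], of g w]) auto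
    have "\<bar>c * B j t\<bar> \<le> 2 ^ (Suc (n + (r + w)) + a)" by (intro abs_mult_le_pow2 gcb bds jn t)
    then have 2: "\<bar>- (c * B j t)\<bar> \<le> 2 ^ (Suc (n + (r + w)) + a)" by simp
    have "Suc (Suc (n + (r + w)) + a) = r + (n + w + a + 2)" by simp
    then show ?thesis using abs_add_le_pow2[OF 1 2] by (simp only: diff_conv_add_uminus)
  qed
  have "\<bar>g * ?T\<bar> \<le> 2 ^ (w + r)" using gcb bds(5) T by (intro abs_mult_le_pow2) auto
  then have Tb: "\<bar>g * ?T\<bar> \<le> 2 ^ (r + (n + w + a + 2))" by (rule abs_le_pow2_mono) simp
  have big: "x \<le> 2 ^ Bd" if "x \<le> 2 ^ (r + (n + w + a + 2))" for x :: int
    using le_pow2_mono[OF that bds(6)] .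
  have "int j \<le> 2 ^ n" using jn of_nat_less_two_power[of n, where 'a = int] by linarith
  then have jB: "int j \<le> 2 ^ Bd" by (rule le_pow2_mono) (use bds(6) in simp)
  let ?s1 = "s(30 := (s 30)(0 := int j))"
  have s1: "s(30 := (s 30)(aval \<epsilon> (Const 0) s := aval \<epsilon> (Sub (V 30) (Const 1)) s)) = ?s1"
    using j by simp
  have B1: "mt n (?s1 14) j = gs n B j" using W jn by simp
  show ?thesis unfolding red_body_def
  proof (subst wp.simps, subst wp.simps(2), intro conjI)
    have "wp \<epsilon> Bd (Sum 31 7 (V 2) (Mul (Ix 26 (Const 0) 7) (Ix 14 (V 30) 7)) ;;
     Cond (Less (V 30) (V 28))
       (Set 33 (V 31) ;; Set 32 (Get 15 (Add (V 30) (Const 1))))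
       (Set 33 (Mul (V 27) (Div (Add (Mul (Const 2) (V 31)) (Mul (Get 15 (Add (V 30) (Const 1))) (V 27)))
                                (Mul (Const 2) (Mul (Get 15 (Add (V 30) (Const 1))) (V 27))))) ;;
        Set 32 (Const 1)) ;;
     Row 26 (Const 0) 7 (Sub (Mul (V 32) (Ix 26 (Const 0) 7)) (Mul (V 33) (Ix 25 (V 30) 7))) ;;
     Set 27 (Mul (V 32) (V 27))) ?Q ?s1"
    proof (subst wp.simps, rule wp_Sum[where len = n and g = "\<lambda>t. ?R t * gs n B j t"])
      fix t s'
      assume "t < n" "s' 7 0 = int t" "\<And>y. y \<notin> {31, 7} \<Longrightarrow> s' y = ?s1 y"
      then show "aok \<epsilon> Bd (Mul (Ix 26 (Const 0) 7) (Ix 14 (V 30) 7)) s' \<and>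
        aval \<epsilon> (Mul (Ix 26 (Const 0) 7) (Ix 14 (V 30) 7)) s' = ?R t * gs n B j t"
        using n W(1)[OF jn] mtD[OF W(1)[OF jn]] mt_eq[of t n "s 26" 0] by simp
    next
      show "(\<Sum>t<n. \<bar>?R t * gs n B j t\<bar>) \<le> 2 ^ Bd" using ab(1) by (rule le_pow2_mono) (use bds(6) in simp)
    next
      fix s2 assume "s2 31 0 = (\<Sum>t<n. ?R t * gs n B j t)" and fr2: "\<And>y. y \<notin> {31, 7} \<Longrightarrow> s2 y = ?s1 y"
      then have a2: "s2 31 0 = ?a" by (simp add: dot_def)
      have "wp \<epsilon> Bd (Cond (Less (V 30) (V 28))
       (Set 33 (V 31) ;; Set 32 (Get 15 (Add (V 30) (Const 1))))
       (Set 33 (Mul (V 27) (Div (Add (Mul (Const 2) (V 31)) (Mul (Get 15 (Add (V 30) (Const 1))) (V 27)))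
                                (Mul (Const 2) (Mul (Get 15 (Add (V 30) (Const 1))) (V 27))))) ;;
        Set 32 (Const 1))) (\<lambda>s3. s3 33 0 = c \<and> s3 32 0 = g) s2"
      proof -
        have "\<bar>c\<bar> \<le> 2 ^ Bd" using gcb(3) by (rule abs_le_pow2_mono) (use bds(6) in simp)
        moreover have "\<bar>g\<bar> \<le> 2 ^ Bd" by (rule abs_le_pow2_mono[of g w]) (use gcb bds(6) in auto)
        moreover have "s 15 (int j + 1) = gd n B (Suc j)" using W(2)[of "Suc j"] jn by (simp add: add.commute)
        ultimately show ?thesis using gc a2 fr2 q by (auto simp: red_coeffs_def split: if_splits)
      qed
      then show "wp \<epsilon> Bd (Cond (Less (V 30) (V 28))
       (Set 33 (V 31) ;; Set 32 (Get 15 (Add (V 30) (Const 1))))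
       (Set 33 (Mul (V 27) (Div (Add (Mul (Const 2) (V 31)) (Mul (Get 15 (Add (V 30) (Const 1))) (V 27)))
                                (Mul (Const 2) (Mul (Get 15 (Add (V 30) (Const 1))) (V 27))))) ;;
        Set 32 (Const 1)) ;;
        Row 26 (Const 0) 7 (Sub (Mul (V 32) (Ix 26 (Const 0) 7)) (Mul (V 33) (Ix 25 (V 30) 7))) ;;
        Set 27 (Mul (V 32) (V 27))) ?Q s2"
      proof (subst wp.simps, rule wp_frame)
        fix s3 assume s3: "s3 33 0 = c \<and> s3 32 0 = g" and
          fr3: "\<And>x. x \<notin> mods (Cond (Less (V 30) (V 28))
       (Set 33 (V 31) ;; Set 32 (Get 15 (Add (V 30) (Const 1))))
       (Set 33 (Mul (V 27) (Div (Add (Mul (Const 2) (V 31)) (Mul (Get 15 (Add (V 30) (Const 1))) (V 27)))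
                                (Mul (Const 2) (Mul (Get 15 (Add (V 30) (Const 1))) (V 27))))) ;;
        Set 32 (Const 1))) \<Longrightarrow> s3 x = s2 x"
        have s3': "s3 x = s x" if "x \<notin> {7, 30, 31, 32, 33}" for x using fr3[of x] fr2[of x] that by simp
        have j3: "s3 30 0 = int j" using fr3[of 30] fr2[of 30] by simp
        show "wp \<epsilon> Bd (Row 26 (Const 0) 7 (Sub (Mul (V 32) (Ix 26 (Const 0) 7)) (Mul (V 33) (Ix 25 (V 30) 7))) ;;
          Set 27 (Mul (V 32) (V 27))) ?Q s3"
        proof (subst wp.simps, rule wp_Row[where n = n and k = 0 and h = "\<lambda>t. g * ?R t - c * B j t"])
          fix t s'
          assume t: "t < n" "s' 7 0 = int t" and fr: "\<And>y. y \<notin> {26, 7} \<Longrightarrow> s' y = s3 y"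
            and old: "\<And>i u. u < n \<Longrightarrow> i \<noteq> 0 \<or> t \<le> u \<Longrightarrow> s' 26 (int i * int n + int u) = mt n (s3 26) i u"
          have "s' 26 (int t) = ?R t" using old[OF t(1), of 0] s3'[of 26] by simp
          then show "aok \<epsilon> Bd (Sub (Mul (V 32) (Ix 26 (Const 0) 7)) (Mul (V 33) (Ix 25 (V 30) 7))) s' \<and>
            aval \<epsilon> (Sub (Mul (V 32) (Ix 26 (Const 0) 7)) (Mul (V 33) (Ix 25 (V 30) 7))) s' = g * ?R t - c * B j t"
            using t fr s3 j3 s3' B n by (simp add: mt_eq)
        next
          fix t assume "t < n"
          from big[OF Rb[OF this]] show "\<bar>g * ?R t - c * B j t\<bar> \<le> 2 ^ Bd" .
        next
          fix s4 assume R4: "mt n (s4 26) = (mt n (s3 26))(0 := (\<lambda>t. if t < n then g * ?R t - c * B j t else 0))"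
            and fr4: "\<And>y. y \<notin> {26, 7} \<Longrightarrow> s4 y = s3 y"
          have "(\<lambda>t. if t < n then g * ?R t - c * B j t else 0) = (\<lambda>t. g * ?R t - c * B j t)"
            by (auto simp: fun_eq_iff B mt_def)
          then have R4': "mt n (s4 26) 0 = (\<lambda>t. g * ?R t - c * B j t)" using R4 by simp
          have "s4 32 0 * s4 27 0 = g * ?T" using fr4 s3 s3' by simp
          then show "wp \<epsilon> Bd (Set 27 (Mul (V 32) (V 27))) ?Q s4"
            using R4' big[OF Tb] Tb Rb fr4[of 30] j3 reduced_step[OF B(2) j(2,3) red gc] by simp
        qed (use s3' n bds(6) in auto)
      qed
    qed (use n bds(6) in auto)
    then show "wp \<epsilon> Bd (Sum 31 7 (V 2) (Mul (Ix 26 (Const 0) 7) (Ix 14 (V 30) 7)) ;;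
     Cond (Less (V 30) (V 28))
       (Set 33 (V 31) ;; Set 32 (Get 15 (Add (V 30) (Const 1))))
       (Set 33 (Mul (V 27) (Div (Add (Mul (Const 2) (V 31)) (Mul (Get 15 (Add (V 30) (Const 1))) (V 27)))
                                (Mul (Const 2) (Mul (Get 15 (Add (V 30) (Const 1))) (V 27))))) ;;
        Set 32 (Const 1)) ;;
     Row 26 (Const 0) 7 (Sub (Mul (V 32) (Ix 26 (Const 0) 7)) (Mul (V 33) (Ix 25 (V 30) 7))) ;;
     Set 27 (Mul (V 32) (V 27))) ?Q
     (s(30 := (s 30)(aval \<epsilon> (Const 0) s := aval \<epsilon> (Sub (V 30) (Const 1)) s)))"
      by (simp only: s1)
  qed (use j jB in auto)
qed

lemma wp_red_prog:
  assumes n: "s 2 0 = int n" and B: "B = mt n (s 25)" "minor B n \<noteq> 0"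
    and W: "\<And>i. i < n \<Longrightarrow> mt n (s 14) i = gs n B i" "\<And>i. i \<le> n \<Longrightarrow> s 15 (int i) = gd n B i"
    and q: "s 28 0 = int q" and m: "s 29 0 = int m" "m \<le> n"
    and bds: "\<And>i t. i < n \<Longrightarrow> t < n \<Longrightarrow> \<bar>B i t\<bar> \<le> 2 ^ a" "\<And>i. i \<le> n \<Longrightarrow> gd n B i \<le> 2 ^ w"
      "\<And>i t. i < n \<Longrightarrow> t < n \<Longrightarrow> \<bar>gs n B i t\<bar> \<le> 2 ^ w"
      "\<And>t. t < n \<Longrightarrow> \<bar>mt n (s 26) 0 t\<bar> \<le> 2 ^ r" "s 27 0 \<le> 2 ^ r" "r + n * (n + w + a + 2) \<le> Bd"
    and T: "s 27 0 > 0"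
  shows "wp \<epsilon> Bd red_prog (\<lambda>s'. reduced n q B m (mt n (s 26) 0) (s 27 0) 0 (mt n (s' 26) 0) (s' 27 0) \<and>
    (\<forall>t<n. \<bar>mt n (s' 26) 0 t\<bar> \<le> 2 ^ (r + n * (n + w + a + 2))) \<and> s' 27 0 \<le> 2 ^ (r + n * (n + w + a + 2))) s"
    (is "wp _ _ _ ?Q s")
proof -
  let ?d = "n + w + a + 2"
  let ?I = "\<lambda>j s'. j \<le> m \<and> s' 30 0 = int j \<and> reduced n q B m (mt n (s 26) 0) (s 27 0) j (mt n (s' 26) 0) (s' 27 0) \<and>
    (\<forall>t<n. \<bar>mt n (s' 26) 0 t\<bar> \<le> 2 ^ (r + (m - j) * ?d)) \<and> s' 27 0 \<le> 2 ^ (r + (m - j) * ?d)"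
  let ?s = "s(30 := (s 30)(0 := int m))"
  have nB: "n \<le> Bd"
  proof -
    have "n * 1 \<le> n * ?d" by (intro mult_left_mono) auto
    then show ?thesis using bds(6) by simp
  qed
  have md: "(m - j) * ?d \<le> n * ?d" for j using m by (intro mult_right_mono) auto
  have "wp \<epsilon> Bd (While (Less (Const 0) (V 30)) red_body) ?Q ?s"
  proof (rule wp_While[where I = ?I and j = m])
    have "reduced n q B m (mt n (s 26) 0) (s 27 0) m (mt n (s 26) 0) (s 27 0)"
      using T by (auto simp: reduced_def intro!: exI[of _ "\<lambda>_. 0"])
    then show "?I m ?s" using bds by simp
    show "m \<le> Bd" using m nB by simp
    fix j s1
    assume I: "?I j s1" and fr0: "\<And>x. x \<notin> mods red_body \<Longrightarrow> s1 x = ?s x"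
    have fr: "s1 x = s x" if "x \<notin> {7, 26, 27, 30, 31, 32, 33}" for x using fr0[of x] that by simp
    show "bok \<epsilon> Bd (Less (Const 0) (V 30)) s1" by simp
    show "?Q s1" if "\<not> bval \<epsilon> (Less (Const 0) (V 30)) s1"
    proof -
      have "j = 0" using that I by simp
      moreover have "r + (m - 0) * ?d \<le> r + n * ?d" using md[of 0] by simp
      ultimately show ?thesis using I by (auto intro: abs_le_pow2_mono le_pow2_mono simp del: add_le_cancel_left)
    qed
    assume "bval \<epsilon> (Less (Const 0) (V 30)) s1"
    then have j: "0 < j" using I by simp
    have "wp \<epsilon> Bd red_body (?I (j - 1)) s1"
    proof (rule wp_mono[OF wp_red_body[where n = n and B = B and q = q and j = "j - 1" and m = m and a = a and w = w
            and r = "r + (m - j) * ?d" and ?R0.0 = "mt n (s 26) 0" and ?T0.0 = "s 27 0"]])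
      have e: "r + (m - j) * ?d + ?d = r + (m - (j - 1)) * ?d"

      proof -
        have "j \<le> m" using I by blast
        then have "m - (j - 1) = Suc (m - j)" using j by arith
        then show ?thesis by simp
      qed
      then show "r + (m - j) * ?d + ?d \<le> Bd" using md[of "j - 1"] bds(6) by simp
      show "?I (j - 1) s'" if "s' 30 0 = int (j - 1) \<and> reduced n q B m (mt n (s 26) 0) (s 27 0) (j - 1) (mt n (s' 26) 0) (s' 27 0) \<and>
        (\<forall>t<n. \<bar>mt n (s' 26) 0 t\<bar> \<le> 2 ^ (r + (m - j) * ?d + ?d)) \<and> s' 27 0 \<le> 2 ^ (r + (m - j) * ?d + ?d)" for s'
        using that I unfolding e by auto
    qed (use fr n B W q m bds I j in auto)
    then show "0 < j \<and> wp \<epsilon> Bd red_body (?I (j - 1)) s1" using j by simp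
  qed
  moreover have "\<bar>int m\<bar> \<le> 2 ^ Bd"
    using m nB of_nat_less_two_power[of Bd, where 'a = int] by linarith
  ultimately show ?thesis using m by (simp add: red_prog_def)
qed

section \<open>Lattice basis reduction\<close>

text \<open>Nearest plane rounding of a row against the earlier rows. It is run with array 28 equal
  to 0, so that every direction counts as integral and the denominator remains 1.\<close>

definition sizered_row :: com where
  "sizered_row =
     Row 26 (Const 0) 7 (Ix 25 (V 36) 7) ;;
     Set 27 (Const 1) ;;
     Set 29 (V 36) ;;
     red_prog ;;
     Row 25 (V 36) 7 (Ix 26 (Const 0) 7)"

text \<open>The last index in violation ends up in array 35. Such an index exceeds the content of
  array 3 and is positive, so 0 is free to signal that there is none.\<close>

definition find_swap :: com where
  "find_swap =
     Set 35 (Const 0) ;;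
     For 36 (V 2)
       (Cond (BAnd (Less (V 3) (V 36))
                   (Less (Mul (Const 4) (Mul (Get 15 (Add (V 36) (Const 1))) (Get 15 (Sub (V 36) (Const 1)))))
                         (Mul (Get 15 (V 36)) (Get 15 (V 36)))))
          (Set 35 (V 36)) Skip)"

definition swap_rows :: com where
  "swap_rows =
     Row 37 (Const 0) 7 (Ix 25 (V 35) 7) ;;
     Row 25 (V 35) 7 (Ix 25 (Sub (V 35) (Const 1)) 7) ;;
     Row 25 (Sub (V 35) (Const 1)) 7 (Ix 37 (Const 0) 7)"

text \<open>Every pass orthogonalizes afresh, reduces all rows and swaps at most once. Size
  reduction leaves the contents of arrays 14 and 15 valid, a swap does not.\<close>

definition lll_body :: com where
  "lll_body =
     gs_prog 25 25 ;;
     For 36 (V 2) sizered_row ;;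
     find_swap ;;
     Cond (Less (Const 0) (V 35)) swap_rows (Set 34 (Const 0))"

definition lll_prog :: com where
  "lll_prog = Set 28 (Const 0) ;; Set 34 (Const 1) ;; While (Less (Const 0) (V 34)) lll_body"

lemma mods_sizered_row [simp]: "mods sizered_row = {7, 25, 26, 27, 29, 30, 31, 32, 33}"
  by (auto simp: sizered_row_def)

lemma mods_find_swap [simp]: "mods find_swap = {35, 36}"
  by (auto simp: find_swap_def)

lemma mods_swap_rows [simp]: "mods swap_rows = {7, 25, 37}"
  by (auto simp: swap_rows_def)

lemma mods_lll_body [simp]:
  "mods lll_body = {7, 14, 15, 16, 17, 18, 25, 26, 27, 29, 30, 31, 32, 33, 34, 35, 36, 37}"
  by (auto simp: lll_body_def)

lemma mods_lll_prog [simp]: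
  "mods lll_prog = {7, 14, 15, 16, 17, 18, 25, 26, 27, 28, 29, 30, 31, 32, 33, 34, 35, 36, 37}"
  by (auto simp: lll_prog_def)

text \<open>With \<open>q = 0\<close> the denominator remains 1 and all multipliers are integers, so
  taking floors changes nothing.\<close>

lemma reduced_rowop:
  assumes "reduced n 0 B k (B k) 1 0 R T"
  shows "\<exists>c. B(k := R) = rowop k c B"
proof -
  have T: "T = 1" using assms by (simp add: reduced_def)
  obtain \<mu> where \<mu>: "\<And>i. 0 \<le> i \<Longrightarrow> \<mu> i \<in> \<int>"
    "\<And>t. of_int (R t) / of_int T = of_int (B k t) / of_int 1 - (\<Sum>i<k. \<mu> i * real_of_int (B i t))"
    using assms unfolding reduced_def by blast
  have "R t = B k t - (\<Sum>i<k. \<lfloor>\<mu> i\<rfloor> * B i t)" for t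
  proof -
    have "real_of_int (R t) = of_int (B k t) - (\<Sum>i<k. of_int \<lfloor>\<mu> i\<rfloor> * of_int (B i t))"
      using \<mu> T by simp
    also have "\<dots> = real_of_int (B k t - (\<Sum>i<k. \<lfloor>\<mu> i\<rfloor> * B i t))" by simp
    finally show ?thesis unfolding of_int_eq_iff .
  qed
  then have "R = (\<lambda>t. B k t - (\<Sum>i<k. \<lfloor>\<mu> i\<rfloor> * B i t))" by (rule ext)
  then show ?thesis by (intro exI[of _ "\<lambda>i. \<lfloor>\<mu> i\<rfloor>"]) (simp add: rowop_def)
qed

definition lat :: "nat \<Rightarrow> nat \<Rightarrow> (nat \<Rightarrow> real) set \<Rightarrow> nat \<Rightarrow> (nat \<Rightarrow> nat \<Rightarrow> int) \<Rightarrow> bool" where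
  "lat n q M x B \<longleftrightarrow> minor B n \<noteq> 0 \<and> mixed n q B = M \<and> (\<forall>i\<le>n. gd n B i \<le> 2 ^ x)"

lemma lat_rowop: "lat n q M x B \<Longrightarrow> k < n \<Longrightarrow> lat n q M x (rowop k c B)"
  using gs_rowop[of B n _ k c] by (auto simp: lat_def minor_rowop mixed_rowop)

text \<open>All Gram-Schmidt coefficients of row \<open>i\<close> are at most 1/2 in absolute
  value.\<close>

definition row_red :: "nat \<Rightarrow> (nat \<Rightarrow> nat \<Rightarrow> int) \<Rightarrow> nat \<Rightarrow> bool" where
  "row_red n B i \<longleftrightarrow> (\<forall>j<i. 2 * \<bar>dot n (B i) (gs n B j)\<bar> \<le> gd n B (Suc j))"

lemma wp_sizered_row:
  assumes n: "s 2 0 = int n" and lat: "lat n q M x (mt n (s 25))"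
    and W: "\<And>i. i < n \<Longrightarrow> mt n (s 14) i = gs n (mt n (s 25)) i"
      "\<And>i. i \<le> n \<Longrightarrow> s 15 (int i) = gd n (mt n (s 25)) i"
    and s: "s 28 0 = 0" "s 36 0 = int k" "k < n"
    and bds: "\<And>i t. i < n \<Longrightarrow> t < n \<Longrightarrow> \<bar>mt n (s 25) i t\<bar> \<le> 2 ^ a" "n + x \<le> a"
      "n + (a + gbits n a) \<le> Bd" "a + n * (n + gbits n a + a + 2) \<le> Bd"
  shows "wp \<epsilon> Bd sizered_row (\<lambda>s'. \<exists>c. mt n (s' 25) = rowop k c (mt n (s 25)) \<and> row_red n (mt n (s' 25)) k \<and>
    (\<forall>i<n. \<forall>t<n. \<bar>mt n (s' 25) i t\<bar> \<le> 2 ^ a)) s" (is "wp _ _ _ ?Q s")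
proof -
  let ?B = "mt n (s 25)"
  have B: "minor ?B n \<noteq> 0" and X: "\<And>i. i \<le> n \<Longrightarrow> gd n ?B i \<le> 2 ^ x" using lat by (auto simp: lat_def)
  have nB: "n \<le> Bd" using bds(3) by simp
  have aB: "y \<le> 2 ^ Bd" if "y \<le> 2 ^ a" for y :: int using that by (rule le_pow2_mono) (use bds(3) in simp)
  have "int k \<le> 2 ^ n" using s(3) of_nat_less_two_power[of n, where 'a = int] by linarith
  then have kB: "int k \<le> 2 ^ Bd" by (rule le_pow2_mono) (use bds(3) in simp)
  have gsb: "\<bar>gs n ?B i t\<bar> \<le> 2 ^ gbits n a" if "i < n" "t < n" for i t
    unfolding gs_def using bds(1) that by (intro gbits_bounds(2)) auto
  have gdb: "gd n ?B i \<le> 2 ^ gbits n a" if "i \<le> n" for i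
    using X[OF that] by (rule le_pow2_mono) (use bds(2) in \<open>simp add: gbits_def\<close>)
  show ?thesis unfolding sizered_row_def
  proof (subst wp.simps, rule wp_Row[where n = n and k = 0 and h = "?B k"])
    fix t s' assume "t < n" "s' 7 0 = int t" "\<And>y. y \<notin> {26, 7} \<Longrightarrow> s' y = s y"
    then show "aok \<epsilon> Bd (Ix 25 (V 36) 7) s' \<and> aval \<epsilon> (Ix 25 (V 36) 7) s' = ?B k t"
      using s n by (simp add: mt_eq)
  next
    fix t assume "t < n"
    then show "\<bar>?B k t\<bar> \<le> 2 ^ Bd" using bds(1) s(3) by (intro aB) auto
  next
    fix s1 assume R1: "mt n (s1 26) = (mt n (s 26))(0 := (\<lambda>t. if t < n then ?B k t else 0))"
      and fr1: "\<And>y. y \<notin> {26, 7} \<Longrightarrow> s1 y = s y"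
    have R1': "mt n (s1 26) 0 = ?B k" using R1 by (auto simp: mt_def)
    let ?s2 = "s1(27 := (s1 27)(0 := 1), 29 := (s1 29)(0 := int k))"
    have "wp \<epsilon> Bd (red_prog ;; Row 25 (V 36) 7 (Ix 26 (Const 0) 7)) ?Q ?s2"
    proof (subst wp.simps, rule wp_frame[OF wp_red_prog[where n = n and B = ?B and q = 0 and m = k and a = a and w = "gbits n a" and r = a]])
      fix s3
      assume red: "reduced n 0 ?B k (mt n (?s2 26) 0) (?s2 27 0) 0 (mt n (s3 26) 0) (s3 27 0) \<and>
        (\<forall>t<n. \<bar>mt n (s3 26) 0 t\<bar> \<le> 2 ^ (a + n * (n + gbits n a + a + 2))) \<and>
        s3 27 0 \<le> 2 ^ (a + n * (n + gbits n a + a + 2))"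
        and fr3: "\<And>y. y \<notin> mods red_prog \<Longrightarrow> s3 y = ?s2 y"
      have s3: "s3 y = s y" if "y \<notin> {7, 26, 27, 29, 30, 31, 32, 33}" for y
        using fr3[of y] fr1[of y] that by simp
      let ?R = "mt n (s3 26) 0"
      have red': "reduced n 0 ?B k (?B k) 1 0 ?R (s3 27 0)" using red R1' by simp
      then have T: "s3 27 0 = 1" by (simp add: reduced_def)
      obtain c where c: "?B(k := ?R) = rowop k c ?B" using reduced_rowop[OF red'] by blast
      have G: "gd n (rowop k c ?B) j = gd n ?B j" "j < n \<Longrightarrow> gs n (rowop k c ?B) j = gs n ?B j" if "j \<le> n" for j
        using gs_rowop[OF B that, of k c] by auto
      have cR: "rowop k c ?B k = ?R" using c by (metis fun_upd_same)
      have rr: "row_red n (rowop k c ?B) k"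
        using red' T s(3) by (simp add: row_red_def G cR reduced_def)
      \<comment> \<open>The bits added by the rounding are temporary: the result is size-reduced,
        hence bounded through the Gram determinants alone.\<close>
      have Rb: "\<bar>?R t\<bar> \<le> 2 ^ a" if "t < n" for t
      proof -
        have "\<bar>rowop k c ?B k t\<bar> \<le> 2 ^ (n + x)"
          by (rule reduced_entry_le[OF minor_rowop[OF B] s(3) that]) (use rr X s(3) in \<open>auto simp: row_red_def G\<close>)
        then show ?thesis using bds(2) unfolding cR by (rule abs_le_pow2_mono)
      qed
      show "wp \<epsilon> Bd (Row 25 (V 36) 7 (Ix 26 (Const 0) 7)) ?Q s3"
      proof (rule wp_Row[where n = n and k = k and h = ?R])
        fix t s' assume "t < n" "s' 7 0 = int t" "\<And>y. y \<notin> {25, 7} \<Longrightarrow> s' y = s3 y"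
        then show "aok \<epsilon> Bd (Ix 26 (Const 0) 7) s' \<and> aval \<epsilon> (Ix 26 (Const 0) 7) s' = ?R t"
          by (simp add: mt_def)
      next
        fix t assume "t < n"
        then show "\<bar>?R t\<bar> \<le> 2 ^ Bd" by (intro aB Rb)
      next
        fix s4 :: mem assume "mt n (s4 25) = (mt n (s3 25))(k := (\<lambda>t. if t < n then ?R t else 0))"
        moreover have "(\<lambda>t. if t < n then ?R t else 0) = ?R" by (auto simp: mt_def)
        ultimately have B4: "mt n (s4 25) = ?B(k := ?R)" using s3[of 25] by simp
        then have "mt n (s4 25) = rowop k c ?B" using c by simp
        moreover have "\<bar>mt n (s4 25) i t\<bar> \<le> 2 ^ a" if "i < n" "t < n" for i t
          using B4 Rb bds(1) that by simp
        ultimately show "?Q s4" using rr by auto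
      qed (use s3 n s nB in auto)
    qed (use fr1 R1' n B W s bds gsb gdb in auto)
    then show "wp \<epsilon> Bd (Set 27 (Const 1) ;; Set 29 (V 36) ;; red_prog ;; Row 25 (V 36) 7 (Ix 26 (Const 0) 7)) ?Q s1"
      using fr1[of 36] s kB by simp
  qed (use n nB in auto)
qed

text \<open>For positive determinants: the orthogonalized vector at \<open>k\<close> is shorter than
  half of its predecessor. Because of \<open>q < k\<close> only two integral rows are ever
  exchanged.\<close>

definition swap_cond :: "nat \<Rightarrow> nat \<Rightarrow> (nat \<Rightarrow> nat \<Rightarrow> int) \<Rightarrow> nat \<Rightarrow> bool" where
  "swap_cond n q B k \<longleftrightarrow> q < k \<and> 4 * (gd n B (Suc k) * gd n B (k - 1)) < gd n B k * gd n B k"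

lemma wp_find_swap:
  assumes n: "s 2 0 = int n" "s 3 0 = int q" "n \<le> Bd"
    and D: "\<And>i. i \<le> n \<Longrightarrow> s 15 (int i) = gd n B i"
  shows "wp \<epsilon> Bd find_swap (\<lambda>s'. s' 35 0 = 0 \<and> (\<forall>k<n. \<not> swap_cond n q B k) \<or>
    (\<exists>k. s' 35 0 = int (Suc k) \<and> Suc k < n \<and> swap_cond n q B (Suc k))) s"
proof -
  have le1: "int k \<le> 2 ^ Bd" if "k < n" for k
    using that n(3) of_nat_less_two_power[of Bd, where 'a = int] by linarith
  let ?I = "\<lambda>i s'. s' 35 0 = 0 \<and> (\<forall>k<i. \<not> swap_cond n q B k) \<or>
    (\<exists>k. s' 35 0 = int (Suc k) \<and> Suc k < i \<and> swap_cond n q B (Suc k))"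
  let ?b = "BAnd (Less (V 3) (V 36))
                   (Less (Mul (Const 4) (Mul (Get 15 (Add (V 36) (Const 1))) (Get 15 (Sub (V 36) (Const 1)))))
                         (Mul (Get 15 (V 36)) (Get 15 (V 36))))"
  let ?s = "s(35 := (s 35)(0 := 0))"
  have "wp \<epsilon> Bd (For 36 (V 2) (Cond ?b (Set 35 (V 36)) Skip)) (?I n) ?s"
  proof (rule wp_For[where len = n and I = ?I])
    fix i s1
    assume i: "i < n" "s1 36 0 = int i" and I: "?I i s1"
      and fr: "\<And>x. x \<notin> insert 36 (mods (Cond ?b (Set 35 (V 36)) Skip)) \<Longrightarrow> s1 x = ?s x"
    have bv: "bval \<epsilon> ?b s1 = swap_cond n q B i"
    proof (cases "q < i")
      case True
      have "s 15 (int i + 1) = gd n B (Suc i)" "s 15 (int i - 1) = gd n B (i - 1)" "s 15 (int i) = gd n B i"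
        using D[of "Suc i"] D[of "i - 1"] D[of i] i True by (simp_all add: add.commute of_nat_diff)
      then show ?thesis using i fr[of 15] fr[of 3] n True by (simp add: swap_cond_def)
    next
      case False
      then show ?thesis using i fr[of 3] n by (simp add: swap_cond_def)
    qed
    let ?P = "\<lambda>s''. ?I (Suc i) (s''(36 := (s'' 36)(0 := int i + 1)))"
    show "wp \<epsilon> Bd (Cond ?b (Set 35 (V 36)) Skip) ?P s1"
    proof (cases "swap_cond n q B i")
      case True
      then have "0 < i" by (simp add: swap_cond_def)
      then have "wp \<epsilon> Bd (Set 35 (V 36)) ?P s1"
        using i le1[OF i(1)] True by (auto intro!: exI[of _ "i - 1"])
      then show ?thesis using bv True by (simp del: bval.simps wp.simps(2))
    next
      case False
      then have "?P s1" using I by (auto simp: less_Suc_eq)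
      then show ?thesis using bv False by (simp del: bval.simps)
    qed
  qed (use n in auto)
  then show ?thesis by (simp add: find_swap_def)
qed

lemma wp_swap_rows:
  assumes n: "s 2 0 = int n" "n \<le> Bd" and k: "s 35 0 = int (Suc k)" "Suc k < n"
    and bds: "\<And>i t. i < n \<Longrightarrow> t < n \<Longrightarrow> \<bar>mt n (s 25) i t\<bar> \<le> 2 ^ Bd"
  shows "wp \<epsilon> Bd swap_rows (\<lambda>s'. mt n (s' 25) = rowswap k (mt n (s 25))) s" (is "wp _ _ _ ?Q s")
proof -
  let ?B = "mt n (s 25)"
  have B0: "(\<lambda>t. if t < n then mt n a i t else 0) = mt n a i" for i a by (auto simp: mt_def)
  show ?thesis unfolding swap_rows_def
  proof (subst wp.simps, rule wp_Row[where n = n and k = 0 and h = "?B (Suc k)"])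
    fix t s' assume "t < n" "s' 7 0 = int t" "\<And>y. y \<notin> {37, 7} \<Longrightarrow> s' y = s y"
    then show "aok \<epsilon> Bd (Ix 25 (V 35) 7) s' \<and> aval \<epsilon> (Ix 25 (V 35) 7) s' = ?B (Suc k) t"
      using n k by (simp add: mt_def)
  next
    fix s1 assume R1: "mt n (s1 37) = (mt n (s 37))(0 := (\<lambda>t. if t < n then ?B (Suc k) t else 0))"
      and fr1: "\<And>y. y \<notin> {37, 7} \<Longrightarrow> s1 y = s y"
    show "wp \<epsilon> Bd (Row 25 (V 35) 7 (Ix 25 (Sub (V 35) (Const 1)) 7) ;;
      Row 25 (Sub (V 35) (Const 1)) 7 (Ix 37 (Const 0) 7)) ?Q s1"
    proof (subst wp.simps, rule wp_Row[where n = n and k = "Suc k" and h = "?B k"])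
      fix t s' assume t: "t < n" "s' 7 0 = int t" "\<And>y. y \<notin> {25, 7} \<Longrightarrow> s' y = s1 y"
        and old: "\<And>i u. u < n \<Longrightarrow> i \<noteq> Suc k \<or> t \<le> u \<Longrightarrow> s' 25 (int i * int n + int u) = mt n (s1 25) i u"
      then show "aok \<epsilon> Bd (Ix 25 (Sub (V 35) (Const 1)) 7) s' \<and> aval \<epsilon> (Ix 25 (Sub (V 35) (Const 1)) 7) s' = ?B k t"
        using n k fr1 old[of t k] by simp
    next
      fix s2 assume R2: "mt n (s2 25) = (mt n (s1 25))(Suc k := (\<lambda>t. if t < n then ?B k t else 0))"
        and fr2: "\<And>y. y \<notin> {25, 7} \<Longrightarrow> s2 y = s1 y"
      show "wp \<epsilon> Bd (Row 25 (Sub (V 35) (Const 1)) 7 (Ix 37 (Const 0) 7)) ?Q s2"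
      proof (rule wp_Row[where n = n and k = k and h = "?B (Suc k)"])
        fix t s' assume t: "t < n" "s' 7 0 = int t" "\<And>y. y \<notin> {25, 7} \<Longrightarrow> s' y = s2 y"
        have "s2 37 (int t) = ?B (Suc k) t"
          using mtD[of n "s2 37" 0 "?B (Suc k)" t] R1 fr2[of 37] t(1) by (simp add: B0)
        then show "aok \<epsilon> Bd (Ix 37 (Const 0) 7) s' \<and> aval \<epsilon> (Ix 37 (Const 0) 7) s' = ?B (Suc k) t"
          using t by simp
      next
        fix s3 :: mem assume "mt n (s3 25) = (mt n (s2 25))(k := (\<lambda>t. if t < n then ?B (Suc k) t else 0))"
        then show "?Q s3" using R2 fr1[of 25] by (simp add: B0 rowswap_def)
      qed (use n k fr1 fr2 bds in auto)
    qed (use n k fr1 bds in auto)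
  qed (use n k bds in auto)
qed

text \<open>In the formula for the new determinant one term is below a quarter of the old value by
  the swap condition, and the other is at most a quarter by size reduction.\<close>

lemma gd_rowswap_halves:
  assumes B: "minor B n \<noteq> 0" and k: "Suc k < n" "swap_cond n q B (Suc k)" "row_red n B (Suc k)"
  shows "2 * gd n (rowswap k B) (Suc k) \<le> gd n B (Suc k)"
proof -
  let ?d = "gd n B (Suc k)" and ?d' = "gd n (rowswap k B) (Suc k)" and ?l = "dot n (gs n B k) (B (Suc k))"
  have d: "?d > 0" using gd_pos[OF B, of "Suc k"] k by simp
  have "2 * \<bar>?l\<bar> \<le> ?d" using k(3) by (simp add: row_red_def dot_commute[of n "gs n B k"])
  then have "(2 * \<bar>?l\<bar>)\<^sup>2 \<le> ?d\<^sup>2" by (intro power_mono) auto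
  then have "4 * ?l\<^sup>2 \<le> ?d * ?d" by (simp add: power2_eq_square)
  moreover have "4 * (gd n B (Suc (Suc k)) * gd n B k) < ?d * ?d" using k(2) by (simp add: swap_cond_def)
  moreover have "?d * ?d' = gd n B (Suc (Suc k)) * gd n B k + ?l\<^sup>2" by (rule gd_rowswap(2)[OF B k(1)])
  ultimately have "?d * (2 * ?d') \<le> ?d * ?d" by linarith
  then show ?thesis using d by (simp only: mult_le_cancel_left_pos)
qed

text \<open>The product of the Gram determinants is the potential: a single factor changes. As a
  positive integer it limits the number of swaps.\<close>

lemma prod_gd_rowswap:
  assumes B: "minor B n \<noteq> 0" and k: "Suc k < n" "swap_cond n q B (Suc k)" "row_red n B (Suc k)"
  shows "2 * (\<Prod>i\<le>n. gd n (rowswap k B) i) \<le> (\<Prod>i\<le>n. gd n B i)"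
proof -
  have k': "Suc k \<in> {..n}" using k by simp
  have eq: "(\<Prod>i\<in>{..n} - {Suc k}. gd n (rowswap k B) i) = (\<Prod>i\<in>{..n} - {Suc k}. gd n B i)"
    by (intro prod.cong refl) (simp add: gd_rowswap(1)[OF B k(1)])
  have "0 \<le> (\<Prod>i\<in>{..n} - {Suc k}. gd n B i)" using gd_pos[OF B] by (intro prod_nonneg) (auto intro: less_imp_le)
  then show ?thesis using gd_rowswap_halves[OF B k]
    unfolding prod.remove[OF _ k', simplified] eq by (simp add: mult_right_mono flip: mult.assoc)
qed

lemma lat_rowswap:
  assumes lat: "lat n q M x B" and k: "Suc k < n" "swap_cond n q B (Suc k)" "row_red n B (Suc k)"
  shows "lat n q M x (rowswap k B)"
proof -
  have B: "minor B n \<noteq> 0" using lat by (simp add: lat_def)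
  have "gd n (rowswap k B) i \<le> 2 ^ x" if "i \<le> n" for i
  proof (cases "i = Suc k")
    case True
    have "gd n (rowswap k B) i > 0" using gd_pos[OF minor_rowswap[OF B k(1)] that] .
    then show ?thesis using gd_rowswap_halves[OF B k] lat that True unfolding lat_def by force
  next
    case False
    then show ?thesis using gd_rowswap(1)[OF B k(1) False] lat that by (simp add: lat_def)
  qed
  then show ?thesis using lat k minor_rowswap[OF B k(1)] mixed_rowswap[OF k(1), of q B]
    by (simp add: lat_def swap_cond_def)
qed

definition lll_final :: "nat \<Rightarrow> nat \<Rightarrow> mem \<Rightarrow> bool" where
  "lll_final n q s \<longleftrightarrow> (\<forall>i<n. mt n (s 14) i = gs n (mt n (s 25)) i) \<and>
     (\<forall>i\<le>n. s 15 (int i) = gd n (mt n (s 25)) i) \<and> (\<forall>k<n. \<not> swap_cond n q (mt n (s 25)) k)"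

lemma wp_lll_body:
  assumes n: "s 2 0 = int n" "s 3 0 = int q" and lat: "lat n q M x (mt n (s 25))"
    and s: "s 28 0 = 0"
    and bds: "\<And>i t. i < n \<Longrightarrow> t < n \<Longrightarrow> \<bar>mt n (s 25) i t\<bar> \<le> 2 ^ a" "n + x \<le> a"
      "n + (a + gbits n a) \<le> Bd" "a + n * (n + gbits n a + a + 2) \<le> Bd"
  shows "wp \<epsilon> Bd lll_body (\<lambda>s'. lat n q M x (mt n (s' 25)) \<and> (\<forall>i<n. \<forall>t<n. \<bar>mt n (s' 25) i t\<bar> \<le> 2 ^ a) \<and>
    (s' 34 = s 34 \<and> 2 * (\<Prod>i\<le>n. gd n (mt n (s' 25)) i) \<le> (\<Prod>i\<le>n. gd n (mt n (s 25)) i) \<or>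
     s' 34 0 = 0 \<and> lll_final n q s')) s" (is "wp _ _ _ ?Q s")
proof -
  let ?B = "mt n (s 25)"
  have B: "minor ?B n \<noteq> 0" using lat by (simp add: lat_def)
  have nB: "n \<le> Bd" using bds(3) by simp
  let ?I = "\<lambda>i s'. lat n q M x (mt n (s' 25)) \<and> (\<forall>j\<le>n. gd n (mt n (s' 25)) j = gd n ?B j) \<and>
    (\<forall>j<n. gs n (mt n (s' 25)) j = gs n ?B j) \<and> (\<forall>r<i. row_red n (mt n (s' 25)) r) \<and>
    (\<forall>i<n. \<forall>t<n. \<bar>mt n (s' 25) i t\<bar> \<le> 2 ^ a)"
  show ?thesis unfolding lll_body_def
  proof (subst wp.simps, rule wp_frame[OF wp_gs_prog[where n = n and ?U0.0 = ?B and A = "gr n ?B" and a = a]])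
    fix s1
    assume "\<exists>k\<le>n. s1 16 0 = int k \<and> (\<forall>i\<le>k. s1 15 (int i) = minor (gr n ?B) i) \<and>
      (\<forall>i<k. mt n (s1 14) i = pu ?B (gr n ?B) i i) \<and> (\<forall>i<k. minor (gr n ?B) i > 0) \<and>
      (k = n \<or> minor (gr n ?B) k \<le> 0)"
      and fr1: "\<And>y. y \<notin> mods (gs_prog 25 25) \<Longrightarrow> s1 y = s y"
    then have W1: "\<forall>i\<le>n. s1 15 (int i) = gd n ?B i" "\<forall>i<n. mt n (s1 14) i = gs n ?B i"
      using gd_pos[OF B] by (auto simp: gs_def gd_def not_le[symmetric])
    show "wp \<epsilon> Bd (For 36 (V 2) sizered_row ;; find_swap ;; Cond (Less (Const 0) (V 35)) swap_rows (Set 34 (Const 0))) ?Q s1"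
    proof (subst wp.simps, rule wp_For[where len = n and I = ?I])
      fix k s2
      assume k: "k < n" "s2 36 0 = int k" and I: "?I k s2"
        and fr2: "\<And>y. y \<notin> insert 36 (mods sizered_row) \<Longrightarrow> s2 y = s1 y"
      have s2: "s2 y = s y" if "y \<notin> {7, 14, 15, 16, 17, 18, 25, 26, 27, 29, 30, 31, 32, 33, 36}" for y
        using fr1[of y] fr2[of y] that by simp
      show "wp \<epsilon> Bd sizered_row (\<lambda>s''. ?I (Suc k) (s''(36 := (s'' 36)(0 := int k + 1)))) s2"
      proof (rule wp_mono[OF wp_sizered_row[where n = n and k = k and a = a and x = x and q = q and M = M]])
        fix s3 :: mem
        assume "\<exists>c. mt n (s3 25) = rowop k c (mt n (s2 25)) \<and> row_red n (mt n (s3 25)) k \<and>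
          (\<forall>i<n. \<forall>t<n. \<bar>mt n (s3 25) i t\<bar> \<le> 2 ^ a)"
        then obtain c where c: "mt n (s3 25) = rowop k c (mt n (s2 25))" "row_red n (mt n (s3 25)) k"
          "\<And>i t. i < n \<Longrightarrow> t < n \<Longrightarrow> \<bar>mt n (s3 25) i t\<bar> \<le> 2 ^ a" by auto
        have B2: "minor (mt n (s2 25)) n \<noteq> 0" using I by (simp add: lat_def)
        have G: "gd n (mt n (s3 25)) j = gd n (mt n (s2 25)) j" "j < n \<Longrightarrow> gs n (mt n (s3 25)) j = gs n (mt n (s2 25)) j"
          if "j \<le> n" for j unfolding c(1) using gs_rowop[OF B2 that, of k c] by auto
        have "row_red n (mt n (s3 25)) r" if "r < k" for r
        proof -
          have "mt n (s3 25) r = mt n (s2 25) r" using that unfolding c(1) by (simp add: rowop_def)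
          moreover have "row_red n (mt n (s2 25)) r" using I that by blast
          ultimately show ?thesis using that k by (simp add: row_red_def G)
        qed
        moreover have "lat n q M x (mt n (s3 25))" using lat_rowop[of n q M x "mt n (s2 25)" k c] I k c(1) by simp
        ultimately have "?I (Suc k) s3" using c(2,3) G I by (auto simp: less_Suc_eq)
        then show "?I (Suc k) (s3(36 := (s3 36)(0 := int k + 1)))" by simp
      next
        show "\<And>i. i < n \<Longrightarrow> mt n (s2 14) i = gs n (mt n (s2 25)) i"
          using fr2[of 14] W1 I by simp
        show "\<And>i. i \<le> n \<Longrightarrow> s2 15 (int i) = gd n (mt n (s2 25)) i"
          using fr2[of 15] W1 I by simp
      qed (use I s2 n s k bds in auto)
    next
      fix s2
      assume I: "?I n s2" and fr2: "\<And>y. y \<notin> insert 36 (mods sizered_row) \<Longrightarrow> s2 y = s1 y"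
      let ?B2 = "mt n (s2 25)"
      have s2: "s2 y = s y" if "y \<notin> {7, 14, 15, 16, 17, 18, 25, 26, 27, 29, 30, 31, 32, 33, 36}" for y
        using fr1[of y] fr2[of y] that by simp
      have B2: "minor ?B2 n \<noteq> 0" using I by (simp add: lat_def)
      have W2: "\<forall>i\<le>n. s2 15 (int i) = gd n ?B2 i" "\<forall>i<n. mt n (s2 14) i = gs n ?B2 i"
        using fr2[of 15] fr2[of 14] W1 I by simp_all
      show "wp \<epsilon> Bd (find_swap ;; Cond (Less (Const 0) (V 35)) swap_rows (Set 34 (Const 0))) ?Q s2"
      proof (subst wp.simps, rule wp_frame[OF wp_find_swap[where n = n and q = q and B = ?B2]])
        fix s3
        assume f: "s3 35 0 = 0 \<and> (\<forall>k<n. \<not> swap_cond n q ?B2 k) \<or>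
          (\<exists>k. s3 35 0 = int (Suc k) \<and> Suc k < n \<and> swap_cond n q ?B2 (Suc k))"
          and fr3: "\<And>y. y \<notin> mods find_swap \<Longrightarrow> s3 y = s2 y"
        have s3: "s3 25 = s2 25" "s3 14 = s2 14" "s3 15 = s2 15" "s3 34 = s 34" "s3 2 = s 2"
          using fr3 s2 by simp_all
        from f show "wp \<epsilon> Bd (Cond (Less (Const 0) (V 35)) swap_rows (Set 34 (Const 0))) ?Q s3"
        proof (elim disjE exE conjE)
          assume "s3 35 0 = 0" "\<forall>k<n. \<not> swap_cond n q ?B2 k"
          then show ?thesis using I s3 W2 by (simp add: lll_final_def)
        next
          fix k assume k: "s3 35 0 = int (Suc k)" "Suc k < n" "swap_cond n q ?B2 (Suc k)"
          have rr: "row_red n ?B2 (Suc k)" using I k by simp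
          have "wp \<epsilon> Bd swap_rows ?Q s3"
          proof (rule wp_frame[OF wp_swap_rows[where n = n and k = k]])
            fix s4 assume sw: "mt n (s4 25) = rowswap k (mt n (s3 25))" and fr4: "\<And>y. y \<notin> mods swap_rows \<Longrightarrow> s4 y = s3 y"
            have "(\<Prod>i\<le>n. gd n ?B2 i) = (\<Prod>i\<le>n. gd n ?B i)" using I by (intro prod.cong) auto
            then show "?Q s4"
              using prod_gd_rowswap[OF B2 k(2,3) rr] lat_rowswap[OF _ k(2,3) rr, of M x] I sw s3 fr4[of 34] k(2)
              by (auto simp: rowswap_def)
          next
            fix i t assume "i < n" "t < n"
            then have "\<bar>mt n (s3 25) i t\<bar> \<le> 2 ^ a" using I s3 by simp
            then show "\<bar>mt n (s3 25) i t\<bar> \<le> 2 ^ Bd" by (rule abs_le_pow2_mono) (use bds(3) in simp)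
          qed (use k n s3 nB in auto)
          then show ?thesis using k(1) by simp
        qed
      qed (use s2 n W2 nB in auto)
    qed (use fr1 n lat bds nB in auto)
  qed (use n bds gr_sym in auto)
qed

lemma wp_lll_prog:
  assumes n: "s 2 0 = int n" "s 3 0 = int q" and lat: "lat n q M x (mt n (s 25))"
    and bds: "\<And>i t. i < n \<Longrightarrow> t < n \<Longrightarrow> \<bar>mt n (s 25) i t\<bar> \<le> 2 ^ a" "n + x \<le> a"
      "n + (a + gbits n a) \<le> Bd" "a + n * (n + gbits n a + a + 2) \<le> Bd" "Suc (Suc n * x) \<le> Bd"
  shows "wp \<epsilon> Bd lll_prog (\<lambda>s'. lat n q M x (mt n (s' 25)) \<and> (\<forall>i<n. \<forall>t<n. \<bar>mt n (s' 25) i t\<bar> \<le> 2 ^ a) \<and>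
     lll_final n q s') s" (is "wp _ _ _ ?Q s")
proof -
  let ?P = "\<lambda>s'. \<Prod>i\<le>n. gd n (mt n (s' 25)) i"
  let ?s = "s(28 := (s 28)(0 := 0), 34 := (s 34)(0 := 1))"
  let ?L = "\<lambda>s'. lat n q M x (mt n (s' 25)) \<and> (\<forall>i<n. \<forall>t<n. \<bar>mt n (s' 25) i t\<bar> \<le> 2 ^ a)"
  let ?I = "\<lambda>j s'. ?L s' \<and> (s' 34 0 = 1 \<and> j > 0 \<and> ?P s' \<le> 2 ^ (j - 1) \<or> s' 34 0 = 0 \<and> lll_final n q s')"
  have Ppos: "?P s' \<ge> 1" if "?L s'" for s'
  proof -
    have "gd n (mt n (s' 25)) i > 0" if "i \<le> n" for i using \<open>?L s'\<close> gd_pos[OF _ that] by (simp add: lat_def)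
    then have "0 < ?P s'" by (intro prod_pos) auto
    then show ?thesis by simp
  qed
  have "wp \<epsilon> Bd (While (Less (Const 0) (V 34)) lll_body) ?Q ?s"
  \<comment> \<open>\<open>Suc n * x\<close> bounds the binary logarithm of the initial potential,
    hence the number of swaps; one more pass finds nothing to swap.\<close>
  proof (rule wp_While[where I = ?I and j = "Suc (Suc n * x)"])
    have "?P s \<le> (\<Prod>i\<le>n. 2 ^ x)"
      by (rule prod_mono) (use lat gd_pos in \<open>auto simp: lat_def intro: less_imp_le\<close>)
    also have "\<dots> = 2 ^ (Suc n * x)" by (simp only: prod_constant card_atMost power_mult mult.commute[of "Suc n"])
    finally have "?P s \<le> 2 ^ (Suc n * x)" .
    then show "?I (Suc (Suc n * x)) ?s" using lat bds by simp
    fix j s1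
    assume I: "?I j s1" and fr0: "\<And>y. y \<notin> mods lll_body \<Longrightarrow> s1 y = ?s y"
    show "bok \<epsilon> Bd (Less (Const 0) (V 34)) s1" by simp
    show "?Q s1" if "\<not> bval \<epsilon> (Less (Const 0) (V 34)) s1" using I that by auto
    assume "bval \<epsilon> (Less (Const 0) (V 34)) s1"
    then have j: "j > 0" "s1 34 0 = 1" "?P s1 \<le> 2 ^ (j - 1)" and L: "?L s1" using I by auto
    have "wp \<epsilon> Bd lll_body (?I (j - 1)) s1"
    proof (rule wp_mono[OF wp_lll_body[where n = n and q = q and M = M and x = x and a = a]])
      fix s2
      assume post: "lat n q M x (mt n (s2 25)) \<and> (\<forall>i<n. \<forall>t<n. \<bar>mt n (s2 25) i t\<bar> \<le> 2 ^ a) \<and>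
        (s2 34 = s1 34 \<and> 2 * ?P s2 \<le> ?P s1 \<or> s2 34 0 = 0 \<and> lll_final n q s2)"
      show "?I (j - 1) s2"
      proof (cases "s2 34 0 = 0 \<and> lll_final n q s2")
        case False
        then have h: "2 * ?P s2 \<le> 2 ^ (j - 1)" "s2 34 0 = 1" using post j by auto
        moreover have "1 \<le> ?P s2" using post by (intro Ppos) simp
        \<comment> \<open>With exponent 0 the potential would be at most 1, and a swap would bring
          it below 1.\<close>
        ultimately have "j - 1 \<noteq> 0" by (intro notI) simp
        then obtain i where "j - 1 = Suc i" using not0_implies_Suc by blast
        then show ?thesis using h post by simp
      qed (use post in auto)
    qed (use fr0 n bds L in auto)
    then show "0 < j \<and> wp \<epsilon> Bd lll_body (?I (j - 1)) s1" using j by simp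
  qed (use bds in auto)
  then show ?thesis by (simp add: lll_prog_def)
qed

section \<open>Bisection\<close>

text \<open>\<open>N\<close> is the least power 2^k with
  \<open>16 \<le> \<lfloor>2 ^ k * \<epsilon>\<rfloor>\<close>, and \<open>E\<close> is this floor
  plus 1. Thus \<epsilon> < E/N \<le> \<epsilon> + 1/N with 1/N \<le> \<epsilon>/16. Rounding
  upwards keeps the width bound valid for \<epsilon> itself, and the 16 makes room for all other
  losses within 7 \<epsilon>.\<close>

definition eps_prog :: com where
  "eps_prog =
     Set 9 (Const 0) ;; Set 10 (Const 1) ;;
     While (Less (Eps (V 9)) (Const 16)) (Set 9 (Add (V 9) (Const 1)) ;; Set 10 (Mul (Const 2) (V 10))) ;;
     Set 11 (Add (Eps (V 9)) (Const 1))"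

lemma mods_eps_prog [simp]: "mods eps_prog = {9, 10, 11}"
  by (auto simp: eps_prog_def)

lemma wp_eps_prog:
  assumes eps: "0 < \<epsilon>" "\<epsilon> < 1" and K: "16 \<le> 2 ^ K * \<epsilon>" "K \<le> B" "16 \<le> B"
  shows "wp \<epsilon> B eps_prog (\<lambda>s'. \<exists>k\<le>K. s' 10 0 = 2 ^ k \<and> s' 11 0 = \<lfloor>2 ^ k * \<epsilon>\<rfloor> + 1 \<and> 16 \<le> \<lfloor>2 ^ k * \<epsilon>\<rfloor>) s"
    (is "wp _ _ _ ?Q s")
proof -
  let ?I = "\<lambda>j s'. \<exists>k\<le>K. j = K - k \<and> s' 9 0 = int k \<and> s' 10 0 = 2 ^ k"
  let ?s = "s(9 := (s 9)(0 := 0), 10 := (s 10)(0 := 1))"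
  have le1: "int k \<le> 2 ^ B" if "k \<le> B" for k
    using that of_nat_less_two_power[of B, where 'a = int] by linarith
  have "wp \<epsilon> B (While (Less (Eps (V 9)) (Const 16)) (Set 9 (Add (V 9) (Const 1)) ;; Set 10 (Mul (Const 2) (V 10))))
    (wp \<epsilon> B (Set 11 (Add (Eps (V 9)) (Const 1))) ?Q) ?s"
  proof (rule wp_While[where I = ?I and j = K])
    show "?I K ?s" by (intro exI[of _ 0]) simp
    fix j and s1 :: mem assume "?I j s1"
    then obtain k where k: "k \<le> K" "j = K - k" "s1 9 0 = int k" "s1 10 0 = 2 ^ k" by blast
    show "bok \<epsilon> B (Less (Eps (V 9)) (Const 16)) s1" using k K by simp
    show "wp \<epsilon> B (Set 11 (Add (Eps (V 9)) (Const 1))) ?Q s1" if "\<not> bval \<epsilon> (Less (Eps (V 9)) (Const 16)) s1"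
    proof -
      have "\<lfloor>2 ^ k * \<epsilon>\<rfloor> < 2 ^ k" using eps by (simp add: floor_less_iff)
      then have "\<lfloor>2 ^ k * \<epsilon>\<rfloor> + 1 \<le> 2 ^ k" by simp
      then have "\<lfloor>2 ^ k * \<epsilon>\<rfloor> + 1 \<le> 2 ^ B" by (rule le_pow2_mono) (use k K in simp)
      then show ?thesis using that k K by auto
    qed
    assume b: "bval \<epsilon> (Less (Eps (V 9)) (Const 16)) s1"
    then have "\<lfloor>2 ^ k * \<epsilon>\<rfloor> < 16" using k by simp
    then have "2 ^ k * \<epsilon> < 16" by (simp add: floor_less_iff)
    then have "k \<noteq> K" using K by auto
    then have kK: "k < K" using k by simp
    have "(2 :: int) * 2 ^ k \<le> 2 ^ Suc k" by simp
    then have "(2 :: int) * 2 ^ k \<le> 2 ^ B" by (rule le_pow2_mono) (use kK K in simp)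
    moreover have "int k + 1 \<le> 2 ^ B" using le1[of "Suc k"] kK K by simp
    ultimately show "0 < j \<and> wp \<epsilon> B (Set 9 (Add (V 9) (Const 1)) ;; Set 10 (Mul (Const 2) (V 10))) (?I (j - 1)) s1"
      using k kK by (auto intro!: exI[of _ "Suc k"])
  qed (use K in auto)
  then show ?thesis by (simp add: eps_prog_def)
qed

definition bisect_body :: "com \<Rightarrow> com" where
  "bisect_body test =
     Set 21 (Div (Add (V 19) (V 20)) (Const 2)) ;;
     test ;;
     Cond (Less (Const 0) (V 22)) (Set 20 (V 21)) (Set 19 (V 21))"

definition bisect_prog :: "com \<Rightarrow> com" where
  "bisect_prog test = While (Less (Const 1) (Sub (V 20) (V 19))) (bisect_body test)"

lemma mods_bisect [simp]:
  "mods (bisect_body test) = {19, 20, 21} \<union> mods test" "mods (bisect_prog test) = {19, 20, 21} \<union> mods test"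
  by (auto simp: bisect_body_def bisect_prog_def)

text \<open>\<open>I l\<close> is the information available about a lower end \<open>l\<close>, and \<open>H u\<close> about an upper end \<open>u\<close>.\<close>

lemma wp_bisect:
  assumes test: "mods test \<inter> {19, 20, 21} = {}"
    and s: "s 19 0 = lo" "s 20 0 = hi" "0 \<le> lo" "lo < hi" "hi \<le> 2 ^ h" "h \<le> B" "I lo s" "H hi"
    and step: "\<And>l m s'. I l s' \<Longrightarrow> lo \<le> l \<Longrightarrow> l < m \<Longrightarrow> m < hi \<Longrightarrow> s' 21 0 = m \<Longrightarrow>
      (\<And>x. x \<notin> {19, 20, 21} \<union> mods test \<Longrightarrow> s' x = s x) \<Longrightarrow>
      wp \<epsilon> B test (\<lambda>s''. s'' 22 0 = 1 \<and> H m \<and> I l s'' \<or> s'' 22 0 = 0 \<and> I m s'') s'"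
    and indep: "\<And>l s' s''. I l s' \<Longrightarrow> (\<And>x. x \<notin> {19, 20, 21} \<Longrightarrow> s'' x = s' x) \<Longrightarrow> I l s''"
    and fin: "\<And>l s'. I l s' \<Longrightarrow> H (l + 1) \<Longrightarrow> lo \<le> l \<Longrightarrow> l < hi \<Longrightarrow> s' 19 0 = l \<Longrightarrow> s' 20 0 = l + 1 \<Longrightarrow>
      (\<And>x. x \<notin> {19, 20, 21} \<union> mods test \<Longrightarrow> s' x = s x) \<Longrightarrow> Q s'"
  shows "wp \<epsilon> B (bisect_prog test) Q s"
proof -
  let ?J = "\<lambda>j s'. \<exists>l u. s' 19 0 = l \<and> s' 20 0 = u \<and> lo \<le> l \<and> l < u \<and> u \<le> hi \<and> u - l \<le> 2 ^ j \<and> I l s' \<and> H u"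
  let ?b = "Less (Const 1) (Sub (V 20) (V 19))"
  have hB: "x \<le> 2 ^ B" if "x \<le> hi" for x using that s(5) le_pow2_mono[OF _ s(6)] by (meson order_trans)
  show ?thesis unfolding bisect_prog_def
  proof (rule wp_While[where I = ?J and j = h])
    show "?J h s" using s by auto
    show "h \<le> B" by (rule s)
    fix j s1 assume "?J j s1" and fr: "\<And>x. x \<notin> mods (bisect_body test) \<Longrightarrow> s1 x = s x"
    then obtain l u where J: "s1 19 0 = l" "s1 20 0 = u" "lo \<le> l" "l < u" "u \<le> hi" "u - l \<le> 2 ^ j" "I l s1" "H u"
      by blast
    show "bok \<epsilon> B ?b s1" by simp
    show "Q s1" if "\<not> bval \<epsilon> ?b s1"
    proof -
      have "u = l + 1" using that J by simp
      then show ?thesis using J fr by (intro fin[OF J(7)]) auto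
    qed
    assume "bval \<epsilon> ?b s1"
    then have gap: "l + 1 < u" using J by simp
    have "j \<noteq> 0" using gap J(6) by (intro notI) simp
    then obtain i where i: "j = Suc i" using not0_implies_Suc by blast
    define m where "m = (l + u) div 2"
    have m: "l < m" "m < u" "u - m \<le> 2 ^ i" "m - l \<le> 2 ^ i" using gap J(6) i by (auto simp: m_def)
    let ?s2 = "s1(21 := (s1 21)(0 := m))"
    have "wp \<epsilon> B (test ;; Cond (Less (Const 0) (V 22)) (Set 20 (V 21)) (Set 19 (V 21))) (?J i) ?s2"
    proof (subst wp.simps, rule wp_frame[OF step])
      show "I l ?s2" by (rule indep[OF J(7)]) auto
      fix s3 assume post: "s3 22 0 = 1 \<and> H m \<and> I l s3 \<or> s3 22 0 = 0 \<and> I m s3"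
        and fr3: "\<And>x. x \<notin> mods test \<Longrightarrow> s3 x = ?s2 x"
      have s3: "s3 19 0 = l" "s3 20 0 = u" "s3 21 0 = m" using fr3[of 19] fr3[of 20] fr3[of 21] test J by auto
      have up: "I l s3 \<Longrightarrow> I l (s3(20 := (s3 20)(0 := m)))" "I m s3 \<Longrightarrow> I m (s3(19 := (s3 19)(0 := m)))"
        by (erule indep; auto)+
      have "\<bar>m\<bar> \<le> 2 ^ B" using hB[of m] m J s(3) by simp
      then show "wp \<epsilon> B (Cond (Less (Const 0) (V 22)) (Set 20 (V 21)) (Set 19 (V 21))) (?J i) s3"
        using post s3 m J up by auto
    qed (use m J fr in auto)
    moreover have "\<bar>m\<bar> \<le> 2 ^ B" using hB[of m] m J s(3) by simp
    ultimately have "wp \<epsilon> B (bisect_body test) (?J i) s1"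
      using J by (simp add: bisect_body_def m_def)
    then show "0 < j \<and> wp \<epsilon> B (bisect_body test) (?J (j - 1)) s1" using i by simp
  qed
qed

section \<open>A starting interval for the bisection\<close>

lemma bform_cong:
  assumes "\<And>a b. a < n \<Longrightarrow> b < n \<Longrightarrow> A a b = A' a b" "\<And>a. a < n \<Longrightarrow> x a = x' a"
  shows "bform n A x x = bform n A' x' x'"
  unfolding bform_def using assms by (intro sum.cong refl) auto

lemma bform_shift:
  "bform n (\<lambda>a b. (if a = b then m else 0) + c * H a b) x x = of_int m * dot n x x + of_int c * bform n H x x"
proof -
  have "bform n (\<lambda>a b. (if a = b then m else 0) + c * H a b) x x =
      (\<Sum>a<n. (\<Sum>b<n. if a = b then of_int m * x a * x a else 0) + of_int c * (\<Sum>b<n. x a * of_int (H a b) * x b))"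
    unfolding bform_def sum_distrib_left sum.distrib[symmetric]
    by (intro sum.cong refl) (auto simp: algebra_simps)
  also have "\<dots> = of_int m * dot n x x + of_int c * bform n H x x"
    by (simp add: sum.distrib sum_distrib_left bform_def dot_def mult.assoc)
  finally show ?thesis .
qed

text \<open>Integers satisfy \<open>\<bar>H a b\<bar> \<le> H a b * H a b\<close>, and |x a x b| is
  at most the squared length of x. The bound is crude, but it is an integer of polynomial length
  obtained without roots.\<close>

lemma bform_le_sum_squares:
  "\<bar>bform n H x x\<bar> \<le> of_int (\<Sum>a<n. \<Sum>b<n. H a b * H a b) * dot n x x"
proof -
  have t: "\<bar>x a * of_int (H a b) * x b\<bar> \<le> of_int (H a b * H a b) * dot n x x" if "a < n" "b < n" for a b
  proof -
    have "\<bar>H a b\<bar> * 1 \<le> \<bar>H a b\<bar> * \<bar>H a b\<bar>" by (cases "H a b = 0") (simp, intro mult_left_mono, auto)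
    then have "real_of_int \<bar>H a b\<bar> \<le> of_int (H a b * H a b)" unfolding of_int_le_iff by simp
    then have h: "\<bar>real_of_int (H a b)\<bar> \<le> of_int (H a b * H a b)" by (simp only: of_int_abs)
    have s: "x i * x i \<le> dot n x x" if "i < n" for i
      unfolding dot_def using that by (intro member_le_sum[of i "{..<n}" "\<lambda>i. x i * x i"]) auto
    have "0 \<le> (\<bar>x a\<bar> - \<bar>x b\<bar>)\<^sup>2" by simp
    then have "2 * (\<bar>x a\<bar> * \<bar>x b\<bar>) \<le> x a * x a + x b * x b" by (simp add: power2_eq_square algebra_simps)
    then have "\<bar>x a\<bar> * \<bar>x b\<bar> \<le> dot n x x" using s[OF that(1)] s[OF that(2)] by linarith
    then have "\<bar>real_of_int (H a b)\<bar> * (\<bar>x a\<bar> * \<bar>x b\<bar>) \<le> of_int (H a b * H a b) * dot n x x"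
      using h by (intro mult_mono) auto
    then show ?thesis by (simp add: abs_mult mult_ac)
  qed
  have "\<bar>bform n H x x\<bar> \<le> (\<Sum>a<n. \<Sum>b<n. \<bar>x a * of_int (H a b) * x b\<bar>)"
    unfolding bform_def by (rule order_trans[OF sum_abs], intro sum_mono sum_abs)
  also have "\<dots> \<le> (\<Sum>a<n. \<Sum>b<n. of_int (H a b * H a b) * dot n x x)" by (intro sum_mono t) auto
  also have "\<dots> = of_int (\<Sum>a<n. \<Sum>b<n. H a b * H a b) * dot n x x"
    by (simp only: of_int_sum sum_distrib_right)
  finally show ?thesis .
qed

lemma sum_square_index: "(\<Sum>t<n * n. f t) = (\<Sum>a<n. \<Sum>b<n. f (a * n + b))" for f :: "nat \<Rightarrow> 'a :: comm_monoid_add"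
proof -
  have "(\<Sum>a<n. \<Sum>b<n. f (a * n + b)) = (\<Sum>(a, b)\<in>{..<n} \<times> {..<n}. f (a * n + b))"
    by (simp add: sum.cartesian_product)
  also have "\<dots> = (\<Sum>t<n * n. f t)"
  proof (rule sum.reindex_bij_witness[of _ "\<lambda>t. (t div n, t mod n)" "\<lambda>(a, b). a * n + b"])
    fix t assume "t \<in> {..<n * n}"
    then have "n > 0" "t < n * n" by (auto intro: gr0I)
    then show "(t div n, t mod n) \<in> {..<n} \<times> {..<n}" by (simp add: less_mult_imp_div_less)
  next
    fix p assume "p \<in> {..<n} \<times> {..<n}"
    then obtain a b where p: "p = (a, b)" "a < n" "b < n" by auto
    have "a * n + b < Suc a * n" using p by simp
    also have "\<dots> \<le> n * n" using p by (intro mult_right_mono) auto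
    finally show "(case p of (a, b) \<Rightarrow> a * n + b) \<in> {..<n * n}" using p by simp
  qed auto
  finally show ?thesis by simp
qed

section \<open>Approximating the spectral norm\<close>

text \<open>Address of the diagonal entry in row \<open>t\<close> when the rows are stored one after
  another.\<close>

abbreviation diag_ix :: aexp where
  "diag_ix \<equiv> Mul (V 7) (Add (V 2) (Const 1))"

definition ident_prog :: com where
  "ident_prog = Vec 12 7 (Mul (V 2) (V 2)) (V 7) (Const 0) ;; Vec 12 7 (V 2) diag_ix (Const 1)"

text \<open>The sign \<open>2 c - 1\<close> runs through \<open>-1, 1\<close> as \<open>c\<close> (array \<open>23\<close>) runs through \<open>0, 1\<close>.\<close>

definition spec_mat :: com where
  "spec_mat =
     Vec 13 7 (Mul (V 2) (V 2)) (V 7) (Mul (Mul (Sub (Mul (Const 2) (V 23)) (Const 1)) (V 10)) (Get 6 (V 7))) ;;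
     Vec 13 7 (V 2) diag_ix (Add (Get 13 diag_ix) (V 21))"

text \<open>With the unit vectors as \<open>U\<close>, the rows of array 14 are coefficient vectors
  for the tested form, so the one at which positivity fails can be copied directly as a
  direction.\<close>

definition spec_one :: com where
  "spec_one =
     spec_mat ;; gs_prog 12 13 ;;
     Cond (Less (Const 0) (Get 15 (V 16))) Skip
       (Set 22 (Const 0) ;; Row 24 (Const 0) 7 (Ix 14 (Sub (V 16) (Const 1)) 7))"

definition spec_test :: com where
  "spec_test = Set 22 (Const 1) ;; For 23 (Const 2) spec_one"

definition spec_prog :: com where
  "spec_prog =
     ident_prog ;;
     Row 24 (Const 0) 7 (Const 0) ;; Store 24 (Const 0) (Const 1) ;;
     Sum 20 7 (Mul (V 2) (V 2)) (Mul (Get 6 (V 7)) (Get 6 (V 7))) ;;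
     Set 20 (Add (Mul (V 10) (V 20)) (Const 1)) ;;
     Set 19 (Const 0) ;;
     bisect_prog spec_test"

lemma mods_spec [simp]:
  "mods ident_prog = {7, 12}" "mods spec_mat = {7, 13}"
  "mods spec_one = {7, 13, 14, 15, 16, 17, 18, 22, 24}"
  "mods spec_test = {7, 13, 14, 15, 16, 17, 18, 22, 23, 24}"
  "mods spec_prog = {7, 12, 13, 14, 15, 16, 17, 18, 19, 20, 21, 22, 23, 24}"
  by (auto simp: ident_prog_def spec_mat_def spec_one_def spec_test_def spec_prog_def)

lemma wp_diag:
  assumes X: "X \<notin> {2, 7}" and n: "s 2 0 = int n" "n \<le> B"
    and f: "\<And>t s'. t < n \<Longrightarrow> s' 7 0 = int t \<Longrightarrow> (\<And>y. y \<notin> {X, 7} \<Longrightarrow> s' y = s y) \<Longrightarrow>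
      s' X (int t * (int n + 1)) = mt n (s X) t t \<Longrightarrow> aok \<epsilon> B f s' \<and> aval \<epsilon> f s' = h t"
    and bound: "\<And>t. t < n \<Longrightarrow> \<bar>h t\<bar> \<le> 2 ^ B"
    and fin: "\<And>s'. (\<And>a b. a < n \<Longrightarrow> b < n \<Longrightarrow> mt n (s' X) a b = (if a = b then h a else mt n (s X) a b)) \<Longrightarrow>
      (\<And>y. y \<notin> {X, 7} \<Longrightarrow> s' y = s y) \<Longrightarrow> Q s'"
  shows "wp \<epsilon> B (Vec X 7 (V 2) diag_ix f) Q s"
proof (rule wp_Vec[where len = n and g = "\<lambda>t. int t * (int n + 1)" and h = h])
  show "inj_on (\<lambda>t. int t * (int n + 1)) {..<n}" by (simp add: inj_on_def)
  fix t s'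
  assume t: "t < n" "s' 7 0 = int t" and fr: "\<And>y. y \<notin> {X, 7} \<Longrightarrow> s' y = s y"
    and old: "\<And>i. i \<notin> (\<lambda>t. int t * (int n + 1)) ` {..<t} \<Longrightarrow> s' X i = s X i"
  have "int t * (int n + 1) \<notin> (\<lambda>t. int t * (int n + 1)) ` {..<t}" by auto
  then have "s' X (int t * (int n + 1)) = mt n (s X) t t"
    using old[of "int t * (int n + 1)"] t by (simp add: mt_def algebra_simps)
  then show "aok \<epsilon> B diag_ix s' \<and> aok \<epsilon> B f s' \<and> aval \<epsilon> diag_ix s' = int t * (int n + 1) \<and> aval \<epsilon> f s' = h t"
    using f[OF t fr] fr[of 2] t n X by simp
next
  fix s' assume new: "\<And>t. t < n \<Longrightarrow> s' X (int t * (int n + 1)) = h t"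
    and old: "\<And>i. i \<notin> (\<lambda>t. int t * (int n + 1)) ` {..<n} \<Longrightarrow> s' X i = s X i"
    and fr: "\<And>y. y \<notin> {X, 7} \<Longrightarrow> s' y = s y"
  show "Q s'"
  proof (rule fin[OF _ fr])
    fix a b assume ab: "a < n" "b < n"
    show "mt n (s' X) a b = (if a = b then h a else mt n (s X) a b)"
    proof (cases "a = b")
      case True
      then show ?thesis using new[OF ab(1)] ab by (simp add: mt_def algebra_simps)
    next
      case False
      have "int a * int n + int b \<notin> (\<lambda>t. int t * (int n + 1)) ` {..<n}"
      proof
        assume "int a * int n + int b \<in> (\<lambda>t. int t * (int n + 1)) ` {..<n}"
        then obtain t where "t < n" "int a * int n + int b = int t * int n + int t" by (auto simp: algebra_simps)
        from row_index_inject[OF ab(2) this] False show False by simp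
      qed
      then show ?thesis using old ab False by (simp add: mt_def)
    qed
  qed auto
qed (use X n bound in auto)

lemma square_index: "a < n \<Longrightarrow> b < n \<Longrightarrow> a * n + b < n * n" for a b n :: nat
proof -
  assume ab: "a < n" "b < n"
  have "a * n + b < Suc a * n" using ab by simp
  also have "\<dots> \<le> n * n" using ab by (intro mult_right_mono) auto
  finally show ?thesis .
qed

lemma wp_fill:
  assumes X: "X \<notin> {2, 7}" and n: "s 2 0 = int n" "n * n \<le> B"
    and f: "\<And>t s'. t < n * n \<Longrightarrow> s' 7 0 = int t \<Longrightarrow> (\<And>y. y \<notin> {X, 7} \<Longrightarrow> s' y = s y) \<Longrightarrow>
      aok \<epsilon> B f s' \<and> aval \<epsilon> f s' = h t"
    and bound: "\<And>t. t < n * n \<Longrightarrow> \<bar>h t\<bar> \<le> 2 ^ B"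
    and fin: "\<And>s'. (\<And>a b. a < n \<Longrightarrow> b < n \<Longrightarrow> mt n (s' X) a b = h (a * n + b)) \<Longrightarrow>
      (\<And>y. y \<notin> {X, 7} \<Longrightarrow> s' y = s y) \<Longrightarrow> Q s'"
  shows "wp \<epsilon> B (Vec X 7 (Mul (V 2) (V 2)) (V 7) f) Q s"
proof (rule wp_Vec[where len = "n * n" and g = int and h = h])
  fix s' assume new: "\<And>t. t < n * n \<Longrightarrow> s' X (int t) = h t" and fr: "\<And>y. y \<notin> {X, 7} \<Longrightarrow> s' y = s y"
  show "Q s'"
  proof (rule fin[OF _ fr])
    fix a b assume ab: "a < n" "b < n"
    then show "mt n (s' X) a b = h (a * n + b)"
      using new[OF square_index[OF ab]] by (simp add: mt_def)
  qed auto
next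
  fix t s' assume "t < n * n" "s' 7 0 = int t" "\<And>y. y \<notin> {X, 7} \<Longrightarrow> s' y = s y"
  then show "aok \<epsilon> B (V 7) s' \<and> aok \<epsilon> B f s' \<and> aval \<epsilon> (V 7) s' = int t \<and> aval \<epsilon> f s' = h t"
    using f by simp
qed (use X n bound in auto)

lemma wp_ident_prog:
  assumes n: "s 2 0 = int n" "n * n \<le> B"
    and fin: "\<And>s'. (\<And>a b. a < n \<Longrightarrow> b < n \<Longrightarrow> mt n (s' 12) a b = of_bool (a = b)) \<Longrightarrow>
      (\<And>y. y \<notin> {12, 7} \<Longrightarrow> s' y = s y) \<Longrightarrow> Q s'"
  shows "wp \<epsilon> B ident_prog Q s"
proof -
  have nB: "n \<le> B" using n(2) le_square le_trans by blast
  show ?thesis unfolding ident_prog_def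
  proof (subst wp.simps, rule wp_fill[where n = n and h = "\<lambda>_. 0"])
    fix s1 assume 1: "\<And>a b. a < n \<Longrightarrow> b < n \<Longrightarrow> mt n (s1 12) a b = 0" and fr1: "\<And>y. y \<notin> {12, 7} \<Longrightarrow> s1 y = s y"
    show "wp \<epsilon> B (Vec 12 7 (V 2) diag_ix (Const 1)) Q s1"
    proof (rule wp_diag[where n = n and h = "\<lambda>_. 1"])
      fix s2
      assume "\<And>a b. a < n \<Longrightarrow> b < n \<Longrightarrow> mt n (s2 12) a b = (if a = b then 1 else mt n (s1 12) a b)"
        and "\<And>y. y \<notin> {12, 7} \<Longrightarrow> s2 y = s1 y"
      then show "Q s2" using 1 fr1 by (intro fin) auto
    qed (use fr1 n nB in auto)
  qed (use n in auto)
qed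

lemma wp_spec_mat:
  assumes n: "s 2 0 = int n" "n * n \<le> B" and c: "s 23 0 = c" "s 10 0 = N" "s 21 0 = m"
    and bound: "\<And>a b. a < n \<Longrightarrow> b < n \<Longrightarrow> \<bar>(if a = b then m else 0) + (2 * c - 1) * N * mt n (s 6) a b\<bar> \<le> 2 ^ B"
      "\<And>a b. a < n \<Longrightarrow> b < n \<Longrightarrow> \<bar>(2 * c - 1) * N * mt n (s 6) a b\<bar> \<le> 2 ^ B"
    and fin: "\<And>s'. (\<And>a b. a < n \<Longrightarrow> b < n \<Longrightarrow>
        mt n (s' 13) a b = (if a = b then m else 0) + (2 * c - 1) * N * mt n (s 6) a b) \<Longrightarrow>
      (\<And>y. y \<notin> {13, 7} \<Longrightarrow> s' y = s y) \<Longrightarrow> Q s'"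
  shows "wp \<epsilon> B spec_mat Q s"
proof -
  have nB: "n \<le> B" using n(2) le_square le_trans by blast
  have ix: "s 6 (int t) = mt n (s 6) (t div n) (t mod n)" "t div n < n" "t mod n < n" if "t < n * n" for t
  proof -
    have "n > 0" using that by (auto intro: gr0I)
    then show "t div n < n" "t mod n < n" using that by (auto simp: less_mult_imp_div_less)
    then show "s 6 (int t) = mt n (s 6) (t div n) (t mod n)"
      by (simp add: mt_def flip: of_nat_mult of_nat_add)
  qed
  show ?thesis unfolding spec_mat_def
  proof (subst wp.simps, rule wp_fill[where n = n and h = "\<lambda>t. (2 * c - 1) * N * s 6 (int t)"])
    fix s1 assume 1: "\<And>a b. a < n \<Longrightarrow> b < n \<Longrightarrow> mt n (s1 13) a b = (2 * c - 1) * N * s 6 (int (a * n + b))"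
      and fr1: "\<And>y. y \<notin> {13, 7} \<Longrightarrow> s1 y = s y"
    have 1: "mt n (s1 13) a b = (2 * c - 1) * N * mt n (s 6) a b" if "a < n" "b < n" for a b
      using 1[OF that] that by (simp add: mt_def)
    show "wp \<epsilon> B (Vec 13 7 (V 2) diag_ix (Add (Get 13 diag_ix) (V 21))) Q s1"
    proof (rule wp_diag[where n = n and h = "\<lambda>t. mt n (s1 13) t t + m"])
      fix s2
      assume "\<And>a b. a < n \<Longrightarrow> b < n \<Longrightarrow> mt n (s2 13) a b = (if a = b then mt n (s1 13) a a + m else mt n (s1 13) a b)"
        and "\<And>y. y \<notin> {13, 7} \<Longrightarrow> s2 y = s1 y"
      then show "Q s2" using 1 fr1 by (intro fin) auto
    next
      fix t assume "t < n"
      then show "\<bar>mt n (s1 13) t t + m\<bar> \<le> 2 ^ B" using 1[of t t] bound(1)[of t t] by (simp add: add.commute)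
    qed (use fr1 n nB c in auto)
  next
    fix t assume "t < n * n"
    then show "\<bar>(2 * c - 1) * N * s 6 (int t)\<bar> \<le> 2 ^ B" using ix[of t] bound(2) by simp
  qed (use n c in auto)
qed

lemma wp_spec_one:
  fixes H :: "nat \<Rightarrow> nat \<Rightarrow> int"
  assumes n: "s 2 0 = int n" "n * n \<le> B" and c: "s 23 0 = c" "s 10 0 = N" "s 21 0 = m"
    and U: "\<And>a b. a < n \<Longrightarrow> b < n \<Longrightarrow> mt n (s 12) a b = of_bool (a = b)"
    and H: "H = mt n (s 6)" "\<And>a b. a < n \<Longrightarrow> b < n \<Longrightarrow> H a b = H b a"
    and bound: "\<And>a b. a < n \<Longrightarrow> b < n \<Longrightarrow> \<bar>(if a = b then m else 0) + (2 * c - 1) * N * H a b\<bar> \<le> 2 ^ h"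
      "\<And>a b. a < n \<Longrightarrow> b < n \<Longrightarrow> \<bar>(2 * c - 1) * N * H a b\<bar> \<le> 2 ^ h"
      "n + (h + gbits n h) \<le> B"
  shows "wp \<epsilon> B spec_one (\<lambda>s'. s' 22 = s 22 \<and> s' 24 = s 24 \<and>
       (\<forall>x. 0 \<le> of_int m * dot n x x + of_int ((2 * c - 1) * N) * bform n H x x) \<or>
     s' 22 0 = 0 \<and> (\<exists>t<n. mt n (s' 24) 0 t \<noteq> 0) \<and> (\<forall>t<n. \<bar>mt n (s' 24) 0 t\<bar> \<le> 2 ^ gbits n h) \<and>
       of_int m * dot n (rv (mt n (s' 24) 0)) (rv (mt n (s' 24) 0)) +
         of_int ((2 * c - 1) * N) * bform n H (rv (mt n (s' 24) 0)) (rv (mt n (s' 24) 0)) \<le> 0) s"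
    (is "wp _ _ _ ?Q s")
proof -
  let ?S = "\<lambda>a b. (if a = b then m else 0) + (2 * c - 1) * N * H a b"
  have nB: "n \<le> B" using n(2) le_square le_trans by blast
  have big: "x \<le> 2 ^ B" if "x \<le> 2 ^ h" for x :: int using that by (rule le_pow2_mono) (use bound(3) in simp)
  show ?thesis unfolding spec_one_def
  proof (subst wp.simps, rule wp_spec_mat[where n = n and c = c and N = N and m = m])
    fix s1 assume S: "\<And>a b. a < n \<Longrightarrow> b < n \<Longrightarrow>
        mt n (s1 13) a b = (if a = b then m else 0) + (2 * c - 1) * N * mt n (s 6) a b"
      and fr1: "\<And>y. y \<notin> {13, 7} \<Longrightarrow> s1 y = s y"
    let ?U = "mt n (s 12)"
    define A where "A = gram n ?U (mt n (s1 13))"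
    \<comment> \<open>Pairing unit vectors with the stored rows yields the transpose; the symmetry
      of \<open>H\<close> makes it the matrix itself.\<close>
    have A: "A a b = ?S a b" if "a < n" "b < n" for a b
    proof -
      have "A a b = (\<Sum>t<n. if a = t then ?S b a else 0)"
        unfolding A_def gram_def dot_def using U S H that by (intro sum.cong refl) auto
      then show ?thesis using that H(2)[OF that] by (simp add: sum.delta)
    qed
    have sym: "A a b = A b a" if "a < n" "b < n" for a b using A that H(2)[OF that] by simp
    have form: "bform n A x x = of_int m * dot n x x + of_int ((2 * c - 1) * N) * bform n H x x" for x
      using bform_cong[of n A ?S x x, OF A] bform_shift[of n m "(2 * c - 1) * N" H x] by simp
    show "wp \<epsilon> B (gs_prog 12 13 ;; Cond (Less (Const 0) (Get 15 (V 16))) Skip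
       (Set 22 (Const 0) ;; Row 24 (Const 0) 7 (Ix 14 (Sub (V 16) (Const 1)) 7))) ?Q s1"
    proof (subst wp.simps, rule wp_frame[OF wp_gs_prog[where n = n and ?U0.0 = ?U and A = A and a = h]])
      fix s2 assume "\<exists>k\<le>n. s2 16 0 = int k \<and> (\<forall>i\<le>k. s2 15 (int i) = minor A i) \<and>
        (\<forall>i<k. mt n (s2 14) i = pu ?U A i i) \<and> (\<forall>i<k. minor A i > 0) \<and> (k = n \<or> minor A k \<le> 0)"
        and fr2: "\<And>y. y \<notin> mods (gs_prog 12 13) \<Longrightarrow> s2 y = s1 y"
      then obtain k where k: "k \<le> n" "s2 16 0 = int k" "s2 15 (int k) = minor A k"
        "\<And>i. i < k \<Longrightarrow> mt n (s2 14) i = pu ?U A i i" "\<And>i. i < k \<Longrightarrow> minor A i > 0" "k = n \<or> minor A k \<le> 0" by blast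
      show "wp \<epsilon> B (Cond (Less (Const 0) (Get 15 (V 16))) Skip
       (Set 22 (Const 0) ;; Row 24 (Const 0) 7 (Ix 14 (Sub (V 16) (Const 1)) 7))) ?Q s2"
      proof (cases "minor A k > 0")
        case True
        then have kn: "k = n" using k(6) by simp
        have "0 < minor A i" if "i \<le> n" for i using True k(5)[of i] that kn by (cases "i = n") auto
        then have "0 \<le> bform n A x x" for x using sym by (intro form_nonneg) auto
        then show ?thesis using True k(2,3) fr2 fr1 unfolding form by simp
      next
        case False
        \<comment> \<open>The empty minor is 1, so there is a predecessor \<open>j\<close> with a
          positive minor, and its orthogonalized vector has been computed.\<close>
        then have "k \<noteq> 0" by (intro notI) simp
        then obtain j where j: "k = Suc j" using not0_implies_Suc by blast
        let ?v = "pu ?U A j j"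
        have jn: "j < n" using j k(1) by simp
        have Dj: "0 < minor A j" using k(5) j by simp
        have v: "?v t = wc A j t" if "t < n" for t
        proof -
          have "?v t = (\<Sum>a<n. if a = t then wc A j a else 0)"
            unfolding pu_eq_wc[OF jn] using U that by (intro sum.cong refl) auto
          then show ?thesis using that by (simp add: sum.delta)
        qed
        have "bform n A (rv ?v) (rv ?v) = bform n A (rv (wc A j)) (rv (wc A j))"
          by (rule bform_cong) (simp_all add: v)
        also have "\<dots> = of_int (minor A j * minor A (Suc j))" by (rule form_gs[OF jn Dj])
        also have "\<dots> \<le> 0" using Dj False j by (simp add: mult_nonneg_nonpos flip: of_int_mult)
        finally have neg: "bform n A (rv ?v) (rv ?v) \<le> 0" .
        have nz: "?v j \<noteq> 0" using v[OF jn] Dj by (simp add: wc_def)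
        have vb: "\<bar>?v t\<bar> \<le> 2 ^ gbits n h" if "t < n" for t
        proof -
          have "\<bar>?U a b\<bar> \<le> 2 ^ h" if "a < n" "b < n" for a b using U[OF that] by simp
          moreover have "\<bar>mt n (s1 13) a b\<bar> \<le> 2 ^ h" if "a < n" "b < n" for a b
            using S[OF that] bound(1)[OF that] H by simp
          ultimately show ?thesis unfolding A_def using jn that by (intro gbits_bounds(2)) auto
        qed
        have W: "mt n (s2 14) j = ?v" using k(4) j by simp
        let ?s3 = "s2(22 := (s2 22)(0 := 0))"
        have "wp \<epsilon> B (Row 24 (Const 0) 7 (Ix 14 (Sub (V 16) (Const 1)) 7)) ?Q ?s3"
        proof (rule wp_Row[where n = n and k = 0 and h = ?v])
          fix t s' assume t: "t < n" "s' 7 0 = int t" "\<And>y. y \<notin> {24, 7} \<Longrightarrow> s' y = ?s3 y"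
          then show "aok \<epsilon> B (Ix 14 (Sub (V 16) (Const 1)) 7) s' \<and> aval \<epsilon> (Ix 14 (Sub (V 16) (Const 1)) 7) s' = ?v t"
            using mtD[OF W t(1)] k(2) j fr2[of 2] fr1[of 2] n by simp
        next
          fix t assume "t < n"
          from vb[OF this] show "\<bar>?v t\<bar> \<le> 2 ^ B" by (rule abs_le_pow2_mono) (use bound(3) in simp)
        next
          fix s4 assume 4: "mt n (s4 24) = (mt n (?s3 24))(0 := (\<lambda>t. if t < n then ?v t else 0))"
            and fr4: "\<And>y. y \<notin> {24, 7} \<Longrightarrow> s4 y = ?s3 y"
          have e: "dot n (rv (mt n (s4 24) 0)) (rv (mt n (s4 24) 0)) = dot n (rv ?v) (rv ?v)"
            "bform n H (rv (mt n (s4 24) 0)) (rv (mt n (s4 24) 0)) = bform n H (rv ?v) (rv ?v)"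
            by (rule dot_cong bform_cong; simp add: 4)+
          show "?Q s4" using nz jn vb neg[unfolded form] fr4[of 22] unfolding e by (auto simp: 4)
        qed (use n nB fr2 fr1 in auto)
        then show ?thesis using False k by simp
      qed
    qed (use n fr1 A_def sym U bound S H in auto)
  qed (use n c bound H big in auto)
qed

text \<open>Everything is scaled by \<open>N\<close>: the vector \<open>v\<close> attests that
  \<open>N\<close> times the spectral norm is at least \<open>l\<close>. The bit bound is part of it
  because \<open>v\<close> enters later computations.\<close>

definition spec_lower :: "nat \<Rightarrow> int \<Rightarrow> (nat \<Rightarrow> nat \<Rightarrow> int) \<Rightarrow> nat \<Rightarrow> int \<Rightarrow> (nat \<Rightarrow> int) \<Rightarrow> bool" where
  "spec_lower n N H g l v \<longleftrightarrow> (\<exists>t<n. v t \<noteq> 0) \<and> (\<forall>t<n. \<bar>v t\<bar> \<le> 2 ^ g) \<and>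
     of_int l * dot n (rv v) (rv v) \<le> \<bar>of_int N * bform n H (rv v) (rv v)\<bar>"

definition spec_upper :: "nat \<Rightarrow> int \<Rightarrow> (nat \<Rightarrow> nat \<Rightarrow> int) \<Rightarrow> int \<Rightarrow> bool" where
  "spec_upper n N H u \<longleftrightarrow> (\<forall>x. \<bar>of_int N * bform n H x x\<bar> \<le> of_int u * dot n x x)"

lemma le_abs_of_sign: "x = f \<or> x = - f \<Longrightarrow> d + x \<le> 0 \<Longrightarrow> d \<le> \<bar>f\<bar>" for d f x :: real
  by (auto simp: abs_if)

text \<open>Success for both signs makes \<open>m I + N H\<close> and \<open>m I - N H\<close>
  nonnegative, an upper bound; failure for either sign delivers a vector, a lower bound. A failure
  lowers the flag in array 22, and nothing raises it again.\<close>

lemma wp_spec_test: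
  fixes H :: "nat \<Rightarrow> nat \<Rightarrow> int"
  assumes n: "s 2 0 = int n" "n * n \<le> B" and c: "s 10 0 = N" "s 21 0 = m" "0 \<le> m" "m \<le> 2 ^ h"
    and U: "\<And>a b. a < n \<Longrightarrow> b < n \<Longrightarrow> mt n (s 12) a b = of_bool (a = b)"
    and H: "H = mt n (s 6)" "\<And>a b. a < n \<Longrightarrow> b < n \<Longrightarrow> H a b = H b a"
    and bound: "\<And>a b. a < n \<Longrightarrow> b < n \<Longrightarrow> \<bar>N * H a b\<bar> \<le> 2 ^ h" "n + (Suc h + gbits n (Suc h)) \<le> B"
    and lower: "spec_lower n N H (gbits n (Suc h)) l (mt n (s 24) 0)"
  shows "wp \<epsilon> B spec_test (\<lambda>s'.
     s' 22 0 = 1 \<and> spec_upper n N H m \<and> spec_lower n N H (gbits n (Suc h)) l (mt n (s' 24) 0) \<or>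
     s' 22 0 = 0 \<and> spec_lower n N H (gbits n (Suc h)) m (mt n (s' 24) 0)) s" (is "wp _ _ _ ?Q s")
proof -
  let ?g = "gbits n (Suc h)"
  let ?P = "\<lambda>c. \<forall>x. 0 \<le> of_int m * dot n x x + of_int ((2 * c - 1) * N) * bform n H x x"
  let ?I = "\<lambda>c s'. s' 22 0 = 1 \<and> (\<forall>c'<c. ?P (int c')) \<and> spec_lower n N H ?g l (mt n (s' 24) 0) \<or>
     s' 22 0 = 0 \<and> spec_lower n N H ?g m (mt n (s' 24) 0)"
  let ?s = "s(22 := (s 22)(0 := 1))"
  have B: "1 < B" using bound(2) by (simp add: gbits_def)
  have "wp \<epsilon> B (For 23 (Const 2) spec_one) ?Q ?s"
  proof (rule wp_For[where len = 2 and I = ?I])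
    fix c s1
    assume c': "c < 2" "s1 23 0 = int c" and I: "?I c s1"
      and fr: "\<And>x. x \<notin> insert 23 (mods spec_one) \<Longrightarrow> s1 x = ?s x"
    have sg: "2 * int c - 1 = 1 \<or> 2 * int c - 1 = - 1" using c'(1) by (auto simp: less_2_cases_iff)
    have b1: "\<bar>(2 * int c - 1) * N * H a b\<bar> \<le> 2 ^ h" if "a < n" "b < n" for a b
      using sg bound(1)[OF that] by (auto simp: mult.assoc)
    have b2: "\<bar>(if a = b then m else 0) + (2 * int c - 1) * N * H a b\<bar> \<le> 2 ^ Suc h" if "a < n" "b < n" for a b
      using b1[OF that] c by (intro abs_add_le_pow2) auto
    show "wp \<epsilon> B spec_one (\<lambda>s''. ?I (Suc c) (s''(23 := (s'' 23)(0 := int c + 1)))) s1"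
    proof (rule wp_mono[OF wp_spec_one[where n = n and c = "int c" and N = N and m = m and H = H and h = "Suc h"]])
      fix s2 :: mem
      let ?v = "mt n (s2 24) 0"
      assume post: "s2 22 = s1 22 \<and> s2 24 = s1 24 \<and> ?P (int c) \<or>
        s2 22 0 = 0 \<and> (\<exists>t<n. ?v t \<noteq> 0) \<and> (\<forall>t<n. \<bar>?v t\<bar> \<le> 2 ^ gbits n (Suc h)) \<and>
        of_int m * dot n (rv ?v) (rv ?v) + of_int ((2 * int c - 1) * N) * bform n H (rv ?v) (rv ?v) \<le> 0"
      then have "?I (Suc c) s2"
      proof (elim disjE conjE)
        assume "s2 22 = s1 22" "s2 24 = s1 24" "?P (int c)"
        then show ?thesis using I by (auto simp: less_Suc_eq)
      next
        assume *: "s2 22 0 = 0" "\<exists>t<n. ?v t \<noteq> 0" "\<forall>t<n. \<bar>?v t\<bar> \<le> 2 ^ gbits n (Suc h)"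
          "of_int m * dot n (rv ?v) (rv ?v) + of_int ((2 * int c - 1) * N) * bform n H (rv ?v) (rv ?v) \<le> 0"
        let ?f = "of_int N * bform n H (rv ?v) (rv ?v)"
        have "of_int ((2 * int c - 1) * N) * bform n H (rv ?v) (rv ?v) = ?f \<or>
          of_int ((2 * int c - 1) * N) * bform n H (rv ?v) (rv ?v) = - ?f"
          using sg by (elim disjE) simp_all
        then have "of_int m * dot n (rv ?v) (rv ?v) \<le> \<bar>?f\<bar>" using *(4) by (rule le_abs_of_sign)
        then show ?thesis using * by (simp add: spec_lower_def)
      qed
      then show "?I (Suc c) (s2(23 := (s2 23)(0 := int c + 1)))" by simp
    next
      show "\<And>a b. a < n \<Longrightarrow> b < n \<Longrightarrow> \<bar>(2 * int c - 1) * N * H a b\<bar> \<le> 2 ^ Suc h"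
        by (rule abs_le_pow2_mono[OF b1]) auto
      show "\<And>a b. a < n \<Longrightarrow> b < n \<Longrightarrow> \<bar>(if a = b then m else 0) + (2 * int c - 1) * N * H a b\<bar> \<le> 2 ^ Suc h"
        by (rule b2)
    qed (use fr n c' c U H bound in auto)
  next
    fix s1 :: mem assume I: "?I 2 s1"
    have "spec_upper n N H m" if "\<forall>c'<2. ?P (int c')"
      unfolding spec_upper_def
    proof
      fix x
      have "0 \<le> of_int m * dot n x x + of_int ((2 * int 0 - 1) * N) * bform n H x x"
        "0 \<le> of_int m * dot n x x + of_int ((2 * int 1 - 1) * N) * bform n H x x"
        using that[rule_format, of 0] that[rule_format, of 1] by simp_all
      then show "\<bar>of_int N * bform n H x x\<bar> \<le> of_int m * dot n x x" by (simp add: abs_le_iff)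
    qed
    then show "?Q s1" using I by auto
  qed (use B lower in auto)
  then show ?thesis by (simp add: spec_test_def)
qed

text \<open>The lower end starts at 0, where any nonzero vector will do, and the upper end just
  above \<open>N\<close> times the sum of squares. Ending with consecutive integers means an error
  of 1/N after division by \<open>N\<close>.\<close>

lemma wp_spec_prog:
  fixes H :: "nat \<Rightarrow> nat \<Rightarrow> int"
  assumes n: "s 2 0 = int n" "n * n \<le> B" "0 < n" and N: "s 10 0 = N" "1 \<le> N" "N \<le> 2 ^ k"
    and H: "H = mt n (s 6)" "\<And>a b. a < n \<Longrightarrow> b < n \<Longrightarrow> H a b = H b a"
    and bound: "\<And>a b. a < n \<Longrightarrow> b < n \<Longrightarrow> \<bar>H a b\<bar> \<le> 2 ^ e"
    and h: "h = Suc (k + (n * n + (e + e)))" "n + (Suc h + gbits n (Suc h)) \<le> B"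
  shows "wp \<epsilon> B spec_prog (\<lambda>s'. \<exists>l\<ge>0. spec_lower n N H (gbits n (Suc h)) l (mt n (s' 24) 0) \<and> spec_upper n N H (l + 1)) s"
    (is "wp _ _ _ ?Q s")
proof -
  let ?g = "gbits n (Suc h)" and ?F = "\<Sum>a<n. \<Sum>b<n. H a b * H a b"
  have nB: "n \<le> B" using n(2) le_square le_trans by blast
  have ix: "s 6 (int t) = H (t div n) (t mod n)" "t div n < n" "t mod n < n" if "t < n * n" for t
  proof -
    have "n > 0" using that by (auto intro: gr0I)
    then show "t div n < n" "t mod n < n" using that by (auto simp: less_mult_imp_div_less)
    then show "s 6 (int t) = H (t div n) (t mod n)"
      by (simp add: H(1) mt_def flip: of_nat_mult of_nat_add)
  qed
  have F: "(\<Sum>t<n * n. s 6 (int t) * s 6 (int t)) = ?F"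
    unfolding sum_square_index by (intro sum.cong refl) (auto simp: H(1) mt_def)
  have Fb: "(\<Sum>t<n * n. \<bar>s 6 (int t) * s 6 (int t)\<bar>) \<le> 2 ^ (n * n + (e + e))"
    by (intro abs_sum_le_pow2 abs_mult_le_pow2) (use ix bound in auto)
  then have Fb': "?F \<le> 2 ^ (n * n + (e + e))" unfolding F[symmetric] by simp
  have F0: "0 \<le> ?F" by (intro sum_nonneg) auto
  have "\<bar>N * ?F\<bar> \<le> 2 ^ (k + (n * n + (e + e)))" using N Fb' F0 by (intro abs_mult_le_pow2) auto
  have NF0: "0 \<le> N * ?F" using N F0 by simp
  have hi: "N * ?F + 1 \<le> 2 ^ h"
  proof -
    have "1 \<le> (2 :: int) ^ (k + (n * n + (e + e)))" by simp
    moreover have "N * ?F \<le> 2 ^ (k + (n * n + (e + e)))"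
      using \<open>\<bar>N * ?F\<bar> \<le> 2 ^ (k + (n * n + (e + e)))\<close> NF0 by (simp only: abs_of_nonneg)
    ultimately show ?thesis unfolding h(1) power_Suc by linarith
  qed
  have hB: "h \<le> B" using h(2) by simp
  have hiB: "x \<le> 2 ^ B" if "x \<le> 2 ^ h" for x :: int using that hB by (rule le_pow2_mono)
  have NH: "\<bar>N * H a b\<bar> \<le> 2 ^ h" if "a < n" "b < n" for a b
  proof -
    have "\<bar>N * H a b\<bar> \<le> 2 ^ (k + e)" using N bound[OF that] by (intro abs_mult_le_pow2) auto
    then show ?thesis by (rule abs_le_pow2_mono) (simp add: h(1))
  qed
  have upper0: "spec_upper n N H (N * ?F + 1)" unfolding spec_upper_def
  proof
    fix x
    have "\<bar>of_int N * bform n H x x\<bar> \<le> of_int N * (of_int ?F * dot n x x)"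
      using bform_le_sum_squares[of n H x] N by (simp add: abs_mult del: of_int_sum)
    moreover have "0 \<le> dot n x x" by (simp add: dot_def sum_nonneg)
    ultimately show "\<bar>of_int N * bform n H x x\<bar> \<le> of_int (N * ?F + 1) * dot n x x"
      by (simp add: distrib_right mult.assoc del: of_int_sum)
  qed
  show ?thesis unfolding spec_prog_def
  proof (subst wp.simps, rule wp_ident_prog[where n = n])
    fix s1 assume U1: "\<And>a b. a < n \<Longrightarrow> b < n \<Longrightarrow> mt n (s1 12) a b = of_bool (a = b)"
      and fr1: "\<And>y. y \<notin> {12, 7} \<Longrightarrow> s1 y = s y"
    show "wp \<epsilon> B (Row 24 (Const 0) 7 (Const 0) ;; Store 24 (Const 0) (Const 1) ;;
       Sum 20 7 (Mul (V 2) (V 2)) (Mul (Get 6 (V 7)) (Get 6 (V 7))) ;;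
       Set 20 (Add (Mul (V 10) (V 20)) (Const 1)) ;; Set 19 (Const 0) ;; bisect_prog spec_test) ?Q s1"
    proof (subst wp.simps, rule wp_Row[where n = n and k = 0 and h = "\<lambda>_. 0"])
      fix s2 assume Z: "mt n (s2 24) = (mt n (s1 24))(0 := (\<lambda>t. if t < n then 0 else 0))"
        and fr2: "\<And>y. y \<notin> {24, 7} \<Longrightarrow> s2 y = s1 y"
      let ?s3 = "s2(24 := (s2 24)(0 := 1))"
      have v: "mt n (?s3 24) 0 = (\<lambda>t. of_bool (t = 0))"
      proof
        fix t
        have "mt n (s2 24) 0 t = 0" using Z by simp
        then show "mt n (?s3 24) 0 t = of_bool (t = 0)" using n(3) by (auto simp: mt_def split: if_splits)
      qed
      have low0: "spec_lower n N H ?g 0 (\<lambda>t. of_bool (t = 0))"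
        using n(3) by (auto simp: spec_lower_def)
      have "wp \<epsilon> B (Sum 20 7 (Mul (V 2) (V 2)) (Mul (Get 6 (V 7)) (Get 6 (V 7))) ;;
       Set 20 (Add (Mul (V 10) (V 20)) (Const 1)) ;; Set 19 (Const 0) ;; bisect_prog spec_test) ?Q ?s3"
      proof (subst wp.simps, rule wp_Sum[where len = "n * n" and g = "\<lambda>t. s 6 (int t) * s 6 (int t)"])
        show "(\<Sum>t<n * n. \<bar>s 6 (int t) * s 6 (int t)\<bar>) \<le> 2 ^ B"
          using Fb by (rule le_pow2_mono) (use h in simp)
      next
        fix s4 assume "s4 20 0 = (\<Sum>t<n * n. s 6 (int t) * s 6 (int t))"
          and fr4: "\<And>y. y \<notin> {20, 7} \<Longrightarrow> s4 y = ?s3 y"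
        then have F4: "s4 20 0 = ?F" using F by simp
        let ?s5 = "s4(20 := (s4 20)(0 := N * ?F + 1), 19 := (s4 19)(0 := 0))"
        have s5: "?s5 y = s y" if "y \<notin> {7, 12, 19, 20, 24}" for y
          using fr4[of y] fr2[of y] fr1[of y] that by simp
        have "wp \<epsilon> B (bisect_prog spec_test) ?Q ?s5"
        proof (rule wp_bisect[where lo = 0 and hi = "N * ?F + 1" and h = h and
              I = "\<lambda>l s'. spec_lower n N H ?g l (mt n (s' 24) 0)" and H = "spec_upper n N H"])
          show "spec_lower n N H ?g 0 (mt n (?s5 24) 0)" using low0 v fr4[of 24] by simp
          fix l m s6
          assume low: "spec_lower n N H ?g l (mt n (s6 24) 0)" and m: "0 \<le> l" "l < m" "m < N * ?F + 1" "s6 21 0 = m"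
            and fr6: "\<And>x. x \<notin> {19, 20, 21} \<union> mods spec_test \<Longrightarrow> s6 x = ?s5 x"
          have s6: "s6 y = s y" if "y \<notin> {7, 12, 13, 14, 15, 16, 17, 18, 19, 20, 21, 22, 23, 24}" for y
            using fr6[of y] s5[of y] that by simp
          have "s6 12 = s1 12" using fr6[of 12] fr4[of 12] fr2[of 12] by simp
          then show "wp \<epsilon> B spec_test (\<lambda>s''. s'' 22 0 = 1 \<and> spec_upper n N H m \<and> spec_lower n N H ?g l (mt n (s'' 24) 0) \<or>
            s'' 22 0 = 0 \<and> spec_lower n N H ?g m (mt n (s'' 24) 0)) s6"
            by (intro wp_spec_test) (use s6 n N m hi U1 H NH h low in auto)
        next
          fix l and s' :: mem assume "spec_lower n N H ?g l (mt n (s' 24) 0)" "spec_upper n N H (l + 1)" "0 \<le> l"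
          then show "?Q s'" by blast
        qed (use hi hB upper0 NF0 in auto)
        then show "wp \<epsilon> B (Set 20 (Add (Mul (V 10) (V 20)) (Const 1)) ;; Set 19 (Const 0) ;; bisect_prog spec_test) ?Q s4"
          using F4 fr4[of 10] fr2[of 10] fr1[of 10] N(1) hiB[OF hi] NF0 by simp
      next
        fix t s' assume "t < n * n" "s' 7 0 = int t" "\<And>y. y \<notin> {20, 7} \<Longrightarrow> s' y = ?s3 y"
        then show "aok \<epsilon> B (Mul (Get 6 (V 7)) (Get 6 (V 7))) s' \<and>
          aval \<epsilon> (Mul (Get 6 (V 7)) (Get 6 (V 7))) s' = s 6 (int t) * s 6 (int t)"
          using fr2[of 6] fr1[of 6] by simp
      qed (use fr1 fr2 n in auto)
      then show "wp \<epsilon> B (Store 24 (Const 0) (Const 1) ;;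
       Sum 20 7 (Mul (V 2) (V 2)) (Mul (Get 6 (V 7)) (Get 6 (V 7))) ;;
       Set 20 (Add (Mul (V 10) (V 20)) (Const 1)) ;; Set 19 (Const 0) ;; bisect_prog spec_test) ?Q s2"
        by simp
    qed (use fr1 n nB in auto)
  qed (use n in auto)
qed

section \<open>Candidate solutions\<close>

definition isqrt_test :: com where
  "isqrt_test = Cond (Less (V 40) (Mul (V 21) (V 21))) (Set 22 (Const 1)) (Set 22 (Const 0))"

lemma mods_isqrt_test [simp]: "mods isqrt_test = {22}"
  by (simp add: isqrt_test_def)

text \<open>The root is rounded up even if \<open>m\<close> is a square, so that \<open>r\<close> can serve as a denominator.\<close>

definition isqrt :: "int \<Rightarrow> int \<Rightarrow> bool" where
  "isqrt m r \<longleftrightarrow> 0 < r \<and> (r - 1) * (r - 1) \<le> m \<and> m < r * r"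

lemma wp_isqrt:
  assumes s: "s 40 0 = m" "0 \<le> m" "m + 1 \<le> 2 ^ h" "h \<le> B" "s 19 0 = 0" "s 20 0 = m + 1"
  shows "wp \<epsilon> B (bisect_prog isqrt_test) (\<lambda>s'. isqrt m (s' 20 0) \<and> s' 20 0 \<le> 2 ^ h) s"
proof (rule wp_bisect[where lo = 0 and hi = "m + 1" and h = h and I = "\<lambda>l s'. l * l \<le> m" and H = "\<lambda>u. m < u * u"])
  show "m < (m + 1) * (m + 1)" using s(2) by (simp add: algebra_simps) (smt (verit) zero_le_mult_iff)
  fix l u s'
  assume "l * l \<le> m" "0 \<le> l" "l < u" "s' 21 0 = u"
    and fr: "\<And>x. x \<notin> {19, 20, 21} \<union> mods isqrt_test \<Longrightarrow> s' x = s x"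
  then show "wp \<epsilon> B isqrt_test (\<lambda>s''. s'' 22 0 = 1 \<and> m < u * u \<and> l * l \<le> m \<or> s'' 22 0 = 0 \<and> u * u \<le> m) s'"
    using s by (simp add: isqrt_test_def)
next
  fix l s' assume "l * l \<le> m" "m < (l + 1) * (l + 1)" "0 \<le> l" "l < m + 1" "s' 20 0 = l + 1"
  then show "isqrt m (s' 20 0) \<and> s' 20 0 \<le> 2 ^ h" using s(3) by (simp add: isqrt_def)
qed (use s in auto)

text \<open>The numbers 0 to 5 in array 38 encode a direction, \<open>i div 3\<close>, and a sign,
  \<open>i mod 3 - 1\<close>.\<close>

definition urow :: aexp where
  "urow = Div (V 38) (Const 3)"

text \<open>In lattice coordinates, which are scaled by D, the target is sign * D (N - E) u / r - D
  c, kept as an integer vector over the denominator r. As r exceeds N |u|, the center sign * (N - E)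
  u / r has length at most 1 - E/N, which leaves E/N for the rounding.\<close>

definition target_prog :: com where
  "target_prog =
     Set 39 (Sub (Sub (V 38) (Mul (Const 3) urow)) (Const 1)) ;;
     Sum 40 7 (V 2) (Mul (Ix 24 urow 7) (Ix 24 urow 7)) ;;
     Set 40 (Mul (Mul (V 10) (V 10)) (V 40)) ;;
     Set 19 (Const 0) ;; Set 20 (Add (V 40) (Const 1)) ;;
     bisect_prog isqrt_test ;;
     Row 26 (Const 0) 7 (Sub (Mul (Mul (Mul (V 39) (V 4)) (Sub (V 10) (V 11))) (Ix 24 urow 7))
                             (Mul (V 20) (Ix 6 (Add (V 2) (Const 1)) 7))) ;;
     Set 27 (V 20) ;; Set 29 (V 2)"

lemma mods_target_prog [simp]: "mods target_prog = {7, 19, 20, 21, 22, 26, 27, 29, 39, 40}"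
  by (auto simp: target_prog_def)

definition sbits :: "nat \<Rightarrow> nat \<Rightarrow> nat \<Rightarrow> nat" where
  "sbits n k b = Suc (k + k + (n + (b + b)))"

lemma wp_target_prog:
  assumes n: "s 2 0 = int n" "n \<le> Bd" and i: "s 38 0 = int i" "i < 6"
    and N: "s 10 0 = N" "s 11 0 = E" "0 \<le> E" "E \<le> N" "N \<le> 2 ^ k" and D: "s 4 0 = D" "0 \<le> D" "D \<le> 2 ^ e"
    and u: "u = mt n (s 24) (i div 3)" "\<And>t. t < n \<Longrightarrow> \<bar>u t\<bar> \<le> 2 ^ b"
    and c: "cv = mt n (s 6) (Suc n)" "\<And>t. t < n \<Longrightarrow> \<bar>cv t\<bar> \<le> 2 ^ e"
    and bds: "sbits n k b + e + 1 \<le> Bd" "3 \<le> Bd"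
  shows "wp \<epsilon> Bd target_prog (\<lambda>s'. isqrt (N * N * dot n u u) (s' 20 0) \<and> s' 20 0 \<le> 2 ^ sbits n k b \<and>
    mt n (s' 26) 0 = (\<lambda>t. (int i mod 3 - 1) * D * (N - E) * u t - s' 20 0 * cv t) \<and>
    (\<forall>t<n. \<bar>mt n (s' 26) 0 t\<bar> \<le> 2 ^ (sbits n k b + e + 1)) \<and>
    s' 27 0 = s' 20 0 \<and> s' 29 0 = int n \<and> s' 39 0 = int i mod 3 - 1) s" (is "wp _ _ _ ?Q s")
proof -
  let ?sg = "int i mod 3 - 1" and ?sb = "sbits n k b" and ?M = "N * N * dot n u u"
  have sg: "int i - 3 * (int i div 3) - 1 = ?sg" by (simp add: minus_mult_div_eq_mod)
  have sga: "\<bar>?sg\<bar> \<le> 1" by (smt (verit) pos_mod_bound pos_mod_sign)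
  have ir: "int i div 3 = int (i div 3)" by simp
  have small: "\<bar>?sg\<bar> \<le> 2 ^ Bd" using sga by (smt (verit) one_le_power)
  have N0: "0 \<le> N" "\<bar>N\<bar> \<le> 2 ^ k" using N by auto
  have ub: "(\<Sum>t<n. \<bar>u t * u t\<bar>) \<le> 2 ^ (n + (b + b))"
    by (intro abs_sum_le_pow2 abs_mult_le_pow2 u) auto
  then have db: "\<bar>dot n u u\<bar> \<le> 2 ^ (n + (b + b))" unfolding dot_def by (rule order_trans[OF sum_abs])
  have d0: "0 \<le> dot n u u" by (simp add: dot_def sum_nonneg)
  have Mb: "\<bar>?M\<bar> \<le> 2 ^ (k + k + (n + (b + b)))" by (intro abs_mult_le_pow2 db N0)
  have M0: "0 \<le> ?M" using N0 d0 by simp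
  have "1 \<le> (2::int) ^ (k + k + (n + (b + b)))" by simp
  then have M1: "?M + 1 \<le> 2 ^ ?sb" using Mb M0 unfolding sbits_def power_Suc by linarith
  have big: "x \<le> 2 ^ Bd" if "x \<le> 2 ^ ?sb" for x :: int using that by (rule le_pow2_mono) (use bds in simp)
  have nB: "int n \<le> 2 ^ Bd" using n(2) of_nat_less_two_power[of Bd, where 'a = int] by linarith
  let ?s1 = "s(39 := (s 39)(0 := ?sg))"
  have "wp \<epsilon> Bd (Sum 40 7 (V 2) (Mul (Ix 24 urow 7) (Ix 24 urow 7)) ;;
     Set 40 (Mul (Mul (V 10) (V 10)) (V 40)) ;;
     Set 19 (Const 0) ;; Set 20 (Add (V 40) (Const 1)) ;;
     bisect_prog isqrt_test ;;
     Row 26 (Const 0) 7 (Sub (Mul (Mul (Mul (V 39) (V 4)) (Sub (V 10) (V 11))) (Ix 24 urow 7))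
                             (Mul (V 20) (Ix 6 (Add (V 2) (Const 1)) 7))) ;;
     Set 27 (V 20) ;; Set 29 (V 2)) ?Q ?s1"
  proof (subst wp.simps, rule wp_Sum[where len = n and g = "\<lambda>t. u t * u t"])
    fix t s' assume "t < n" "s' 7 0 = int t" "\<And>y. y \<notin> {40, 7} \<Longrightarrow> s' y = ?s1 y"
    then show "aok \<epsilon> Bd (Mul (Ix 24 urow 7) (Ix 24 urow 7)) s' \<and> aval \<epsilon> (Mul (Ix 24 urow 7) (Ix 24 urow 7)) s' = u t * u t"
      using n i u(1) by (simp add: urow_def ir mt_eq)
  next
    show "(\<Sum>t<n. \<bar>u t * u t\<bar>) \<le> 2 ^ Bd" using ub by (rule le_pow2_mono) (use bds in \<open>simp add: sbits_def\<close>)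
  next
    fix s2 assume "s2 40 0 = (\<Sum>t<n. u t * u t)" and fr2: "\<And>y. y \<notin> {40, 7} \<Longrightarrow> s2 y = ?s1 y"
    then have s2: "s2 40 0 = dot n u u" by (simp add: dot_def)
    let ?s3 = "s2(40 := (s2 40)(0 := ?M), 19 := (s2 19)(0 := 0), 20 := (s2 20)(0 := ?M + 1))"
    have "wp \<epsilon> Bd (bisect_prog isqrt_test ;;
     Row 26 (Const 0) 7 (Sub (Mul (Mul (Mul (V 39) (V 4)) (Sub (V 10) (V 11))) (Ix 24 urow 7))
                             (Mul (V 20) (Ix 6 (Add (V 2) (Const 1)) 7))) ;;
     Set 27 (V 20) ;; Set 29 (V 2)) ?Q ?s3"
    proof (subst wp.simps, rule wp_frame[OF wp_isqrt[where m = ?M and h = ?sb]])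
      fix s4 assume r: "isqrt ?M (s4 20 0) \<and> s4 20 0 \<le> 2 ^ ?sb"
        and fr4: "\<And>y. y \<notin> mods (bisect_prog isqrt_test) \<Longrightarrow> s4 y = ?s3 y"
      let ?r = "s4 20 0"
      have s4: "s4 y = s y" if "y \<notin> {7, 19, 20, 21, 22, 39, 40}" for y using fr4[of y] fr2[of y] that by simp
      have s4': "s4 39 0 = ?sg" using fr4[of 39] fr2[of 39] by simp
      let ?h = "\<lambda>t. ?sg * D * (N - E) * u t - ?r * cv t"
      have hb: "\<bar>?h t\<bar> \<le> 2 ^ (?sb + e + 1)" if t: "t < n" for t
      proof -
        have "\<bar>?sg\<bar> \<le> 2 ^ 0" using sga by simp
        then have "\<bar>?sg * D * (N - E) * u t\<bar> \<le> 2 ^ (0 + e + k + b)"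
          using D N u(2)[OF t] by (intro abs_mult_le_pow2) auto
        then have 1: "\<bar>?sg * D * (N - E) * u t\<bar> \<le> 2 ^ (?sb + e)"
          by (rule abs_le_pow2_mono) (simp add: sbits_def)
        have "\<bar>?r * cv t\<bar> \<le> 2 ^ (?sb + e)" using r c(2)[OF t] by (intro abs_mult_le_pow2) (auto simp: isqrt_def)
        then have 2: "\<bar>- (?r * cv t)\<bar> \<le> 2 ^ (?sb + e)" by simp
        show ?thesis using abs_add_le_pow2[OF 1 2] by simp
      qed
      show "wp \<epsilon> Bd (Row 26 (Const 0) 7 (Sub (Mul (Mul (Mul (V 39) (V 4)) (Sub (V 10) (V 11))) (Ix 24 urow 7))
                             (Mul (V 20) (Ix 6 (Add (V 2) (Const 1)) 7))) ;;
        Set 27 (V 20) ;; Set 29 (V 2)) ?Q s4"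
      proof (subst wp.simps, rule wp_Row[where n = n and k = 0 and h = ?h])
        fix t s' assume t: "t < n" "s' 7 0 = int t" and fr: "\<And>y. y \<notin> {26, 7} \<Longrightarrow> s' y = s4 y"
        have "s 24 (int (i div 3) * int n + int t) = u t" "s 6 (int (Suc n) * int n + int t) = cv t"
          using t(1) u(1) c(1) by (simp_all add: mt_def)
        then show "aok \<epsilon> Bd (Sub (Mul (Mul (Mul (V 39) (V 4)) (Sub (V 10) (V 11))) (Ix 24 urow 7))
                             (Mul (V 20) (Ix 6 (Add (V 2) (Const 1)) 7))) s' \<and>
          aval \<epsilon> (Sub (Mul (Mul (Mul (V 39) (V 4)) (Sub (V 10) (V 11))) (Ix 24 urow 7))
                             (Mul (V 20) (Ix 6 (Add (V 2) (Const 1)) 7))) s' = ?h t"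
          using fr s4 s4' n i N D t by (simp add: urow_def ir add.commute)
      next
        fix t assume "t < n"
        from hb[OF this] show "\<bar>?h t\<bar> \<le> 2 ^ Bd" by (rule abs_le_pow2_mono) (use bds in simp)
      next
        fix s5 assume R: "mt n (s5 26) = (mt n (s4 26))(0 := (\<lambda>t. if t < n then ?h t else 0))"
          and fr5: "\<And>y. y \<notin> {26, 7} \<Longrightarrow> s5 y = s4 y"
        have e: "(\<lambda>t. if t < n then ?h t else 0) = ?h" by (auto simp: u(1) c(1) mt_def)
        have "\<bar>?r\<bar> \<le> 2 ^ Bd" using r big by (auto simp: isqrt_def)
        then show "wp \<epsilon> Bd (Set 27 (V 20) ;; Set 29 (V 2)) ?Q s5"
          using R r hb fr5[of 20] fr5[of 2] fr5[of 39] s4 s4' n nB unfolding e by simp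
      qed (use s4 n in auto)
    qed (use s2 fr2 M0 M1 bds in auto)
    then show "wp \<epsilon> Bd (Set 40 (Mul (Mul (V 10) (V 10)) (V 40)) ;;
     Set 19 (Const 0) ;; Set 20 (Add (V 40) (Const 1)) ;;
     bisect_prog isqrt_test ;;
     Row 26 (Const 0) 7 (Sub (Mul (Mul (Mul (V 39) (V 4)) (Sub (V 10) (V 11))) (Ix 24 urow 7))
                             (Mul (V 20) (Ix 6 (Add (V 2) (Const 1)) 7))) ;;
     Set 27 (V 20) ;; Set 29 (V 2)) ?Q s2"
      using s2 fr2[of 10] N M0 M1 big[OF M1] by simp
  qed (use n in auto)
  then show ?thesis using i small sg by (simp add: target_prog_def urow_def)
qed

text \<open>Numerator over \<open>Q\<^sup>2\<close> of \<open>D\<close> times the objective at X/Q,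
  if \<open>H\<close> and \<open>hv\<close> hold the data multiplied by \<open>D\<close>.\<close>

definition fval :: "nat \<Rightarrow> (nat \<Rightarrow> nat \<Rightarrow> int) \<Rightarrow> (nat \<Rightarrow> int) \<Rightarrow> int \<Rightarrow> (nat \<Rightarrow> int) \<Rightarrow> int" where
  "fval n H hv Q X = (\<Sum>a<n. (dot n (H a) X + Q * hv a) * X a)"

text \<open>The length test compares squares by cross-multiplication. Array 47 is set as soon as one
  residual is too long and is not reset by later candidates; evaluation goes on regardless, which
  keeps the control flow uniform.\<close>

definition eval_prog :: com where
  "eval_prog =
     Sum 41 7 (V 2) (Mul (Ix 26 (Const 0) 7) (Ix 26 (Const 0) 7)) ;;
     Cond (Less (Mul (Mul (V 11) (V 11)) (Mul (Mul (V 27) (V 4)) (Mul (V 27) (V 4)))) (Mul (V 41) (Mul (V 10) (V 10))))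
       (Set 47 (Const 1)) Skip ;;
     Set 42 (Mul (Mul (V 20) (V 27)) (V 4)) ;;
     Row 43 (Const 0) 7 (Sub (Mul (Mul (Mul (V 39) (Sub (V 10) (V 11))) (Ix 24 urow 7)) (Mul (V 27) (V 4)))
                             (Mul (V 20) (Ix 26 (Const 0) 7))) ;;
     Set 45 (Const 0) ;;
     For 36 (V 2)
       (Sum 44 7 (V 2) (Mul (Ix 6 (V 36) 7) (Ix 43 (Const 0) 7)) ;;
        Set 45 (Add (V 45) (Mul (Add (V 44) (Mul (V 42) (Get 6 (Add (Mul (V 2) (V 2)) (V 36))))) (Get 43 (V 36)))))"

lemma mods_eval_prog [simp]: "mods eval_prog = {7, 36, 41, 42, 43, 44, 45, 47}"
  by (auto simp: eval_prog_def)

lemma wp_eval_prog: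
  fixes H :: "nat \<Rightarrow> nat \<Rightarrow> int"
  assumes n: "s 2 0 = int n" "n \<le> Bd" and i: "s 38 0 = int i" "s 39 0 = sg" "\<bar>sg\<bar> \<le> 1"
    and N: "s 10 0 = N" "s 11 0 = E" "0 \<le> E" "E \<le> N" "N \<le> 2 ^ k" and D: "s 4 0 = D" "0 < D" "D \<le> 2 ^ e"
    and u: "u = mt n (s 24) (i div 3)" "\<And>t. t < n \<Longrightarrow> \<bar>u t\<bar> \<le> 2 ^ b"
    and H: "H = mt n (s 6)" "\<And>a t. a \<le> n \<Longrightarrow> t < n \<Longrightarrow> \<bar>H a t\<bar> \<le> 2 ^ e"
    and R: "R = mt n (s 26) 0" "\<And>t. t < n \<Longrightarrow> \<bar>R t\<bar> \<le> 2 ^ l" and T: "s 27 0 = T" "0 < T" "T \<le> 2 ^ l"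
    and r: "s 20 0 = r" "0 < r" "r \<le> 2 ^ g"
    and x: "x = Suc (k + b + l + e + g)" and bds: "2 * n + e + 2 * x + 1 \<le> Bd"
  defines "Q \<equiv> r * T * D" and "X \<equiv> (\<lambda>t. sg * (N - E) * u t * (T * D) - r * R t)"
  shows "wp \<epsilon> Bd eval_prog (\<lambda>s'. s' 47 0 = (if E * E * (T * D * (T * D)) < dot n R R * (N * N) then 1 else s 47 0) \<and>
    s' 42 0 = Q \<and> mt n (s' 43) 0 = X \<and> s' 45 0 = fval n H (H n) Q X \<and>
    (\<forall>t<n. \<bar>X t\<bar> \<le> 2 ^ x) \<and> \<bar>Q\<bar> \<le> 2 ^ x \<and> \<bar>fval n H (H n) Q X\<bar> \<le> 2 ^ (2 * n + e + 2 * x + 1)) s" (is "wp _ _ _ ?P s")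
proof -
  have X0: "(\<lambda>t. if t < n then X t else 0) = X" by (auto simp: X_def u R mt_def)
  have sgb: "\<bar>sg\<bar> \<le> 2 ^ 0" using i by simp
  have NE: "\<bar>N - E\<bar> \<le> 2 ^ k" "\<bar>D\<bar> \<le> 2 ^ e" "\<bar>T\<bar> \<le> 2 ^ l" "\<bar>r\<bar> \<le> 2 ^ g" using N D T r by auto
  have Xb: "\<bar>X t\<bar> \<le> 2 ^ x" if t: "t < n" for t
  proof -
    have "\<bar>sg * (N - E) * u t * (T * D)\<bar> \<le> 2 ^ (0 + k + b + (l + e))"
      by (intro abs_mult_le_pow2 sgb NE u t)
    then have 1: "\<bar>sg * (N - E) * u t * (T * D)\<bar> \<le> 2 ^ (k + b + l + e + g)" by (rule abs_le_pow2_mono) simp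
    have "\<bar>r * R t\<bar> \<le> 2 ^ (g + l)" by (intro abs_mult_le_pow2 NE R t)
    then have "\<bar>r * R t\<bar> \<le> 2 ^ (k + b + l + e + g)" by (rule abs_le_pow2_mono) simp
    then have 2: "\<bar>- (r * R t)\<bar> \<le> 2 ^ (k + b + l + e + g)" by simp
    show ?thesis using abs_add_le_pow2[OF 1 2] by (simp add: X_def x)
  qed
  have "\<bar>Q\<bar> \<le> 2 ^ (g + l + e)" unfolding Q_def by (intro abs_mult_le_pow2 NE)
  then have Qb: "\<bar>Q\<bar> \<le> 2 ^ x" by (rule abs_le_pow2_mono) (simp add: x)
  let ?y = "\<lambda>a. (dot n (H a) X + Q * H n a) * X a"
  have hb: "(\<Sum>t<n. \<bar>H a t * X t\<bar>) \<le> 2 ^ (n + (e + x))" if "a < n" for a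
    by (intro abs_sum_le_pow2 abs_mult_le_pow2 H Xb) (use that in auto)
  have yb: "\<bar>?y a\<bar> \<le> 2 ^ (Suc (n + (e + x)) + x)" if a: "a < n" for a
  proof -
    have 1: "\<bar>dot n (H a) X\<bar> \<le> 2 ^ (n + (e + x))"
      unfolding dot_def using hb[OF a] by (rule order_trans[OF sum_abs])
    have "\<bar>Q * H n a\<bar> \<le> 2 ^ (x + e)" by (intro abs_mult_le_pow2 Qb H) (use a in auto)
    then have 2: "\<bar>Q * H n a\<bar> \<le> 2 ^ (n + (e + x))" by (rule abs_le_pow2_mono) simp
    show ?thesis by (intro abs_mult_le_pow2 abs_add_le_pow2 1 2 Xb a)
  qed
  have Fb: "\<bar>\<Sum>a<j. ?y a\<bar> \<le> 2 ^ (2 * n + e + 2 * x + 1)" if "j \<le> n" for j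
  proof -
    have "\<bar>\<Sum>a<j. ?y a\<bar> \<le> (\<Sum>a<j. \<bar>?y a\<bar>)" by (rule sum_abs)
    also have "\<dots> \<le> 2 ^ (n + (Suc (n + (e + x)) + x))" by (intro abs_sum_le_pow2 yb) (use that in auto)
    also have "n + (Suc (n + (e + x)) + x) = 2 * n + e + 2 * x + 1" by simp
    finally show ?thesis .
  qed
  let ?body = "Sum 44 7 (V 2) (Mul (Ix 6 (V 36) 7) (Ix 43 (Const 0) 7)) ;;
        Set 45 (Add (V 45) (Mul (Add (V 44) (Mul (V 42) (Get 6 (Add (Mul (V 2) (V 2)) (V 36))))) (Get 43 (V 36))))"
  let ?t47 = "if E * E * (T * D * (T * D)) < dot n R R * (N * N) then 1 else s 47 0"
  show ?thesis unfolding eval_prog_def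
  proof (subst wp.simps, rule wp_Sum[where len = n and g = "\<lambda>t. R t * R t"])
    fix t s' assume "t < n" "s' 7 0 = int t" "\<And>y. y \<notin> {41, 7} \<Longrightarrow> s' y = s y"
    then show "aok \<epsilon> Bd (Mul (Ix 26 (Const 0) 7) (Ix 26 (Const 0) 7)) s' \<and>
      aval \<epsilon> (Mul (Ix 26 (Const 0) 7) (Ix 26 (Const 0) 7)) s' = R t * R t"
      using R(1) by (simp add: mt_def)
  next
    have "(\<Sum>t<n. \<bar>R t * R t\<bar>) \<le> 2 ^ (n + (l + l))" by (intro abs_sum_le_pow2 abs_mult_le_pow2 R) auto
    then show "(\<Sum>t<n. \<bar>R t * R t\<bar>) \<le> 2 ^ Bd" by (rule le_pow2_mono) (use bds x in simp)
  next
    fix s1 assume "s1 41 0 = (\<Sum>t<n. R t * R t)" and fr1: "\<And>y. y \<notin> {41, 7} \<Longrightarrow> s1 y = s y"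
    then have s1: "s1 41 0 = dot n R R" by (simp add: dot_def)
    let ?c = "Cond (Less (Mul (Mul (V 11) (V 11)) (Mul (Mul (V 27) (V 4)) (Mul (V 27) (V 4)))) (Mul (V 41) (Mul (V 10) (V 10))))
       (Set 47 (Const 1)) Skip"
    have "wp \<epsilon> Bd ?c (\<lambda>s'. s' 47 0 = ?t47) s1" using s1 fr1 N D T by simp
    then show "wp \<epsilon> Bd (?c ;; Set 42 (Mul (Mul (V 20) (V 27)) (V 4)) ;;
     Row 43 (Const 0) 7 (Sub (Mul (Mul (Mul (V 39) (Sub (V 10) (V 11))) (Ix 24 urow 7)) (Mul (V 27) (V 4)))
                             (Mul (V 20) (Ix 26 (Const 0) 7))) ;;
     Set 45 (Const 0) ;; For 36 (V 2) ?body) ?P s1"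
    proof (subst wp.simps, rule wp_frame)
      fix s2 assume s47: "s2 47 0 = ?t47" and fr2: "\<And>y. y \<notin> mods ?c \<Longrightarrow> s2 y = s1 y"
      have s2: "s2 y = s y" if "y \<notin> {7, 41, 47}" for y using fr2[of y] fr1[of y] that by simp
      let ?s3 = "s2(42 := (s2 42)(0 := Q))"
      have "wp \<epsilon> Bd (Row 43 (Const 0) 7 (Sub (Mul (Mul (Mul (V 39) (Sub (V 10) (V 11))) (Ix 24 urow 7)) (Mul (V 27) (V 4)))
                             (Mul (V 20) (Ix 26 (Const 0) 7))) ;;
        Set 45 (Const 0) ;; For 36 (V 2) ?body) ?P ?s3"
      proof (subst wp.simps, rule wp_Row[where n = n and k = 0 and h = X])
        fix t s' assume t: "t < n" "s' 7 0 = int t" "\<And>y. y \<notin> {43, 7} \<Longrightarrow> s' y = ?s3 y"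
        have "s 24 (int (i div 3) * int n + int t) = u t" "s 26 (int t) = R t"
          using t(1) u(1) R(1) by (simp_all add: mt_def)
        then show "aok \<epsilon> Bd (Sub (Mul (Mul (Mul (V 39) (Sub (V 10) (V 11))) (Ix 24 urow 7)) (Mul (V 27) (V 4)))
                             (Mul (V 20) (Ix 26 (Const 0) 7))) s' \<and>
          aval \<epsilon> (Sub (Mul (Mul (Mul (V 39) (Sub (V 10) (V 11))) (Ix 24 urow 7)) (Mul (V 27) (V 4)))
                             (Mul (V 20) (Ix 26 (Const 0) 7))) s' = X t"
          using t s2 n i N D T r by (simp add: urow_def X_def zdiv_int)
      next
        fix t assume "t < n"
        from Xb[OF this] show "\<bar>X t\<bar> \<le> 2 ^ Bd" by (rule abs_le_pow2_mono) (use bds in simp)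
      next
        fix s4 assume "mt n (s4 43) = (mt n (?s3 43))(0 := (\<lambda>t. if t < n then X t else 0))"
          and fr4: "\<And>y. y \<notin> {43, 7} \<Longrightarrow> s4 y = ?s3 y"
        then have X4: "mt n (s4 43) 0 = X" by (simp add: X0)
        let ?s5 = "s4(45 := (s4 45)(0 := 0))"
        have "wp \<epsilon> Bd (For 36 (V 2) ?body) ?P ?s5"
        proof (rule wp_For[where len = n and I = "\<lambda>j s'. s' 45 0 = (\<Sum>a<j. ?y a)"])
          fix a s6 assume a: "a < n" "s6 36 0 = int a" and I: "s6 45 0 = (\<Sum>a<a. ?y a)"
            and fr6: "\<And>y. y \<notin> insert 36 (mods ?body) \<Longrightarrow> s6 y = ?s5 y"
          have s6: "s6 y = s y" if "y \<notin> {7, 36, 41, 42, 43, 44, 45, 47}" for y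
            using fr6[of y] fr4[of y] s2[of y] that by simp
          have s6': "s6 43 = s4 43" "s6 42 0 = Q" using fr6 fr4 by simp_all
          show "wp \<epsilon> Bd ?body (\<lambda>s''. (s''(36 := (s'' 36)(0 := int a + 1))) 45 0 = (\<Sum>a<Suc a. ?y a)) s6"
          proof (subst wp.simps, rule wp_Sum[where len = n and g = "\<lambda>t. H a t * X t"])
            fix t s' assume t: "t < n" "s' 7 0 = int t" "\<And>y. y \<notin> {44, 7} \<Longrightarrow> s' y = s6 y"
            have "s 6 (int a * int n + int t) = H a t" "s4 43 (int t) = X t"
              using t(1) H(1) X4[symmetric] by (simp_all add: mt_def)
            then show "aok \<epsilon> Bd (Mul (Ix 6 (V 36) 7) (Ix 43 (Const 0) 7)) s' \<and>
              aval \<epsilon> (Mul (Ix 6 (V 36) 7) (Ix 43 (Const 0) 7)) s' = H a t * X t"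
              using t s6 s6' a n by simp
          next
            show "(\<Sum>t<n. \<bar>H a t * X t\<bar>) \<le> 2 ^ Bd" using hb[OF a(1)] by (rule le_pow2_mono) (use bds in simp)
          next
            fix s7 assume s7: "s7 44 0 = (\<Sum>t<n. H a t * X t)" and fr7: "\<And>y. y \<notin> {44, 7} \<Longrightarrow> s7 y = s6 y"
            have "s 6 (int n * int n + int a) = H n a" "s4 43 (int a) = X a"
              using a(1) H(1) X4[symmetric] by (simp_all add: mt_def)
            then have "aval \<epsilon> (Add (V 45) (Mul (Add (V 44) (Mul (V 42) (Get 6 (Add (Mul (V 2) (V 2)) (V 36))))) (Get 43 (V 36)))) s7
              = (\<Sum>a<Suc a. ?y a)"
              using s7 fr7 s6 s6' a n I by (simp add: dot_def)
            moreover have "\<bar>\<Sum>a<Suc a. ?y a\<bar> \<le> 2 ^ Bd"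
              by (rule abs_le_pow2_mono[OF Fb]) (use a bds in auto)
            ultimately show "wp \<epsilon> Bd (Set 45 (Add (V 45) (Mul (Add (V 44) (Mul (V 42) (Get 6 (Add (Mul (V 2) (V 2)) (V 36))))) (Get 43 (V 36)))))
              (\<lambda>s''. (s''(36 := (s'' 36)(0 := int a + 1))) 45 0 = (\<Sum>a<Suc a. ?y a)) s7"
              by (simp del: sum.lessThan_Suc aval.simps(4))
          qed (use s6 n in auto)
        next
          fix s6 assume I: "s6 45 0 = (\<Sum>a<n. ?y a)"
            and fr6: "\<And>y. y \<notin> insert 36 (mods ?body) \<Longrightarrow> s6 y = ?s5 y"
          have "s6 47 0 = ?t47" "s6 42 0 = Q" "mt n (s6 43) 0 = X"
            using fr6[of 47] fr6[of 42] fr6[of 43] fr4[of 47] fr4[of 42] s47 X4 by simp_all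
          then show "?P s6" using I Fb[of n] Xb Qb by (simp add: fval_def)
        qed (use fr4 s2 n in auto)
        then show "wp \<epsilon> Bd (Set 45 (Const 0) ;; For 36 (V 2) ?body) ?P s4" by simp
      qed (use s2 n in auto)
      moreover have "\<bar>Q\<bar> \<le> 2 ^ Bd" by (rule abs_le_pow2_mono[OF Qb]) (use bds in simp)
      ultimately show "wp \<epsilon> Bd (Set 42 (Mul (Mul (V 20) (V 27)) (V 4)) ;;
     Row 43 (Const 0) 7 (Sub (Mul (Mul (Mul (V 39) (Sub (V 10) (V 11))) (Ix 24 urow 7)) (Mul (V 27) (V 4)))
                             (Mul (V 20) (Ix 26 (Const 0) 7))) ;;
     Set 45 (Const 0) ;; For 36 (V 2) ?body) ?P s2"
        using s2 r T D by (simp add: Q_def)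
    qed
  qed (use n in auto)
qed

text \<open>Candidate \<open>X / Q\<close>: a point of the translated lattice within distance \<open>E / N\<close> of a multiple of \<open>u\<close>.\<close>

definition cand_ok :: "nat \<Rightarrow> nat \<Rightarrow> (nat \<Rightarrow> nat \<Rightarrow> int) \<Rightarrow> int \<Rightarrow> (nat \<Rightarrow> int) \<Rightarrow> int \<Rightarrow> int \<Rightarrow> (nat \<Rightarrow> int) \<Rightarrow> int \<Rightarrow>
    (nat \<Rightarrow> int) \<Rightarrow> int \<Rightarrow> bool" where
  "cand_ok n q B D cv N E u sg X Q \<longleftrightarrow> 0 < Q \<and>
     (\<lambda>t. of_int D * (of_int (X t) / of_int Q) - of_int (cv t)) \<in> mixed n q B \<and>
     (\<exists>r. isqrt (N * N * dot n u u) r \<and>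
       (let d = (\<lambda>t. of_int (X t) / of_int Q - of_int (sg * (N - E)) * of_int (u t) / of_int r)
        in (of_int N)\<^sup>2 * dot n d d \<le> (of_int E :: real)\<^sup>2))"

text \<open>A residual of the rounding longer than D E / N. Of its origin only the bounds in the
  orthogonalized frame are retained, from which the length of the last orthogonalized vector is
  estimated.\<close>

definition bad :: "nat \<Rightarrow> nat \<Rightarrow> (nat \<Rightarrow> nat \<Rightarrow> int) \<Rightarrow> int \<Rightarrow> int \<Rightarrow> int \<Rightarrow> bool" where
  "bad n q B D N E \<longleftrightarrow> (\<exists>r. (\<forall>i<n. i < q \<longrightarrow> dot n r (rv (gs n B i)) = 0) \<and>
     (\<forall>i<n. q \<le> i \<longrightarrow> \<bar>dot n r (rv (gs n B i))\<bar> \<le> of_int (gd n B (Suc i)) / 2) \<and>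
     (of_int E)\<^sup>2 * (of_int D)\<^sup>2 < (of_int N)\<^sup>2 * dot n r r)"

lemma dot_scale: "dot n (\<lambda>t. x t / c) y = dot n x y / (c :: real)" "dot n (\<lambda>t. x t / c) (\<lambda>t. x t / c) = dot n x x / c\<^sup>2"
  by (simp_all add: dot_def sum_divide_distrib power2_eq_square)

text \<open>The candidate is the center minus the residual divided by \<open>T * D\<close>, which
  undoes both the denominator and the scaling of the lattice. Its distance from the center is
  therefore the length of that vector, and the integer test decides exactly between the two
  outcomes.\<close>

lemma reduced_cand:
  assumes red: "reduced n q B n (\<lambda>t. sg * D * (N - E) * u t - r * cv t) r 0 R T"
    and r: "isqrt (N * N * dot n u u) r" and D: "0 < D"
  defines "Q \<equiv> r * T * D" and "X \<equiv> (\<lambda>t. sg * (N - E) * u t * (T * D) - r * R t)"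
  shows "E * E * (T * D * (T * D)) < dot n R R * (N * N) \<Longrightarrow> bad n q B D N E"
    and "\<not> E * E * (T * D * (T * D)) < dot n R R * (N * N) \<Longrightarrow> cand_ok n q B D cv N E u sg X Q"
proof -
  have T: "T > 0" and r0: "r > 0" using red r by (simp_all add: reduced_def isqrt_def)
  have TD: "real_of_int T \<noteq> 0" "real_of_int D \<noteq> 0" "real_of_int r \<noteq> 0" using T D r0 by simp_all
  have "\<exists>\<mu>. (\<forall>i. q \<le> i \<longrightarrow> \<mu> i \<in> \<int>) \<and> (\<forall>t. of_int (R t) / of_int T =
      of_int (sg * D * (N - E) * u t - r * cv t) / of_int r - (\<Sum>i<n. \<mu> i * real_of_int (B i t)))"
    using red unfolding reduced_def by (elim conjE)
  then obtain \<mu> where \<mu>: "\<And>i. q \<le> i \<Longrightarrow> \<mu> i \<in> \<int>"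
    "\<And>t. of_int (R t) / of_int T = of_int (sg * D * (N - E) * u t - r * cv t) / of_int r - (\<Sum>i<n. \<mu> i * real_of_int (B i t))"
    by metis
  have XQ: "real_of_int (X t) / of_int Q = of_int (sg * (N - E)) * of_int (u t) / of_int r - of_int (R t) / (of_int T * of_int D)" for t
    using TD by (simp add: X_def Q_def field_simps)
  { assume fail: "E * E * (T * D * (T * D)) < dot n R R * (N * N)"
    let ?r = "\<lambda>t. real_of_int (R t) / of_int T"
    have dr: "dot n ?r (rv (gs n B i)) = of_int (dot n R (gs n B i)) / of_int T" for i
      by (subst dot_scale(1)) (simp add: dot_of_int)
    have "dot n ?r (rv (gs n B i)) = 0" if "i < n" "i < q" for i
    proof -
      have "dot n R (gs n B i) = 0" using red that by (simp add: reduced_def)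
      then show ?thesis by (simp add: dr)
    qed
    moreover have "\<bar>dot n ?r (rv (gs n B i))\<bar> \<le> of_int (gd n B (Suc i)) / 2" if "i < n" "q \<le> i" for i
    proof -
      have "2 * \<bar>dot n R (gs n B i)\<bar> \<le> T * gd n B (Suc i)" using red that by (simp add: reduced_def)
      then have "real_of_int (2 * \<bar>dot n R (gs n B i)\<bar>) \<le> of_int (T * gd n B (Suc i))" by (simp only: of_int_le_iff)
      then show ?thesis using T by (simp add: dr field_simps)
    qed
    moreover have "(of_int E)\<^sup>2 * (of_int D)\<^sup>2 < (of_int N)\<^sup>2 * dot n ?r ?r"
    proof -
      have "real_of_int (E * E * (T * D * (T * D))) < of_int (dot n R R * (N * N))" using fail by (simp only: of_int_less_iff)
      then have "(of_int E)\<^sup>2 * (of_int D)\<^sup>2 * (of_int T)\<^sup>2 < (of_int N)\<^sup>2 * real_of_int (dot n R R)"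
        by (simp add: power2_eq_square mult_ac)
      then show ?thesis using T unfolding dot_scale(2) dot_of_int by (simp add: pos_less_divide_eq)
    qed
    ultimately show "bad n q B D N E" unfolding bad_def by blast
  next
    assume ok: "\<not> E * E * (T * D * (T * D)) < dot n R R * (N * N)"
    have "of_int D * (of_int (X t) / of_int Q) - of_int (cv t) = (\<Sum>i<n. \<mu> i * real_of_int (B i t))" for t
    proof -
      have "of_int D * (of_int (X t) / of_int Q) - of_int (cv t) =
          of_int (sg * D * (N - E) * u t - r * cv t) / of_int r - of_int (R t) / real_of_int T"
        unfolding XQ using TD by (simp add: field_simps)
      then show ?thesis using \<mu>(2)[of t] by simp
    qed
    then have "(\<lambda>t. of_int D * (of_int (X t) / of_int Q) - of_int (cv t)) \<in> mixed n q B"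
      unfolding mixed_def using \<mu>(1) by auto
    moreover have "(of_int N)\<^sup>2 * dot n (\<lambda>t. of_int (X t) / of_int Q - of_int (sg * (N - E)) * of_int (u t) / of_int r)
        (\<lambda>t. of_int (X t) / of_int Q - of_int (sg * (N - E)) * of_int (u t) / of_int r) \<le> (of_int E :: real)\<^sup>2"
    proof -
      have d: "(\<lambda>t. of_int (X t) / of_int Q - of_int (sg * (N - E)) * of_int (u t) / of_int r) =
          (\<lambda>t. real_of_int (R t) / (- (of_int T * of_int D)))" by (simp add: XQ)
      have "real_of_int (dot n R R * (N * N)) \<le> of_int (E * E * (T * D * (T * D)))" using ok by (simp only: of_int_le_iff not_less)
      then have "(of_int N)\<^sup>2 * real_of_int (dot n R R) \<le> (of_int E)\<^sup>2 * (of_int T * of_int D)\<^sup>2"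
        by (simp add: power2_eq_square mult_ac)
      then show ?thesis using T D unfolding d dot_scale(2) dot_of_int by (simp add: divide_le_eq)
    qed
    moreover have "0 < Q" using T D r0 by (simp add: Q_def)
    ultimately show "cand_ok n q B D cv N E u sg X Q"
      unfolding cand_ok_def Let_def using r by (intro conjI exI[of _ r]) }
qed

section \<open>Output of vectors and selection of the extreme candidates\<close>

definition write_prog :: "aexp \<Rightarrow> aexp \<Rightarrow> aexp \<Rightarrow> com" where
  "write_prog off f g =
     Vec 1 7 (V 2) (Add off (Mul (Const 2) (V 7))) f ;;
     Vec 1 7 (V 2) (Add off (Add (Mul (Const 2) (V 7)) (Const 1))) g"

lemma mods_write_prog [simp]: "mods (write_prog off f g) = {1, 7}"
  by (simp add: write_prog_def)

text \<open>One common denominator, repeated for every entry because the output format stores a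
  fraction per entry.\<close>

definition outs :: "mem \<Rightarrow> int \<Rightarrow> nat \<Rightarrow> (nat \<Rightarrow> int) \<Rightarrow> int \<Rightarrow> bool" where
  "outs s a n X Q \<longleftrightarrow> (\<forall>t<n. s 1 (a + 2 * int t) = X t \<and> s 1 (a + 2 * int t + 1) = Q)"

lemma wp_write_prog:
  assumes n: "s 2 0 = int n" "n \<le> B"
    and off: "\<And>s'. (\<And>y. y \<notin> {1, 7} \<Longrightarrow> s' y = s y) \<Longrightarrow> aok \<epsilon> B off s' \<and> aval \<epsilon> off s' = a"
    and f: "\<And>t s'. t < n \<Longrightarrow> s' 7 0 = int t \<Longrightarrow> (\<And>y. y \<notin> {1, 7} \<Longrightarrow> s' y = s y) \<Longrightarrow>
      aok \<epsilon> B f s' \<and> aval \<epsilon> f s' = X t \<and> aok \<epsilon> B g s' \<and> aval \<epsilon> g s' = Q"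
    and bound: "\<And>t. t < n \<Longrightarrow> \<bar>X t\<bar> \<le> 2 ^ B" "\<bar>Q\<bar> \<le> 2 ^ B"
  shows "wp \<epsilon> B (write_prog off f g) (\<lambda>s'. outs s' a n X Q \<and> (\<forall>i. i < a \<or> a + 2 * int n \<le> i \<longrightarrow> s' 1 i = s 1 i)) s"
    (is "wp _ _ _ ?Q s")
  unfolding write_prog_def
proof (subst wp.simps, rule wp_Vec[where len = n and g = "\<lambda>t. a + 2 * int t" and h = X])
  fix s1 :: mem
  assume 1: "\<And>t. t < n \<Longrightarrow> s1 1 (a + 2 * int t) = X t"
    "\<And>i. i \<notin> (\<lambda>t. a + 2 * int t) ` {..<n} \<Longrightarrow> s1 1 i = s 1 i" and fr1: "\<And>y. y \<notin> {1, 7} \<Longrightarrow> s1 y = s y"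
  show "wp \<epsilon> B (Vec 1 7 (V 2) (Add off (Add (Mul (Const 2) (V 7)) (Const 1))) g) ?Q s1"
  proof (rule wp_Vec[where len = n and g = "\<lambda>t. a + 2 * int t + 1" and h = "\<lambda>_. Q"])
    fix s2 :: mem
    assume 2: "\<And>t. t < n \<Longrightarrow> s2 1 (a + 2 * int t + 1) = Q"
      "\<And>i. i \<notin> (\<lambda>t. a + 2 * int t + 1) ` {..<n} \<Longrightarrow> s2 1 i = s1 1 i"
    have "s2 1 (a + 2 * int t) = X t" if "t < n" for t
    proof -
      have "a + 2 * int t \<notin> (\<lambda>t. a + 2 * int t + 1) ` {..<n}" by (auto, presburger)
      then show ?thesis using 1(1)[OF that] 2(2) by simp
    qed
    moreover have "s2 1 i = s 1 i" if "i < a \<or> a + 2 * int n \<le> i" for i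
    proof -
      have "i \<notin> (\<lambda>t. a + 2 * int t + 1) ` {..<n}" "i \<notin> (\<lambda>t. a + 2 * int t) ` {..<n}" using that by auto
      then show ?thesis using 1(2) 2(2) by simp
    qed
    ultimately show "?Q s2" using 2(1) by (simp add: outs_def)
  next
    fix t s' assume t: "t < n" "s' 7 0 = int t" and fr: "\<And>y. y \<notin> {1, 7} \<Longrightarrow> s' y = s1 y"
    have fr': "s' y = s y" if "y \<notin> {1, 7}" for y using fr[OF that] fr1[OF that] by simp
    show "aok \<epsilon> B (Add off (Add (Mul (Const 2) (V 7)) (Const 1))) s' \<and> aok \<epsilon> B g s' \<and>
      aval \<epsilon> (Add off (Add (Mul (Const 2) (V 7)) (Const 1))) s' = a + 2 * int t + 1 \<and> aval \<epsilon> g s' = Q"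
      using off[of s'] f[of t s'] fr' t by simp
  qed (use fr1 n bound in \<open>auto simp: inj_on_def\<close>)
next
  fix t s' assume t: "t < n" "s' 7 0 = int t" and fr: "\<And>y. y \<notin> {1, 7} \<Longrightarrow> s' y = s y"
  show "aok \<epsilon> B (Add off (Mul (Const 2) (V 7))) s' \<and> aok \<epsilon> B f s' \<and>
      aval \<epsilon> (Add off (Mul (Const 2) (V 7))) s' = a + 2 * int t \<and> aval \<epsilon> f s' = X t"
    using off[of s'] f[of t s'] fr t by simp
qed (use n bound in \<open>auto simp: inj_on_def\<close>)

text \<open>Keeps the candidate \<open>X / Q\<close> maximizing \<open>G / Q\<^sup>2\<close>; the initial value \<open>- 1 / 0\<close> is smaller than
  every fraction.\<close>

definition best_prog :: "nat \<Rightarrow> nat \<Rightarrow> aexp \<Rightarrow> aexp \<Rightarrow> com" where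
  "best_prog fa qa off fe =
     Cond (Less (Mul (V fa) (Mul (V 42) (V 42))) (Mul fe (Mul (V qa) (V qa))))
       (Set fa fe ;; Set qa (V 42) ;; write_prog off (Get 43 (V 7)) (V 42)) Skip"

lemma mods_best_prog [simp]: "mods (best_prog fa qa off fe) = {fa, qa, 1, 7}"
  by (auto simp: best_prog_def)

text \<open>\<open>fa\<close> and \<open>qa\<close> hold the numerator \<open>G m\<close> and the
  number \<open>Q m\<close> whose square is the denominator of the best value so far; the vector
  itself is kept in the output array from cell \<open>a\<close> on.\<close>

definition best :: "nat \<Rightarrow> int \<Rightarrow> nat \<Rightarrow> nat \<Rightarrow> nat \<Rightarrow> (nat \<Rightarrow> int) \<Rightarrow> (nat \<Rightarrow> int) \<Rightarrow> (nat \<Rightarrow> nat \<Rightarrow> int) \<Rightarrow> mem \<Rightarrow> bool" where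
  "best n a fa qa j G Q X s \<longleftrightarrow> j = 0 \<and> s fa 0 = - 1 \<and> s qa 0 = 0 \<or>
     (\<exists>m<j. s fa 0 = G m \<and> s qa 0 = Q m \<and> outs s a n (X m) (Q m) \<and>
       (\<forall>i<j. G i * (Q m * Q m) \<le> G m * (Q i * Q i)))"

lemma best_cong:
  assumes "best n a fa qa j G Q X s" "\<And>i. i < j \<Longrightarrow> G' i = G i \<and> Q' i = Q i \<and> X' i = X i"
    "s' fa 0 = s fa 0" "s' qa 0 = s qa 0" "\<And>i. a \<le> i \<Longrightarrow> i < a + 2 * int n \<Longrightarrow> s' 1 i = s 1 i"
  shows "best n a fa qa j G' Q' X' s'"
proof -
  have "outs s' a n Y P" if "outs s a n Y P" for Y P
    using that assms(5) by (auto simp: outs_def)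
  then show ?thesis using assms(1-4) unfolding best_def by (elim disjE; simp) (metis (no_types, lifting))
qed

text \<open>Transitivity for the fractions with denominators p^2, q^2 and r^2, compared by
  cross-multiplication.\<close>

lemma frac_trans:
  fixes a b c p q r :: int
  assumes "0 < q" "0 < p" "0 < r" "a * (q * q) \<le> b * (p * p)" "b * (r * r) \<le> c * (q * q)"
  shows "a * (r * r) \<le> c * (p * p)"
proof -
  have "a * (q * q) * (r * r) \<le> b * (p * p) * (r * r)" using assms(4) by (intro mult_right_mono) auto
  also have "\<dots> = b * (r * r) * (p * p)" by simp
  also have "\<dots> \<le> c * (q * q) * (p * p)" using assms(5) by (intro mult_right_mono) auto
  finally have "(a * (r * r)) * (q * q) \<le> (c * (p * p)) * (q * q)" by (simp only: mult_ac)
  then show ?thesis using assms(1) by (simp only: mult_le_cancel_right_pos mult_pos_pos)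
qed

lemma wp_best_prog:
  assumes n: "s 2 0 = int n" "n \<le> B" and names: "fa \<notin> {1, 2, 7, 42, 43, qa}" "qa \<notin> {1, 2, 7, 42, 43}"
    and best: "best n a fa qa j G Q X s" and Q: "\<And>i. i \<le> j \<Longrightarrow> 0 < Q i"
    and s: "s 42 0 = Q j" "mt n (s 43) 0 = X j" "aok \<epsilon> B fe s" "aval \<epsilon> fe s = G j"
    and off: "\<And>s'. s' 2 = s 2 \<Longrightarrow> aok \<epsilon> B off s' \<and> aval \<epsilon> off s' = a"
    and bound: "\<And>t. t < n \<Longrightarrow> \<bar>X j t\<bar> \<le> 2 ^ B" "\<bar>Q j\<bar> \<le> 2 ^ B" "\<bar>G j\<bar> \<le> 2 ^ B"
  shows "wp \<epsilon> B (best_prog fa qa off fe) (\<lambda>s'. best n a fa qa (Suc j) G Q X s' \<and>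
    (\<forall>i. i < a \<or> a + 2 * int n \<le> i \<longrightarrow> s' 1 i = s 1 i)) s" (is "wp _ _ _ ?P s")
proof -
  let ?c = "s fa 0 * (Q j * Q j) < G j * (s qa 0 * s qa 0)"
  show ?thesis
  proof (cases ?c)
    case True
    have le: "G i * (Q j * Q j) \<le> G j * (Q i * Q i)" if i: "i < Suc j" for i
    proof (cases "i = j")
      case False
      then obtain m where m: "m < j" "s fa 0 = G m" "s qa 0 = Q m" "G i * (Q m * Q m) \<le> G m * (Q i * Q i)"
        using best i unfolding best_def by auto
      show ?thesis by (rule frac_trans[of "Q m" "Q i" "Q j" _ "G m"]) (use m Q i True in auto)
    qed simp
    let ?s1 = "s(fa := (s fa)(0 := G j), qa := (s qa)(0 := Q j))"
    have "wp \<epsilon> B (write_prog off (Get 43 (V 7)) (V 42)) ?P ?s1"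
    proof (rule wp_frame[OF wp_write_prog[where n = n and a = a and X = "X j" and Q = "Q j"]])
      fix s2 assume "outs s2 a n (X j) (Q j) \<and> (\<forall>i. i < a \<or> a + 2 * int n \<le> i \<longrightarrow> s2 1 i = ?s1 1 i)"
        and fr: "\<And>y. y \<notin> mods (write_prog off (Get 43 (V 7)) (V 42)) \<Longrightarrow> s2 y = ?s1 y"
      then show "?P s2" using fr[of fa] fr[of qa] names le unfolding best_def
        by (intro conjI disjI2 exI[of _ j]) auto
    next
      fix t s' assume t: "t < n" "s' 7 0 = int t" "\<And>y. y \<notin> {1, 7} \<Longrightarrow> s' y = ?s1 y"
      have "s 43 (int t) = X j t" using mtD[OF s(2) t(1)] by simp
      then show "aok \<epsilon> B (Get 43 (V 7)) s' \<and> aval \<epsilon> (Get 43 (V 7)) s' = X j t \<and> aok \<epsilon> B (V 42) s' \<and> aval \<epsilon> (V 42) s' = Q j"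
        using t names s(1) by simp
    qed (use n names bound off in auto)
    moreover have "qa \<noteq> fa" using names by auto
    ultimately show ?thesis using True s names bound by (simp add: best_prog_def)
  next
    case False
    have "j \<noteq> 0" using False best Q[of j] by (auto simp: best_def)
    then obtain m where m: "m < j" "s fa 0 = G m" "s qa 0 = Q m" "outs s a n (X m) (Q m)"
      "\<And>i. i < j \<Longrightarrow> G i * (Q m * Q m) \<le> G m * (Q i * Q i)"
      using best unfolding best_def by auto
    have "best n a fa qa (Suc j) G Q X s"
      unfolding best_def using m False by (intro disjI2 exI[of _ m]) (auto simp: less_Suc_eq)
    then show ?thesis using False s by (simp add: best_prog_def)
  qed
qed

text \<open>The minimum is tracked as the maximum of the negated values, in the cells reserved for
  the second output vector.\<close>

definition cand_body :: com where
  "cand_body =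
     target_prog ;; red_prog ;; eval_prog ;;
     best_prog 48 49 (Const 1) (V 45) ;;
     best_prog 50 51 (Add (Mul (Const 2) (V 2)) (Const 1)) (Sub (Const 0) (V 45))"

definition cand_prog :: com where
  "cand_prog =
     Set 28 (V 3) ;; Set 47 (Const 0) ;;
     Set 48 (Const (- 1)) ;; Set 49 (Const 0) ;; Set 50 (Const (- 1)) ;; Set 51 (Const 0) ;;
     For 38 (Const 6) cand_body"

lemma mods_cand_body [simp]: "mods cand_body =
    {1, 7, 19, 20, 21, 22, 26, 27, 29, 30, 31, 32, 33, 36, 39, 40, 41, 42, 43, 44, 45, 47, 48, 49, 50, 51}"
  by (auto simp: cand_body_def)

lemma mods_cand_prog [simp]: "mods cand_prog =
    {1, 7, 19, 20, 21, 22, 26, 27, 28, 29, 30, 31, 32, 33, 36, 38, 39, 40, 41, 42, 43, 44, 45, 47, 48, 49, 50, 51}"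
  by (auto simp: cand_prog_def)

definition cand_inv :: "nat \<Rightarrow> nat \<Rightarrow> (nat \<Rightarrow> nat \<Rightarrow> int) \<Rightarrow> int \<Rightarrow> (nat \<Rightarrow> nat \<Rightarrow> int) \<Rightarrow> int \<Rightarrow> int \<Rightarrow>
    (nat \<Rightarrow> nat \<Rightarrow> int) \<Rightarrow> nat \<Rightarrow> mem \<Rightarrow> bool" where
  "cand_inv n q B D H N E u j s \<longleftrightarrow> s 47 0 = 1 \<and> bad n q B D N E \<or>
     s 47 0 = 0 \<and> (\<exists>X Q. (\<forall>i<j. cand_ok n q B D (H (Suc n)) N E (u (i div 3)) (int i mod 3 - 1) (X i) (Q i)) \<and>
       best n 1 48 49 j (\<lambda>i. fval n H (H n) (Q i) (X i)) Q X s \<and>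
       best n (2 * int n + 1) 50 51 j (\<lambda>i. - fval n H (H n) (Q i) (X i)) Q X s)"

text \<open>After a failure the recorded candidates no longer matter, but the update must still run
  within the bounds.\<close>

lemma wp_best_any:
  assumes n: "s 2 0 = int n" "n \<le> B" and names: "fa \<notin> {1, 2, 7, 42, 43, qa}" "qa \<notin> {1, 2, 7, 42, 43}"
    and s: "s 42 0 = Q" "mt n (s 43) 0 = X" "aok \<epsilon> B fe s" "aval \<epsilon> fe s = G"
    and off: "\<And>s'. s' 2 = s 2 \<Longrightarrow> aok \<epsilon> B off s' \<and> aval \<epsilon> off s' = a"
    and bound: "\<And>t. t < n \<Longrightarrow> \<bar>X t\<bar> \<le> 2 ^ B" "\<bar>Q\<bar> \<le> 2 ^ B" "\<bar>G\<bar> \<le> 2 ^ B"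
  shows "wp \<epsilon> B (best_prog fa qa off fe) (\<lambda>_. True) s"
proof -
  let ?s1 = "s(fa := (s fa)(0 := G), qa := (s qa)(0 := Q))"
  have "wp \<epsilon> B (write_prog off (Get 43 (V 7)) (V 42)) (\<lambda>_. True) ?s1"
  proof (rule wp_mono[OF wp_write_prog[where n = n and a = a and X = X and Q = Q]])
    fix t s' assume t: "t < n" "s' 7 0 = int t" "\<And>y. y \<notin> {1, 7} \<Longrightarrow> s' y = ?s1 y"
    have "s 43 (int t) = X t" using mtD[OF s(2) t(1)] by simp
    then show "aok \<epsilon> B (Get 43 (V 7)) s' \<and> aval \<epsilon> (Get 43 (V 7)) s' = X t \<and> aok \<epsilon> B (V 42) s' \<and> aval \<epsilon> (V 42) s' = Q"
      using t names s(1) by simp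
  qed (use n names bound off in auto)
  moreover have "qa \<noteq> fa" using names by auto
  ultimately show ?thesis using s names bound by (simp add: best_prog_def)
qed

lemma wp_cand_body:
  fixes H :: "nat \<Rightarrow> nat \<Rightarrow> int"
  assumes n: "s 2 0 = int n" and j: "s 38 0 = int j" "j < 6" and q: "s 28 0 = int q"
    and N: "s 10 0 = N" "s 11 0 = E" "0 \<le> E" "E \<le> N" "N \<le> 2 ^ k" and D: "s 4 0 = D" "0 < D" "D \<le> 2 ^ e"
    and u: "u = mt n (s 24)" "\<And>i t. i < 2 \<Longrightarrow> t < n \<Longrightarrow> \<bar>u i t\<bar> \<le> 2 ^ b"
    and H: "H = mt n (s 6)" "\<And>a t. a \<le> Suc n \<Longrightarrow> t < n \<Longrightarrow> \<bar>H a t\<bar> \<le> 2 ^ e"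
    and B: "B = mt n (s 25)" "minor B n \<noteq> 0"
    and W: "\<And>i. i < n \<Longrightarrow> mt n (s 14) i = gs n B i" "\<And>i. i \<le> n \<Longrightarrow> s 15 (int i) = gd n B i"
    and Bb: "\<And>i t. i < n \<Longrightarrow> t < n \<Longrightarrow> \<bar>B i t\<bar> \<le> 2 ^ a" "\<And>i. i \<le> n \<Longrightarrow> gd n B i \<le> 2 ^ w"
      "\<And>i t. i < n \<Longrightarrow> t < n \<Longrightarrow> \<bar>gs n B i t\<bar> \<le> 2 ^ w"
    and l: "l = sbits n k b + e + 1 + n * (n + w + a + 2)" and x: "x = Suc (k + b + l + e + sbits n k b)"
    and bds: "2 * n + e + 2 * x + 1 \<le> Bd" "3 \<le> Bd"
    and inv: "cand_inv n q B D H N E u j s"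
  shows "wp \<epsilon> Bd cand_body (cand_inv n q B D H N E u (Suc j)) s"
proof -
  let ?sg = "int j mod 3 - 1" and ?u = "u (j div 3)" and ?cv = "H (Suc n)" and ?g = "sbits n k b"
  have nB: "n \<le> Bd" using bds by simp
  have j3: "j div 3 < 2" using j(2) by auto
  have sga: "\<bar>?sg\<bar> \<le> 1" by (smt (verit) pos_mod_bound pos_mod_sign)
  show ?thesis unfolding cand_body_def
  proof (subst wp.simps, rule wp_frame[OF wp_target_prog[where n = n and i = j and N = N and E = E and D = D and
          u = ?u and cv = ?cv and k = k and b = b and e = e]])
    fix s1
    assume t1: "isqrt (N * N * dot n ?u ?u) (s1 20 0) \<and> s1 20 0 \<le> 2 ^ ?g \<and>
      mt n (s1 26) 0 = (\<lambda>t. ?sg * D * (N - E) * ?u t - s1 20 0 * ?cv t) \<and>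
      (\<forall>t<n. \<bar>mt n (s1 26) 0 t\<bar> \<le> 2 ^ (?g + e + 1)) \<and>
      s1 27 0 = s1 20 0 \<and> s1 29 0 = int n \<and> s1 39 0 = ?sg"
      and fr1: "\<And>y. y \<notin> mods target_prog \<Longrightarrow> s1 y = s y"
    let ?r = "s1 20 0" and ?R0 = "mt n (s1 26) 0"
    have r0: "0 < ?r" using t1 by (simp add: isqrt_def)
    have rg: "?r \<le> 2 ^ ?g" and r27: "s1 27 0 = ?r" and r29: "s1 29 0 = int n"
      and R0b: "\<forall>t<n. \<bar>?R0 t\<bar> \<le> 2 ^ (?g + e + 1)" using t1 by blast+
    have rg': "?r \<le> 2 ^ (?g + e + 1)" using rg by (rule le_pow2_mono) simp
    show "wp \<epsilon> Bd (red_prog ;; eval_prog ;; best_prog 48 49 (Const 1) (V 45) ;;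
     best_prog 50 51 (Add (Mul (Const 2) (V 2)) (Const 1)) (Sub (Const 0) (V 45))) (cand_inv n q B D H N E u (Suc j)) s1"
    proof (subst wp.simps, rule wp_frame[OF wp_red_prog[where n = n and B = B and q = q and m = n and a = a and w = w and r = "?g + e + 1"]])
      fix s2
      assume t2: "reduced n q B n ?R0 (s1 27 0) 0 (mt n (s2 26) 0) (s2 27 0) \<and>
        (\<forall>t<n. \<bar>mt n (s2 26) 0 t\<bar> \<le> 2 ^ (?g + e + 1 + n * (n + w + a + 2))) \<and>
        s2 27 0 \<le> 2 ^ (?g + e + 1 + n * (n + w + a + 2))"
        and fr2: "\<And>y. y \<notin> mods red_prog \<Longrightarrow> s2 y = s1 y"
      have s2: "s2 y = s y" if "y \<notin> {7, 19, 20, 21, 22, 26, 27, 29, 30, 31, 32, 33, 39, 40}" for y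
        using fr2[of y] fr1[of y] that by simp
      have s2': "s2 20 0 = ?r" "s2 39 0 = ?sg" using fr2[of 20] fr2[of 39] t1 by simp_all
      let ?R = "mt n (s2 26) 0" and ?T = "s2 27 0"
      let ?Q = "?r * ?T * D" and ?X = "\<lambda>t. ?sg * (N - E) * ?u t * (?T * D) - ?r * ?R t"
      have red: "reduced n q B n (\<lambda>t. ?sg * D * (N - E) * ?u t - ?r * ?cv t) ?r 0 ?R ?T"
        using t1 t2 by simp
      have T0: "0 < ?T" using red by (simp add: reduced_def)
      have rc: "E * E * (?T * D * (?T * D)) < dot n ?R ?R * (N * N) \<Longrightarrow> bad n q B D N E"
        "\<not> E * E * (?T * D * (?T * D)) < dot n ?R ?R * (N * N) \<Longrightarrow> cand_ok n q B D ?cv N E ?u ?sg ?X ?Q"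
        using reduced_cand[OF red _ D(2)] t1 by blast+
      have Rl: "\<forall>t<n. \<bar>?R t\<bar> \<le> 2 ^ l" "?T \<le> 2 ^ l" unfolding l using t2 by blast+
      have e: "s2 2 0 = int n" "s2 38 0 = int j" "s2 10 0 = N" "s2 11 0 = E" "s2 4 0 = D"
        using n j N D by (simp_all add: s2)
      have e1: "?u = mt n (s2 24) (j div 3)" "H = mt n (s2 6)"
        by (simp_all only: s2 u(1) H(1)) (simp_all add: s2)
      have e3: "\<And>t. t < n \<Longrightarrow> \<bar>?u t\<bar> \<le> 2 ^ b" "\<And>a t. a \<le> n \<Longrightarrow> t < n \<Longrightarrow> \<bar>H a t\<bar> \<le> 2 ^ e"
        "\<And>t. t < n \<Longrightarrow> \<bar>?R t\<bar> \<le> 2 ^ l"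
        using u(2) j3 H(2) Rl(1) by simp_all
      note e2 = e e1 e3 nB s2' sga N(3-5) D(2,3) T0 Rl(2) r0 rg bds(1)
      show "wp \<epsilon> Bd (eval_prog ;; best_prog 48 49 (Const 1) (V 45) ;;
        best_prog 50 51 (Add (Mul (Const 2) (V 2)) (Const 1)) (Sub (Const 0) (V 45))) (cand_inv n q B D H N E u (Suc j)) s2"
      proof (subst wp.simps, rule wp_frame[OF wp_eval_prog[where n = n and i = j and sg = ?sg and N = N and E = E and D = D and
              u = ?u and H = H and R = ?R and T = ?T and r = ?r and k = k and b = b and e = e and l = l and g = ?g and x = x]])
        fix s3
        assume t3: "s3 47 0 = (if E * E * (?T * D * (?T * D)) < dot n ?R ?R * (N * N) then 1 else s2 47 0) \<and>
          s3 42 0 = ?Q \<and> mt n (s3 43) 0 = ?X \<and> s3 45 0 = fval n H (H n) ?Q ?X \<and>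
          (\<forall>t<n. \<bar>?X t\<bar> \<le> 2 ^ x) \<and> \<bar>?Q\<bar> \<le> 2 ^ x \<and> \<bar>fval n H (H n) ?Q ?X\<bar> \<le> 2 ^ (2 * n + e + 2 * x + 1)"
          and fr3: "\<And>y. y \<notin> mods eval_prog \<Longrightarrow> s3 y = s2 y"
        define Xj where "Xj = ?X"
        define Qj where "Qj = ?Q"
        let ?F = "fval n H (H n) Qj Xj" and ?far = "E * E * (?T * D * (?T * D)) < dot n ?R ?R * (N * N)"
        have t47: "s3 47 0 = (if ?far then 1 else s2 47 0)" using t3 by (rule conjunct1)
        have v: "s3 42 0 = Qj" "mt n (s3 43) 0 = Xj" "s3 45 0 = ?F" "\<forall>t<n. \<bar>Xj t\<bar> \<le> 2 ^ x" "\<bar>Qj\<bar> \<le> 2 ^ x"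
          "\<bar>?F\<bar> \<le> 2 ^ (2 * n + e + 2 * x + 1)"
          unfolding Xj_def Qj_def using t3 by blast+
        have rc': "\<not> ?far \<Longrightarrow> cand_ok n q B D ?cv N E ?u ?sg Xj Qj"
          unfolding Xj_def Qj_def by (rule rc(2))
        have s3: "s3 y = s y" if "y \<notin> {7, 19, 20, 21, 22, 26, 27, 29, 30, 31, 32, 33, 36, 39, 40, 41, 42, 43, 44, 45, 47}" for y
          using fr3[of y] s2[of y] that by simp
        have bX: "\<And>t. t < n \<Longrightarrow> \<bar>Xj t\<bar> \<le> 2 ^ Bd" "\<bar>Qj\<bar> \<le> 2 ^ Bd" "\<bar>?F\<bar> \<le> 2 ^ Bd" "\<bar>- ?F\<bar> \<le> 2 ^ Bd"
        proof -
          show "\<bar>Xj t\<bar> \<le> 2 ^ Bd" if "t < n" for t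
            by (rule abs_le_pow2_mono[of _ x]) (use v that bds in auto)
          show "\<bar>Qj\<bar> \<le> 2 ^ Bd" by (rule abs_le_pow2_mono[of _ x]) (use v bds in auto)
          show F: "\<bar>?F\<bar> \<le> 2 ^ Bd" by (rule abs_le_pow2_mono[of _ "2 * n + e + 2 * x + 1"]) (use v bds in auto)
          then show "\<bar>- ?F\<bar> \<le> 2 ^ Bd" by simp
        qed
        show "wp \<epsilon> Bd (best_prog 48 49 (Const 1) (V 45) ;;
          best_prog 50 51 (Add (Mul (Const 2) (V 2)) (Const 1)) (Sub (Const 0) (V 45))) (cand_inv n q B D H N E u (Suc j)) s3"
        proof (cases "s3 47 0 = 0")
          case False
          have "s3 47 0 = 1 \<and> bad n q B D N E"
            using False t47 rc(1) s2[of 47] inv unfolding cand_inv_def by (cases ?far) auto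
          then have inv1: "s5 47 = s3 47 \<Longrightarrow> cand_inv n q B D H N E u (Suc j) s5" for s5
            by (simp add: cand_inv_def)
          have "wp \<epsilon> Bd (best_prog 48 49 (Const 1) (V 45)) (\<lambda>_. True) s3"
            by (rule wp_best_any[where n = n and X = Xj and Q = Qj and G = ?F and a = 1]) (use s3 n nB v bX in auto)
          then show ?thesis
          proof (subst wp.simps, elim wp_frame)
            fix s4 assume fr4: "\<And>y. y \<notin> mods (best_prog 48 49 (Const 1) (V 45)) \<Longrightarrow> s4 y = s3 y"
            have "wp \<epsilon> Bd (best_prog 50 51 (Add (Mul (Const 2) (V 2)) (Const 1)) (Sub (Const 0) (V 45))) (\<lambda>_. True) s4"
              by (rule wp_best_any[where n = n and X = Xj and Q = Qj and G = "- ?F" and a = "2 * int n + 1"])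
                (use fr4 s3 n nB v bX in auto)
            then show "wp \<epsilon> Bd (best_prog 50 51 (Add (Mul (Const 2) (V 2)) (Const 1)) (Sub (Const 0) (V 45))) (cand_inv n q B D H N E u (Suc j)) s4"
              by (rule wp_frame) (use fr4 in \<open>auto intro: inv1\<close>)
          qed
        next
          case True
          have ok: "cand_ok n q B D ?cv N E ?u ?sg Xj Qj" and s47: "s 47 0 = 0"
            using True t47 rc' s2[of 47] by (cases ?far; simp)+
          have "\<exists>X Q. (\<forall>i<j. cand_ok n q B D (H (Suc n)) N E (u (i div 3)) (int i mod 3 - 1) (X i) (Q i)) \<and>
            best n 1 48 49 j (\<lambda>i. fval n H (H n) (Q i) (X i)) Q X s \<and>
            best n (2 * int n + 1) 50 51 j (\<lambda>i. - fval n H (H n) (Q i) (X i)) Q X s"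
            using inv s47 by (simp add: cand_inv_def)
          then obtain X Q where XQ: "\<forall>i<j. cand_ok n q B D (H (Suc n)) N E (u (i div 3)) (int i mod 3 - 1) (X i) (Q i)"
            "best n 1 48 49 j (\<lambda>i. fval n H (H n) (Q i) (X i)) Q X s"
            "best n (2 * int n + 1) 50 51 j (\<lambda>i. - fval n H (H n) (Q i) (X i)) Q X s"
            by (elim exE conjE)
          let ?X' = "X(j := Xj)" and ?Q' = "Q(j := Qj)"
          have ok': "cand_ok n q B D (H (Suc n)) N E (u (i div 3)) (int i mod 3 - 1) (?X' i) (?Q' i)" if "i < Suc j" for i
            using XQ(1) ok that by (cases "i = j") auto
          then have Qpos: "0 < ?Q' i" if "i \<le> j" for i using that by (auto simp: cand_ok_def)
          let ?G = "\<lambda>i. fval n H (H n) (?Q' i) (?X' i)"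
          have "wp \<epsilon> Bd (best_prog 48 49 (Const 1) (V 45)) (\<lambda>s'. best n 1 48 49 (Suc j) ?G ?Q' ?X' s' \<and>
            (\<forall>i. i < 1 \<or> 1 + 2 * int n \<le> i \<longrightarrow> s' 1 i = s3 1 i)) s3"
          proof (rule wp_best_prog)
            show "best n 1 48 49 j ?G ?Q' ?X' s3" by (rule best_cong[OF XQ(2)]) (use s3 in auto)
          qed (use s3 n nB v bX Qpos in auto)
          then show ?thesis
          proof (subst wp.simps, elim wp_frame)
            fix s4 assume t4: "best n 1 48 49 (Suc j) ?G ?Q' ?X' s4 \<and>
              (\<forall>i. i < 1 \<or> 1 + 2 * int n \<le> i \<longrightarrow> s4 1 i = s3 1 i)"
              and fr4: "\<And>y. y \<notin> mods (best_prog 48 49 (Const 1) (V 45)) \<Longrightarrow> s4 y = s3 y"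
            have "wp \<epsilon> Bd (best_prog 50 51 (Add (Mul (Const 2) (V 2)) (Const 1)) (Sub (Const 0) (V 45)))
              (\<lambda>s'. best n (2 * int n + 1) 50 51 (Suc j) (\<lambda>i. - ?G i) ?Q' ?X' s' \<and>
                (\<forall>i. i < 2 * int n + 1 \<or> 2 * int n + 1 + 2 * int n \<le> i \<longrightarrow> s' 1 i = s4 1 i)) s4"
            proof (rule wp_best_prog)
              show "best n (2 * int n + 1) 50 51 j (\<lambda>i. - ?G i) ?Q' ?X' s4"
                by (rule best_cong[OF XQ(3)]) (use s3 fr4 t4 in auto)
            qed (use fr4 s3 n nB v bX Qpos in auto)
            then show "wp \<epsilon> Bd (best_prog 50 51 (Add (Mul (Const 2) (V 2)) (Const 1)) (Sub (Const 0) (V 45))) (cand_inv n q B D H N E u (Suc j)) s4"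
            proof (rule wp_frame)
              fix s5 assume t5: "best n (2 * int n + 1) 50 51 (Suc j) (\<lambda>i. - ?G i) ?Q' ?X' s5 \<and>
                (\<forall>i. i < 2 * int n + 1 \<or> 2 * int n + 1 + 2 * int n \<le> i \<longrightarrow> s5 1 i = s4 1 i)"
                and fr5: "\<And>y. y \<notin> mods (best_prog 50 51 (Add (Mul (Const 2) (V 2)) (Const 1)) (Sub (Const 0) (V 45))) \<Longrightarrow> s5 y = s4 y"
              have "best n 1 48 49 (Suc j) ?G ?Q' ?X' s5"
                by (rule best_cong[OF conjunct1[OF t4]]) (use t5 fr5 in auto)
              moreover have "s5 47 0 = 0" using fr5[of 47] fr4[of 47] True by simp
              ultimately show "cand_inv n q B D H N E u (Suc j) s5"
                unfolding cand_inv_def using ok' t5 by blast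
            qed
          qed
        qed
      next
        show "x = Suc (k + b + l + e + ?g)" by (rule x)
      qed (rule refl | fact e2)+
    next
      show "?g + e + 1 + n * (n + w + a + 2) \<le> Bd" using x bds unfolding l by simp
    qed (use fr1 r27 r29 R0b n B W q Bb r0 rg' in auto)
  next
    show "?g + e + 1 \<le> Bd" using l x bds by simp
  qed (use n nB j N D u j3 H bds in auto)
qed

lemma wp_cand_prog:
  fixes H :: "nat \<Rightarrow> nat \<Rightarrow> int"
  assumes n: "s 2 0 = int n" and q: "s 3 0 = int q" "q \<le> n"
    and N: "s 10 0 = N" "s 11 0 = E" "0 \<le> E" "E \<le> N" "N \<le> 2 ^ k" and D: "s 4 0 = D" "0 < D" "D \<le> 2 ^ e"
    and u: "u = mt n (s 24)" "\<And>i t. i < 2 \<Longrightarrow> t < n \<Longrightarrow> \<bar>u i t\<bar> \<le> 2 ^ b"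
    and H: "H = mt n (s 6)" "\<And>a t. a \<le> Suc n \<Longrightarrow> t < n \<Longrightarrow> \<bar>H a t\<bar> \<le> 2 ^ e"
    and B: "B = mt n (s 25)" "minor B n \<noteq> 0"
    and W: "\<And>i. i < n \<Longrightarrow> mt n (s 14) i = gs n B i" "\<And>i. i \<le> n \<Longrightarrow> s 15 (int i) = gd n B i"
    and Bb: "\<And>i t. i < n \<Longrightarrow> t < n \<Longrightarrow> \<bar>B i t\<bar> \<le> 2 ^ a" "\<And>i. i \<le> n \<Longrightarrow> gd n B i \<le> 2 ^ w"
      "\<And>i t. i < n \<Longrightarrow> t < n \<Longrightarrow> \<bar>gs n B i t\<bar> \<le> 2 ^ w"
    and l: "l = sbits n k b + e + 1 + n * (n + w + a + 2)" and x: "x = Suc (k + b + l + e + sbits n k b)"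
    and bds: "2 * n + e + 2 * x + 1 \<le> Bd" "6 \<le> Bd"
  shows "wp \<epsilon> Bd cand_prog (cand_inv n q B D H N E u 6) s"
proof -
  let ?s = "s(28 := (s 28)(0 := int q), 47 := (s 47)(0 := 0), 48 := (s 48)(0 := - 1), 49 := (s 49)(0 := 0),
    50 := (s 50)(0 := - 1), 51 := (s 51)(0 := 0))"
  have "wp \<epsilon> Bd (For 38 (Const 6) cand_body) (cand_inv n q B D H N E u 6) ?s"
  proof (rule wp_For[where len = 6 and I = "cand_inv n q B D H N E u"])
    show "cand_inv n q B D H N E u 0 (?s(38 := (?s 38)(0 := 0)))"
      by (simp add: cand_inv_def best_def)
    fix j s1 assume j: "j < 6" "s1 38 0 = int j" and inv: "cand_inv n q B D H N E u j s1"
      and fr: "\<And>y. y \<notin> insert 38 (mods cand_body) \<Longrightarrow> s1 y = ?s y"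
    show "wp \<epsilon> Bd cand_body (\<lambda>s''. cand_inv n q B D H N E u (Suc j) (s''(38 := (s'' 38)(0 := int j + 1)))) s1"
    proof (rule wp_mono[OF wp_cand_body[where n = n and q = q and B = B and D = D and H = H and N = N and E = E and u = u and j = j
            and k = k and b = b and e = e and a = a and w = w and l = l and x = x]])
      fix s2 :: mem assume "cand_inv n q B D H N E u (Suc j) s2"
      then show "cand_inv n q B D H N E u (Suc j) (s2(38 := (s2 38)(0 := int j + 1)))"
        unfolding cand_inv_def best_def outs_def by simp
    qed (use fr j n N D u H B W Bb l x bds inv in auto)
  qed (use bds in auto)
  moreover have "int q \<le> 2 ^ Bd"
    using q(2) bds of_nat_less_two_power[of Bd, where 'a = int] by linarith
  ultimately show ?thesis using q by (simp add: cand_prog_def)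
qed

section \<open>The algorithm\<close>

text \<open>The common denominator is the product of all denominators; its length is at most the sum
  of theirs. Array 5 holds the number 2 n (n + 1) of rational entries, which are 2 n + 2 vectors of
  length n, stored as pairs from input cell 2 on.\<close>

definition init_prog :: com where
  "init_prog =
     Set 2 (Get 0 (Const 0)) ;; Set 8 (Get 0 (Const 1)) ;; Set 3 (Sub (V 2) (V 8)) ;;
     Set 5 (Mul (Mul (Const 2) (V 2)) (Add (V 2) (Const 1))) ;; Set 4 (Const 1) ;;
     For 38 (V 5) (Set 4 (Mul (V 4) (Get 0 (Add (Mul (Const 2) (V 38)) (Const 3))))) ;;
     Vec 6 7 (V 5) (V 7) (Mul (Get 0 (Add (Mul (Const 2) (V 7)) (Const 2)))
       (Div (V 4) (Get 0 (Add (Mul (Const 2) (V 7)) (Const 3)))))"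

text \<open>A cyclic shift of the basis that brings the continuous directions to the front.\<close>

definition setup_prog :: com where
  "setup_prog =
     For 38 (V 2)
       (Cond (Less (V 38) (V 3)) (Set 36 (Add (V 38) (V 8))) (Set 36 (Sub (V 38) (V 3))) ;;
        Row 25 (V 38) 7 (Ix 6 (Add (V 36) (Add (V 2) (Const 2))) 7))"

text \<open>The scaled vector in the last row, divided by the last Gram determinant, is the
  orthogonalized vector over its squared length; the factor from array 4 compensates the scaling of
  the basis by D.\<close>

definition out_prog :: com where
  "out_prog =
     Cond (Less (Const 0) (V 47))
       (write_prog (Const 1) (Mul (V 4) (Ix 14 (Sub (V 2) (Const 1)) 7)) (Get 15 (V 2)) ;;
        Store 1 (Const 0) (Const 2))
       (Store 1 (Const 0) (Const 1))"

definition mitr_prog :: com where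
  "mitr_prog =
     init_prog ;; setup_prog ;; eps_prog ;; spec_prog ;; Row 24 (Const 1) 7 (Ix 6 (V 2) 7) ;;
     lll_prog ;; cand_prog ;; out_prog"

lemma mods_mitr_parts [simp]:
  "mods init_prog = {2, 3, 4, 5, 6, 7, 8, 38}" "mods setup_prog = {7, 25, 36, 38}" "mods out_prog = {1, 7}"
  by (auto simp: init_prog_def setup_prog_def out_prog_def)

lemma wp_init_prog:
  assumes s: "s 0 0 = int n" "s 0 1 = int p" "p \<le> n" and Z: "Z = 2 * n * (n + 1)" "Z \<le> B"
    and inp: "\<And>j. j < Z \<Longrightarrow> s 0 (2 * int j + 2) = num j \<and> s 0 (2 * int j + 3) = den j"
    and den: "\<And>j. j < Z \<Longrightarrow> 0 < den j" "(\<Prod>j<Z. den j) \<le> 2 ^ e"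
    and num: "\<And>j. j < Z \<Longrightarrow> \<bar>num j\<bar> \<le> 2 ^ e" "2 * e \<le> B"
  shows "wp \<epsilon> B init_prog (\<lambda>s'. s' 2 0 = int n \<and> s' 3 0 = int (n - p) \<and> s' 8 0 = int p \<and> s' 4 0 = (\<Prod>j<Z. den j) \<and>
     (\<forall>j. s' 6 (int j) = (if j < Z then num j * ((\<Prod>j<Z. den j) div den j) else s 6 (int j)))) s"
proof -
  let ?D = "\<Prod>j<Z. den j"
  have D0: "1 \<le> (\<Prod>j<i. den j)" if "i \<le> Z" for i
  proof (rule prod_ge_1)
    fix x assume "x \<in> {..<i}"
    then show "1 \<le> den x" using den(1)[of x] that by simp
  qed
  have Dle: "(\<Prod>j<i. den j) \<le> ?D" if "i \<le> Z" for i
    using that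
  proof (induction rule: inc_induct)
    case (step m)
    have "(\<Prod>j<m. den j) * 1 \<le> (\<Prod>j<m. den j) * den m"
      using D0[of m] den(1)[of m] step by (intro mult_left_mono) auto
    then show ?case using step by simp
  qed simp
  have eB: "x \<le> 2 ^ B" if "x \<le> 2 ^ e" for x :: int
    by (rule le_pow2_mono[OF that]) (use num(2) in simp)
  have Zb: "int Z \<le> 2 ^ B" using Z(2) of_nat_less_two_power[of B, where 'a = int] by linarith
  have nZ: "int n \<le> int Z" "int p \<le> int Z"
  proof -
    have "n * 1 \<le> n * (2 * (n + 1))" by (rule mult_le_mono2) simp
    then have "n \<le> Z" unfolding Z(1) by (simp add: mult.assoc mult.left_commute)
    then show "int n \<le> int Z" "int p \<le> int Z" using s(3) by simp_all
  qed
  define s1 where "s1 = s(2 := (s 2)(0 := int n), 8 := (s 8)(0 := int p), 3 := (s 3)(0 := int n - int p),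
    5 := (s 5)(0 := int Z), 4 := (s 4)(0 := 1))"
  have "wp \<epsilon> B (For 38 (V 5) (Set 4 (Mul (V 4) (Get 0 (Add (Mul (Const 2) (V 38)) (Const 3))))))
    (\<lambda>s'. s' 4 0 = ?D) s1"
  proof (rule wp_For[where len = Z and I = "\<lambda>j s'. s' 4 0 = (\<Prod>i<j. den i)"])
    fix j s' assume j: "j < Z" "s' 4 0 = (\<Prod>i<j. den i)" "s' 38 0 = int j"
      and fr: "\<And>x. x \<notin> insert 38 (mods (Set 4 (Mul (V 4) (Get 0 (Add (Mul (Const 2) (V 38)) (Const 3)))))) \<Longrightarrow> s' x = s1 x"
    have "s' 0 (2 * int j + 3) = den j" using fr[of 0] inp[OF j(1)] by (simp add: s1_def)
    moreover have "\<bar>(\<Prod>i<Suc j. den i)\<bar> \<le> 2 ^ B"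
      using D0[of "Suc j"] Dle[of "Suc j"] den(2) j(1) eB[of "\<Prod>i<Suc j. den i"] by linarith
    ultimately show "wp \<epsilon> B (Set 4 (Mul (V 4) (Get 0 (Add (Mul (Const 2) (V 38)) (Const 3)))))
      (\<lambda>s''. (s''(38 := (s'' 38)(0 := int j + 1))) 4 0 = (\<Prod>i<Suc j. den i)) s'"
      using j by simp
  qed (use Z in \<open>auto simp: s1_def\<close>)
  then have "wp \<epsilon> B (For 38 (V 5) (Set 4 (Mul (V 4) (Get 0 (Add (Mul (Const 2) (V 38)) (Const 3))))) ;;
    Vec 6 7 (V 5) (V 7) (Mul (Get 0 (Add (Mul (Const 2) (V 7)) (Const 2)))
       (Div (V 4) (Get 0 (Add (Mul (Const 2) (V 7)) (Const 3))))))
    (\<lambda>s'. s' 2 0 = int n \<and> s' 3 0 = int (n - p) \<and> s' 8 0 = int p \<and> s' 4 0 = ?D \<and>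
     (\<forall>j. s' 6 (int j) = (if j < Z then num j * (?D div den j) else s 6 (int j)))) s1"
  proof (subst wp.simps, elim wp_frame)
    fix s2 assume s2: "s2 4 0 = ?D" and fr: "\<And>x. x \<notin> mods (For 38 (V 5) (Set 4 (Mul (V 4) (Get 0 (Add (Mul (Const 2) (V 38)) (Const 3)))))) \<Longrightarrow> s2 x = s1 x"
    have bd: "\<bar>num j * (?D div den j)\<bar> \<le> 2 ^ B" if "j < Z" for j
    proof (rule abs_le_pow2_mono[of _ "e + e"])
      have "?D div den j \<le> ?D" using zdiv_mono2[of ?D 1 "den j"] D0[of Z] den(1)[OF that] by simp
      moreover have "0 \<le> ?D div den j" using D0[of Z] den(1)[OF that] by (simp add: pos_imp_zdiv_nonneg_iff)
      ultimately show "\<bar>num j * (?D div den j)\<bar> \<le> 2 ^ (e + e)"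
        using num(1)[OF that] den(2) by (intro abs_mult_le_pow2) auto
    qed (use num(2) in simp)
    show "wp \<epsilon> B (Vec 6 7 (V 5) (V 7) (Mul (Get 0 (Add (Mul (Const 2) (V 7)) (Const 2)))
         (Div (V 4) (Get 0 (Add (Mul (Const 2) (V 7)) (Const 3))))))
      (\<lambda>s'. s' 2 0 = int n \<and> s' 3 0 = int (n - p) \<and> s' 8 0 = int p \<and> s' 4 0 = ?D \<and>
       (\<forall>j. s' 6 (int j) = (if j < Z then num j * (?D div den j) else s 6 (int j)))) s2"
    proof (rule wp_Vec[where len = Z and g = int and h = "\<lambda>j. num j * (?D div den j)"])
      fix t s' assume t: "t < Z" "s' 7 0 = int t" and fr': "\<And>y. y \<notin> {6, 7} \<Longrightarrow> s' y = s2 y"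
      have "s' 0 = s 0" using fr'[of 0] fr[of 0] by (simp add: s1_def)
      then show "aok \<epsilon> B (V 7) s' \<and> aok \<epsilon> B (Mul (Get 0 (Add (Mul (Const 2) (V 7)) (Const 2)))
         (Div (V 4) (Get 0 (Add (Mul (Const 2) (V 7)) (Const 3))))) s' \<and> aval \<epsilon> (V 7) s' = int t \<and>
         aval \<epsilon> (Mul (Get 0 (Add (Mul (Const 2) (V 7)) (Const 2)))
         (Div (V 4) (Get 0 (Add (Mul (Const 2) (V 7)) (Const 3))))) s' = num t * (?D div den t)"
        using t fr'[of 4] s2 inp[OF t(1)] by simp
    next
      fix s' assume s': "\<And>t. t < Z \<Longrightarrow> s' 6 (int t) = num t * (?D div den t)"
        "\<And>i. i \<notin> int ` {..<Z} \<Longrightarrow> s' 6 i = s2 6 i" "\<And>y. y \<notin> {6, 7} \<Longrightarrow> s' y = s2 y"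
      have "s' 6 (int j) = s 6 (int j)" if "\<not> j < Z" for j
        using s'(2)[of "int j"] that fr[of 6] by (fastforce simp: s1_def)
      then show "s' 2 0 = int n \<and> s' 3 0 = int (n - p) \<and> s' 8 0 = int p \<and> s' 4 0 = ?D \<and>
        (\<forall>j. s' 6 (int j) = (if j < Z then num j * (?D div den j) else s 6 (int j)))"
        using s' fr[of 2] fr[of 3] fr[of 8] s2 s by (simp add: s1_def)
    qed (use Z bd s s2 fr in \<open>auto simp: s1_def\<close>)
  qed
  moreover have "2 * int n * (int n + 1) = int Z" by (simp add: Z(1) algebra_simps)
  moreover have "int n \<le> 2 ^ B" "int p \<le> 2 ^ B" "int n - int p \<le> 2 ^ B" using Zb nZ by linarith+
  ultimately show ?thesis
    using s Zb by (simp add: init_prog_def s1_def)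
qed

lemma wp_setup_prog:
  assumes n: "s 2 0 = int n" "n \<le> Bd" and p: "s 8 0 = int p" "p \<le> n" "s 3 0 = int (n - p)"
    and M: "M = mt n (s 6)" "\<And>i t. i < n \<Longrightarrow> t < n \<Longrightarrow> \<bar>M (i + n + 2) t\<bar> \<le> 2 ^ Bd"
    and z: "mt n (s 25) = (\<lambda>_ _. 0)"
  shows "wp \<epsilon> Bd setup_prog (\<lambda>s'. mt n (s' 25) =
    (\<lambda>i t. if i < n then M ((if i < n - p then i + p else i - (n - p)) + n + 2) t else 0)) s"
  unfolding setup_prog_def
proof (rule wp_For[where len = n and I = "\<lambda>j s'. mt n (s' 25) =
    (\<lambda>i t. if i < j then M ((if i < n - p then i + p else i - (n - p)) + n + 2) t else 0)"])
  let ?c = "Cond (Less (V 38) (V 3)) (Set 36 (Add (V 38) (V 8))) (Set 36 (Sub (V 38) (V 3)))"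
    and ?r = "Row 25 (V 38) 7 (Ix 6 (Add (V 36) (Add (V 2) (Const 2))) 7)"
  let ?f = "\<lambda>i. if i < n - p then i + p else i - (n - p)"
  have nb: "int n \<le> 2 ^ Bd" using n(2) of_nat_less_two_power[of Bd, where 'a = int] by linarith
  fix j s1 assume j: "j < n" "s1 38 0 = int j"
    and I: "mt n (s1 25) = (\<lambda>i t. if i < j then M (?f i + n + 2) t else 0)"
    and fr: "\<And>x. x \<notin> insert 38 (mods (?c ;; ?r)) \<Longrightarrow> s1 x = s x"
  have f: "?f j < n" using j p(2) by auto
  have "wp \<epsilon> Bd ?c (\<lambda>s'. s' 36 0 = int (?f j)) s1"
  proof (cases "j < n - p")
    case True
    then have "int j + int p \<le> 2 ^ Bd" using nb by linarith
    then show ?thesis using True fr[of 3] fr[of 8] p j by (simp add: of_nat_diff)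
  next
    case False
    then have "int j - (int n - int p) \<le> 2 ^ Bd" "int n - int p \<le> int j" using nb j p by linarith+
    then show ?thesis using False fr[of 3] fr[of 8] p j by (simp add: of_nat_diff)
  qed
  then show "wp \<epsilon> Bd (?c ;; ?r) (\<lambda>s''. mt n ((s''(38 := (s'' 38)(0 := int j + 1))) 25) =
    (\<lambda>i t. if i < Suc j then M (?f i + n + 2) t else 0)) s1"
  proof (subst wp.simps, elim wp_frame)
    fix s2 assume s2: "s2 36 0 = int (?f j)" and fr2: "\<And>y. y \<notin> mods ?c \<Longrightarrow> s2 y = s1 y"
    show "wp \<epsilon> Bd ?r (\<lambda>s''. mt n ((s''(38 := (s'' 38)(0 := int j + 1))) 25) =
      (\<lambda>i t. if i < Suc j then M (?f i + n + 2) t else 0)) s2"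
    proof (rule wp_Row[where n = n and k = j and h = "M (?f j + n + 2)"])
      fix t and s' :: mem assume t: "t < n" "s' 7 0 = int t" and fr': "\<And>y. y \<notin> {25, 7} \<Longrightarrow> s' y = s2 y"
      have *: "s' 6 = s 6" "s' 2 0 = int n" "s' 36 0 = int (?f j)"
        using fr'[of 6] fr2[of 6] fr[of 6] fr'[of 2] fr2[of 2] fr[of 2] fr'[of 36] s2 n by simp_all
      have "s' 6 (int (?f j + n + 2) * int n + int t) = M (?f j + n + 2) t"
        unfolding *(1) M(1) by (rule mt_eq) (rule t(1))
      moreover have "aval \<epsilon> (Add (V 36) (Add (V 2) (Const 2))) s' = int (?f j + n + 2)" using * by simp
      ultimately show "aok \<epsilon> Bd (Ix 6 (Add (V 36) (Add (V 2) (Const 2))) 7) s' \<and>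
        aval \<epsilon> (Ix 6 (Add (V 36) (Add (V 2) (Const 2))) 7) s' = M (?f j + n + 2) t"
        using * t by (simp only: Ix_def aval.simps aok.simps)
    next
      fix s' :: mem assume s': "mt n (s' 25) = (mt n (s2 25))(j := \<lambda>t. if t < n then M (?f j + n + 2) t else 0)"
      show "mt n ((s'(38 := (s' 38)(0 := int j + 1))) 25) = (\<lambda>i t. if i < Suc j then M (?f i + n + 2) t else 0)"
      proof -
        have "s2 25 = s1 25" using fr2[of 25] by simp
        moreover have "(s'(38 := (s' 38)(0 := int j + 1))) 25 = s' 25" by simp
        ultimately have "mt n ((s'(38 := (s' 38)(0 := int j + 1))) 25) =
          (\<lambda>i t. if i < j then M (?f i + n + 2) t else 0)(j := \<lambda>t. if t < n then M (?f j + n + 2) t else 0)"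
          by (simp only: s' I)
        moreover have "(if t < n then M (?f j + n + 2) t else 0) = M (?f j + n + 2) t" for t
          by (simp add: M(1) mt_def)
        ultimately show ?thesis by (auto simp: fun_eq_iff less_Suc_eq)
      qed
    next
      show "\<bar>M (?f j + n + 2) t\<bar> \<le> 2 ^ Bd" if "t < n" for t using M(2)[OF f that] .
    qed (use n fr2 fr j in auto)
  qed
qed (use n z in auto)

lemma wp_out_prog:
  assumes n: "s 2 0 = int n" "n \<le> Bd" "0 < n" and D: "s 4 0 = D"
    and W: "mt n (s 14) (n - 1) = g" "s 15 (int n) = d"
    and bds: "\<And>t. t < n \<Longrightarrow> \<bar>D * g t\<bar> \<le> 2 ^ Bd" "\<bar>d\<bar> \<le> 2 ^ Bd" "2 \<le> Bd" and f: "s 47 0 = f"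
  shows "wp \<epsilon> Bd out_prog (\<lambda>s'. if 0 < f then s' 1 0 = 2 \<and> outs s' 1 n (\<lambda>t. D * g t) d
     else s' 1 0 = 1 \<and> (\<forall>i. i \<noteq> 0 \<longrightarrow> s' 1 i = s 1 i)) s"
proof -
  have two: "2 \<le> (2 :: int) ^ Bd" using bds(3) power_increasing[of 1 Bd "2 :: int"] by simp
  show ?thesis
  proof (cases "0 < f")
    case True
    have w: "wp \<epsilon> Bd (write_prog (Const 1) (Mul (V 4) (Ix 14 (Sub (V 2) (Const 1)) 7)) (Get 15 (V 2)))
      (\<lambda>s'. outs s' 1 n (\<lambda>t. D * g t) d) s"
    proof (rule wp_mono[OF wp_write_prog[where n = n and a = 1 and X = "\<lambda>t. D * g t" and Q = d]])
      fix t s' assume t: "t < n" "s' 7 0 = int t" "\<And>y. y \<notin> {1, 7} \<Longrightarrow> s' y = s y"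
      have "s 14 ((int n - 1) * int n + int t) = g t"
        using mtD[OF W(1) t(1)] n(3) by (simp add: of_nat_diff)
      then show "aok \<epsilon> Bd (Mul (V 4) (Ix 14 (Sub (V 2) (Const 1)) 7)) s' \<and>
        aval \<epsilon> (Mul (V 4) (Ix 14 (Sub (V 2) (Const 1)) 7)) s' = D * g t \<and> aok \<epsilon> Bd (Get 15 (V 2)) s' \<and> aval \<epsilon> (Get 15 (V 2)) s' = d"
        using t n D W(2) by (simp add: Ix_def)
    qed (use n bds in auto)
    show ?thesis using True f two by (auto simp: out_prog_def outs_def intro!: wp_mono[OF w])
  next
    case False
    have "(1 :: int) \<le> 2 ^ Bd" using two by linarith
    then show ?thesis using False f by (simp add: out_prog_def)
  qed
qed

text \<open>What correctness needs to know about a run. Here \<open>l\<close> is the lower end of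
  the bisection, \<open>u\<close> the two directions and \<open>B\<close> the reduced basis; memory
  occurs only through the output and the records of the best values.\<close>

definition mitr_result :: "nat \<Rightarrow> nat \<Rightarrow> (nat \<Rightarrow> nat \<Rightarrow> int) \<Rightarrow> int \<Rightarrow> (nat \<Rightarrow> nat \<Rightarrow> int) \<Rightarrow> int \<Rightarrow> int \<Rightarrow> mem \<Rightarrow> bool" where
  "mitr_result n q M D B0 N E s \<longleftrightarrow> (\<exists>l g u B. 0 \<le> l \<and> spec_lower n N M g l (u 0) \<and> u 1 = M n \<and>
     spec_upper n N M (l + 1) \<and> minor B n \<noteq> 0 \<and> mixed n q B = mixed n q B0 \<and> (\<forall>k<n. \<not> swap_cond n q B k) \<and>
     (s 1 0 = 2 \<and> outs s 1 n (\<lambda>t. D * gs n B (n - 1) t) (gd n B n) \<and> bad n q B D N E \<or>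
      s 1 0 = 1 \<and> (\<exists>X Q. (\<forall>i<6. cand_ok n q B D (M (Suc n)) N E (u (i div 3)) (int i mod 3 - 1) (X i) (Q i)) \<and>
       best n 1 48 49 6 (\<lambda>i. fval n M (M n) (Q i) (X i)) Q X s \<and>
       best n (2 * int n + 1) 50 51 6 (\<lambda>i. - fval n M (M n) (Q i) (X i)) Q X s)))"

section \<open>Bit lengths of a complete run\<close>

definition dbits :: "nat \<Rightarrow> nat \<Rightarrow> nat" where
  "dbits n e = gbits n (e + e)"

definition vbits :: "nat \<Rightarrow> nat \<Rightarrow> nat \<Rightarrow> nat" where
  "vbits n K e = Suc (Suc (K + (n * n + (e + e + (e + e)))))"

definition ubits :: "nat \<Rightarrow> nat \<Rightarrow> nat \<Rightarrow> nat" where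
  "ubits n K e = gbits n (vbits n K e) + (e + e)"

definition lbits :: "nat \<Rightarrow> nat \<Rightarrow> nat" where
  "lbits n e = n + dbits n e + (e + e)"

definition rbits :: "nat \<Rightarrow> nat \<Rightarrow> nat \<Rightarrow> nat" where
  "rbits n K e = sbits n K (ubits n K e) + (e + e) + 1 + n * (n + dbits n e + lbits n e + 2)"

definition xbits :: "nat \<Rightarrow> nat \<Rightarrow> nat \<Rightarrow> nat" where
  "xbits n K e = Suc (K + ubits n K e + rbits n K e + (e + e) + sbits n K (ubits n K e))"

text \<open>The sum of all bounds demanded by the parts, so that each demand follows by dropping
  summands.\<close>

definition mbits :: "nat \<Rightarrow> nat \<Rightarrow> nat \<Rightarrow> nat" where
  "mbits n K e =
     2 * n * (n + 1) + K + 16 + (n + (vbits n K e + gbits n (vbits n K e))) +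
     (n + (lbits n e + gbits n (lbits n e))) + (lbits n e + n * (n + gbits n (lbits n e) + lbits n e + 2)) +
     Suc (Suc n * dbits n e) + (2 * n + (e + e) + 2 * xbits n K e + 1)"

text \<open>The squared length is a product of two consecutive Gram determinants. In contrast to
  \<open>gbits_bounds\<close>, the entries of \<open>B\<close> do not enter.\<close>

lemma gs_le:
  assumes B: "minor B n \<noteq> 0" and gd: "\<And>i. i \<le> n \<Longrightarrow> gd n B i \<le> 2 ^ x" and i: "i < n" "t < n"
  shows "\<bar>gs n B i t\<bar> \<le> 2 ^ x"
proof -
  have "(gs n B i t)\<^sup>2 \<le> dot n (gs n B i) (gs n B i)"
    unfolding dot_def power2_eq_square by (rule member_le_sum) (use i in auto)
  also have "\<dots> = gd n B i * gd n B (Suc i)"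
    using gd_pos[OF B, of i] i by (intro dot_gs_gs) simp
  also have "\<dots> \<le> 2 ^ x * 2 ^ x"
    using gd[of i] gd[of "Suc i"] gd_pos[OF B, of i] gd_pos[OF B, of "Suc i"] i by (intro mult_mono) auto
  finally have "(gs n B i t)\<^sup>2 \<le> (2 ^ x)\<^sup>2" by (simp only: power2_eq_square)
  then have "\<bar>gs n B i t\<bar> \<le> \<bar>2 ^ x\<bar>" by (subst abs_le_square_iff)
  then show ?thesis by simp
qed

lemma wp_mitr_prog:
  fixes num den :: "nat \<Rightarrow> int"
  defines "D n \<equiv> \<Prod>j<2 * n * (n + 1). den j"
  defines "M n \<equiv> \<lambda>i t. if i < 2 * n + 2 \<and> t < n then num (i * n + t) * (D n div den (i * n + t)) else 0"
  defines "B0 n p \<equiv> \<lambda>i t. if i < n then M n ((if i < n - p then i + p else i - (n - p)) + n + 2) t else 0"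
  assumes s: "s 0 0 = int n" "s 0 1 = int p" "p \<le> n" "0 < n" and s0: "\<And>x. x \<noteq> 0 \<Longrightarrow> s x = (\<lambda>_. 0)"
    and inp: "\<And>j. j < 2 * n * (n + 1) \<Longrightarrow> s 0 (2 * int j + 2) = num j \<and> s 0 (2 * int j + 3) = den j"
    and den: "\<And>j. j < 2 * n * (n + 1) \<Longrightarrow> 0 < den j" "D n \<le> 2 ^ e"
    and num: "\<And>j. j < 2 * n * (n + 1) \<Longrightarrow> \<bar>num j\<bar> \<le> 2 ^ e"
    and sym: "\<And>a b. a < n \<Longrightarrow> b < n \<Longrightarrow> M n a b = M n b a" and B0: "minor (B0 n p) n \<noteq> 0"
    and eps: "0 < \<epsilon>" "\<epsilon> < 1" "16 \<le> 2 ^ K * \<epsilon>" and Bd: "mbits n K e \<le> Bd"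
  shows "wp \<epsilon> Bd mitr_prog (\<lambda>s'. \<exists>k. 16 \<le> \<lfloor>2 ^ k * \<epsilon>\<rfloor> \<and>
    mitr_result n (n - p) (M n) (D n) (B0 n p) (2 ^ k) (\<lfloor>2 ^ k * \<epsilon>\<rfloor> + 1) s') s" (is "wp _ _ _ ?Q s")
proof -
  let ?Z = "2 * n * (n + 1)" and ?q = "n - p" and ?D = "D n" and ?M = "M n" and ?B0 = "B0 n p"
  note bd = Bd[unfolded mbits_def]
  have D0: "0 < ?D" unfolding D_def by (rule prod_pos) (use den(1) in auto)
  have idx: "i * n + t < ?Z \<longleftrightarrow> i < 2 * n + 2" if "t < n" for i t
  proof -
    have *: "?Z = (2 * n + 2) * n" by simp
    show ?thesis
    proof
      assume "i * n + t < ?Z"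
      then have "i * n < (2 * n + 2) * n" unfolding * by linarith
      then show "i < 2 * n + 2" using mult_less_cancel2 by blast
    next
      assume "i < 2 * n + 2"
      then have "Suc i * n \<le> (2 * n + 2) * n" by (intro mult_le_mono1) simp
      then show "i * n + t < ?Z" unfolding * using that by simp
    qed
  qed
  have Mb: "\<bar>?M i t\<bar> \<le> 2 ^ (e + e)" for i t
  proof (cases "i < 2 * n + 2 \<and> t < n")
    case True
    let ?j = "i * n + t"
    have j: "?j < ?Z" using idx True by blast
    have "?D div den ?j \<le> ?D" "0 \<le> ?D div den ?j"
      using zdiv_mono2[of ?D 1 "den ?j"] D0 den(1)[OF j] by (simp_all add: pos_imp_zdiv_nonneg_iff)
    then have "\<bar>num ?j * (?D div den ?j)\<bar> \<le> 2 ^ (e + e)"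
      using num[OF j] den(2) by (intro abs_mult_le_pow2) auto
    then show ?thesis using True by (simp add: M_def)
  qed (auto simp: M_def)
  have e2: "x \<le> 2 ^ (e + e)" if "x \<le> 2 ^ e" for x :: int by (rule le_pow2_mono[OF that]) simp
  have ub: "\<bar>v\<bar> \<le> 2 ^ Bd" if "\<bar>v\<bar> \<le> 2 ^ (e + e)" for v :: int
    by (rule abs_le_pow2_mono[OF that]) (use bd in simp)
  have Bb: "\<bar>?B0 i t\<bar> \<le> 2 ^ (e + e)" for i t using Mb by (simp add: B0_def)
  have lat0: "lat n ?q (mixed n ?q ?B0) (dbits n e) ?B0"
    unfolding lat_def
  proof (intro conjI allI impI refl B0)
    fix i assume "i \<le> n"
    then have "\<bar>minor (gram n ?B0 ?B0) i\<bar> \<le> 2 ^ gbits n (e + e)" by (rule gbits_bounds(1)[rotated 2]) (use Bb in auto)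
    then show "gd n ?B0 i \<le> 2 ^ dbits n e" by (simp add: gd_def dbits_def)
  qed
  show ?thesis unfolding mitr_prog_def
  proof (subst wp.simps, rule wp_frame[OF wp_init_prog[where n = n and p = p and Z = ?Z and num = num and den = den and e = e]])
    fix s1 assume t1: "s1 2 0 = int n \<and> s1 3 0 = int (n - p) \<and> s1 8 0 = int p \<and> s1 4 0 = (\<Prod>j<?Z. den j) \<and>
       (\<forall>j. s1 6 (int j) = (if j < ?Z then num j * ((\<Prod>j<?Z. den j) div den j) else s 6 (int j)))"
      and fr1: "\<And>y. y \<notin> mods init_prog \<Longrightarrow> s1 y = s y"
    have r1: "s1 2 0 = int n" "s1 3 0 = int ?q" "s1 8 0 = int p" "s1 4 0 = ?D" using t1 unfolding D_def by blast+
    have M1: "mt n (s1 6) = ?M"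
    proof (intro ext)
      fix i t
      have "s1 6 (int j) = (if j < ?Z then num j * (?D div den j) else s 6 (int j))" for j
        using t1 unfolding D_def by blast
      from this[of "i * n + t"] show "mt n (s1 6) i t = ?M i t" using idx[of t i] s0[of 6] by (auto simp: mt_def M_def)
    qed
    have z1: "mt n (s1 25) = (\<lambda>_ _. 0)" using fr1[of 25] s0[of 25] by (simp add: mt_def fun_eq_iff)
    show "wp \<epsilon> Bd (setup_prog ;; eps_prog ;; spec_prog ;; Row 24 (Const 1) 7 (Ix 6 (V 2) 7) ;;
      lll_prog ;; cand_prog ;; out_prog) ?Q s1"
    proof (subst wp.simps, rule wp_frame[OF wp_setup_prog[OF r1(1) _ r1(3) s(3) r1(2) M1[symmetric] _ z1]])
      fix s2 assume t2: "mt n (s2 25) = (\<lambda>i t. if i < n then ?M ((if i < ?q then i + p else i - ?q) + n + 2) t else 0)"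
        and fr2: "\<And>y. y \<notin> mods setup_prog \<Longrightarrow> s2 y = s1 y"
      have B2: "mt n (s2 25) = ?B0" unfolding t2 B0_def by (rule refl)
      show "wp \<epsilon> Bd (eps_prog ;; spec_prog ;; Row 24 (Const 1) 7 (Ix 6 (V 2) 7) ;;
        lll_prog ;; cand_prog ;; out_prog) ?Q s2"
      proof (subst wp.simps, rule wp_frame[OF wp_eps_prog[OF eps]])
        fix s3 assume t3: "\<exists>k\<le>K. s3 10 0 = 2 ^ k \<and> s3 11 0 = \<lfloor>2 ^ k * \<epsilon>\<rfloor> + 1 \<and> 16 \<le> \<lfloor>2 ^ k * \<epsilon>\<rfloor>"
          and fr3: "\<And>y. y \<notin> mods eps_prog \<Longrightarrow> s3 y = s2 y"
        obtain k where k: "k \<le> K" "s3 10 0 = 2 ^ k" "s3 11 0 = \<lfloor>2 ^ k * \<epsilon>\<rfloor> + 1" "16 \<le> \<lfloor>2 ^ k * \<epsilon>\<rfloor>"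
          using t3 by blast
        define N :: int where "N = 2 ^ k"
        define E where "E = \<lfloor>2 ^ k * \<epsilon>\<rfloor> + 1"
        have N3: "s3 10 0 = N" "s3 11 0 = E" "1 \<le> N" "N \<le> 2 ^ K" "0 \<le> E" "E \<le> N"
        proof -
          have "\<lfloor>2 ^ k * \<epsilon>\<rfloor> < N" using eps(1,2) by (simp add: floor_less_iff N_def)
          then show "E \<le> N" unfolding E_def by simp
          show "N \<le> 2 ^ K" unfolding N_def using k(1) by (intro power_increasing) auto
        qed (use k in \<open>simp_all add: N_def E_def\<close>)
        have r3: "s3 2 0 = int n" "s3 3 0 = int ?q" "s3 4 0 = ?D" "mt n (s3 6) = ?M" "mt n (s3 25) = ?B0"
          using fr3[of 2] fr2[of 2] fr3[of 3] fr2[of 3] fr3[of 4] fr2[of 4] fr3[of 6] fr2[of 6] fr3[of 25] r1 M1 B2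
          by simp_all
        have "wp \<epsilon> Bd (spec_prog ;; Row 24 (Const 1) 7 (Ix 6 (V 2) 7) ;; lll_prog ;; cand_prog ;; out_prog)
          (mitr_result n ?q ?M ?D ?B0 N E) s3"
        proof (subst wp.simps, rule wp_frame[OF wp_spec_prog[where n = n and N = N and k = K and H = ?M and e = "e + e"
              and h = "Suc (K + (n * n + (e + e + (e + e))))"]])
          fix s4 assume t4: "\<exists>l\<ge>0. spec_lower n N ?M (gbits n (Suc (Suc (K + (n * n + (e + e + (e + e))))))) l (mt n (s4 24) 0) \<and>
              spec_upper n N ?M (l + 1)"
            and fr4: "\<And>y. y \<notin> mods spec_prog \<Longrightarrow> s4 y = s3 y"
          obtain l where l: "0 \<le> l" "spec_lower n N ?M (gbits n (vbits n K e)) l (mt n (s4 24) 0)" "spec_upper n N ?M (l + 1)"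
            using t4 unfolding vbits_def by blast
          let ?v = "mt n (s4 24) 0"
          have r4: "s4 2 0 = int n" "mt n (s4 6) = ?M"
            using fr4[of 2] fr4[of 6] r3 by simp_all
          show "wp \<epsilon> Bd (Row 24 (Const 1) 7 (Ix 6 (V 2) 7) ;; lll_prog ;; cand_prog ;; out_prog)
            (mitr_result n ?q ?M ?D ?B0 N E) s4"
          proof (subst wp.simps, rule wp_Row[where n = n and k = 1 and h = "?M n"])
            fix t and s' :: mem assume t: "t < n" "s' 7 0 = int t" and fr': "\<And>y. y \<notin> {24, 7} \<Longrightarrow> s' y = s4 y"
            have "s' 6 (int n * int n + int t) = ?M n t"
              using fr'[of 6] mtD[OF fun_cong[OF r4(2)] t(1)] by simp
            then show "aok \<epsilon> Bd (Ix 6 (V 2) 7) s' \<and> aval \<epsilon> (Ix 6 (V 2) 7) s' = ?M n t"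
              using fr'[of 2] r4 t by (simp add: Ix_def)
          next
            fix s5 assume t5: "mt n (s5 24) = (mt n (s4 24))(1 := \<lambda>t. if t < n then ?M n t else 0)"
              and fr5: "\<And>y. y \<notin> {24, 7} \<Longrightarrow> s5 y = s4 y"
            define u where "u = mt n (s5 24)"
            have u: "u 0 = ?v" "u 1 = ?M n"
              unfolding u_def t5 by (simp_all add: M_def fun_eq_iff)
            have ubd: "\<bar>u i t\<bar> \<le> 2 ^ ubits n K e" if "i < 2" "t < n" for i t
            proof (cases "i = 0")
              case True
              have "\<bar>?v t\<bar> \<le> 2 ^ gbits n (vbits n K e)" using l(2) that unfolding spec_lower_def by blast
              then show ?thesis using True u(1) by - (rule abs_le_pow2_mono[of _ "gbits n (vbits n K e)"], simp_all add: ubits_def)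
            next
              case False
              then have "i = 1" using that by simp
              then show ?thesis using u(2) Mb[of n t] by - (rule abs_le_pow2_mono[of _ "e + e"], simp_all add: ubits_def)
            qed
            have r5: "s5 2 0 = int n" "s5 3 0 = int ?q" "mt n (s5 25) = ?B0" "mt n (s5 6) = ?M"
              using fr5[of 2] fr5[of 3] fr5[of 25] fr5[of 6] fr4[of 3] fr4[of 25] r4 r3 by simp_all
            show "wp \<epsilon> Bd (lll_prog ;; cand_prog ;; out_prog) (mitr_result n ?q ?M ?D ?B0 N E) s5"
            proof (subst wp.simps, rule wp_frame[OF wp_lll_prog[where n = n and q = ?q and M = "mixed n ?q ?B0" and x = "dbits n e" and a = "lbits n e"]])
              fix s6 assume t6: "lat n ?q (mixed n ?q ?B0) (dbits n e) (mt n (s6 25)) \<and>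
                (\<forall>i<n. \<forall>t<n. \<bar>mt n (s6 25) i t\<bar> \<le> 2 ^ lbits n e) \<and> lll_final n ?q s6"
                and fr6: "\<And>y. y \<notin> mods lll_prog \<Longrightarrow> s6 y = s5 y"
              define B where "B = mt n (s6 25)"
              have B: "minor B n \<noteq> 0" "mixed n ?q B = mixed n ?q ?B0" "\<And>i. i \<le> n \<Longrightarrow> gd n B i \<le> 2 ^ dbits n e"
                "\<And>i t. i < n \<Longrightarrow> t < n \<Longrightarrow> \<bar>B i t\<bar> \<le> 2 ^ lbits n e"
                "\<And>i. i < n \<Longrightarrow> mt n (s6 14) i = gs n B i" "\<And>i. i \<le> n \<Longrightarrow> s6 15 (int i) = gd n B i"
                "\<forall>k<n. \<not> swap_cond n ?q B k"
                using t6 unfolding lat_def lll_final_def B_def by blast+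
              have gsb: "\<bar>gs n B i t\<bar> \<le> 2 ^ dbits n e" if "i < n" "t < n" for i t
                using gs_le[OF B(1) B(3)] that by blast
              have r6: "s6 2 0 = int n" "s6 3 0 = int ?q" "s6 10 0 = N" "s6 11 0 = E" "s6 4 0 = ?D" "u = mt n (s6 24)" "?M = mt n (s6 6)"
                using fr6[of 2] fr6[of 3] fr6[of 10] fr6[of 11] fr6[of 4] fr6[of 24] fr6[of 6] fr5[of 10] fr5[of 11] fr5[of 4]
                  fr4[of 10] fr4[of 11] fr4[of 4] N3 r5 r3 by (simp_all only: u_def) simp_all
              show "wp \<epsilon> Bd (cand_prog ;; out_prog) (mitr_result n ?q ?M ?D ?B0 N E) s6"
              proof (subst wp.simps, rule wp_frame[OF wp_cand_prog[OF r6(1,2) _ r6(3,4) N3(5,6,4) r6(5) D0 e2[OF den(2)] r6(6) ubd r6(7) Mb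
                    B_def B(1,5,6,4,3) gsb rbits_def xbits_def]])
                fix s7 assume inv: "cand_inv n ?q B ?D ?M N E u 6 s7" and fr7: "\<And>y. y \<notin> mods cand_prog \<Longrightarrow> s7 y = s6 y"
                have f01: "s7 47 0 = 1 \<and> bad n ?q B ?D N E \<or> s7 47 0 = 0" using inv unfolding cand_inv_def by blast
                have Dg: "\<bar>?D * gs n B (n - 1) t\<bar> \<le> 2 ^ Bd" if "t < n" for t
                proof (rule abs_le_pow2_mono[of _ "e + dbits n e"])
                  show "\<bar>?D * gs n B (n - 1) t\<bar> \<le> 2 ^ (e + dbits n e)"
                    using den(2) D0 gsb[of "n - 1" t] that s(4) by (intro abs_mult_le_pow2) auto
                qed (use bd in \<open>simp add: lbits_def\<close>)
                have dB: "\<bar>gd n B n\<bar> \<le> 2 ^ Bd"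
                  by (rule abs_le_pow2_mono[of _ "dbits n e"]) (use B(3)[of n] gd_pos[OF B(1), of n] bd in \<open>auto simp: lbits_def\<close>)
                show "wp \<epsilon> Bd out_prog (mitr_result n ?q ?M ?D ?B0 N E) s7"
                proof (rule wp_frame[OF wp_out_prog[where n = n and D = ?D and g = "gs n B (n - 1)" and d = "gd n B n" and f = "s7 47 0"]])
                  fix s8 assume t8: "if 0 < s7 47 0 then s8 1 0 = 2 \<and> outs s8 1 n (\<lambda>t. ?D * gs n B (n - 1) t) (gd n B n)
                      else s8 1 0 = 1 \<and> (\<forall>i. i \<noteq> 0 \<longrightarrow> s8 1 i = s7 1 i)"
                    and fr8: "\<And>y. y \<notin> mods out_prog \<Longrightarrow> s8 y = s7 y"
                  have "s8 1 0 = 2 \<and> outs s8 1 n (\<lambda>t. ?D * gs n B (n - 1) t) (gd n B n) \<and> bad n ?q B ?D N E \<or>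
                    s8 1 0 = 1 \<and> (\<exists>X Q. (\<forall>i<6. cand_ok n ?q B ?D (?M (Suc n)) N E (u (i div 3)) (int i mod 3 - 1) (X i) (Q i)) \<and>
                     best n 1 48 49 6 (\<lambda>i. fval n ?M (?M n) (Q i) (X i)) Q X s8 \<and>
                     best n (2 * int n + 1) 50 51 6 (\<lambda>i. - fval n ?M (?M n) (Q i) (X i)) Q X s8)"
                  proof (cases "s7 47 0 = 1")
                    case True
                    then show ?thesis using t8 f01 by simp
                  next
                    case False
                    then have f0: "s7 47 0 = 0" using f01 by blast
                    then have s8: "s8 1 0 = 1" "\<And>i. i \<noteq> 0 \<Longrightarrow> s8 1 i = s7 1 i" using t8 by simp_all
                    have "\<exists>X Q. (\<forall>i<6. cand_ok n ?q B ?D (?M (Suc n)) N E (u (i div 3)) (int i mod 3 - 1) (X i) (Q i)) \<and>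
                      best n 1 48 49 6 (\<lambda>i. fval n ?M (?M n) (Q i) (X i)) Q X s7 \<and>
                      best n (2 * int n + 1) 50 51 6 (\<lambda>i. - fval n ?M (?M n) (Q i) (X i)) Q X s7"
                      using inv f0 by (simp add: cand_inv_def)
                    then obtain X Q where XQ:
                      "\<forall>i<6. cand_ok n ?q B ?D (?M (Suc n)) N E (u (i div 3)) (int i mod 3 - 1) (X i) (Q i)"
                      "best n 1 48 49 6 (\<lambda>i. fval n ?M (?M n) (Q i) (X i)) Q X s7"
                      "best n (2 * int n + 1) 50 51 6 (\<lambda>i. - fval n ?M (?M n) (Q i) (X i)) Q X s7"
                      by (elim exE conjE)
                    have "best n 1 48 49 6 (\<lambda>i. fval n ?M (?M n) (Q i) (X i)) Q X s8"
                      "best n (2 * int n + 1) 50 51 6 (\<lambda>i. - fval n ?M (?M n) (Q i) (X i)) Q X s8"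
                      by (rule best_cong[OF XQ(2)] best_cong[OF XQ(3)]; use s8(2) fr8 in auto)+
                    then show ?thesis using s8(1) XQ(1) by blast
                  qed
                  moreover have "spec_lower n N ?M (gbits n (vbits n K e)) l (u 0)" using l(2) u(1) by simp
                  ultimately show "mitr_result n ?q ?M ?D ?B0 N E s8"
                    unfolding mitr_result_def using l(1,3) u(2) B(1,2,7) by blast
                next
                  show "s7 2 0 = int n" "s7 4 0 = ?D" "mt n (s7 14) (n - 1) = gs n B (n - 1)" "s7 15 (int n) = gd n B n"
                    using fr7[of 2] fr7[of 4] fr7[of 14] fr7[of 15] r6 B(5)[of "n - 1"] B(6)[of n] s(4) by simp_all
                  show "n \<le> Bd" "2 \<le> Bd" using bd by simp_all
                qed (use Dg dB s(4) in auto)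
              next
                show "2 * n + (e + e) + 2 * xbits n K e + 1 \<le> Bd" "6 \<le> Bd" using bd by simp_all
              qed (use s(3) in simp)
            next
              show "\<bar>mt n (s5 25) i t\<bar> \<le> 2 ^ lbits n e" for i t
                unfolding r5(3) by (rule abs_le_pow2_mono[OF Bb]) (simp add: lbits_def)
              show "n + dbits n e \<le> lbits n e" by (simp add: lbits_def)
              show "n + (lbits n e + gbits n (lbits n e)) \<le> Bd" using bd by simp
              show "lbits n e + n * (n + gbits n (lbits n e) + lbits n e + 2) \<le> Bd" using bd by simp
              show "Suc (Suc n * dbits n e) \<le> Bd" using bd by simp
              show "lat n ?q (mixed n ?q ?B0) (dbits n e) (mt n (s5 25))" using lat0 r5(3) by simp
            qed (use r5 in auto)
          next
            show "n \<le> Bd" using bd by simp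
          qed (use r4 ub Mb in auto)
        next
          show "n * n \<le> Bd" using bd by (simp add: algebra_simps)
          show "n + (Suc (Suc (K + (n * n + (e + e + (e + e))))) + gbits n (Suc (Suc (K + (n * n + (e + e + (e + e))))))) \<le> Bd"
            using bd by (simp add: vbits_def)
        qed (use r3 N3 s(4) sym Mb in auto)
        then show "wp \<epsilon> Bd (spec_prog ;; Row 24 (Const 1) 7 (Ix 6 (V 2) 7) ;; lll_prog ;; cand_prog ;; out_prog) ?Q s3"
          by (rule wp_mono) (use k(4) in \<open>auto simp: N_def E_def\<close>)
      next
        show "K \<le> Bd" "16 \<le> Bd" using bd by simp_all
      qed
    next
      show "n \<le> Bd" using bd by simp
    qed (use Mb ub in blast)
  next
    show "2 * e \<le> Bd" "?Z \<le> Bd" using bd by simp_all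
  qed (use s inp den num in \<open>auto simp: D_def\<close>)
qed

section \<open>The gap between the best and the worst candidate\<close>

abbreviation nm :: "nat \<Rightarrow> (nat \<Rightarrow> real) \<Rightarrow> real" where
  "nm n x \<equiv> L2_set x {..<n}"

lemma dot_nm: "dot n x x = (nm n x)\<^sup>2"
  by (simp add: dot_def L2_set_def sum_nonneg power2_eq_square)

lemma abs_dot_le: "\<bar>dot n x y\<bar> \<le> nm n x * nm n y"
proof -
  have "\<bar>dot n x y\<bar> \<le> (\<Sum>t<n. \<bar>x t\<bar> * \<bar>y t\<bar>)"
    unfolding dot_def by (rule order_trans[OF sum_abs]) (simp add: abs_mult)
  also have "\<dots> \<le> nm n x * nm n y" by (rule L2_set_mult_ineq)
  finally show ?thesis .
qed

lemma nm_scale: "nm n (\<lambda>t. c * x t) = \<bar>c\<bar> * nm n x"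
  by (simp add: L2_set_def power_mult_distrib real_sqrt_mult flip: sum_distrib_left)

lemma nm_add_le: "nm n (\<lambda>t. x t + c * y t) \<le> nm n x + \<bar>c\<bar> * nm n y"
  using L2_set_triangle_ineq[of x "\<lambda>t. c * y t" "{..<n}"] by (simp add: nm_scale)

lemma dot_add: "dot n x (\<lambda>t. y t + c * z t) = dot n x y + c * dot n x (z :: nat \<Rightarrow> real)"
  by (simp add: dot_def algebra_simps sum.distrib sum_distrib_left)

lemma dot_scale_right: "dot n x (\<lambda>t. c * y t) = c * dot n x (y :: nat \<Rightarrow> real)"
  by (simp add: dot_def algebra_simps sum_distrib_left)

lemma bform_scale: "bform N A (\<lambda>a. c * x a) y = c * bform N A x y" "bform N A y (\<lambda>a. c * x a) = c * bform N A y x"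
  by (simp_all add: bform_def algebra_simps sum_distrib_left)

lemma bform_parallelogram:
  assumes sym: "\<And>a b. a < N \<Longrightarrow> b < N \<Longrightarrow> A a b = A b a"
  shows "bform N A (\<lambda>a. x a + c * y a) (\<lambda>a. x a + c * y a) = bform N A x x + 2 * c * bform N A x y + c\<^sup>2 * bform N A y y"
  using bform_sym[where x = y and y = x, OF sym] by (simp add: bform_add algebra_simps power2_eq_square)

text \<open>Polarization after scaling both vectors to the same length; the parallelogram identity
  then turns the two bounds on the diagonal into the product of the norms.\<close>

lemma abs_bform_le:
  assumes sym: "\<And>a b. a < n \<Longrightarrow> b < n \<Longrightarrow> A a b = A b a"
    and th: "\<And>x. \<bar>bform n A x x\<bar> \<le> \<theta> * dot n x x"
  shows "\<bar>bform n A x y\<bar> \<le> \<theta> * (nm n x * nm n y)"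
proof (cases "nm n x = 0 \<or> nm n y = 0")
  case True
  then have "bform n A x y = 0" by (auto simp: bform_def L2_set_eq_0_iff)
  then show ?thesis using True by auto
next
  case False
  let ?X = "nm n x" and ?Y = "nm n y"
  have pos: "0 < ?X" "0 < ?Y" using False by (simp_all add: order_less_le)
  let ?p = "\<lambda>t. ?Y * x t" and ?q = "\<lambda>t. ?X * y t"
  let ?s = "\<lambda>c t. ?p t + c * ?q t"
  have "4 * bform n A ?p ?q = bform n A (?s 1) (?s 1) - bform n A (?s (- 1)) (?s (- 1))"
    by (simp only: bform_parallelogram[OF sym]) simp
  then have "4 * \<bar>bform n A ?p ?q\<bar> \<le> \<theta> * dot n (?s 1) (?s 1) + \<theta> * dot n (?s (- 1)) (?s (- 1))"
    using th[of "?s 1"] th[of "?s (- 1)"] by linarith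
  also have "\<dots> = \<theta> * (dot n (?s 1) (?s 1) + dot n (?s (- 1)) (?s (- 1)))" by (rule distrib_left[symmetric])
  also have "dot n (?s 1) (?s 1) + dot n (?s (- 1)) (?s (- 1)) = 2 * (dot n ?p ?p + dot n ?q ?q)"
    unfolding dot_def sum_distrib_left sum.distrib[symmetric] by (intro sum.cong refl) (simp add: algebra_simps)
  also have "dot n ?p ?p + dot n ?q ?q = 2 * (?X * ?Y) * (?X * ?Y)"
    by (simp only: dot_nm nm_scale) (simp add: power2_eq_square algebra_simps)
  also have "bform n A ?p ?q = ?X * ?Y * bform n A x y" unfolding bform_scale by simp
  finally have "?X * ?Y * \<bar>bform n A x y\<bar> \<le> (?X * ?Y) * (\<theta> * (?X * ?Y))"
    using pos by (simp add: abs_mult)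
  then show ?thesis using pos by (simp add: mult_le_cancel_left)
qed

lemma isqrt_unique: "isqrt m r \<Longrightarrow> isqrt m r' \<Longrightarrow> r = r'"
proof -
  have "r \<le> r'" if "isqrt m r" "isqrt m r'" for r r'
  proof -
    have "(r - 1) * (r - 1) < r' * r'" "0 \<le> r - 1" "0 \<le> r'" using that by (auto simp: isqrt_def)
    then have "r - 1 < r'" by (meson mult_mono not_le)
    then show ?thesis by simp
  qed
  then show "isqrt m r \<Longrightarrow> isqrt m r' \<Longrightarrow> r = r'" by (simp add: order_antisym)
qed

text \<open>\<open>r\<close> is the least integer above N |u|. A nonzero integer vector has length
  at least 1, so rounding up costs at most the factor N / (N + 1), which is at least 1 -
  1/N.\<close>

lemma isqrt_center:
  assumes r: "isqrt (N * N * dot n u u) r" and N: "1 \<le> N"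
  shows "0 < r" "of_int N * nm n (rv u) / of_int r \<le> 1" "\<exists>t<n. u t \<noteq> 0 \<Longrightarrow> 1 - 1 / of_int N \<le> of_int N * nm n (rv u) / of_int r"
proof -
  let ?S = "of_int N * nm n (rv u)"
  have r0: "0 < r" using r by (simp add: isqrt_def)
  then show "0 < r" .
  have S0: "0 \<le> ?S" using N by simp
  have S2: "?S\<^sup>2 = of_int (N * N * dot n u u)"
    by (simp add: power_mult_distrib dot_of_int flip: dot_nm) (simp add: power2_eq_square)
  have "?S\<^sup>2 < (of_int r)\<^sup>2" using r unfolding S2 isqrt_def by (simp add: power2_eq_square flip: of_int_mult)
  then have lt: "?S < of_int r" by (rule power2_less_imp_less) (use r0 in simp)
  then show "?S / of_int r \<le> 1" using r0 by simp
  have "(of_int r - 1)\<^sup>2 = (of_int ((r - 1) * (r - 1)) :: real)" by (simp add: power2_eq_square)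
  also have "\<dots> \<le> ?S\<^sup>2" using r unfolding S2 isqrt_def by (simp only: of_int_le_iff)
  finally have "of_int r - 1 \<le> ?S" by (rule power2_le_imp_le) (rule S0)
  assume "\<exists>t<n. u t \<noteq> 0"
  from dot_self_pos[OF this] have "1 \<le> dot n u u" by simp
  then have "1 \<le> (nm n (rv u))\<^sup>2" by (simp add: dot_of_int flip: dot_nm)
  then have "1 \<le> nm n (rv u)" using power2_le_imp_le[of 1 "nm n (rv u)"] by simp
  then have NS: "of_int N \<le> ?S" using N by simp
  have "(of_int N - 1) * of_int r \<le> (of_int N - 1) * (?S + 1)"
    using \<open>of_int r - 1 \<le> ?S\<close> N by (intro mult_left_mono) auto
  also have "\<dots> \<le> ?S * of_int N" using NS by (simp add: algebra_simps)
  finally show "1 - 1 / of_int N \<le> ?S / of_int r" using r0 N by (simp add: field_simps)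
qed

text \<open>The loss constants: three factors \<open>1 - d\<close> come from the bisection for the spectral norm and from the
  rounding of the length of the center.\<close>

lemma loss_form:
  fixes e d \<epsilon> \<theta> \<eta> :: real
  assumes e: "e \<le> \<epsilon> + d" "16 * d \<le> \<epsilon>" "0 \<le> d" "0 \<le> e" "e \<le> 1" "\<epsilon> \<le> 1 / 3" and th: "0 \<le> \<theta>" "\<eta> \<le> \<theta>"
  shows "(1 - 7 * \<epsilon>) * \<theta> \<le> \<theta> * (1 - d) * ((1 - e) * (1 - d))\<^sup>2 - 2 * \<theta> * e - 2 * \<eta> * e"
proof -
  have bern: "1 - (a + b) \<le> (1 - a) * (1 - b)" if "0 \<le> a" "0 \<le> b" for a b :: real
    using that by (simp add: algebra_simps)
  have d1: "d \<le> 1" using e by linarith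
  have sq: "1 - 2 * a \<le> (1 - a)\<^sup>2" for a :: real by (simp add: power2_eq_square algebra_simps)
  have "1 - (d + (2 * e + 2 * d)) \<le> (1 - d) * ((1 - e) * (1 - d))\<^sup>2"
  proof -
    have p: "1 - (e + d) \<le> (1 - e) * (1 - d)" using bern e by blast
    have "1 - 2 * (e + d) \<le> ((1 - e) * (1 - d))\<^sup>2"
      using sq[of "1 - (1 - e) * (1 - d)"] p by simp
    then have "(1 - d) * (1 - 2 * (e + d)) \<le> (1 - d) * ((1 - e) * (1 - d))\<^sup>2"
      using d1 by (intro mult_left_mono) auto
    moreover have "1 - (d + 2 * (e + d)) \<le> (1 - d) * (1 - 2 * (e + d))" using bern[of d "2 * (e + d)"] e by simp
    ultimately show ?thesis by simp
  qed
  \<comment> \<open>The right-hand side is at least 1 - 6 e - 3 d, hence at least 1 - 6 \<epsilon> -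
    9 d, and 9 d is at most 9 \<epsilon> / 16.\<close>
  then have "1 - 7 * \<epsilon> \<le> (1 - d) * ((1 - e) * (1 - d))\<^sup>2 - 4 * e" using e by linarith
  then have "\<theta> * (1 - 7 * \<epsilon>) \<le> \<theta> * ((1 - d) * ((1 - e) * (1 - d))\<^sup>2 - 4 * e)"
    using th(1) by (rule mult_left_mono)
  moreover have "2 * \<eta> * e \<le> 2 * \<theta> * e" using th(2) e by (simp add: mult_right_mono)
  ultimately show ?thesis by (simp add: algebra_simps)
qed

text \<open>Two opposite centers start from 2 instead of 1. What remains is at least 2 - 8 e - 2 d,
  hence at least 2 - 8 \<epsilon> - 10 d, and \<epsilon> \<le> 1/3 together with 16 d \<le>
  \<epsilon> makes \<epsilon> + 10 d less than 1.\<close>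

lemma loss_linear:
  fixes e d \<epsilon> \<theta> \<eta> :: real
  assumes e: "e \<le> \<epsilon> + d" "16 * d \<le> \<epsilon>" "0 \<le> d" "0 \<le> e" "\<epsilon> \<le> 1 / 3" and th: "0 \<le> \<eta>" "\<theta> \<le> \<eta>"
  shows "(1 - 7 * \<epsilon>) * \<eta> \<le> 2 * \<eta> * ((1 - e) * (1 - d)) - 2 * \<eta> * e - 4 * \<theta> * e"
proof -
  have "1 - (e + d) \<le> (1 - e) * (1 - d)" using e by (simp add: algebra_simps)
  then have "1 - 7 * \<epsilon> \<le> 2 * ((1 - e) * (1 - d)) - 6 * e" using e by linarith
  then have "\<eta> * (1 - 7 * \<epsilon>) \<le> \<eta> * (2 * ((1 - e) * (1 - d)) - 6 * e)" using th(1) by (rule mult_left_mono)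
  moreover have "4 * \<theta> * e \<le> 4 * \<eta> * e" using th(2) e by (simp add: mult_right_mono)
  ultimately show ?thesis by (simp add: algebra_simps)
qed

text \<open>The bilinear form at two unit vectors. For an integer matrix, a bound below 1 then
  forces all entries to vanish.\<close>

lemma abs_entry_le:
  assumes sym: "\<And>a b. a < n \<Longrightarrow> b < n \<Longrightarrow> A a b = A b a"
    and th: "\<And>x. \<bar>bform n A x x\<bar> \<le> \<theta> * dot n x x" and ab: "a < n" "b < n"
  shows "\<bar>of_int (A a b)\<bar> \<le> \<theta>"
proof -
  let ?e = "\<lambda>a t. if t = a then 1 else 0 :: real"
  have "nm n (?e a) = 1" if "a < n" for a
    using that by (simp add: L2_set_def if_distrib[where f = "\<lambda>x. x\<^sup>2"] cong: if_cong)
  moreover have "bform n A (?e a) (?e b) = of_int (A a b)"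
    using ab by (simp add: bform_def if_distrib[where f = "\<lambda>x. x * _"] if_distrib[where f = "\<lambda>x. _ * x"] cong: if_cong)
  ultimately show ?thesis using abs_bform_le[OF sym th, of "?e a" "?e b"] ab by simp
qed

text \<open>Expansion around \<open>c * w\<close> with an error vector of length at most
  \<open>e\<close>. Because |w| is at most 1 - e, the errors of the quadratic part at an outer
  center and at 0 add up to exactly 2 \<theta> e.\<close>

lemma near_form:
  assumes sym: "\<And>a b. a < n \<Longrightarrow> b < n \<Longrightarrow> A a b = A b a"
    and th: "\<And>x. \<bar>bform n A x x\<bar> \<le> \<theta> * dot n x x" "0 \<le> \<theta>"
    and x: "nm n (\<lambda>t. x t - c * w t) \<le> e" and w: "nm n w \<le> 1 - e"
  shows "\<bar>bform n A x x - c\<^sup>2 * bform n A w w\<bar> \<le> \<theta> * (2 * \<bar>c\<bar> * ((1 - e) * e) + e * e)"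
    "\<bar>dot n g x - c * dot n g w\<bar> \<le> nm n g * e"
proof -
  let ?p = "\<lambda>t. x t - c * w t" and ?y = "\<lambda>t. c * w t"
  have xe: "x = (\<lambda>t. ?y t + 1 * ?p t)" by simp
  have e: "0 \<le> e" "0 \<le> 1 - e" using order_trans[OF L2_set_nonneg x] order_trans[OF L2_set_nonneg w] .
  have "bform n A x x = bform n A (\<lambda>t. ?y t + 1 * ?p t) (\<lambda>t. ?y t + 1 * ?p t)" by (simp only: flip: xe)
  also have "\<dots> = bform n A ?y ?y + 2 * 1 * bform n A ?y ?p + 1\<^sup>2 * bform n A ?p ?p"
    by (rule bform_parallelogram[OF sym])
  finally have "\<bar>bform n A x x - c\<^sup>2 * bform n A w w\<bar> = \<bar>2 * c * bform n A w ?p + bform n A ?p ?p\<bar>"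
    by (simp add: bform_scale power2_eq_square)
  also have "\<dots> \<le> 2 * \<bar>c\<bar> * \<bar>bform n A w ?p\<bar> + \<bar>bform n A ?p ?p\<bar>"
    by (rule order_trans[OF abs_triangle_ineq]) (simp add: abs_mult)
  also have "\<dots> \<le> 2 * \<bar>c\<bar> * (\<theta> * ((1 - e) * e)) + \<theta> * (e * e)"
  proof (intro add_mono mult_left_mono)
    note b = abs_bform_le[OF sym th(1)]
    show "\<bar>bform n A w ?p\<bar> \<le> \<theta> * ((1 - e) * e)"
      using mult_left_mono[OF mult_mono[OF w x e(2) L2_set_nonneg] th(2)] b[of w ?p] by linarith
    show "\<bar>bform n A ?p ?p\<bar> \<le> \<theta> * (e * e)"
      using mult_left_mono[OF mult_mono[OF x x e(1) L2_set_nonneg] th(2)] b[of ?p ?p] by linarith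
  qed simp
  finally show "\<bar>bform n A x x - c\<^sup>2 * bform n A w w\<bar> \<le> \<theta> * (2 * \<bar>c\<bar> * ((1 - e) * e) + e * e)"
    by (simp add: algebra_simps)
  have "dot n g x - c * dot n g w = dot n g ?p"
    using dot_add[of n g x "- c" w] by simp
  then show "\<bar>dot n g x - c * dot n g w\<bar> \<le> nm n g * e"
    using abs_dot_le[of n g ?p] mult_left_mono[OF x L2_set_nonneg[of g "{..<n}"]] by linarith
qed

text \<open>The indices 0, 1, 2 stand for the centers -w, 0 and w, \<open>a\<close> for the
  quadratic and \<open>g\<close> for the linear part. The signs of \<open>b\<close> and
  \<open>L\<close> decide which outer point is compared with the middle one, so that the linear part
  does not work against the quadratic one.\<close>

lemma gap_cases:
  fixes a0 a1 a2 g0 g1 g2 b L K Q H m :: real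
  assumes F: "\<bar>a0 - b\<bar> \<le> K" "\<bar>g0 + L\<bar> \<le> H" "\<bar>a1\<bar> \<le> Q" "\<bar>g1\<bar> \<le> H" "\<bar>a2 - b\<bar> \<le> K" "\<bar>g2 - L\<bar> \<le> H"
    and m: "m \<le> \<bar>b\<bar> - (K + Q) - 2 * H"
  shows "m \<le> \<bar>a2 + g2 - (a1 + g1)\<bar> \<or> m \<le> \<bar>a0 + g0 - (a1 + g1)\<bar>"
proof -
  note F' = F[unfolded abs_le_iff]
  have "m \<le> a2 + g2 - (a1 + g1) \<or> m \<le> a0 + g0 - (a1 + g1)" if "0 \<le> b"
    using F' m that by (cases "0 \<le> L") auto
  moreover have "m \<le> - (a2 + g2 - (a1 + g1)) \<or> m \<le> - (a0 + g0 - (a1 + g1))" if "b < 0"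
    using F' m that by (cases "0 \<le> L") auto
  ultimately show ?thesis by linarith
qed

text \<open>The metric half of \<open>cand_ok\<close>, for a real point and without lattice
  membership.\<close>

definition near :: "nat \<Rightarrow> int \<Rightarrow> int \<Rightarrow> (nat \<Rightarrow> int) \<Rightarrow> int \<Rightarrow> (nat \<Rightarrow> real) \<Rightarrow> bool" where
  "near n N E u sg x \<longleftrightarrow> (\<exists>r. isqrt (N * N * dot n u u) r \<and>
     (let d = (\<lambda>t. x t - of_int (sg * (N - E)) * of_int (u t) / of_int r)
      in (of_int N)\<^sup>2 * dot n d d \<le> (of_int E :: real)\<^sup>2))"

text \<open>The rounded root is unique, so the three signs share one denominator and thus one vector
  \<open>w\<close>.\<close>

lemma near_center:
  assumes N: "1 \<le> N" "0 \<le> E" "E \<le> N" and x: "\<And>c. c < 3 \<Longrightarrow> near n N E u (int c - 1) (x c)"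
  obtains w \<kappa> where "0 \<le> \<kappa>" "w = (\<lambda>t. \<kappa> * of_int (u t))" "nm n w \<le> 1 - of_int E / of_int N"
    "\<exists>t<n. u t \<noteq> 0 \<Longrightarrow> (1 - of_int E / of_int N) * (1 - 1 / of_int N) \<le> nm n w"
    "\<And>c. c < 3 \<Longrightarrow> nm n (\<lambda>t. x c t - of_int (int c - 1) * w t) \<le> of_int E / of_int N"
proof -
  let ?e = "of_int E / of_int N :: real"
  obtain r where r: "isqrt (N * N * dot n u u) r" using x[of 0] by (auto simp: near_def)
  note R = isqrt_center[OF r N(1)]
  define \<kappa> :: real where "\<kappa> = of_int (N - E) / of_int r"
  have k: "0 \<le> \<kappa>" using R(1) N by (simp add: \<kappa>_def)
  have e: "0 \<le> 1 - ?e" using N by simp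
  have nw: "nm n (\<lambda>t. \<kappa> * of_int (u t)) = (1 - ?e) * (of_int N * nm n (rv u) / of_int r)"
  proof -
    have "\<kappa> = (1 - ?e) * (of_int N / of_int r)" using R(1) N by (simp add: \<kappa>_def left_diff_distrib diff_divide_distrib)
    then show ?thesis unfolding nm_scale abs_of_nonneg[OF k] by simp
  qed
  show ?thesis
  proof (rule that[of \<kappa> "\<lambda>t. \<kappa> * of_int (u t)"])
    show "nm n (\<lambda>t. \<kappa> * of_int (u t)) \<le> 1 - ?e" unfolding nw using mult_left_mono[OF R(2) e] by simp
    show "(1 - ?e) * (1 - 1 / of_int N) \<le> nm n (\<lambda>t. \<kappa> * of_int (u t))" if "\<exists>t<n. u t \<noteq> 0"
      unfolding nw by (rule mult_left_mono[OF R(3)[OF that] e])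
    fix c :: nat assume c: "c < 3"
    let ?d = "\<lambda>t. x c t - of_int (int c - 1) * (\<kappa> * of_int (u t))"
    obtain r' where r': "isqrt (N * N * dot n u u) r'"
      "let d = (\<lambda>t. x c t - of_int ((int c - 1) * (N - E)) * of_int (u t) / of_int r') in (of_int N)\<^sup>2 * dot n d d \<le> (of_int E :: real)\<^sup>2"
      using x[OF c] by (auto simp: near_def)
    have "(\<lambda>t. x c t - of_int ((int c - 1) * (N - E)) * of_int (u t) / of_int r') = ?d"
      unfolding isqrt_unique[OF r'(1) r] \<kappa>_def by (simp add: fun_eq_iff)
    then have "(of_int N)\<^sup>2 * (nm n ?d)\<^sup>2 \<le> (of_int E)\<^sup>2" using r'(2) by (simp add: Let_def dot_nm)
    then have "(of_int N * nm n ?d)\<^sup>2 \<le> (of_int E)\<^sup>2" by (simp add: power_mult_distrib)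
    then have "of_int N * nm n ?d \<le> of_int E" by (rule power2_le_imp_le) (use N in simp)
    then show "nm n ?d \<le> ?e" using N by (simp add: field_simps)
  qed (use k in auto)
qed

lemma objective_gap:
  fixes M :: "nat \<Rightarrow> nat \<Rightarrow> int" and x :: "nat \<Rightarrow> nat \<Rightarrow> real"
  assumes sym: "\<And>a b. a < n \<Longrightarrow> b < n \<Longrightarrow> M a b = M b a"
    and th: "\<And>z. \<bar>bform n M z z\<bar> \<le> \<theta> * dot n z z" "0 \<le> \<theta>"
      "\<And>\<tau>. 0 \<le> \<tau> \<Longrightarrow> (\<And>z. \<bar>bform n M z z\<bar> \<le> \<tau> * dot n z z) \<Longrightarrow> \<theta> \<le> \<tau>"
    and N: "1 \<le> N" "0 \<le> E" "E \<le> N"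
    and eps: "of_int E / of_int N \<le> \<epsilon> + 1 / of_int N" "16 / of_int N \<le> \<epsilon>" "\<epsilon> \<le> 1 / 3"
    and l: "0 \<le> l" "spec_lower n N M g l (u 0)" "spec_upper n N M (l + 1)" and u: "u 1 = M n"
    and x: "\<And>i. i < 6 \<Longrightarrow> near n N E (u (i div 3)) (int i mod 3 - 1) (x i)"
  defines "G \<equiv> \<lambda>z. bform n M z z + dot n (rv (M n)) z"
  shows "\<exists>i<6. \<exists>j<6. (1 - 7 * \<epsilon>) * max \<theta> (nm n (rv (M n))) \<le> \<bar>G (x i) - G (x j)\<bar>"
proof -
  define e d \<eta> where "e = of_int E / (of_int N :: real)" and "d = 1 / (of_int N :: real)" and "\<eta> = nm n (rv (M n))"
  have ed: "e \<le> \<epsilon> + d" "16 * d \<le> \<epsilon>" "0 \<le> d" "0 \<le> e" "e \<le> 1"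
    using eps N by (simp_all add: e_def d_def)
  have eta: "0 \<le> \<eta>" by (simp add: \<eta>_def)
  show ?thesis
  proof (cases "max \<theta> \<eta> = 0")
    case True
    then show ?thesis unfolding \<eta>_def by (intro exI[of _ 0] conjI) simp_all
  next
    case False
    show ?thesis
    proof (cases "\<eta> \<le> \<theta>")
      case True
      obtain w \<kappa> where w: "0 \<le> \<kappa>" "w = (\<lambda>t. \<kappa> * of_int (u 0 t))" "nm n w \<le> 1 - e"
        "\<exists>t<n. u 0 t \<noteq> 0 \<Longrightarrow> (1 - e) * (1 - d) \<le> nm n w"
        "\<And>c. c < 3 \<Longrightarrow> nm n (\<lambda>t. x c t - of_int (int c - 1) * w t) \<le> e"
        unfolding e_def d_def
      proof (rule near_center[OF N])
        show "near n N E (u 0) (int c - 1) (x c)" if "c < 3" for c using x[of c] that by simp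
      qed blast
      \<comment> \<open>Below 1 the integer matrix would be zero, and so would \<theta> by
        minimality. This is what turns the absolute error 1/N of the bisection into a relative
        one.\<close>
      have th1: "1 \<le> \<theta>"
      proof (rule ccontr)
        assume "\<not> 1 \<le> \<theta>"
        then have "M a b = 0" if "a < n" "b < n" for a b
          using abs_entry_le[OF sym th(1) that] by (cases "M a b = 0") auto
        then have "bform n M z z = 0" for z by (simp add: bform_def)
        then have "\<theta> \<le> 0" by (intro th(3)) simp_all
        then show False using False True th(2) eta by simp
      qed
      have N0: "0 < (of_int N :: real)" using N by simp
      have "\<theta> \<le> of_int (l + 1) / of_int N"
      proof (rule th(3))
        show "0 \<le> of_int (l + 1) / (of_int N :: real)" using l(1) N by simp
        have "of_int N * \<bar>bform n M z z\<bar> \<le> of_int (l + 1) * dot n z z" for z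
          using l(3) N unfolding spec_upper_def by (simp add: abs_mult)
        then show "\<bar>bform n M z z\<bar> \<le> of_int (l + 1) / of_int N * dot n z z" for z
          using N0 by (simp add: field_simps)
      qed
      then have "\<theta> - d \<le> of_int l / of_int N" by (simp add: d_def add_divide_distrib)
      moreover have "d * 1 \<le> d * \<theta>" using th1 ed(3) by (rule mult_left_mono)
      ultimately have lN: "\<theta> * (1 - d) \<le> of_int l / of_int N" by (simp add: algebra_simps)
      let ?b = "bform n M w w" and ?v = "rv (u 0)"
      have "of_int l * dot n ?v ?v \<le> of_int N * \<bar>bform n M ?v ?v\<bar>"
        using l(2) N by (simp add: spec_lower_def abs_mult)
      then have "of_int l / of_int N * dot n ?v ?v \<le> \<bar>bform n M ?v ?v\<bar>"
        using N0 by (simp add: field_simps)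
      then have "\<kappa>\<^sup>2 * (of_int l / of_int N * dot n ?v ?v) \<le> \<kappa>\<^sup>2 * \<bar>bform n M ?v ?v\<bar>"
        by (rule mult_left_mono) simp
      also have "\<dots> = \<bar>?b\<bar>" by (simp add: w(2) bform_scale abs_mult power2_eq_square)
      also have "\<kappa>\<^sup>2 * (of_int l / of_int N * dot n ?v ?v) = of_int l / of_int N * (nm n w)\<^sup>2"
        unfolding w(2) nm_scale dot_nm by (simp add: power_mult_distrib)
      finally have b1: "of_int l / of_int N * (nm n w)\<^sup>2 \<le> \<bar>?b\<bar>" .
      have "(1 - e) * (1 - d) \<le> nm n w" by (rule w(4)) (use l(2) in \<open>auto simp: spec_lower_def\<close>)
      moreover have d1: "0 \<le> 1 - d" using N by (simp add: d_def)
      ultimately have "\<theta> * (1 - d) * ((1 - e) * (1 - d))\<^sup>2 \<le> of_int l / of_int N * (nm n w)\<^sup>2"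
        using lN th(2) ed l(1) N0 by (intro mult_mono power_mono) (auto simp: zero_le_divide_iff)
      then have b: "\<theta> * (1 - d) * ((1 - e) * (1 - d))\<^sup>2 \<le> \<bar>?b\<bar>" using b1 by linarith
      have F: "\<bar>bform n M (x c) (x c) - (of_int (int c - 1))\<^sup>2 * ?b\<bar> \<le> \<theta> * (2 * \<bar>of_int (int c - 1)\<bar> * ((1 - e) * e) + e * e)"
        "\<bar>dot n (rv (M n)) (x c) - of_int (int c - 1) * dot n (rv (M n)) w\<bar> \<le> \<eta> * e" if "c < 3" for c
        using near_form[OF sym th(1,2) w(5)[OF that] w(3)] unfolding \<eta>_def by blast+
      let ?L = "dot n (rv (M n)) w"
      have F0: "\<bar>bform n M (x 0) (x 0) - ?b\<bar> \<le> \<theta> * (2 * ((1 - e) * e) + e * e)" "\<bar>dot n (rv (M n)) (x 0) + ?L\<bar> \<le> \<eta> * e"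
        using F[of 0] by simp_all
      have F1: "\<bar>bform n M (x 1) (x 1)\<bar> \<le> \<theta> * (e * e)" "\<bar>dot n (rv (M n)) (x 1)\<bar> \<le> \<eta> * e"
        using F[of 1] by simp_all
      have F2: "\<bar>bform n M (x 2) (x 2) - ?b\<bar> \<le> \<theta> * (2 * ((1 - e) * e) + e * e)" "\<bar>dot n (rv (M n)) (x 2) - ?L\<bar> \<le> \<eta> * e"
        using F[of 2] by simp_all
      have split: "\<theta> * (2 * ((1 - e) * e) + e * e) + \<theta> * (e * e) = 2 * \<theta> * e" by (simp add: algebra_simps)
      have main: "(1 - 7 * \<epsilon>) * \<theta> \<le> \<bar>?b\<bar> - 2 * \<theta> * e - 2 * (\<eta> * e)"
        using loss_form[OF ed eps(3) th(2) True] b by simp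
      have "(1 - 7 * \<epsilon>) * \<theta> \<le> \<bar>G (x 2) - G (x 1)\<bar> \<or> (1 - 7 * \<epsilon>) * \<theta> \<le> \<bar>G (x 0) - G (x 1)\<bar>"
        unfolding G_def using gap_cases[OF F0 F1 F2, of "(1 - 7 * \<epsilon>) * \<theta>"] main split by linarith
      then show ?thesis using True unfolding \<eta>_def[symmetric]
        by (elim disjE; intro exI conjI; assumption?) (auto simp: max_absorb1)
    next
      case False
      then have le: "\<theta> \<le> \<eta>" by simp
      obtain w \<kappa> where w: "0 \<le> \<kappa>" "w = (\<lambda>t. \<kappa> * of_int (u 1 t))" "nm n w \<le> 1 - e"
        "\<exists>t<n. u 1 t \<noteq> 0 \<Longrightarrow> (1 - e) * (1 - d) \<le> nm n w"
        "\<And>c. c < 3 \<Longrightarrow> nm n (\<lambda>t. x (3 + c) t - of_int (int c - 1) * w t) \<le> e"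
        unfolding e_def d_def
      proof (rule near_center[OF N])
        show "near n N E (u 1) (int c - 1) (x (3 + c))" if "c < 3" for c
        proof -
          have "(3 + int c) mod 3 = int c" "(3 + c) div 3 = 1" using that by auto
          then show ?thesis using x[of "3 + c"] that by simp
        qed
      qed blast
      let ?b = "bform n M w w" and ?L = "dot n (rv (M n)) w"
      have F: "\<bar>bform n M (x (3 + c)) (x (3 + c)) - (of_int (int c - 1))\<^sup>2 * ?b\<bar> \<le> \<theta> * (2 * \<bar>of_int (int c - 1)\<bar> * ((1 - e) * e) + e * e)"
        "\<bar>dot n (rv (M n)) (x (3 + c)) - of_int (int c - 1) * dot n (rv (M n)) w\<bar> \<le> \<eta> * e" if "c < 3" for c
        using near_form[OF sym th(1,2) w(5)[OF that] w(3)] unfolding \<eta>_def by blast+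
      have F0: "\<bar>bform n M (x 3) (x 3) - ?b\<bar> \<le> \<theta> * (2 * ((1 - e) * e) + e * e)" "\<bar>dot n (rv (M n)) (x 3) + ?L\<bar> \<le> \<eta> * e"
        using F[of 0] by simp_all
      have F2: "\<bar>bform n M (x 5) (x 5) - ?b\<bar> \<le> \<theta> * (2 * ((1 - e) * e) + e * e)" "\<bar>dot n (rv (M n)) (x 5) - ?L\<bar> \<le> \<eta> * e"
        using F[of 2] by simp_all
      have u1: "\<exists>t<n. u 1 t \<noteq> 0"
      proof (rule ccontr)
        assume "\<not> (\<exists>t<n. u 1 t \<noteq> 0)"
        then have "\<eta> = 0" unfolding \<eta>_def u by (simp add: L2_set_def)
        then show False using False th(2) by simp
      qed
      have "?L = \<kappa> * \<eta>\<^sup>2" unfolding w(2) u dot_scale_right dot_nm \<eta>_def ..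
      moreover have "nm n w = \<kappa> * \<eta>" unfolding w(2) u nm_scale \<eta>_def using w(1) by simp
      ultimately have "?L = \<eta> * nm n w" by (simp add: power2_eq_square)
      then have L: "\<eta> * ((1 - e) * (1 - d)) \<le> ?L" using mult_left_mono[OF w(4)[OF u1] eta] by simp
      have "2 * ((1 - e) * e) + e * e \<le> 2 * e" by (simp add: algebra_simps)
      then have "\<theta> * (2 * ((1 - e) * e) + e * e) \<le> \<theta> * (2 * e)" using th(2) by (rule mult_left_mono)
      moreover have "(1 - 7 * \<epsilon>) * \<eta> \<le> 2 * \<eta> * ((1 - e) * (1 - d)) - 2 * (\<eta> * e) - 2 * (\<theta> * (2 * e))"
        using loss_linear[OF ed(1-4) eps(3) eta le] by simp
      \<comment> \<open>The quadratic part agrees at the two opposite centers and cancels up to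
        rounding errors, whereas the linear part differs by twice its value at
        \<open>w\<close>.\<close>
      ultimately have "(1 - 7 * \<epsilon>) * \<eta> \<le> \<bar>G (x 5) - G (x 3)\<bar>"
        unfolding G_def using F0[unfolded abs_le_iff] F2[unfolded abs_le_iff] L by linarith
      moreover have "max \<theta> (nm n (rv (M n))) = \<eta>" using le unfolding \<eta>_def by simp
      ultimately show ?thesis by (intro exI[of _ 5] conjI exI[of _ 3]) simp_all
    qed
  qed
qed

section \<open>The flatness direction\<close>

text \<open>The last orthogonalized vector is orthogonal to all rows but the last, with which its
  scaled version has product \<open>gd n B n\<close>. So the quotient is the multiplier of the last
  row, which is integral.\<close>

lemma direction_dot:
  assumes B: "minor B n \<noteq> 0" and q: "q < n" and w: "w \<in> mixed n q B"
  shows "dot n w (rv (gs n B (n - 1))) / of_int (gd n B n) \<in> \<int>"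
proof -
  let ?g = "rv (gs n B (n - 1))"
  obtain \<mu> where w: "w = (\<lambda>t. \<Sum>i<n. \<mu> i * of_int (B i t))" and \<mu>: "\<And>i. q \<le> i \<Longrightarrow> i < n \<Longrightarrow> \<mu> i \<in> \<int>"
    using w unfolding mixed_def by blast
  have gd: "gd n B (n - 1) \<noteq> 0" "gd n B n \<noteq> 0" using gd_pos[OF B, of "n - 1"] gd_pos[OF B, of n] by simp_all
  have "dot n (rv (B i)) ?g = (if i = n - 1 then of_int (gd n B n) else 0)" if "i < n" for i
    using dot_gs_diag[OF gd(1)] dot_gs_eq_0[of i "n - 1" n B] q that
    by (auto simp: dot_of_int dot_commute[of n "B i"])
  then have "dot n w ?g = (\<Sum>i<n. \<mu> i * (if i = n - 1 then of_int (gd n B n) else 0))"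
    unfolding w dot_sum_left by (intro sum.cong) auto
  also have "\<dots> = \<mu> (n - 1) * of_int (gd n B n)" using q by (simp add: if_distrib[where f = "\<lambda>x. _ * x"] cong: if_cong)
  finally show ?thesis using gd \<mu>[of "n - 1"] q by simp
qed

lemma sum_below: "real (\<Sum>i<p. i) = real p * (real p - 1) / 2"
  by (induction p) (simp_all add: algebra_simps)

text \<open>The bad residual bounds the sum of the squared lengths \<beta> i from below, reducedness
  bounds it by a multiple of the last one, and the direction has squared length D^2 / \<beta> (n -
  1).\<close>

lemma direction_norm:
  assumes B: "minor B n \<noteq> 0" and sw: "\<forall>k<n. \<not> swap_cond n q B k" and bad: "bad n q B D N E"
    and D: "0 < D" and N: "1 \<le> N" and eps: "0 < \<epsilon>" "\<epsilon> * of_int N \<le> of_int E"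
  shows "q < n" "2 * (of_int D * nm n (rv (gs n B (n - 1))) / of_int (gd n B n)) \<le>
    real (n - q) * 2 powr (real (n - q) * (real (n - q) - 1) / 4) / \<epsilon>"
proof -
  define \<beta> where "\<beta> i = of_int (gd n B (Suc i)) / (of_int (gd n B i) :: real)" for i
  let ?p = "n - q"
  have pos: "0 < gd n B i" if "i \<le> n" for i using gd_pos[OF B that] .
  obtain r where r: "\<And>i. i < n \<Longrightarrow> i < q \<Longrightarrow> dot n r (rv (gs n B i)) = 0"
    "\<And>i. i < n \<Longrightarrow> q \<le> i \<Longrightarrow> \<bar>dot n r (rv (gs n B i))\<bar> \<le> of_int (gd n B (Suc i)) / 2"
    "(of_int E)\<^sup>2 * (of_int D)\<^sup>2 < (of_int N)\<^sup>2 * dot n r r"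
    using bad unfolding bad_def by blast
  have rr: "dot n r r \<le> (\<Sum>i=q..<n. \<beta> i) / 4"
    unfolding \<beta>_def by (rule babai_bound[OF B]) (use r in auto)
  \<comment> \<open>Without integral directions nothing is rounded, so the residual would vanish and
    could not be too long.\<close>
  show q: "q < n"
  proof (rule ccontr)
    assume "\<not> q < n"
    then have "dot n r r \<le> 0" using rr by simp
    then have "(of_int N)\<^sup>2 * dot n r r \<le> 0" by (simp add: mult_le_0_iff)
    moreover have "0 \<le> (of_int E)\<^sup>2 * (of_int D :: real)\<^sup>2" by simp
    ultimately show False using r(3) by linarith
  qed
  have step: "\<beta> i \<le> 4 * \<beta> (Suc i)" if "q \<le> i" "Suc i < n" for i
  proof -
    have "\<not> swap_cond n q B (Suc i)" using sw that by blast
    then have "gd n B (Suc i) * gd n B (Suc i) \<le> 4 * (gd n B (Suc (Suc i)) * gd n B i)"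
      using that by (simp add: swap_cond_def)
    then have "of_int (gd n B (Suc i)) * of_int (gd n B (Suc i)) \<le> 4 * (of_int (gd n B (Suc (Suc i))) * (of_int (gd n B i) :: real))"
      by (metis of_int_le_iff of_int_mult of_int_numeral)
    then show ?thesis using pos[of i] pos[of "Suc i"] that by (simp add: \<beta>_def field_simps)
  qed
  have last: "0 < \<beta> (n - 1)" using pos[of "n - 1"] pos[of n] q by (simp add: \<beta>_def)
  have "(\<Sum>i=q..<n. \<beta> i) \<le> \<beta> (n - 1) * (real (?p\<^sup>2) * 2 ^ (\<Sum>i<?p. i))"
    by (rule sum_quotients_le) (use q step last in auto)
  then have rr': "4 * dot n r r \<le> \<beta> (n - 1) * (real (?p\<^sup>2) * 2 ^ (\<Sum>i<?p. i))" using rr by simp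
  \<comment> \<open>\<open>W\<^sup>2\<close> is the factor from \<open>sum_quotients_le\<close>; p
    (p - 1) / 4 is half of the exponent 0 + ... + (p - 1).\<close>
  define W where "W = real ?p * 2 powr (real ?p * (real ?p - 1) / 4)"
  have "(2 powr (real ?p * (real ?p - 1) / 4))\<^sup>2 = (2 :: real) powr real (\<Sum>i<?p. i)"
    unfolding sum_below power2_eq_square powr_add[symmetric] by (rule arg_cong[where f = "\<lambda>x. 2 powr x"]) simp
  also have "\<dots> = 2 ^ (\<Sum>i<?p. i)" by (rule powr_realpow) simp
  finally have W2: "W\<^sup>2 = real (?p\<^sup>2) * 2 ^ (\<Sum>i<?p. i)" by (simp add: W_def power_mult_distrib)
  define d where "d = of_int D * nm n (rv (gs n B (n - 1))) / of_int (gd n B n)"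
  have "dot n (gs n B (n - 1)) (gs n B (n - 1)) = gd n B (n - 1) * gd n B n"
    using dot_gs_gs[of n B "n - 1"] pos[of "n - 1"] q by simp
  then have "(nm n (rv (gs n B (n - 1))))\<^sup>2 = of_int (gd n B (n - 1)) * of_int (gd n B n)"
    by (simp add: dot_of_int flip: dot_nm)
  then have d2: "d\<^sup>2 * \<beta> (n - 1) = (of_int D)\<^sup>2"
    using pos[of "n - 1"] pos[of n] q by (simp add: d_def \<beta>_def power_divide power_mult_distrib) (simp add: field_simps power2_eq_square)
  have "4 * ((of_int E)\<^sup>2 * (of_int D)\<^sup>2) \<le> 4 * ((of_int N)\<^sup>2 * dot n r r)" using r(3) by simp
  also have "\<dots> = (of_int N)\<^sup>2 * (4 * dot n r r)" by simp
  also have "\<dots> \<le> (of_int N)\<^sup>2 * (\<beta> (n - 1) * W\<^sup>2)" unfolding W2 by (rule mult_left_mono[OF rr']) simp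
  finally have "\<beta> (n - 1) * (2 * (of_int E * d))\<^sup>2 \<le> \<beta> (n - 1) * (of_int N * W)\<^sup>2"
    unfolding d2[symmetric] by (simp add: power_mult_distrib algebra_simps)
  then have "(2 * (of_int E * d))\<^sup>2 \<le> (of_int N * W)\<^sup>2" using last by simp
  then have le: "2 * (of_int E * d) \<le> of_int N * W"
    by (rule power2_le_imp_le) (use N in \<open>simp add: W_def\<close>)
  have d0: "0 \<le> d" unfolding d_def using D pos[of n] by simp
  have "\<epsilon> * of_int N * d \<le> of_int E * d" using eps(2) d0 by (rule mult_right_mono)
  then have "of_int N * (2 * d * \<epsilon>) \<le> of_int N * W" using le by (simp add: algebra_simps)
  then have "2 * d * \<epsilon> \<le> W" using N by simp
  then have "2 * d \<le> W / \<epsilon>" using eps(1) by (simp add: pos_le_divide_eq)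
  then show "2 * (of_int D * nm n (rv (gs n B (n - 1))) / of_int (gd n B n)) \<le>
    real (n - q) * 2 powr (real (n - q) * (real (n - q) - 1) / 4) / \<epsilon>"
    unfolding d_def W_def .
qed

text \<open>The center has length at most 1 - E/N and the rounding error at most E/N.\<close>

lemma near_norm:
  assumes N: "1 \<le> N" "0 \<le> E" "E \<le> N" and sg: "\<bar>sg\<bar> \<le> 1" and x: "near n N E u sg x"
  shows "nm n x \<le> 1"
proof -
  obtain r where r: "isqrt (N * N * dot n u u) r"
    "let d = (\<lambda>t. x t - of_int (sg * (N - E)) * of_int (u t) / of_int r) in (of_int N)\<^sup>2 * dot n d d \<le> (of_int E :: real)\<^sup>2"
    using x by (auto simp: near_def)
  note R = isqrt_center[OF r(1) N(1)]
  define \<kappa> :: real where "\<kappa> = of_int (sg * (N - E)) / of_int r"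
  let ?d = "\<lambda>t. x t - \<kappa> * of_int (u t)"
  have "(of_int N * nm n ?d)\<^sup>2 \<le> (of_int E)\<^sup>2"
    using r(2) by (simp add: Let_def dot_nm power_mult_distrib \<kappa>_def)
  then have "of_int N * nm n ?d \<le> of_int E" by (rule power2_le_imp_le) (use N in simp)
  moreover have "of_int N * (\<bar>\<kappa>\<bar> * nm n (rv u)) \<le> of_int (N - E)"
  proof -
    have "of_int N * (\<bar>\<kappa>\<bar> * nm n (rv u)) = of_int (\<bar>sg\<bar> * (N - E)) * (of_int N * nm n (rv u) / of_int r)"
      using R(1) N by (simp add: \<kappa>_def abs_mult)
    also have "\<dots> \<le> of_int (\<bar>sg\<bar> * (N - E)) * 1" using R(2) N by (intro mult_left_mono) auto
    also have "\<dots> \<le> of_int (1 * (N - E))" unfolding mult_1_right of_int_le_iff using sg N by (intro mult_right_mono) auto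
    finally show ?thesis by simp
  qed
  moreover have "of_int N * nm n x \<le> of_int N * (nm n ?d + \<bar>\<kappa>\<bar> * nm n (rv u))"
    using nm_add_le[where n = n and x = ?d and c = \<kappa> and y = "rv u"] N by simp
  ultimately have "of_int N * nm n x \<le> of_int N * 1" by (simp add: distrib_left)
  then show ?thesis using N by simp
qed

lemma fval_eq:
  assumes Q: "(0 :: int) < Q"
  shows "of_int (fval n M (M n) Q X) / (of_int Q)\<^sup>2 =
    bform n M (\<lambda>t. of_int (X t) / of_int Q) (\<lambda>t. of_int (X t) / of_int Q) + dot n (rv (M n)) (\<lambda>t. of_int (X t) / of_int Q)"
proof -
  have "bform n M (\<lambda>t. of_int (X t) / of_int Q) (\<lambda>t. of_int (X t) / of_int Q) * (of_int Q)\<^sup>2 =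
      (\<Sum>a<n. of_int (dot n (M a) X * X a))"
    using Q by (simp add: bform_def dot_def sum_distrib_left sum_distrib_right power2_eq_square field_simps)
  moreover have "dot n (rv (M n)) (\<lambda>t. of_int (X t) / of_int Q) * (of_int Q)\<^sup>2 = (\<Sum>a<n. of_int (Q * M n a * X a) :: real)"
    using Q by (simp add: dot_def sum_distrib_left sum_distrib_right power2_eq_square field_simps)
  ultimately show ?thesis
    using Q by (simp add: fval_def field_simps sum.distrib)
qed

section \<open>From instances to integer data\<close>

lemma l2_norm_eq: "v \<in> carrier_vec n \<Longrightarrow> l2_norm v = nm n (\<lambda>t. v $ t)"
  by (simp add: l2_norm_def scalar_prod_def L2_set_def power2_eq_square lessThan_atLeast0)

lemma scalar_prod_dot: "v \<in> carrier_vec n \<Longrightarrow> w \<in> carrier_vec n \<Longrightarrow> v \<bullet> w = dot n (\<lambda>t. v $ t) (\<lambda>t. w $ t)"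
  by (simp add: scalar_prod_def dot_def lessThan_atLeast0)

lemma concat_nth_block:
  assumes "\<And>xs. xs \<in> set xss \<Longrightarrow> length xs = m" "i < length xss" "t < m"
  shows "concat xss ! (i * m + t) = xss ! i ! t"
  using assms
proof (induction xss arbitrary: i)
  case (Cons xs xss)
  then show ?case by (cases i) (auto simp: nth_append)
qed simp

text \<open>Cauchy-Schwarz bounds the linear functional on the unit ball from both sides.\<close>

lemma width_le:
  assumes d: "d \<in> carrier_vec n"
  shows "width d (l2_ball (0\<^sub>v n) 1) \<le> 2 * l2_norm d"
proof -
  let ?B = "l2_ball (0\<^sub>v n) 1"
  have d0: "0 \<le> l2_norm d" using d by (simp add: l2_norm_eq)
  have b: "\<bar>d \<bullet> x\<bar> \<le> l2_norm d" if "x \<in> ?B" for x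
  proof -
    have x: "x \<in> carrier_vec n" using that by (simp add: l2_ball_def)
    then have "x - 0\<^sub>v n = x" by (intro eq_vecI) auto
    then have x1: "l2_norm x \<le> 1" using that by (simp add: l2_ball_def)
    have "\<bar>d \<bullet> x\<bar> \<le> l2_norm d * l2_norm x"
      using abs_dot_le[of n "\<lambda>t. d $ t" "\<lambda>t. x $ t"] d x by (simp add: scalar_prod_dot l2_norm_eq)
    also have "\<dots> \<le> l2_norm d * 1" using x1 d0 by (rule mult_left_mono)
    finally show ?thesis by simp
  qed
  have "0\<^sub>v n \<in> ?B" by (simp add: l2_ball_def l2_norm_def)
  then have ne: "(\<lambda>x. d \<bullet> x) ` ?B \<noteq> {}" by blast
  have "Sup ((\<lambda>x. d \<bullet> x) ` ?B) \<le> l2_norm d"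
    by (rule cSup_least[OF ne]) (use b in force)
  moreover have "- l2_norm d \<le> Inf ((\<lambda>x. d \<bullet> x) ` ?B)"
    by (rule cInf_greatest[OF ne]) (use b in force)
  ultimately show ?thesis by (simp add: width_def)
qed

locale mitr =
  fixes n p :: nat and H :: "rat mat" and h c :: "rat vec" and bs :: "rat vec list"
  assumes inst: "mitr_instance n p H h c bs"
begin

definition vs :: "rat vec list" where "vs = rows H @ [h, c] @ bs"
definition entry :: "nat \<Rightarrow> rat" where "entry j = vs ! (j div n) $ (j mod n)"
definition num :: "nat \<Rightarrow> int" where "num j = fst (quotient_of (entry j))"
definition den :: "nat \<Rightarrow> int" where "den j = snd (quotient_of (entry j))"
definition D :: int where "D = (\<Prod>j<2 * n * (n + 1). den j)"
definition M :: "nat \<Rightarrow> nat \<Rightarrow> int" where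
  "M = (\<lambda>i t. if i < 2 * n + 2 \<and> t < n then num (i * n + t) * (D div den (i * n + t)) else 0)"
text \<open>The original index of the basis vector in row \<open>i\<close>, once the continuous
  directions stand in front.\<close>

definition \<sigma> :: "nat \<Rightarrow> nat" where "\<sigma> i = (if i < n - p then i + p else i - (n - p))"
definition B0 :: "nat \<Rightarrow> nat \<Rightarrow> int" where "B0 = (\<lambda>i t. if i < n then M (\<sigma> i + n + 2) t else 0)"

lemma dims: "1 \<le> n" "p \<le> n" "H \<in> carrier_mat n n" "transpose_mat H = H" "h \<in> carrier_vec n" "c \<in> carrier_vec n"
  "length bs = n" "set bs \<subseteq> carrier_vec n" "lin_indep_vecs n (map real_vec bs)"
  using inst by (auto simp: mitr_instance_def)

lemma bs_carrier: "i < n \<Longrightarrow> bs ! i \<in> carrier_vec n"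
  using dims(7,8) nth_mem by blast

lemma vs_carrier: "v \<in> set vs \<Longrightarrow> v \<in> carrier_vec n"
  using dims by (auto simp: vs_def rows_def)

lemma length_vs: "length vs = 2 * n + 2"
  using dims by (simp add: vs_def)

lemma vs_nth: "a < n \<Longrightarrow> vs ! a = row H a" "vs ! n = h" "vs ! Suc n = c" "i < n \<Longrightarrow> vs ! (i + n + 2) = bs ! i"
proof -
  have l: "length (rows H) = n" using dims by simp
  then show "a < n \<Longrightarrow> vs ! a = row H a" "vs ! n = h" "vs ! Suc n = c" "i < n \<Longrightarrow> vs ! (i + n + 2) = bs ! i"
    using dims by (simp_all add: vs_def nth_append)
qed

lemma entry_nth: "t < n \<Longrightarrow> entry (i * n + t) = vs ! i $ t"
  by (simp add: entry_def)

lemma den_pos: "0 < den j"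
  by (simp add: den_def quotient_of_denom_pos')

lemma num_den: "entry j = of_int (num j) / of_int (den j)"
  by (rule quotient_of_div) (simp add: num_def den_def)

lemma D_pos: "0 < D"
  unfolding D_def by (rule prod_pos) (simp add: den_pos)

lemma index_less: "i < 2 * n + 2 \<Longrightarrow> t < n \<Longrightarrow> i * n + t < 2 * n * (n + 1)"
proof -
  assume "i < 2 * n + 2" "t < n"
  then have "Suc i * n \<le> (2 * n + 2) * n" by (intro mult_le_mono1) simp
  then show ?thesis using \<open>t < n\<close> by simp
qed

lemma den_dvd: "j < 2 * n * (n + 1) \<Longrightarrow> den j dvd D"
  unfolding D_def by (rule dvd_prodI) auto

lemma of_int_M: "i < 2 * n + 2 \<Longrightarrow> t < n \<Longrightarrow> real_of_int (M i t) = real_of_int D * of_rat (vs ! i $ t)"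
proof -
  assume i: "i < 2 * n + 2" "t < n"
  let ?j = "i * n + t"
  have "den ?j dvd D" by (rule den_dvd) (rule index_less[OF i])
  then have "D = den ?j * (D div den ?j)" by simp
  then have "real_of_int D = of_int (den ?j) * of_int (D div den ?j)" by (metis of_int_mult)
  moreover have "of_rat (vs ! i $ t) = (of_int (num ?j) / of_int (den ?j) :: real)"
    using num_den[of ?j] i by (simp add: entry_nth of_rat_divide)
  ultimately show ?thesis using i den_pos[of ?j] by (simp add: M_def)
qed

lemma M_sym: "a < n \<Longrightarrow> b < n \<Longrightarrow> M a b = M b a"
proof -
  assume ab: "a < n" "b < n"
  have "H $$ (a, b) = transpose_mat H $$ (a, b)" by (simp only: dims(4))
  also have "\<dots> = H $$ (b, a)" using ab dims(3) by simp
  finally have "real_of_int (M a b) = real_of_int (M b a)"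
    using ab dims(3) by (simp add: of_int_M vs_nth)
  then show ?thesis by simp
qed

lemma code_nth:
  shows "length (mitr_code n p H h c bs) = 2 * (2 * n * (n + 1)) + 2"
    "j < 2 * n * (n + 1) \<Longrightarrow> mitr_code n p H h c bs ! (2 * j + 2) = num j"
    "j < 2 * n * (n + 1) \<Longrightarrow> mitr_code n p H h c bs ! (2 * j + 3) = den j"
proof -
  let ?i = "j div n" and ?t = "j mod n"
  have n: "0 < n" using dims(1) by simp
  have t: "?t < n" using n by simp
  have code: "mitr_code n p H h c bs = [int n, int p] @ concat (map vec_code vs)"
    by (simp add: mitr_code_def vs_def)
  have len: "length (vec_code v) = n * 2" if "v \<in> set vs" for v
  proof -
    have "length (vec_code v) = sum_list (map (\<lambda>_. Suc (Suc 0)) (list_of_vec v))"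
      by (simp add: vec_code_def length_concat comp_def rat_code_def)
    then show ?thesis using vs_carrier[OF that] by (simp add: sum_list_triv)
  qed
  have "map length (map vec_code vs) = map (\<lambda>_. n * 2) vs" using len by simp
  then have "length (concat (map vec_code vs)) = (2 * n + 2) * (n * 2)"
    by (simp only: length_concat sum_list_triv length_vs of_nat_id)
  then show "length (mitr_code n p H h c bs) = 2 * (2 * n * (n + 1)) + 2" unfolding code by simp
  assume j: "j < 2 * n * (n + 1)"
  have i: "?i < 2 * n + 2" using j n by (simp add: less_mult_imp_div_less algebra_simps)
  have vi: "vs ! ?i \<in> carrier_vec n" using vs_carrier nth_mem i length_vs by metis
  have c2: "concat (map vec_code vs) ! (2 * j + k) = rat_code (entry j) ! k" if k: "k < 2" for k
  proof -
    have j': "2 * j + k = ?i * (n * 2) + (?t * 2 + k)"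
    proof -
      have "2 * j + k = 2 * (?i * n + ?t) + k" by (simp only: div_mult_mod_eq)
      also have "\<dots> = ?i * (n * 2) + (?t * 2 + k)" by (simp only: distrib_left mult.commute mult.left_commute add.assoc)
      finally show ?thesis .
    qed
    have "?t * 2 + k < n * 2" using t k by linarith
    then have "concat (map vec_code vs) ! (2 * j + k) = map vec_code vs ! ?i ! (?t * 2 + k)"
      unfolding j' by (intro concat_nth_block) (use len i length_vs in auto)
    also have "\<dots> = concat (map rat_code (list_of_vec (vs ! ?i))) ! (?t * 2 + k)"
      using i length_vs by (simp add: vec_code_def)
    also have "\<dots> = map rat_code (list_of_vec (vs ! ?i)) ! ?t ! k"
      by (intro concat_nth_block) (use vi t k in \<open>auto simp: rat_code_def\<close>)
    also have "\<dots> = rat_code (entry j) ! k" using vi t by (simp add: entry_def list_of_vec_index)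
    finally show ?thesis .
  qed
  show "mitr_code n p H h c bs ! (2 * j + 2) = num j"
    using c2[of 0] by (simp add: code rat_code_def num_def)
  show "mitr_code n p H h c bs ! (2 * j + 3) = den j"
    using c2[of 1] by (simp add: code rat_code_def den_def numeral_3_eq_3)
qed

lemma bform_eq: "bform n M x x = of_int D * (vec n x \<bullet> (real_mat H *\<^sub>v vec n x))"
proof -
  have M: "real_of_int (M a b) = of_int D * of_rat (H $$ (a, b))" if "a < n" "b < n" for a b
    using that dims(3) by (simp add: of_int_M vs_nth)
  have "of_int D * (vec n x \<bullet> (real_mat H *\<^sub>v vec n x)) = of_int D * (\<Sum>a<n. x a * (\<Sum>b<n. of_rat (H $$ (a, b)) * x b))"
    using dims(3) by (simp add: scalar_prod_def lessThan_atLeast0)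
  also have "\<dots> = bform n M x x"
    unfolding bform_def sum_distrib_left by (intro sum.cong refl) (simp add: M)
  finally show ?thesis ..
qed

lemma h_eq: "t < n \<Longrightarrow> real_of_int (M n t) = of_int D * of_rat (h $ t)"
  using vs_nth(2) by (simp add: of_int_M)

lemma norm_h: "nm n (rv (M n)) = of_int D * l2_norm (real_vec h)"
proof -
  have "nm n (rv (M n)) = nm n (\<lambda>t. of_int D * (real_vec h $ t))"
    using dims(5) by (intro L2_set_cong) (auto simp: h_eq)
  then show ?thesis using D_pos dims(5) by (simp add: nm_scale l2_norm_eq[of _ n])
qed

lemma objective_eq:
  assumes "x \<in> carrier_vec n"
  shows "bform n M (\<lambda>t. x $ t) (\<lambda>t. x $ t) + dot n (rv (M n)) (\<lambda>t. x $ t) = of_int D * mitr_objective H h x"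
proof -
  have "vec n (($) x) = x" using assms by auto
  moreover have "dot n (rv (M n)) (\<lambda>t. x $ t) = of_int D * (real_vec h \<bullet> x)"
    using assms dims(5) by (simp add: scalar_prod_dot[of _ n] dot_def sum_distrib_left mult_ac h_eq)
  ultimately show ?thesis by (simp add: bform_eq mitr_objective_def distrib_left)
qed

end

lemma less_two_power_floorlog: "x < 2 ^ floorlog 2 x"
  using floorlog_bounds[of x 2] by (cases "x = 0") auto

section \<open>Size and nonsingularity of the integer data\<close>

context mitr
begin

lemma sum_entry_size: "(\<Sum>j<2 * n * (n + 1). rat_size (entry j) + 1) \<le> mitr_size n p H h c bs"
proof -
  have row: "vec_size v = (\<Sum>t<n. rat_size (v $ t) + 1)" if "v \<in> carrier_vec n" for v
    using that by (simp add: vec_size_def sum_Suc)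
  have "mat_size H = (\<Sum>i<n. vec_size (row H i))"
    using dims(3) by (simp add: mat_size_def vec_size_def sum.distrib)
  also have "\<dots> = sum_list (map vec_size (rows H))"
    using dims(3) by (simp add: rows_def comp_def interv_sum_list_conv_sum_set_nat lessThan_atLeast0)
  finally have le: "sum_list (map vec_size vs) \<le> mitr_size n p H h c bs"
    by (simp add: mitr_size_def vs_def)
  have nth: "sum_list (map vec_size vs) = (\<Sum>i<2 * n + 2. vec_size (vs ! i))"
    by (simp add: sum_list_sum_nth length_vs lessThan_atLeast0)
  have block: "vec_size (vs ! i) = (\<Sum>j\<in>{i * n..<i * n + n}. rat_size (entry j) + 1)" if "i < 2 * n + 2" for i
  proof -
    have "vs ! i \<in> carrier_vec n" using that length_vs vs_carrier nth_mem by metis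
    then show ?thesis
      by (simp add: row sum.atLeastLessThan_shift_0[of _ "i * n"] entry_nth lessThan_atLeast0)
  qed
  have "(\<Sum>j<2 * n * (n + 1). rat_size (entry j) + 1) = (\<Sum>j<(2 * n + 2) * n. rat_size (entry j) + 1)"
    by (rule arg_cong[where f = "\<lambda>m. sum _ {..<m}"]) simp
  also have "\<dots> = (\<Sum>i<2 * n + 2. \<Sum>j\<in>{i * n..<i * n + n}. rat_size (entry j) + 1)"
    by (rule sum.nat_group[symmetric])
  also have "\<dots> = (\<Sum>i<2 * n + 2. vec_size (vs ! i))"
    by (rule sum.cong) (simp_all only: block lessThan_iff)
  finally show ?thesis using le nth by simp
qed

text \<open>The length of a product is at most the sum of the lengths of its factors, so even the
  product of all denominators is controlled by the size of the instance.\<close>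

lemma size_bounds:
  defines "z \<equiv> mitr_size n p H h c bs"
  shows "2 * n * (n + 1) \<le> z" "D \<le> 2 ^ z" "j < 2 * n * (n + 1) \<Longrightarrow> \<bar>num j\<bar> \<le> 2 ^ z"
proof -
  let ?Z = "2 * n * (n + 1)"
  have "(\<Sum>j<?Z. 1) \<le> (\<Sum>j<?Z. rat_size (entry j) + 1)" by (rule sum_mono) simp
  then show "?Z \<le> z" using sum_entry_size unfolding z_def by simp
  have "(\<Sum>j<?Z. floorlog 2 (nat (den j))) \<le> (\<Sum>j<?Z. rat_size (entry j) + 1)"
    by (rule sum_mono) (simp add: rat_size_def den_def)
  then have le: "(\<Sum>j<?Z. floorlog 2 (nat (den j))) \<le> z" using sum_entry_size unfolding z_def by simp
  have "D \<le> (\<Prod>j<?Z. 2 ^ floorlog 2 (nat (den j)))"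
    unfolding D_def
  proof (rule prod_mono)
    fix j
    have "int (nat (den j)) < int (2 ^ floorlog 2 (nat (den j)))"
      using less_two_power_floorlog[of "nat (den j)"] by (simp only: of_nat_less_iff)
    then show "0 \<le> den j \<and> den j \<le> 2 ^ floorlog 2 (nat (den j))" using den_pos[of j] by simp
  qed
  also have "\<dots> = 2 ^ (\<Sum>j<?Z. floorlog 2 (nat (den j)))" by (rule power_sum[symmetric])
  also have "\<dots> \<le> 2 ^ z" using le by (rule power_increasing) simp
  finally show "D \<le> 2 ^ z" .
  assume j: "j < ?Z"
  have "rat_size (entry j) + 1 \<le> (\<Sum>j<?Z. rat_size (entry j) + 1)"
    by (rule member_le_sum) (use j in auto)
  then have "floorlog 2 (nat \<bar>num j\<bar>) \<le> z"
    using sum_entry_size unfolding z_def by (simp add: rat_size_def int_size_def num_def)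
  then have "(2 :: int) ^ floorlog 2 (nat \<bar>num j\<bar>) \<le> 2 ^ z" by (rule power_increasing) simp
  moreover have "int (nat \<bar>num j\<bar>) < int (2 ^ floorlog 2 (nat \<bar>num j\<bar>))"
    using less_two_power_floorlog[of "nat \<bar>num j\<bar>"] by (simp only: of_nat_less_iff)
  then have "\<bar>num j\<bar> < 2 ^ floorlog 2 (nat \<bar>num j\<bar>)" by simp
  ultimately show "\<bar>num j\<bar> \<le> 2 ^ z" by linarith
qed

lemma initial_mem_le:
  assumes "mitr_size n p H h c bs \<le> B"
  shows "mem_le B (initial_mem (mitr_code n p H h c bs))"
  unfolding mem_le_def
proof (intro allI)
  fix x i
  let ?z = "mitr_size n p H h c bs" and ?code = "mitr_code n p H h c bs"
  have nB: "n \<le> B" using size_bounds(1) assms by simp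
  have two: "int m \<le> 2 ^ B" if "m \<le> B" for m
    using that of_nat_less_two_power[of B, where 'a = int] by linarith
  have z2: "x \<le> 2 ^ B" if "x \<le> 2 ^ ?z" for x :: int by (rule le_pow2_mono[OF that assms])
  have "\<bar>?code ! k\<bar> \<le> 2 ^ B" if "k < length ?code" for k
  proof (cases "k < 2")
    case True
    then have "?code ! k = int n \<or> ?code ! k = int p" by (auto simp: mitr_code_def less_2_cases_iff)
    then show ?thesis using two[OF nB] two[of p] dims(2) nB by auto
  next
    case False
    define j where "j = (k - 2) div 2"
    have "k = 2 * j + 2 \<or> k = 2 * j + 3" using False by (auto simp: j_def)
    moreover have "j < 2 * n * (n + 1)" using that False unfolding code_nth(1) j_def by linarith
    moreover from zdvd_imp_le[OF den_dvd[OF this] D_pos] have "\<bar>den j\<bar> \<le> 2 ^ B"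
      using z2[OF order_trans[OF _ size_bounds(2)]] den_pos[of j] by simp
    ultimately show ?thesis using code_nth(2,3)[of j] z2[OF size_bounds(3)[of j]] by auto
  qed
  then show "\<bar>initial_mem ?code x i\<bar> \<le> 2 ^ B" by (auto simp: initial_mem_def nat_less_iff)
qed

lemma \<sigma>_less: "i < n \<Longrightarrow> \<sigma> i < n"
  using dims(2) by (auto simp: \<sigma>_def)

lemma B0_eq: "i < n \<Longrightarrow> t < n \<Longrightarrow> real_of_int (B0 i t) = of_int D * of_rat (bs ! \<sigma> i $ t)"
  using \<sigma>_less[of i] vs_nth(4)[of "\<sigma> i"] of_int_M[of "\<sigma> i + n + 2" t] by (simp add: B0_def)

lemma sum_\<sigma>:
  "(\<Sum>i<n. f i (\<sigma> i)) = (\<Sum>j<n. f (if j < p then j + (n - p) else j - p) j)"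
  by (rule sum.reindex_bij_witness[of _ "\<lambda>j. if j < p then j + (n - p) else j - p" \<sigma>])
    (use dims(2) in \<open>auto simp: \<sigma>_def\<close>)

text \<open>A kernel vector of the transposed matrix is a combination of the rows; after division by
  \<open>D\<close> and reindexing along \<open>\<sigma>\<close> it becomes a linear dependence of
  the given basis vectors.\<close>

lemma minor_B0: "minor B0 n \<noteq> 0"
proof
  let ?A = "transpose_mat (map_mat real_of_int (sqm n B0))"
  have A: "sqm n B0 \<in> carrier_mat n n" by (simp add: sqm_def)
  then have At: "?A \<in> carrier_mat n n" by simp
  assume "minor B0 n = 0"
  then have "det ?A = 0" using A by (simp add: minor_def det_transpose[of _ n] of_int_hom.hom_det[symmetric])
  then obtain v where v: "v \<in> carrier_vec n" "v \<noteq> 0\<^sub>v n" "?A *\<^sub>v v = 0\<^sub>v n"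
    using det_0_iff_vec_prod_zero_field[OF At] by blast
  \<comment> \<open>The index is the inverse of \<open>\<sigma>\<close> at \<open>j\<close>.\<close>
  define a where "a j = v $ (if j < p then j + (n - p) else j - p)" for j
  let ?b = "\<lambda>j. real_vec (bs ! j)"
  have comb: "(\<Sum>j<n. a j * ?b j $ t) = 0" if t: "t < n" for t
  proof -
    have "0 = (?A *\<^sub>v v) $ t" using v(3) t by simp
    also have "\<dots> = (\<Sum>i<n. of_int (B0 i t) * v $ i)"
      using t v(1) A by (simp add: scalar_prod_def lessThan_atLeast0 sqm_def)
    also have "\<dots> = of_int D * (\<Sum>i<n. v $ i * of_rat (bs ! \<sigma> i $ t))"
      unfolding sum_distrib_left by (intro sum.cong refl) (use t in \<open>simp add: B0_eq\<close>)
    also have "(\<Sum>i<n. v $ i * of_rat (bs ! \<sigma> i $ t)) = (\<Sum>j<n. a j * of_rat (bs ! j $ t))"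
      unfolding a_def by (rule sum_\<sigma>[of "\<lambda>i j. v $ i * of_rat (bs ! j $ t)"])
    also have "\<dots> = (\<Sum>j<n. a j * ?b j $ t)"
      by (intro sum.cong refl) (use t carrier_vecD[OF bs_carrier] in simp)
    finally show ?thesis using D_pos by simp
  qed
  obtain i where i: "i < n" "v $ i \<noteq> 0" using v(1,2) eq_vecI[of v "0\<^sub>v n"] by auto
  have "a (\<sigma> i) = v $ i" using i(1) dims(2) by (auto simp: a_def \<sigma>_def)
  moreover have si: "\<sigma> i < n" using \<sigma>_less[OF i(1)] .
  ultimately have ai: "a (\<sigma> i) \<noteq> 0" using i(2) by simp
  let ?bs = "map real_vec bs"
  have dist: "distinct ?bs" and ind: "module.lin_indpt class_ring (module_vec TYPE(real) n) (set ?bs)"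
    using dims(9) by (auto simp: lin_indep_vecs_def)
  interpret V: vec_space "TYPE(real)" n .
  have car: "set ?bs \<subseteq> carrier_vec n" using dims(8) by auto
  have nth: "?bs ! j = ?b j" if "j < n" for j using that dims(7) by simp
  have inj: "inj_on ?b {..<n}"
  proof (rule inj_onI)
    fix i j assume "i \<in> {..<n}" "j \<in> {..<n}" "?b i = ?b j"
    then show "i = j" using nth_eq_iff_index_eq[OF dist, of i j] dims(7) by (simp add: nth)
  qed
  have "set bs = (!) bs ` {..<n}" using dims(7) by (auto simp: in_set_conv_nth)
  then have set: "set ?bs = ?b ` {..<n}" by (simp add: image_image)
  define g where "g w = a (the_inv_into {..<n} ?b w)" for w
  have g: "g (?b j) = a j" if "j < n" for j using the_inv_into_f_f[OF inj] that by (simp add: g_def)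
  have "V.lincomb g (set ?bs) = 0\<^sub>v n"
  proof (rule eq_vecI)
    fix t assume "t < dim_vec (0\<^sub>v n :: real vec)"
    then have t: "t < n" by simp
    have "V.lincomb g (set ?bs) $ t = (\<Sum>w\<in>set ?bs. g w * w $ t)" by (rule V.lincomb_index[OF t car])
    also have "\<dots> = (\<Sum>j<n. g (?b j) * ?b j $ t)" unfolding set by (rule sum.reindex_cong[OF inj refl refl])
    also have "\<dots> = (\<Sum>j<n. a j * ?b j $ t)" by (intro sum.cong refl) (simp add: g)
    finally show "V.lincomb g (set ?bs) $ t = 0\<^sub>v n $ t" using comb[OF t] t by simp
  qed (use V.lincomb_closed[OF car, of g] in simp)
  moreover have "g (?b (\<sigma> i)) \<noteq> 0" using g[OF si] ai by simp
  moreover have "?b (\<sigma> i) \<in> set ?bs" unfolding set using si by simp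
  ultimately have "V.lin_dep (set ?bs)"
    unfolding V.lin_dep_def by (intro exI[of _ "set ?bs"] exI[of _ g] exI[of _ "?b (\<sigma> i)"]) (auto simp: module_vec_simps class_ring_simps)
  then show False using ind by simp
qed

section \<open>The scaled spectral norm as the least bound for the form\<close>

definition \<theta> :: real where "\<theta> = of_int D * spectral_norm (real_mat H)"

lemma mult_vec_carrier: "x \<in> carrier_vec n \<Longrightarrow> real_mat H *\<^sub>v x \<in> carrier_vec n"
  by (rule mult_mat_vec_carrier[of _ n n]) (use dims(3) in auto)

text \<open>An element of the image lies below the supremum only once the quotients are known to be
  bounded; the sum of the row norms is such a bound.\<close>

lemma norm_mult_le:
  assumes x: "x \<in> carrier_vec n"
  shows "l2_norm (real_mat H *\<^sub>v x) \<le> spectral_norm (real_mat H) * l2_norm x"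
proof -
  let ?A = "real_mat H"
  let ?S = "{x \<in> carrier_vec (dim_col ?A). x \<noteq> 0\<^sub>v (dim_col ?A)} :: real vec set"
  have S: "?S = {x \<in> carrier_vec n. x \<noteq> 0\<^sub>v n}" using dims(3) by simp
  define K where "K = (\<Sum>a<n. nm n (\<lambda>t. row ?A a $ t))"
  have K: "l2_norm (?A *\<^sub>v x) \<le> K * l2_norm x" if "x \<in> carrier_vec n" for x
  proof -
    have "l2_norm (?A *\<^sub>v x) \<le> (\<Sum>a<n. \<bar>(?A *\<^sub>v x) $ a\<bar>)"
      unfolding l2_norm_eq[OF mult_vec_carrier[OF that]] by (rule L2_set_le_sum_abs)
    also have "\<dots> \<le> (\<Sum>a<n. nm n (\<lambda>t. row ?A a $ t) * l2_norm x)"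
    proof (rule sum_mono)
      fix a assume "a \<in> {..<n}"
      then have a: "row ?A a \<in> carrier_vec n" "(?A *\<^sub>v x) $ a = row ?A a \<bullet> x" using dims(3) by auto
      show "\<bar>(?A *\<^sub>v x) $ a\<bar> \<le> nm n (\<lambda>t. row ?A a $ t) * l2_norm x"
        unfolding a(2) scalar_prod_dot[OF a(1) that] l2_norm_eq[OF that] by (rule abs_dot_le)
    qed
    finally show ?thesis by (simp add: K_def sum_distrib_right)
  qed
  have pos: "0 < l2_norm x" if "x \<in> ?S" for x
  proof -
    have x: "x \<in> carrier_vec n" "x \<noteq> 0\<^sub>v n" using that unfolding S by simp_all
    have "x = 0\<^sub>v n" if "nm n (\<lambda>t. x $ t) = 0"
      using that x(1) by (intro eq_vecI) (auto simp: L2_set_eq_0_iff)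
    then show ?thesis using x by (auto simp: l2_norm_eq[OF x(1)] order_less_le)
  qed
  show ?thesis
  proof (cases "x = 0\<^sub>v n")
    case True
    then have "l2_norm x = 0" by (simp add: l2_norm_def)
    then show ?thesis using K[OF x] by simp
  next
    case False
    then have xS: "x \<in> ?S" using x unfolding S by simp
    have "bdd_above ((\<lambda>x. l2_norm (?A *\<^sub>v x) / l2_norm x) ` ?S)"
    proof (rule bdd_aboveI2)
      fix y :: "real vec" assume "y \<in> ?S"
      then show "l2_norm (?A *\<^sub>v y) / l2_norm y \<le> K" using K[of y] pos[of y] unfolding S by (simp add: pos_divide_le_eq)
    qed
    then have "l2_norm (?A *\<^sub>v x) / l2_norm x \<le> spectral_norm ?A"
      unfolding spectral_norm_def by (rule cSUP_upper[OF xS])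
    then show ?thesis using pos[OF xS] by (simp add: pos_divide_le_eq)
  qed
qed

lemma form_le: "\<bar>bform n M z z\<bar> \<le> \<theta> * dot n z z"
proof -
  let ?x = "vec n z"
  have x: "?x \<in> carrier_vec n" by simp
  have "\<bar>?x \<bullet> (real_mat H *\<^sub>v ?x)\<bar> \<le> l2_norm ?x * l2_norm (real_mat H *\<^sub>v ?x)"
    unfolding scalar_prod_dot[OF x mult_vec_carrier[OF x]] l2_norm_eq[OF x] l2_norm_eq[OF mult_vec_carrier[OF x]]
    by (rule abs_dot_le)
  also have "\<dots> \<le> l2_norm ?x * (spectral_norm (real_mat H) * l2_norm ?x)"
    by (rule mult_left_mono[OF norm_mult_le[OF x]]) (simp add: l2_norm_eq[OF x])
  also have "\<dots> = spectral_norm (real_mat H) * dot n z z"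
  proof -
    have "nm n (\<lambda>t. ?x $ t) = nm n z" by (rule L2_set_cong) simp_all
    then show ?thesis by (simp add: l2_norm_eq[OF x] dot_nm power2_eq_square)
  qed
  finally have "of_int D * \<bar>?x \<bullet> (real_mat H *\<^sub>v ?x)\<bar> \<le> of_int D * (spectral_norm (real_mat H) * dot n z z)"
    using D_pos by (intro mult_left_mono) auto
  then show ?thesis unfolding bform_eq \<theta>_def using D_pos by (simp add: abs_mult)
qed

lemma \<theta>_nonneg: "0 \<le> \<theta>"
  using abs_entry_le[OF M_sym form_le, of 0 0] dims(1) by simp

text \<open>For a symmetric matrix a bound on the form bounds the operator: D |Hx|^2 is the bilinear
  form at Hx and x, hence at most \<tau> |Hx| |x|, and a factor |Hx| cancels.\<close>

lemma \<theta>_least: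
  assumes \<tau>: "0 \<le> \<tau>" "\<And>z. \<bar>bform n M z z\<bar> \<le> \<tau> * dot n z z"
  shows "\<theta> \<le> \<tau>"
proof -
  let ?A = "real_mat H"
  let ?S = "{x \<in> carrier_vec (dim_col ?A). x \<noteq> 0\<^sub>v (dim_col ?A)} :: real vec set"
  have S: "?S = {x \<in> carrier_vec n. x \<noteq> 0\<^sub>v n}" using dims(3) by simp
  have "unit_vec n 0 \<noteq> (0\<^sub>v n :: real vec)"
  proof
    assume eq: "unit_vec n 0 = (0\<^sub>v n :: real vec)"
    have "unit_vec n 0 $ 0 = (0\<^sub>v n :: real vec) $ 0" by (simp only: eq)
    then show False using dims(1) by simp
  qed
  then have "unit_vec n 0 \<in> ?S" unfolding S by simp
  then have ne: "?S \<noteq> {}" by blast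
  have "l2_norm (?A *\<^sub>v x) / l2_norm x \<le> \<tau> / of_int D" if "x \<in> ?S" for x
  proof -
    have x: "x \<in> carrier_vec n" using that unfolding S by simp
    let ?y = "?A *\<^sub>v x"
    have y: "?y \<in> carrier_vec n" by (rule mult_vec_carrier[OF x])
    have "(l2_norm ?y)\<^sup>2 = ?y \<bullet> ?y" unfolding scalar_prod_dot[OF y y] l2_norm_eq[OF y] dot_nm ..
    also have "of_int D * \<dots> = bform n M (\<lambda>t. ?y $ t) (\<lambda>t. x $ t)"
    proof -
      have M: "real_of_int (M a b) = of_int D * of_rat (H $$ (a, b))" if "a < n" "b < n" for a b
        using that dims(3) by (simp add: of_int_M vs_nth)
      have "?y \<bullet> ?y = (\<Sum>a<n. ?y $ a * (\<Sum>b<n. of_rat (H $$ (a, b)) * x $ b))"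
        using dims(3) x by (simp add: scalar_prod_def[of ?y] lessThan_atLeast0) (simp add: scalar_prod_def)
      then show ?thesis
        unfolding bform_def by (simp only: sum_distrib_left) (intro sum.cong refl, simp add: M)
    qed
    also have "\<dots> \<le> \<tau> * (l2_norm ?y * l2_norm x)"
      using abs_bform_le[OF M_sym \<tau>(2), of "\<lambda>t. ?y $ t" "\<lambda>t. x $ t"]
      unfolding l2_norm_eq[OF x] l2_norm_eq[OF y] by linarith
    finally have le: "l2_norm ?y * (of_int D * l2_norm ?y) \<le> l2_norm ?y * (\<tau> * l2_norm x)"
      by (simp add: power2_eq_square mult_ac)
    have "of_int D * l2_norm ?y \<le> \<tau> * l2_norm x"
    proof (cases "l2_norm ?y = 0")
      case True
      then show ?thesis using \<tau>(1) by (simp add: l2_norm_eq[OF x])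
    next
      case False
      then have "0 < l2_norm ?y" by (simp add: l2_norm_eq[OF y] order_less_le)
      then show ?thesis using le by simp
    qed
    moreover have "0 \<le> l2_norm x" by (simp add: l2_norm_eq[OF x])
    ultimately show ?thesis using D_pos \<tau>(1) by (cases "l2_norm x = 0") (simp_all add: field_simps)
  qed
  then have "spectral_norm ?A \<le> \<tau> / of_int D"
    unfolding spectral_norm_def by (rule cSUP_least[OF ne])
  then show ?thesis using D_pos by (simp add: \<theta>_def pos_le_divide_eq mult.commute)
qed

lemma real_frac_vec: "0 < Q \<Longrightarrow> t < n \<Longrightarrow> real_vec (vec n (\<lambda>t. Rat.Fract (X t) Q)) $ t = of_int (X t) / of_int Q"
  by (simp add: of_rat_rat)

lemma feasibleI:
  assumes Q: "0 < Q" and lat: "(\<lambda>t. of_int D * (of_int (X t) / of_int Q) - of_int (M (Suc n) t)) \<in> mixed n (n - p) B0"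
    and nm: "nm n (\<lambda>t. of_int (X t) / of_int Q) \<le> 1"
  shows "mitr_feasible n p c bs (real_vec (vec n (\<lambda>t. Rat.Fract (X t) Q)))"
proof -
  let ?x = "real_vec (vec n (\<lambda>t. Rat.Fract (X t) Q))"
  have x: "?x \<in> carrier_vec n" by simp
  have "?x \<bullet> ?x = (nm n (\<lambda>t. of_int (X t) / of_int Q))\<^sup>2"
    unfolding scalar_prod_dot[OF x x] dot_nm
    by (rule arg_cong[where f = "\<lambda>x. x\<^sup>2"], rule L2_set_cong) (simp_all add: real_frac_vec[OF Q] del: index_map_vec)
  also have "\<dots> \<le> 1" using nm by (simp add: abs_square_le_1)
  finally have le: "?x \<bullet> ?x \<le> 1" .
  obtain \<mu> :: "nat \<Rightarrow> real" where mu: "\<And>t. of_int D * (of_int (X t) / of_int Q) - of_int (M (Suc n) t) = (\<Sum>i<n. \<mu> i * of_int (B0 i t))"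
    "\<And>i. n - p \<le> i \<Longrightarrow> i < n \<Longrightarrow> \<mu> i \<in> \<int>"
    using lat unfolding mixed_def by (auto simp: fun_eq_iff)
  define \<nu> where "\<nu> j = \<mu> (if j < p then j + (n - p) else j - p)" for j
  let ?b = "\<lambda>j. \<nu> j \<cdot>\<^sub>v (map real_vec bs ! j)"
  let ?y = "finsum_vec TYPE(real) n ?b {..<n}"
  have car: "?b \<in> {..<n} \<rightarrow> carrier_vec n" using bs_carrier dims(7) by auto
  have "?x = ?y + real_vec c"
  proof (rule eq_vecI)
    show dim: "dim_vec ?x = dim_vec (?y + real_vec c)" using dims(6) by simp
    fix t assume "t < dim_vec (?y + real_vec c)"
    then have t: "t < n" using dims(6) by simp
    have "?y $ t = (\<Sum>j<n. \<nu> j * of_rat (bs ! j $ t))"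
      unfolding index_finsum_vec[OF finite_lessThan t car]
      by (intro sum.cong refl) (use t dims(7) carrier_vecD[OF bs_carrier] in simp)
    then have "of_int D * (?y $ t) = of_int D * (\<Sum>i<n. \<mu> i * of_rat (bs ! \<sigma> i $ t))"
      unfolding \<nu>_def sum_\<sigma>[of "\<lambda>i j. \<mu> i * of_rat (bs ! j $ t)"] by simp
    also have "\<dots> = (\<Sum>i<n. \<mu> i * of_int (B0 i t))"
      unfolding sum_distrib_left by (intro sum.cong refl) (use t in \<open>simp add: B0_eq\<close>)
    also have "\<dots> = of_int D * (of_int (X t) / of_int Q - of_rat (c $ t))"
      using mu(1)[of t] t of_int_M[of "Suc n" t] by (simp add: vs_nth right_diff_distrib)
    finally have "?y $ t = of_int (X t) / of_int Q - of_rat (c $ t)" using D_pos by simp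
    then show "?x $ t = (?y + real_vec c) $ t"
      unfolding real_frac_vec[OF Q t] using t dims(6) by simp
  qed
  moreover have "\<forall>j<p. \<nu> j \<in> \<int>" using mu(2) dims(2) by (simp add: \<nu>_def)
  then have "?y \<in> mixed_lattice n p (map real_vec bs)" unfolding mixed_lattice_def by blast
  ultimately show ?thesis using le by (auto simp: mitr_feasible_def)
qed

text \<open>The factor \<open>a\<close> is there for the continuous directions: integral products
  for all real multiples will force orthogonality.\<close>

lemma basis_in_mixed:
  assumes i: "i < n" "p \<le> i \<or> a \<in> \<int>"
  shows "\<exists>w \<in> mixed n (n - p) B0. \<forall>t<n. w t = a * (of_int D * of_rat (bs ! i $ t))"
proof -
  define k where "k = (if i < p then i + (n - p) else i - p)"
  have k: "k < n" "\<sigma> k = i" "n - p \<le> k \<Longrightarrow> a \<in> \<int>" using i dims(2) by (auto simp: k_def \<sigma>_def)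
  let ?\<mu> = "\<lambda>j. if j = k then a else 0"
  have mem: "(\<lambda>t. \<Sum>j<n. ?\<mu> j * of_int (B0 j t)) \<in> mixed n (n - p) B0"
    unfolding mixed_def by (rule CollectI, intro exI[of _ ?\<mu>]) (use k in auto)
  have "(\<Sum>j<n. ?\<mu> j * of_int (B0 j t)) = a * (of_int D * of_rat (bs ! i $ t))" if "t < n" for t
    using k(1) B0_eq[OF k(1) that] unfolding k(2) by (simp add: if_distrib[where f = "\<lambda>x. x * _"] cong: if_cong)
  then show ?thesis by (intro bexI[OF _ mem] allI impI)
qed

end

lemma outs_holds_vec: "outs s a n X Q \<Longrightarrow> 0 < Q \<Longrightarrow> holds_vec s a (vec n (\<lambda>t. Rat.Fract (X t) Q))"
  by (simp add: outs_def holds_vec_def)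

lemma of_rat_Ints: "real_of_rat x \<in> \<int> \<Longrightarrow> x \<in> \<int>"
proof -
  assume "real_of_rat x \<in> \<int>"
  then obtain k where "real_of_rat x = of_int k" by (auto elim: Ints_cases)
  then have "real_of_rat x = real_of_rat (of_int k)" by simp
  then have "x = of_int k" by (simp only: of_rat_eq_iff)
  then show ?thesis by simp
qed

lemma of_rat_scalar_prod:
  assumes "v \<in> carrier_vec n" "w \<in> carrier_vec n"
  shows "real_of_rat (v \<bullet> w) = dot n (\<lambda>t. real_vec v $ t) (\<lambda>t. of_rat (w $ t))"
  using assms by (simp add: scalar_prod_def dot_def of_rat_sum of_rat_mult lessThan_atLeast0)

section \<open>Correctness of the two kinds of answer\<close>

context mitr
begin

lemma direction_case:
  assumes B: "minor B n \<noteq> 0" "mixed n (n - p) B = mixed n (n - p) B0" "\<forall>k<n. \<not> swap_cond n (n - p) B k"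
    and bad: "bad n (n - p) B D N E" and N: "1 \<le> N" and eps: "0 < \<epsilon>" "\<epsilon> * of_int N \<le> of_int E"
    and s: "s 1 0 = 2" "outs s 1 n (\<lambda>t. D * gs n B (n - 1) t) (gd n B n)"
  shows "\<exists>d \<in> carrier_vec n. outputs_direction s d \<and> d \<noteq> 0\<^sub>v n \<and> (\<forall>i<p. d \<bullet> (bs ! i) \<in> \<int>) \<and>
    (\<forall>i. p \<le> i \<and> i < n \<longrightarrow> d \<bullet> (bs ! i) = 0) \<and>
    width (real_vec d) (l2_ball (0\<^sub>v n) 1) \<le> real p * 2 powr (real p * (real p - 1) / 4) / \<epsilon>"
proof -
  note dir = direction_norm[OF B(1,3) bad D_pos N eps]
  define d where "d = vec n (\<lambda>t. Rat.Fract (D * gs n B (n - 1) t) (gd n B n))"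
  have d: "d \<in> carrier_vec n" by (simp add: d_def)
  have gd: "0 < gd n B n" by (rule gd_pos[OF B(1)]) simp
  have dt: "real_vec d $ t = of_int D / of_int (gd n B n) * of_int (gs n B (n - 1) t)" if "t < n" for t
    unfolding d_def real_frac_vec[OF gd that] by simp
  have "outputs_direction s d"
    using s outs_holds_vec[OF s(2) gd] by (simp add: outputs_direction_def d_def)
  moreover have "d \<noteq> 0\<^sub>v n"
  proof
    assume z: "d = 0\<^sub>v n"
    have n0: "n - 1 < n" using dims(1) by simp
    obtain t where t: "t < n" "gs n B (n - 1) t \<noteq> 0"
      using gs_nonzero[OF B(1) n0] gd_pos[OF B(1), of "n - 1"] by auto
    then show False using dt[OF t(1)] D_pos gd unfolding z by simp
  qed
  moreover have key: "a * real_of_rat (d \<bullet> (bs ! i)) \<in> \<int>" if i: "i < n" "p \<le> i \<or> a \<in> \<int>" for a i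
  proof -
    obtain w where w: "w \<in> mixed n (n - p) B" "\<forall>t<n. w t = a * (of_int D * of_rat (bs ! i $ t))"
      using basis_in_mixed[OF i] unfolding B(2) by blast
    have "dot n w (rv (gs n B (n - 1))) / of_int (gd n B n) = a * real_of_rat (d \<bullet> (bs ! i))"
      unfolding of_rat_scalar_prod[OF d bs_carrier[OF i(1)]] dot_def sum_distrib_left sum_divide_distrib
      by (intro sum.cong refl) (use w(2) dt in simp)
    then show ?thesis using direction_dot[OF B(1) dir(1) w(1)] by simp
  qed
  have "d \<bullet> (bs ! i) \<in> \<int>" if "i < p" for i
    using key[of i 1] that dims(2) by (intro of_rat_Ints) simp
  moreover have "d \<bullet> (bs ! i) = 0" if i: "p \<le> i" "i < n" for i
  proof (rule ccontr)
    let ?r = "real_of_rat (d \<bullet> (bs ! i))"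
    assume "d \<bullet> (bs ! i) \<noteq> 0"
    \<comment> \<open>In a continuous direction every real multiple of the product would be an
      integer, in particular the one equal to 1/2.\<close>
    then have half: "1 / (2 * ?r) * ?r = 1 / 2" by simp
    have "1 / (2 * ?r) * ?r \<in> \<int>" by (rule key) (use i in simp_all)
    then have "(1 / 2 :: real) \<in> \<int>" by (simp only: half)
    then obtain k where "(1 / 2 :: real) = of_int k" by (auto elim: Ints_cases)
    then have "2 * k = 1" by linarith
    then show False by presburger
  qed
  moreover have "width (real_vec d) (l2_ball (0\<^sub>v n) 1) \<le> real p * 2 powr (real p * (real p - 1) / 4) / \<epsilon>"
  proof -
    have rd: "real_vec d \<in> carrier_vec n" using d by simp
    have "l2_norm (real_vec d) = nm n (\<lambda>t. of_int D / of_int (gd n B n) * of_int (gs n B (n - 1) t))"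
      unfolding l2_norm_eq[OF rd] by (rule L2_set_cong) (use dt in auto)
    also have "\<dots> = of_int D * nm n (rv (gs n B (n - 1))) / of_int (gd n B n)"
      unfolding nm_scale using D_pos gd by simp
    finally show ?thesis using width_le[OF rd] dir(2) dims(2) by simp
  qed
  ultimately show ?thesis using d by blast
qed

lemma solutions_case:
  assumes N: "1 \<le> N" "0 \<le> E" "E \<le> N"
    and eps: "of_int E / of_int N \<le> \<epsilon> + 1 / of_int N" "16 / of_int N \<le> \<epsilon>" "\<epsilon> \<le> 1 / 3"
    and l: "0 \<le> l" "spec_lower n N M g l (u 0)" "spec_upper n N M (l + 1)" and u: "u 1 = M n"
    and B: "mixed n (n - p) B = mixed n (n - p) B0"
    and ok: "\<And>i. i < 6 \<Longrightarrow> cand_ok n (n - p) B D (M (Suc n)) N E (u (i div 3)) (int i mod 3 - 1) (X i) (Q i)"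
    and best1: "best n 1 48 49 6 (\<lambda>i. fval n M (M n) (Q i) (X i)) Q X s"
    and best2: "best n (2 * int n + 1) 50 51 6 (\<lambda>i. - fval n M (M n) (Q i) (X i)) Q X s" and s: "s 1 0 = 1"
  shows "\<exists>x1 \<in> carrier_vec n. \<exists>x2 \<in> carrier_vec n. outputs_solutions s x1 x2 \<and>
    mitr_feasible n p c bs (real_vec x1) \<and> mitr_feasible n p c bs (real_vec x2) \<and>
    mitr_objective H h (real_vec x1) - mitr_objective H h (real_vec x2)
      \<ge> (1 - 7 * \<epsilon>) * max (spectral_norm (real_mat H)) (l2_norm (real_vec h))"
proof -
  define x where "x i = (\<lambda>t. of_int (X i t) / of_int (Q i) :: real)" for i
  define v where "v i = vec n (\<lambda>t. Rat.Fract (X i t) (Q i))" for i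
  define G where "G z = bform n M z z + dot n (rv (M n)) z" for z
  define F where "F i = fval n M (M n) (Q i) (X i)" for i
  have Q: "0 < Q i" if "i < 6" for i using ok[OF that] by (simp add: cand_ok_def)
  have near: "near n N E (u (i div 3)) (int i mod 3 - 1) (x i)" if "i < 6" for i
    using ok[OF that] unfolding cand_ok_def near_def x_def by blast
  have feas: "mitr_feasible n p c bs (real_vec (v i))" if "i < 6" for i
    unfolding v_def
  proof (rule feasibleI[OF Q[OF that]])
    show "(\<lambda>t. of_int D * (of_int (X i t) / of_int (Q i)) - of_int (M (Suc n) t)) \<in> mixed n (n - p) B0"
      using ok[OF that] unfolding cand_ok_def B by blast
    have "\<bar>int i mod 3 - 1\<bar> \<le> 1" by (smt (verit) pos_mod_bound pos_mod_sign)
    from near_norm[OF N this near[OF that]] show "nm n (\<lambda>t. of_int (X i t) / of_int (Q i)) \<le> 1"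
      by (simp add: x_def)
  qed
  have Gx: "G (x i) = of_int D * mitr_objective H h (real_vec (v i))" if "i < 6" for i
  proof -
    have "of_int D * mitr_objective H h (real_vec (v i)) =
      bform n M (\<lambda>t. real_vec (v i) $ t) (\<lambda>t. real_vec (v i) $ t) + dot n (rv (M n)) (\<lambda>t. real_vec (v i) $ t)"
      by (rule objective_eq[symmetric]) (simp add: v_def)
    also have "\<dots> = G (x i)"
      unfolding G_def v_def x_def bform_def dot_def
      by (intro arg_cong2[where f = "(+)"] sum.cong refl) (simp_all add: real_frac_vec[OF Q[OF that]] del: index_map_vec)
    finally show ?thesis ..
  qed
  have GF: "G (x i) = of_int (F i) / (of_int (Q i))\<^sup>2" if "i < 6" for i
    unfolding G_def x_def F_def by (rule fval_eq[OF Q[OF that], symmetric])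
  have cmp: "of_int a / (of_int (Q i))\<^sup>2 \<le> (of_int b / (of_int (Q m))\<^sup>2 :: real)"
    if "a * (Q m * Q m) \<le> b * (Q i * Q i)" "i < 6" "m < 6" for a b :: int and i m
  proof -
    have "real_of_int (a * (Q m * Q m)) \<le> real_of_int (b * (Q i * Q i))" using that(1) by (simp only: of_int_le_iff)
    then show ?thesis using Q[OF that(2)] Q[OF that(3)] by (simp add: field_simps power2_eq_square)
  qed
  obtain m1 where m1: "m1 < 6" "outs s 1 n (X m1) (Q m1)" "\<forall>i<6. F i * (Q m1 * Q m1) \<le> F m1 * (Q i * Q i)"
    using best1 unfolding best_def F_def by auto
  obtain m2 where m2: "m2 < 6" "outs s (2 * int n + 1) n (X m2) (Q m2)" "\<forall>i<6. - F i * (Q m2 * Q m2) \<le> - F m2 * (Q i * Q i)"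
    using best2 unfolding best_def F_def by auto
  have max: "G (x i) \<le> G (x m1)" if "i < 6" for i
    using cmp[of "F i" m1 "F m1" i] m1 that by (simp add: GF)
  have min: "G (x m2) \<le> G (x i)" if "i < 6" for i
    using cmp[of "- F i" m2 "- F m2" i] m2 that by (simp add: GF)
  \<comment> \<open>This pair need not be the one that is output; the maximum and the minimum differ
    by at least as much.\<close>
  obtain i j where ij: "i < 6" "j < 6" "(1 - 7 * \<epsilon>) * max \<theta> (nm n (rv (M n))) \<le> \<bar>G (x i) - G (x j)\<bar>"
    using objective_gap[OF M_sym form_le \<theta>_nonneg \<theta>_least N eps l u near] unfolding G_def by blast
  have "(1 - 7 * \<epsilon>) * max \<theta> (nm n (rv (M n))) \<le> G (x m1) - G (x m2)"
    using ij max[OF ij(1)] max[OF ij(2)] min[OF ij(1)] min[OF ij(2)] by linarith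
  also have "max \<theta> (nm n (rv (M n))) = of_int D * max (spectral_norm (real_mat H)) (l2_norm (real_vec h))"
    unfolding \<theta>_def norm_h using D_pos by (simp add: max_mult_distrib_left)
  also have "G (x m1) - G (x m2) = of_int D * (mitr_objective H h (real_vec (v m1)) - mitr_objective H h (real_vec (v m2)))"
    using Gx m1(1) m2(1) by (simp add: right_diff_distrib)
  finally have "of_int D * ((1 - 7 * \<epsilon>) * max (spectral_norm (real_mat H)) (l2_norm (real_vec h))) \<le>
    of_int D * (mitr_objective H h (real_vec (v m1)) - mitr_objective H h (real_vec (v m2)))"
    by (simp only: mult.left_commute)
  then have gap: "(1 - 7 * \<epsilon>) * max (spectral_norm (real_mat H)) (l2_norm (real_vec h)) \<le>
    mitr_objective H h (real_vec (v m1)) - mitr_objective H h (real_vec (v m2))"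
    using D_pos by simp
  have "outputs_solutions s (v m1) (v m2)"
    using s outs_holds_vec[OF m1(2) Q[OF m1(1)]] outs_holds_vec[OF m2(2) Q[OF m2(1)]]
    by (simp add: outputs_solutions_def v_def add.commute)
  moreover have "v i \<in> carrier_vec n" for i by (simp add: v_def)
  ultimately show ?thesis using feas[OF m1(1)] feas[OF m2(1)] gap by blast
qed

end

section \<open>Running time\<close>

text \<open>Closed under sums and products, so the nested length bounds are handled by composition
  without computing a degree.\<close>

definition poly_bounded :: "(nat \<Rightarrow> nat \<Rightarrow> nat \<Rightarrow> nat) \<Rightarrow> bool" where
  "poly_bounded f \<longleftrightarrow> (\<exists>C d. \<forall>n K e. f n K e \<le> C * (n + K + e + 1) ^ d)"

lemma poly_boundedI: "(\<And>n K e. f n K e \<le> C * (n + K + e + 1) ^ d) \<Longrightarrow> poly_bounded f"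
  unfolding poly_bounded_def by blast

lemma poly_bounded_vars:
  "poly_bounded (\<lambda>n K e. n)" "poly_bounded (\<lambda>n K e. K)" "poly_bounded (\<lambda>n K e. e)" "poly_bounded (\<lambda>n K e. k)"
  by (rule poly_boundedI[of _ 1 1], simp, rule poly_boundedI[of _ 1 1], simp, rule poly_boundedI[of _ 1 1], simp,
    rule poly_boundedI[of _ k 0], simp)

lemma poly_bounded_op:
  assumes "poly_bounded f" "poly_bounded g"
  shows "poly_bounded (\<lambda>n K e. f n K e + g n K e)" "poly_bounded (\<lambda>n K e. f n K e * g n K e)"
proof -
  obtain C c where f: "\<And>n K e. f n K e \<le> C * (n + K + e + 1) ^ c"
    using assms(1) unfolding poly_bounded_def by blast
  obtain D d where g: "\<And>n K e. g n K e \<le> D * (n + K + e + 1) ^ d"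
    using assms(2) unfolding poly_bounded_def by blast
  show "poly_bounded (\<lambda>n K e. f n K e + g n K e)"
  proof (rule poly_boundedI[of _ "C + D" "c + d"])
    fix n K e :: nat
    let ?y = "n + K + e + 1"
    have "?y ^ c \<le> ?y ^ (c + d)" "?y ^ d \<le> ?y ^ (c + d)" by (intro power_increasing; simp)+
    then have "C * ?y ^ c + D * ?y ^ d \<le> C * ?y ^ (c + d) + D * ?y ^ (c + d)"
      by (intro add_mono mult_le_mono2)
    then show "f n K e + g n K e \<le> (C + D) * ?y ^ (c + d)"
      using f[of n K e] g[of n K e] unfolding distrib_right by linarith
  qed
  show "poly_bounded (\<lambda>n K e. f n K e * g n K e)"
  proof (rule poly_boundedI[of _ "C * D" "c + d"])
    fix n K e :: nat
    show "f n K e * g n K e \<le> C * D * (n + K + e + 1) ^ (c + d)"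
      using mult_le_mono[OF f[of n K e] g[of n K e]] by (simp add: power_add mult_ac)
  qed
qed

lemma poly_bounded_Suc: "poly_bounded f \<Longrightarrow> poly_bounded (\<lambda>n K e. Suc (f n K e))"
  using poly_bounded_op(1)[OF poly_bounded_vars(4)[of 1]] by simp

lemmas poly_bounded_intros = poly_bounded_vars poly_bounded_op poly_bounded_Suc

lemma poly_bounded_gbits: "poly_bounded f \<Longrightarrow> poly_bounded g \<Longrightarrow> poly_bounded (\<lambda>n K e. gbits (f n K e) (g n K e))"
  unfolding gbits_def by (intro poly_bounded_intros)

lemma poly_bounded_sbits: "poly_bounded f \<Longrightarrow> poly_bounded g \<Longrightarrow> poly_bounded k \<Longrightarrow>
    poly_bounded (\<lambda>n K e. sbits (f n K e) (g n K e) (k n K e))"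
  unfolding sbits_def by (intro poly_bounded_intros)

lemma poly_bounded_mbits: "poly_bounded mbits"
proof -
  have d: "poly_bounded (\<lambda>n K e. dbits n e)" and v: "poly_bounded vbits"
    unfolding dbits_def vbits_def by (intro poly_bounded_intros poly_bounded_gbits)+
  have u: "poly_bounded ubits" unfolding ubits_def by (intro poly_bounded_intros poly_bounded_gbits v)
  have l: "poly_bounded (\<lambda>n K e. lbits n e)" unfolding lbits_def by (intro poly_bounded_intros d)
  have r: "poly_bounded rbits" unfolding rbits_def by (intro poly_bounded_intros poly_bounded_sbits u d l)
  have x: "poly_bounded xbits" unfolding xbits_def by (intro poly_bounded_intros poly_bounded_sbits u r)
  show ?thesis unfolding mbits_def by (intro poly_bounded_intros poly_bounded_gbits v l d x)
qed

lemma time_poly: "\<exists>C d. \<forall>n K e. ctime mitr_prog (mbits n K e) \<le> C * (n + K + e + 1) ^ d"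
proof -
  obtain C k where C: "\<And>B. ctime mitr_prog B \<le> C * (B + 2) ^ k" using ctime_poly by metis
  have "poly_bounded (\<lambda>n K e. mbits n K e + 2)" by (intro poly_bounded_intros poly_bounded_mbits)
  then obtain D d where D: "\<And>n K e. mbits n K e + 2 \<le> D * (n + K + e + 1) ^ d"
    unfolding poly_bounded_def by metis
  have "ctime mitr_prog (mbits n K e) \<le> C * D ^ k * (n + K + e + 1) ^ (d * k)" for n K e
  proof -
    have "(mbits n K e + 2) ^ k \<le> (D * (n + K + e + 1) ^ d) ^ k" by (rule power_mono[OF D]) simp
    also have "\<dots> = D ^ k * (n + K + e + 1) ^ (d * k)" by (simp add: power_mult_distrib power_mult)
    finally have "C * (mbits n K e + 2) ^ k \<le> C * (D ^ k * (n + K + e + 1) ^ (d * k))" by (rule mult_le_mono2)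
    then show ?thesis using order_trans[OF C[of "mbits n K e"]] by (simp only: mult.assoc)
  qed
  then show ?thesis by blast
qed

context mitr
begin

lemma run:
  assumes eps: "0 < \<epsilon>" "\<epsilon> \<le> 1 / 3" and K: "16 \<le> 2 ^ K * \<epsilon>"
  shows "\<exists>t s. exec \<epsilon> mitr_prog (initial_mem (mitr_code n p H h c bs)) t s \<and>
    t \<le> ctime mitr_prog (mbits n K (mitr_size n p H h c bs)) \<and>
    ((\<exists>x1 \<in> carrier_vec n. \<exists>x2 \<in> carrier_vec n.
        outputs_solutions s x1 x2 \<and> mitr_feasible n p c bs (real_vec x1) \<and> mitr_feasible n p c bs (real_vec x2) \<and>
        mitr_objective H h (real_vec x1) - mitr_objective H h (real_vec x2)
          \<ge> (1 - 7 * \<epsilon>) * max (spectral_norm (real_mat H)) (l2_norm (real_vec h))) \<or>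
     (\<exists>d \<in> carrier_vec n. outputs_direction s d \<and> d \<noteq> 0\<^sub>v n \<and> (\<forall>i<p. d \<bullet> (bs ! i) \<in> \<int>) \<and>
        (\<forall>i. p \<le> i \<and> i < n \<longrightarrow> d \<bullet> (bs ! i) = 0) \<and>
        width (real_vec d) (l2_ball (0\<^sub>v n) 1) \<le> real p * 2 powr (real p * (real p - 1) / 4) / \<epsilon>))"
proof -
  let ?z = "mitr_size n p H h c bs" and ?s = "initial_mem (mitr_code n p H h c bs)"
  let ?B = "mbits n K ?z"
  have len: "2 * n * (n + 1) * 2 + 2 = length (mitr_code n p H h c bs)" by (simp only: code_nth(1) mult.commute)
  have cell: "?s 0 (int k) = mitr_code n p H h c bs ! k" if "k < length (mitr_code n p H h c bs)" for k
    using that by (simp add: initial_mem_def)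
  have "wp \<epsilon> ?B mitr_prog (\<lambda>s'. \<exists>k. 16 \<le> \<lfloor>2 ^ k * \<epsilon>\<rfloor> \<and>
    mitr_result n (n - p) M D B0 (2 ^ k) (\<lfloor>2 ^ k * \<epsilon>\<rfloor> + 1) s') ?s"
    unfolding M_def D_def B0_def \<sigma>_def
  proof (rule wp_mitr_prog[where e = ?z and K = K])
    show "?s 0 0 = int n" "?s 0 1 = int p"
      using cell[of 0] cell[of 1] len[symmetric] by (simp_all add: mitr_code_def)
    show "?s 0 (2 * int j + 2) = num j \<and> ?s 0 (2 * int j + 3) = den j" if "j < 2 * n * (n + 1)" for j
    proof -
      have "2 * j + 2 < length (mitr_code n p H h c bs)" "2 * j + 3 < length (mitr_code n p H h c bs)"
        using that unfolding code_nth(1) by linarith+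
      from this[THEN cell] code_nth(2,3)[OF that] show ?thesis by (simp only: of_nat_add of_nat_mult of_nat_numeral)
    qed
    show "?s x = (\<lambda>_. 0)" if "x \<noteq> 0" for x using that by (simp add: initial_mem_def)
    show "0 < n" "\<epsilon> < 1" using dims(1) eps(2) by simp_all
  qed (rule den_pos | fact dims size_bounds(2)[unfolded D_def] size_bounds(3) M_sym[unfolded M_def D_def]
      minor_B0[unfolded B0_def M_def D_def \<sigma>_def] eps(1) K order_refl)+
  moreover have "?z \<le> ?B" by (simp add: mbits_def lbits_def)
  then have "mem_le ?B ?s" by (rule initial_mem_le)
  ultimately obtain t s k where t: "exec \<epsilon> mitr_prog ?s t s" "t \<le> ctime mitr_prog ?B"
    and k: "16 \<le> \<lfloor>2 ^ k * \<epsilon>\<rfloor>" "mitr_result n (n - p) M D B0 (2 ^ k) (\<lfloor>2 ^ k * \<epsilon>\<rfloor> + 1) s"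
    using wp_sound[of \<epsilon> ?B mitr_prog _ ?s] eps by force
  define N :: int where "N = 2 ^ k"
  define E where "E = \<lfloor>2 ^ k * \<epsilon>\<rfloor> + 1"
  have N: "1 \<le> N" by (simp add: N_def)
  have NE: "\<epsilon> * of_int N \<le> of_int E" "of_int E \<le> \<epsilon> * of_int N + 1" "16 \<le> \<epsilon> * of_int N" "0 \<le> E" "E \<le> N"
  proof -
    have N': "2 ^ k * \<epsilon> = \<epsilon> * of_int N" by (simp add: N_def)
    show "\<epsilon> * of_int N \<le> of_int E" "of_int E \<le> \<epsilon> * of_int N + 1"
      unfolding E_def N' by linarith+
    show "16 \<le> \<epsilon> * of_int N" using k(1) unfolding N' by linarith
    show "0 \<le> E" using k(1) by (simp add: E_def)
    have "\<epsilon> * of_int N < 1 * of_int N" using eps N by (intro mult_strict_right_mono) auto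
    then have "\<lfloor>2 ^ k * \<epsilon>\<rfloor> < N" unfolding N' by (simp add: floor_less_iff)
    then show "E \<le> N" by (simp add: E_def)
  qed
  have e: "of_int E / of_int N \<le> \<epsilon> + 1 / of_int N" "16 / of_int N \<le> \<epsilon>"
    using NE(2,3) N by (simp_all add: field_simps)
  have res: "mitr_result n (n - p) M D B0 N E s" using k(2) by (simp add: N_def E_def)
  obtain l g u B where r: "0 \<le> l" "spec_lower n N M g l (u 0)" "u 1 = M n" "spec_upper n N M (l + 1)"
    "minor B n \<noteq> 0" "mixed n (n - p) B = mixed n (n - p) B0" "\<forall>k<n. \<not> swap_cond n (n - p) B k"
    and out: "s 1 0 = 2 \<and> outs s 1 n (\<lambda>t. D * gs n B (n - 1) t) (gd n B n) \<and> bad n (n - p) B D N E \<or>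
      s 1 0 = 1 \<and> (\<exists>X Q. (\<forall>i<6. cand_ok n (n - p) B D (M (Suc n)) N E (u (i div 3)) (int i mod 3 - 1) (X i) (Q i)) \<and>
       best n 1 48 49 6 (\<lambda>i. fval n M (M n) (Q i) (X i)) Q X s \<and>
       best n (2 * int n + 1) 50 51 6 (\<lambda>i. - fval n M (M n) (Q i) (X i)) Q X s)"
    using res unfolding mitr_result_def by (elim exE conjE)
  from out show ?thesis
  proof (elim disjE conjE exE)
    assume "s 1 0 = 2" "outs s 1 n (\<lambda>t. D * gs n B (n - 1) t) (gd n B n)" "bad n (n - p) B D N E"
    from direction_case[OF r(5-7) this(3) N eps(1) NE(1) this(1,2)] t show ?thesis by blast
  next
    fix X Q
    assume A: "s 1 0 = 1" "\<forall>i<6. cand_ok n (n - p) B D (M (Suc n)) N E (u (i div 3)) (int i mod 3 - 1) (X i) (Q i)"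
      "best n 1 48 49 6 (\<lambda>i. fval n M (M n) (Q i) (X i)) Q X s"
      "best n (2 * int n + 1) 50 51 6 (\<lambda>i. - fval n M (M n) (Q i) (X i)) Q X s"
    have "cand_ok n (n - p) B D (M (Suc n)) N E (u (i div 3)) (int i mod 3 - 1) (X i) (Q i)" if "i < 6" for i
      using A(2) that by blast
    from solutions_case[OF N NE(4,5) e eps(2) r(1,2,4,3,6) this A(3,4,1)] t show ?thesis by blast
  qed
qed

end

theorem proposition1:
  shows "\<exists>(prog :: com) (P :: real poly poly).
    \<forall>(n::nat) (p::nat) (H :: rat mat) (h :: rat vec) (c :: rat vec) (bs :: rat vec list) (\<epsilon> :: real).
      mitr_instance n p H h c bs \<and> 0 < \<epsilon> \<and> \<epsilon> \<le> 1 / 3 \<longrightarrow>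
      (\<exists>(t::nat) (s::mem).
        exec \<epsilon> prog (initial_mem (mitr_code n p H h c bs)) t s \<and>
        real t \<le> poly (poly P [:log 2 (1 / \<epsilon>):]) (real (mitr_size n p H h c bs)) \<and>
        ((\<exists>x1 \<in> carrier_vec n. \<exists>x2 \<in> carrier_vec n.
            outputs_solutions s x1 x2 \<and>
            mitr_feasible n p c bs (real_vec x1) \<and>
            mitr_feasible n p c bs (real_vec x2) \<and>
            mitr_objective H h (real_vec x1) - mitr_objective H h (real_vec x2)
              \<ge> (1 - 7 * \<epsilon>) * max (spectral_norm (real_mat H)) (l2_norm (real_vec h))) \<or>
         (\<exists>d \<in> carrier_vec n.
            outputs_direction s d \<and>
            d \<noteq> 0\<^sub>v n \<and>
            (\<forall>i<p. d \<bullet> (bs ! i) \<in> \<int>) \<and>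
            (\<forall>i. p \<le> i \<and> i < n \<longrightarrow> d \<bullet> (bs ! i) = 0) \<and>
            width (real_vec d) (l2_ball (0\<^sub>v n) 1)
              \<le> real p * 2 powr (real p * (real p - 1) / 4) / \<epsilon>)))"
proof -
  obtain C d where C: "\<And>n K e. ctime mitr_prog (mbits n K e) \<le> C * (n + K + e + 1) ^ d"
    using time_poly by metis
  \<comment> \<open>The outer variable stands for log(1/\<epsilon>), the inner one for the size z,
    so the value is C (6 + log(1/\<epsilon>) + 2 z)^d. The 6 collects K \<le> log(1/\<epsilon>) + 5
    and the summand 1, and 2 z covers n + z.\<close>
  define P :: "real poly poly" where "P = Polynomial.smult [:real C:] ([:[:6, 2:], [:1:]:] ^ d)"
  show ?thesis
  proof (intro exI[of _ mitr_prog] exI[of _ P] allI impI, elim conjE, goal_cases)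
    case (1 n p H h c bs \<epsilon>)
    note eps = 1(2,3)
    interpret mitr n p H h c bs by unfold_locales (rule 1(1))
    let ?L = "log 2 (1 / \<epsilon>)" and ?z = "mitr_size n p H h c bs"
    have L: "0 \<le> ?L" using eps by (simp add: zero_le_log_cancel_iff)
    \<comment> \<open>Four extra digits, because 2^4 = 16 is the threshold in
      \<open>eps_prog\<close>.\<close>
    define K where "K = nat \<lceil>?L\<rceil> + 4"
    have K: "?L + 4 \<le> real K" "real K \<le> ?L + 5" using L unfolding K_def by linarith+
    have "16 * (1 / \<epsilon>) = 2 powr (?L + 4)" using eps by (simp add: powr_add)
    also have "\<dots> \<le> 2 powr real K" using K(1) by (intro powr_mono) auto
    also have "\<dots> = 2 ^ K" by (simp add: powr_realpow)
    finally have "16 \<le> 2 ^ K * \<epsilon>" using eps(1) by (simp add: field_simps)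
    note run = run[OF eps this]
    have "n * 1 \<le> n * (2 * (n + 1))" by (rule mult_le_mono2) simp
    then have nz: "n \<le> ?z" using size_bounds(1) by (simp add: mult.assoc mult.left_commute)
    have "real t \<le> poly (poly P [:?L:]) (real ?z)" if "t \<le> ctime mitr_prog (mbits n K ?z)" for t
    proof -
      have "real t \<le> real (C * (n + K + ?z + 1) ^ d)" using order_trans[OF that C] by (rule of_nat_mono)
      also have "\<dots> = real C * (real n + real K + real ?z + 1) ^ d" by (simp add: add_ac)
      also have "\<dots> \<le> real C * (6 + ?L + 2 * real ?z) ^ d"
        using nz K(2) by (intro mult_left_mono power_mono) auto
      also have "\<dots> = poly (poly P [:?L:]) (real ?z)"
        by (simp add: P_def poly_power poly_smult algebra_simps)
      finally show ?thesis .
    qed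
    with run show ?case by blast
  qed
qed

end
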